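(* Let $\Gamma\curvearrowright^\sigma(X,\mu)$, $\Lambda\curvearrowright^\theta(Y,\nu)$ be free measure preserving (m.p.) actions of countable discrete groups on standard probability spaces, with $\sigma$ weak mixing, and let $\Delta:(X,\mu)\to(Y_0,\nu_{Y_0})$ be either an embedding or a local OE of $\mathcal R_\sigma,\mathcal R_\theta^{Y_0}$, for some $Y_0\subset Y$ of positive measure. Let $A,B,M,P,n,A^n,M^n,p,u_g,v_h,\theta'$ be as in the context. Let $w=w_\Delta:X\times\Gamma\to\Lambda$ be the Zimmer cocycle of $\Delta$. Assume $\delta:\Gamma\to\Lambda$ is a group morphism and $v:X\to\Lambda$ is a measurable map such that for each $g\in\Gamma$, $v(t)^{-1}w(t,g)v(g^{-1}t)=\delta(g)$ for a.e. $t\in X$. For $h\in\Lambda$ let $X_h=\{t\in X: v(t)=h\}$, $q_h=\chi_{X_h}\in L^\infty X$, and put $b=\sum_{h\in\Lambda}q_hv_h$, viewed as an element of $L^2P$ if $\Delta$ is an embedding, and of $L^2M^n$ if $\Delta$ is a local OE. Then $u_gb=bv_{\delta(g)}$ for all $g\in\Gamma$, $b$ is a scalar multiple of a partial isometry, $K=\ker(\delta)$ is a finite normal subgroup of $\Gamma$, and, writing $\Lambda_0=\delta(\Gamma)$, we have: (i) If $\Delta$ is a local OE, then $bb^*=\sum_{k\in K}u_k$, $b^*b=|K|q$ with $q\in A^n$ a projection invariant under the pull back $\theta'_h$, $h\in\Lambda_0$, and $n=[\Lambda:\Lambda_0]$ is an integer. Moreover, if $A^K=L^\infty(X/K)$ denotes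 the fixed point subalgebra of $A$ under $\sigma_{|K}$, then $\alpha=|K|^{-1}\mathrm{Ad}(b^* )$ implements an isomorphism of $A^K$ onto $A^nq$ which conjugates the $\Gamma/K$-action $\sigma_0=\sigma_{|A^K}$ and the $\Lambda_0$-action $\theta'_{|\Lambda_0}$, with respect to the identification $\Gamma/K\simeq\Lambda_0$ implemented by $\delta$. In particular, if $\Gamma$ has no non-trivial finite normal subgroups, then $b^*b=q$, $bb^*=p$, $\alpha=\mathrm{Ad}\,b^*$ has graph in $\mathcal R_\sigma^n=\mathcal R_{\theta'}$ and conjugates $\sigma$, $\theta'_{|\Lambda_0}$, with respect to the isomorphism $\delta:\Gamma\simeq\Lambda_0\subset\Lambda$. (ii) If $\Delta$ is an embedding and we identify $A^n=B$, $M^n\subset P$ and $\mathcal R_\sigma\subset\mathcal R_\theta^X$ via $\Delta$, then there exists a finite $\sigma(\Gamma)$-invariant subequivalence relation $\mathcal K\subset\mathcal R_\theta^X$ containing $\mathcal R_{\sigma(K)}$ such that, if $m$ denotes the cardinality of the orbits of $\mathcal K$, $A^{\mathcal K}\simeq L^\infty(X/\mathcal K)$ the quotient (or fixed point algebra) under $\mathcal K$, and $q\in A^n=B$ the right support projection of $b$, then $\alpha=m^{-1}\mathrm{Ad}(b^* )$ implements an isomorphism of $A^{\mathcal K}$ onto $A^nq$ which conjugates the $\Gamma/K$-action $\sigma_0=\sigma_{|A^{\mathcal K}}$ onto the $\Lambda_0$-action $\theta_0$ implemented by $\theta_{|\Lambda_0}$ on $Bq=A^nq$, with respect to the identification $\Gamma/K\simeq\Lambda_0$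 implemented by $\delta$. If in addition any finite $\sigma(\Gamma)$-invariant subequivalence relation of $\mathcal R_\theta^X$ is contained in $\mathcal R_\sigma$, then $\mathcal K=\mathcal R_{\sigma(K)}$, $b^*b=|K|q$, $bb^*=\sum_{k\in K}u_k$, $\alpha=|K|^{-1}\mathrm{Ad}(b^* )$, and $\alpha$ implements an isomorphism of $A^K$ onto $A^nq$. Also, if $\Gamma$ has no non-trivial finite normal subgroups, then $b$ is a partial isometry in $P$ normalizing $A^n=B$, with left support $p=\chi_X$, that conjugates the $\Gamma$-action $\sigma$ and the $\Lambda_0$-action $\theta_0$.
   Context: All statements are modulo null sets. $\mathcal R_\sigma$ is the orbit equivalence relation of $\sigma$; $\mathcal R_\theta^{Y_0}=\mathcal R_\theta\cap(Y_0\times Y_0)$; $\nu_{Y_0}$ is the normalized restriction of $\nu$ to $Y_0$. $\sigma$ is weak mixing if $L^2X\ominus\mathbb C1$ has no non-zero finite dimensional $\Gamma$-invariant subspace. $\Delta$ is an *embedding* of $\mathcal R_\sigma$ into $\mathcal R_\theta^{Y_0}$ if it is an isomorphism of probability spaces taking a.e. $\mathcal R_\sigma$-orbit into an $\mathcal R_\theta^{Y_0}$-orbit. $\Delta$ is a *local OE* if it is a measurable m.p. map that for a.e. $t\in X$ is a bijection from the $\mathcal R_\sigma$-orbit of $t$ onto the $\mathcal R_\theta^{Y_0}$-orbit of $\Delta(t)$. The *Zimmer cocycle*: $w_\Delta(t,g)$ is the unique $h\in\Lambda$ with $\Delta(g^{-1}t)=h^{-1}\Delta(t)$. A subequivalence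 relation is finite if a.e. orbit is finite; it is $\sigma(\Gamma)$-invariant if $(s,s')$ in it implies $(gs,gs')$ in it for all $g\in\Gamma$. $\mathrm{Ad}(b^* )(a)=b^*ab$. **Algebras.** $A=L^\infty X$, $B=L^\infty Y$, $M=A\rtimes_\sigma\Gamma$, $P=B\rtimes_\theta\Lambda$ (group measure space von Neumann algebras), $u_g\in M$ and $v_h\in P$ the canonical unitaries. $L(\mathcal R)$ is the (Feldman–Moore) von Neumann algebra of a countable m.p. relation $\mathcal R$; for a free action it coincides with the crossed product. $n=\nu(Y_0)^{-1}$. *Embedding case.* Identify $X$ with $Y_0\subset Y$ via $\Delta$; $p=\chi_{Y_0}=\chi_X\in B$, $A=Bp$, and $M=L(\mathcal R_\sigma)\subset L(\mathcal R_\theta^{Y_0})=pPp$; explicitly $u_g=\sum_h\chi_{\{t:\,w(t,g)=h\}}v_h$. The amplification by $n$ of this inclusion is $M^n\subset P$, with $A^n=B$. *Local OE case.* Here $\Delta$ is amplified to a local OE onto all of $Y$ (amplifications are formed for ergodic relations, $\theta$ being understood ergodic for this purpose): choose a countable measurable partition $\{Y_i\}_{i\ge 1}$ of $Y$ with $Y_1=Y_0$ and injective measure preserving maps $\psi_i:Y_i\to Y_0$ with graph in $\mathcal R_\theta$, $\psi_1=\mathrm{id}$. Let $X^n=\bigsqcup_i\{(x,i):x\in X,\ \Delta(x)\in\psi_i(Y_i)\}$ with measure $n^{-1}\mu$ on each piece (total mass 1), $X=X\times\{1\}\subset X^n$, let $\mathcal R_\sigma^n$ be the relation $(x,i)\sim(x',j)\Leftrightarrow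 (x,x')\in\mathcal R_\sigma$, and extend $\Delta$ to $\Delta^n:X^n\to Y$, $\Delta^n(x,i)=\psi_i^{-1}(\Delta(x))$, which is a local OE of $\mathcal R_\sigma^n$ and $\mathcal R_\theta$. The pull back $\theta'$ of $\theta$ is the free $\Lambda$-action on $X^n$ where $\theta'_h(s)$ is the unique point in the $\mathcal R_\sigma^n$-orbit of $s$ with $\Delta^n(\theta'_h(s))=\theta_h(\Delta^n(s))$; thus $\mathcal R_{\theta'}=\mathcal R_\sigma^n$. $A^n=L^\infty(X^n)$, $M^n=L(\mathcal R_\sigma^n)=A^n\rtimes_{\theta'}\Lambda$, containing $P$ (via $\Delta^n$) with the same canonical unitaries $v_h$; $p=\chi_X\in A^n$ (the image of $\chi_{Y_0}$), $A=A^np$, $M=pM^np$. An isomorphism of abelian algebras conjugates two actions with respect to an identification of the groups if it intertwines the corresponding automorphisms.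
   Formalization: In (i), n=[Λ:Λ₀] is corrected to [Λ:Λ₀]=n|K| (the printed formula can fail when K is non-trivial, and is kept when Γ has no non-trivial finite normal subgroups); in (ii), the last sentence is stated under the preceding hypothesis on finite σ(Γ)-invariant subequivalence relations. *)

theory Defs
  imports "HOL-Probability.Probability" "HOL-Algebra.Group_Action"
begin

section \<open>Actions on standard probability spaces and their orbit relations\<close>

definition standard_prob_space :: "'x::polish_space measure \<Rightarrow> bool" where
  "standard_prob_space M \<longleftrightarrow> prob_space M \<and> sets M = sets borel"

definition mp_action ::
    "('g, 'm) monoid_scheme \<Rightarrow> 'x measure \<Rightarrow> ('g \<Rightarrow> 'x \<Rightarrow> 'x) \<Rightarrow> bool" where
  "mp_action G M \<sigma> \<longleftrightarrow> countable (carrier G) \<and> group_action G (space M) \<sigma> \<and>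
     (\<forall>g\<in>carrier G. \<sigma> g \<in> measurable M M \<and> distr M M (\<sigma> g) = M)"

definition free_action ::
    "('g, 'm) monoid_scheme \<Rightarrow> 'x measure \<Rightarrow> ('g \<Rightarrow> 'x \<Rightarrow> 'x) \<Rightarrow> bool" where
  "free_action G M \<sigma> \<longleftrightarrow>
     (AE t in M. \<forall>g\<in>carrier G. \<sigma> g t = t \<longrightarrow> g = \<one>\<^bsub>G\<^esub>)"

definition ergodic_action ::
    "('g, 'm) monoid_scheme \<Rightarrow> 'x measure \<Rightarrow> ('g \<Rightarrow> 'x \<Rightarrow> 'x) \<Rightarrow> bool" where
  "ergodic_action G M \<sigma> \<longleftrightarrow>
     (\<forall>E\<in>sets M. (\<forall>g\<in>carrier G. AE t in M. \<sigma> g t \<in> E \<longleftrightarrow> t \<in> E) \<longrightarrow>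
        (AE t in M. t \<in> E) \<or> (AE t in M. t \<notin> E))"

definition orbit_rel :: "('g, 'm) monoid_scheme \<Rightarrow> ('g \<Rightarrow> 'x \<Rightarrow> 'x) \<Rightarrow> ('x \<times> 'x) set" where
  "orbit_rel G \<sigma> = {(s, t). t \<in> orbit G \<sigma> s}"

definition restrict_rel :: "('x \<times> 'x) set \<Rightarrow> 'x set \<Rightarrow> ('x \<times> 'x) set" where
  "restrict_rel R E = R \<inter> E \<times> E"

definition conull :: "'x measure \<Rightarrow> 'x set \<Rightarrow> bool" where
  "conull M E \<longleftrightarrow> E \<in> sets M \<and> (AE t in M. t \<in> E)"

definition ae_subrel :: "'x measure \<Rightarrow> ('x \<times> 'x) set \<Rightarrow> ('x \<times> 'x) set \<Rightarrow> bool" where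
  "ae_subrel M R S \<longleftrightarrow> (\<exists>E. conull M E \<and> restrict_rel R E \<subseteq> S)"

text \<open>
  Finite, invariant subequivalence relations of \<open>R\<close>, modulo null sets: all requirements are
  imposed after restriction to a conull set, so that points of a null set which may happen to be
  related to many others play no role.
\<close>

definition finite_invariant_subrel ::
    "('g, 'm) monoid_scheme \<Rightarrow> 'x measure \<Rightarrow> ('g \<Rightarrow> 'x \<Rightarrow> 'x) \<Rightarrow> ('x \<times> 'x) set \<Rightarrow> ('x \<times> 'x) set \<Rightarrow> bool"
  where
  "finite_invariant_subrel G M \<sigma> R K \<longleftrightarrow>
     K \<in> sets (M \<Otimes>\<^sub>M M) \<and> equiv (space M) K \<and>
     (\<exists>E. conull M E \<and> restrict_rel K E \<subseteq> R \<and>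
        (\<forall>t\<in>E. finite (restrict_rel K E `` {t})) \<and>
        (\<forall>g\<in>carrier G. \<forall>(s, t)\<in>restrict_rel K E. (\<sigma> g s, \<sigma> g t) \<in> K))"

definition orbits_have_card :: "'x measure \<Rightarrow> ('x \<times> 'x) set \<Rightarrow> nat \<Rightarrow> bool" where
  "orbits_have_card M K m \<longleftrightarrow>
     (\<exists>E. conull M E \<and> (\<forall>t\<in>E. finite (restrict_rel K E `` {t}) \<and> card (restrict_rel K E `` {t}) = m))"


section \<open>Square integrable functions and bounded operators\<close>

text \<open>
  Elements of \<open>L\<^sup>2\<close> and \<open>L\<^sup>\<infinity>\<close> are represented by functions, equality being equality almost
  everywhere; operators on \<open>L\<^sup>2\<close> are maps on representatives.
\<close>

definition ae_eq :: "'a measure \<Rightarrow> ('a \<Rightarrow> complex) \<Rightarrow> ('a \<Rightarrow> complex) \<Rightarrow> bool" where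
  "ae_eq M f g \<longleftrightarrow> (AE x in M. f x = g x)"

definition L2 :: "'a measure \<Rightarrow> ('a \<Rightarrow> complex) set" where
  "L2 M = {f \<in> borel_measurable M. integrable M (\<lambda>x. (cmod (f x))\<^sup>2)}"

definition Linf :: "'a measure \<Rightarrow> ('a \<Rightarrow> complex) set" where
  "Linf M = {f \<in> borel_measurable M. \<exists>C. AE x in M. cmod (f x) \<le> C}"

definition l2_inner :: "'a measure \<Rightarrow> ('a \<Rightarrow> complex) \<Rightarrow> ('a \<Rightarrow> complex) \<Rightarrow> complex" where
  "l2_inner M f g = (\<integral>x. f x * cnj (g x) \<partial>M)"

definition l2_norm :: "'a measure \<Rightarrow> ('a \<Rightarrow> complex) \<Rightarrow> real" where
  "l2_norm M f = sqrt (\<integral>x. (cmod (f x))\<^sup>2 \<partial>M)"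

type_synonym 'a oper = "('a \<Rightarrow> complex) \<Rightarrow> ('a \<Rightarrow> complex)"

definition op_eq :: "'a measure \<Rightarrow> 'a oper \<Rightarrow> 'a oper \<Rightarrow> bool" where
  "op_eq M F G \<longleftrightarrow> (\<forall>f\<in>L2 M. ae_eq M (F f) (G f))"

definition bounded_op :: "'a measure \<Rightarrow> 'a oper \<Rightarrow> bool" where
  "bounded_op M F \<longleftrightarrow>
     (\<forall>f\<in>L2 M. F f \<in> L2 M) \<and>
     (\<forall>f\<in>L2 M. \<forall>g\<in>L2 M. ae_eq M f g \<longrightarrow> ae_eq M (F f) (F g)) \<and>
     (\<forall>f\<in>L2 M. \<forall>g\<in>L2 M. \<forall>c. ae_eq M (F (\<lambda>x. c * f x + g x)) (\<lambda>x. c * F f x + F g x)) \<and>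
     (\<exists>C. \<forall>f\<in>L2 M. l2_norm M (F f) \<le> C * l2_norm M f)"

definition adjoint_op :: "'a measure \<Rightarrow> 'a oper \<Rightarrow> 'a oper" where
  "adjoint_op M F = (SOME G. bounded_op M G \<and>
     (\<forall>f\<in>L2 M. \<forall>g\<in>L2 M. l2_inner M (F f) g = l2_inner M f (G g)))"

definition scale_op :: "complex \<Rightarrow> 'a oper \<Rightarrow> 'a oper" where
  "scale_op c F = (\<lambda>f x. c * F f x)"

definition projection_op :: "'a measure \<Rightarrow> 'a oper \<Rightarrow> bool" where
  "projection_op M E \<longleftrightarrow> bounded_op M E \<and> op_eq M (E \<circ> E) E \<and> op_eq M (adjoint_op M E) E"

definition partial_isometry_op :: "'a measure \<Rightarrow> 'a oper \<Rightarrow> bool" where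
  "partial_isometry_op M V \<longleftrightarrow> bounded_op M V \<and> projection_op M (adjoint_op M V \<circ> V)"

definition right_support :: "'a measure \<Rightarrow> 'a oper \<Rightarrow> 'a oper \<Rightarrow> bool" where
  "right_support M F Q \<longleftrightarrow> projection_op M Q \<and> op_eq M (F \<circ> Q) F \<and>
     (\<forall>E. projection_op M E \<and> op_eq M (F \<circ> E) F \<longrightarrow> op_eq M (E \<circ> Q) Q)"

definition left_support :: "'a measure \<Rightarrow> 'a oper \<Rightarrow> 'a oper \<Rightarrow> bool" where
  "left_support M F Q \<longleftrightarrow> projection_op M Q \<and> op_eq M (Q \<circ> F) F \<and>
     (\<forall>E. projection_op M E \<and> op_eq M (E \<circ> F) F \<longrightarrow> op_eq M (E \<circ> Q) Q)"

definition commutant :: "'a measure \<Rightarrow> 'a oper set \<Rightarrow> 'a oper set" where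
  "commutant M S = {F. bounded_op M F \<and> (\<forall>G\<in>S. op_eq M (F \<circ> G) (G \<circ> F))}"

definition koopman :: "('g, 'm) monoid_scheme \<Rightarrow> ('g \<Rightarrow> 'x \<Rightarrow> 'x) \<Rightarrow> 'g \<Rightarrow> 'x oper" where
  "koopman G \<sigma> g f = (\<lambda>t. f (\<sigma> (inv\<^bsub>G\<^esub> g) t))"

definition weak_mixing ::
    "('g, 'm) monoid_scheme \<Rightarrow> 'x measure \<Rightarrow> ('g \<Rightarrow> 'x \<Rightarrow> 'x) \<Rightarrow> bool" where
  "weak_mixing G M \<sigma> \<longleftrightarrow> \<not> (\<exists>V.
     V \<subseteq> {f \<in> L2 M. l2_inner M f (\<lambda>_. 1) = 0} \<and>
     (\<forall>f\<in>V. \<forall>f'\<in>L2 M. ae_eq M f f' \<longrightarrow> f' \<in> V) \<and>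
     (\<forall>f\<in>V. \<forall>f'\<in>V. \<forall>c. (\<lambda>t. c * f t + f' t) \<in> V) \<and>
     (\<forall>g\<in>carrier G. \<forall>f\<in>V. koopman G \<sigma> g f \<in> V) \<and>
     (\<exists>B. finite B \<and> B \<subseteq> V \<and> (\<forall>f\<in>V. \<exists>c. ae_eq M f (\<lambda>t. \<Sum>e\<in>B. c e * e t))) \<and>
     (\<exists>f\<in>V. \<not> ae_eq M f (\<lambda>_. 0)))"


section \<open>The group measure space construction\<close>

text \<open>
  For an action \<open>T\<close> of \<open>G\<close> on \<open>Z\<close>, everything acts on \<open>L\<^sup>2(Z \<times> G)\<close>, the vector \<open>\<xi>\<close> standing for the
  series \<open>\<Sum>\<^sub>k \<xi>(\<cdot>, k) v\<^sub>k\<close>; this is \<open>L\<^sup>2\<close> of the crossed product, whose unit is \<open>one_vec\<close>.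
\<close>

definition gms_measure :: "('h, 'm) monoid_scheme \<Rightarrow> 'z measure \<Rightarrow> ('z \<times> 'h) measure" where
  "gms_measure G Z = Z \<Otimes>\<^sub>M count_space (carrier G)"

definition mult_op :: "('z \<Rightarrow> complex) \<Rightarrow> ('z \<times> 'h) oper" where
  "mult_op a \<xi> = (\<lambda>(z, k). a z * \<xi> (z, k))"

definition v_op :: "('h, 'm) monoid_scheme \<Rightarrow> ('h \<Rightarrow> 'z \<Rightarrow> 'z) \<Rightarrow> 'h \<Rightarrow> ('z \<times> 'h) oper" where
  "v_op G T h \<xi> = (\<lambda>(z, k). \<xi> (T (inv\<^bsub>G\<^esub> h) z, inv\<^bsub>G\<^esub> h \<otimes>\<^bsub>G\<^esub> k))"

definition right_v :: "('h, 'm) monoid_scheme \<Rightarrow> 'h \<Rightarrow> ('z \<times> 'h) oper" where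
  "right_v G h \<xi> = (\<lambda>(z, k). \<xi> (z, k \<otimes>\<^bsub>G\<^esub> inv\<^bsub>G\<^esub> h))"

definition one_vec :: "('h, 'm) monoid_scheme \<Rightarrow> 'z \<times> 'h \<Rightarrow> complex" where
  "one_vec G = (\<lambda>(z, k). if k = \<one>\<^bsub>G\<^esub> then 1 else 0)"

text \<open>The von Neumann algebra generated by a self-adjoint set of operators is its bicommutant.\<close>

definition crossed_product ::
    "('h, 'm) monoid_scheme \<Rightarrow> 'z measure \<Rightarrow> ('h \<Rightarrow> 'z \<Rightarrow> 'z) \<Rightarrow> ('z \<times> 'h) oper set" where
  "crossed_product G Z T = commutant (gms_measure G Z) (commutant (gms_measure G Z)
     (mult_op ` Linf Z \<union> v_op G T ` carrier G))"

text \<open>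
  Functions on \<open>X\<close> are transported to functions on a set \<open>S \<subseteq> Z\<close> identified with \<open>X\<close> by means of
  \<open>\<pi>: Z \<rightarrow> X\<close>, and extended by zero. For a function \<open>c\<close> on \<open>X\<close> with values in \<open>G\<close>,
  \<open>coeff_op G T S \<pi> c\<close> is the series \<open>\<Sum>\<^sub>h \<chi>\<^bsub>{c = h}\<^esub> v\<^sub>h\<close>. The sets \<open>{c = h}\<close> being disjoint, at each
  point at most one term is nonzero.
\<close>

definition transport :: "'z set \<Rightarrow> ('z \<Rightarrow> 'x) \<Rightarrow> ('x \<Rightarrow> complex) \<Rightarrow> 'z \<Rightarrow> complex" where
  "transport S \<pi> a z = (if z \<in> S then a (\<pi> z) else 0)"

definition coeff_op ::
    "('h, 'm) monoid_scheme \<Rightarrow> ('h \<Rightarrow> 'z \<Rightarrow> 'z) \<Rightarrow> 'z set \<Rightarrow> ('z \<Rightarrow> 'x) \<Rightarrow> ('x \<Rightarrow> 'h) \<Rightarrow> ('z \<times> 'h) oper"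
  where
  "coeff_op G T S \<pi> c \<xi> = (\<lambda>x. \<Sum>\<^sub>\<infinity>h\<in>carrier G.
     mult_op (transport S \<pi> (indicator {t. c t = h})) (v_op G T h \<xi>) x)"


section \<open>Orbit equivalence\<close>

definition mod_null_inverse ::
    "'x measure \<Rightarrow> 'y measure \<Rightarrow> ('x \<Rightarrow> 'y) \<Rightarrow> ('y \<Rightarrow> 'x) \<Rightarrow> bool" where
  "mod_null_inverse M N f g \<longleftrightarrow> g \<in> measurable N M \<and>
     (AE x in M. g (f x) = x) \<and> (AE y in N. f (g y) = y)"

definition mp_map :: "'x measure \<Rightarrow> 'y measure \<Rightarrow> ('x \<Rightarrow> 'y) \<Rightarrow> bool" where
  "mp_map M N f \<longleftrightarrow> f \<in> measurable M N \<and> distr M N f = N"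

definition mp_iso :: "'x measure \<Rightarrow> 'y measure \<Rightarrow> ('x \<Rightarrow> 'y) \<Rightarrow> bool" where
  "mp_iso M N f \<longleftrightarrow> mp_map M N f \<and> (\<exists>g. mod_null_inverse M N f g)"

definition OE_embedding ::
    "'x measure \<Rightarrow> ('x \<times> 'x) set \<Rightarrow> 'y measure \<Rightarrow> ('y \<times> 'y) set \<Rightarrow> 'y set \<Rightarrow> ('x \<Rightarrow> 'y) \<Rightarrow> bool" where
  "OE_embedding M R N S Y0 \<Delta> \<longleftrightarrow> mp_iso M (uniform_measure N Y0) \<Delta> \<and>
     (AE t in M. \<Delta> ` (R `` {t}) \<subseteq> restrict_rel S Y0 `` {\<Delta> t})"

definition local_OE ::
    "'x measure \<Rightarrow> ('x \<times> 'x) set \<Rightarrow> 'y measure \<Rightarrow> ('y \<times> 'y) set \<Rightarrow> 'y set \<Rightarrow> ('x \<Rightarrow> 'y) \<Rightarrow> bool" where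
  "local_OE M R N S Y0 \<Delta> \<longleftrightarrow> mp_map M (uniform_measure N Y0) \<Delta> \<and>
     (AE t in M. bij_betw \<Delta> (R `` {t}) (restrict_rel S Y0 `` {\<Delta> t}))"

text \<open>
  The element with property \<open>P\<close>; the default value \<open>d\<close>, taken where there is no unique such element,
  is only relevant on null sets, where it preserves measurability.
\<close>

definition the_unique :: "'a \<Rightarrow> ('a \<Rightarrow> bool) \<Rightarrow> 'a" where
  "the_unique d P = (if \<exists>!x. P x then THE x. P x else d)"

definition zimmer_cocycle ::
    "('g, 'm) monoid_scheme \<Rightarrow> ('h, 'n) monoid_scheme \<Rightarrow> ('g \<Rightarrow> 'x \<Rightarrow> 'x) \<Rightarrow> ('h \<Rightarrow> 'y \<Rightarrow> 'y) \<Rightarrow>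
     ('x \<Rightarrow> 'y) \<Rightarrow> 'x \<Rightarrow> 'g \<Rightarrow> 'h" where
  "zimmer_cocycle \<Gamma> \<Lambda> \<sigma> \<theta> \<Delta> t g = the_unique \<one>\<^bsub>\<Lambda>\<^esub>
     (\<lambda>h. h \<in> carrier \<Lambda> \<and> \<Delta> (\<sigma> (inv\<^bsub>\<Gamma>\<^esub> g) t) = \<theta> (inv\<^bsub>\<Lambda>\<^esub> h) (\<Delta> t))"


section \<open>Amplification of a local orbit equivalence\<close>

definition amplification_data ::
    "'y measure \<Rightarrow> ('y \<times> 'y) set \<Rightarrow> 'y set \<Rightarrow> (nat \<Rightarrow> 'y set) \<Rightarrow> (nat \<Rightarrow> 'y \<Rightarrow> 'y) \<Rightarrow> bool" where
  "amplification_data N S Y0 Yp \<psi> \<longleftrightarrow>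
     Yp 1 = Y0 \<and> (\<forall>y\<in>Y0. \<psi> 1 y = y) \<and>
     (\<forall>i\<ge>1. Yp i \<in> sets N) \<and> disjoint_family_on Yp {1..} \<and> (AE y in N. \<exists>i\<ge>1. y \<in> Yp i) \<and>
     (\<forall>i\<ge>1. inj_on (\<psi> i) (Yp i) \<and> \<psi> i \<in> measurable (restrict_space N (Yp i)) (restrict_space N Y0) \<and>
        (\<forall>y\<in>Yp i. (y, \<psi> i y) \<in> S) \<and>
        (\<forall>E\<in>sets N. E \<subseteq> Yp i \<longrightarrow> \<psi> i ` E \<in> sets N \<and> emeasure N (\<psi> i ` E) = emeasure N E))"

definition amp_set :: "(nat \<Rightarrow> 'y set) \<Rightarrow> (nat \<Rightarrow> 'y \<Rightarrow> 'y) \<Rightarrow> ('x \<Rightarrow> 'y) \<Rightarrow> ('x \<times> nat) set" where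
  "amp_set Yp \<psi> \<Delta> = {(x, i). i \<ge> 1 \<and> \<Delta> x \<in> \<psi> i ` Yp i}"

definition amp_measure :: "real \<Rightarrow> 'x measure \<Rightarrow> ('x \<times> nat) set \<Rightarrow> ('x \<times> nat) measure" where
  "amp_measure n M Xn =
     scale_measure (ennreal (1 / n)) (restrict_space (M \<Otimes>\<^sub>M count_space UNIV) Xn)"

definition amp_rel :: "('x \<times> 'x) set \<Rightarrow> ('x \<times> nat) set \<Rightarrow> (('x \<times> nat) \<times> ('x \<times> nat)) set" where
  "amp_rel R Xn = {((x, i), (x', j)). (x, i) \<in> Xn \<and> (x', j) \<in> Xn \<and> (x, x') \<in> R}"

definition amp_map ::
    "(nat \<Rightarrow> 'y set) \<Rightarrow> (nat \<Rightarrow> 'y \<Rightarrow> 'y) \<Rightarrow> ('x \<Rightarrow> 'y) \<Rightarrow> 'x \<times> nat \<Rightarrow> 'y" where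
  "amp_map Yp \<psi> \<Delta> = (\<lambda>(x, i). inv_into (Yp i) (\<psi> i) (\<Delta> x))"

definition pull_back ::
    "('z \<times> 'z) set \<Rightarrow> ('z \<Rightarrow> 'y) \<Rightarrow> ('h \<Rightarrow> 'y \<Rightarrow> 'y) \<Rightarrow> 'h \<Rightarrow> 'z \<Rightarrow> 'z" where
  "pull_back R D \<theta> h s = the_unique s (\<lambda>s'. (s, s') \<in> R \<and> D s' = \<theta> h (D s))"


section \<open>Isomorphisms of abelian algebras\<close>

definition fixed_alg ::
    "('g, 'm) monoid_scheme \<Rightarrow> 'x measure \<Rightarrow> ('g \<Rightarrow> 'x \<Rightarrow> 'x) \<Rightarrow> 'g set \<Rightarrow> ('x \<Rightarrow> complex) set" where
  "fixed_alg G M \<sigma> K = {a \<in> Linf M. \<forall>k\<in>K. ae_eq M (koopman G \<sigma> k a) a}"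

definition rel_fixed_alg :: "'x measure \<Rightarrow> ('x \<times> 'x) set \<Rightarrow> ('x \<Rightarrow> complex) set" where
  "rel_fixed_alg M K =
     {a \<in> Linf M. \<exists>E. conull M E \<and> (\<forall>(s, t)\<in>restrict_rel K E. a s = a t)}"

definition corner :: "'z measure \<Rightarrow> 'z set \<Rightarrow> ('z \<Rightarrow> complex) set" where
  "corner Z E = {f \<in> Linf Z. ae_eq Z (\<lambda>z. f z * indicator E z) f}"

definition alg_iso ::
    "'x measure \<Rightarrow> ('x \<Rightarrow> complex) set \<Rightarrow> 'z measure \<Rightarrow> ('z \<Rightarrow> complex) set \<Rightarrow>
     (('x \<Rightarrow> complex) \<Rightarrow> ('z \<Rightarrow> complex)) \<Rightarrow> bool" where
  "alg_iso M A Z B \<alpha> \<longleftrightarrow>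
     (\<forall>a\<in>A. \<alpha> a \<in> B) \<and>
     (\<forall>a\<in>A. \<forall>a'\<in>A. ae_eq M a a' \<longleftrightarrow> ae_eq Z (\<alpha> a) (\<alpha> a')) \<and>
     (\<forall>f\<in>B. \<exists>a\<in>A. ae_eq Z (\<alpha> a) f) \<and>
     (\<forall>a\<in>A. \<forall>a'\<in>A. \<forall>c. ae_eq Z (\<alpha> (\<lambda>t. c * a t + a' t)) (\<lambda>z. c * \<alpha> a z + \<alpha> a' z)) \<and>
     (\<forall>a\<in>A. \<forall>a'\<in>A. ae_eq Z (\<alpha> (\<lambda>t. a t * a' t)) (\<lambda>z. \<alpha> a z * \<alpha> a' z)) \<and>
     (\<forall>a\<in>A. ae_eq Z (\<alpha> (\<lambda>t. cnj (a t))) (\<lambda>z. cnj (\<alpha> a z)))"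

text \<open>\<open>\<alpha> = c Ad(b\<^sup>*)\<close> on \<open>A\<close>, elements of \<open>L\<^sup>\<infinity>\<close> being identified with multiplication operators.\<close>

definition implements ::
    "('z \<times> 'h) measure \<Rightarrow> ('z \<times> 'h) oper \<Rightarrow> complex \<Rightarrow> 'z set \<Rightarrow> ('z \<Rightarrow> 'x) \<Rightarrow>
     ('x \<Rightarrow> complex) set \<Rightarrow> (('x \<Rightarrow> complex) \<Rightarrow> ('z \<Rightarrow> complex)) \<Rightarrow> bool" where
  "implements H b c S \<pi> A \<alpha> \<longleftrightarrow> (\<forall>a\<in>A.
     op_eq H (scale_op c (adjoint_op H b \<circ> mult_op (transport S \<pi> a) \<circ> b)) (mult_op (\<alpha> a)))"

text \<open>
  \<open>\<alpha>\<close> conjugates the two actions with respect to \<open>\<delta>\<close>, respectively to the map induced by \<open>\<delta>\<close> on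
  \<open>G/K\<close>. In the second case the coset \<open>C\<close> acts by any of its elements \<open>g\<close>.
\<close>

definition conjugates ::
    "('g, 'm) monoid_scheme \<Rightarrow> ('h, 'n) monoid_scheme \<Rightarrow> ('g \<Rightarrow> 'h) \<Rightarrow> ('g \<Rightarrow> 'x \<Rightarrow> 'x) \<Rightarrow>
     ('h \<Rightarrow> 'z \<Rightarrow> 'z) \<Rightarrow> 'z measure \<Rightarrow> ('x \<Rightarrow> complex) set \<Rightarrow>
     (('x \<Rightarrow> complex) \<Rightarrow> ('z \<Rightarrow> complex)) \<Rightarrow> bool" where
  "conjugates G H \<delta> \<sigma> T Z A \<alpha> \<longleftrightarrow> (\<forall>g\<in>carrier G. \<forall>a\<in>A.
     koopman G \<sigma> g a \<in> A \<and> ae_eq Z (\<alpha> (koopman G \<sigma> g a)) (koopman H T (\<delta> g) (\<alpha> a)))"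

definition quotient_conjugates ::
    "('g, 'm) monoid_scheme \<Rightarrow> 'g set \<Rightarrow> ('h, 'n) monoid_scheme \<Rightarrow> ('g set \<Rightarrow> 'h) \<Rightarrow>
     ('g \<Rightarrow> 'x \<Rightarrow> 'x) \<Rightarrow> ('h \<Rightarrow> 'z \<Rightarrow> 'z) \<Rightarrow> 'z measure \<Rightarrow> ('x \<Rightarrow> complex) set \<Rightarrow>
     (('x \<Rightarrow> complex) \<Rightarrow> ('z \<Rightarrow> complex)) \<Rightarrow> bool" where
  "quotient_conjugates G K H \<delta>' \<sigma> T Z A \<alpha> \<longleftrightarrow> (\<forall>C\<in>carrier (G Mod K). \<forall>g\<in>C. \<forall>a\<in>A.
     koopman G \<sigma> g a \<in> A \<and> ae_eq Z (\<alpha> (koopman G \<sigma> g a)) (koopman H T (\<delta>' C) (\<alpha> a)))"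

text \<open>\<open>b\<close> is in the normalizing groupoid of \<open>B = L\<^sup>\<infinity>\<close>: \<open>b b\<^sup>*, b\<^sup>* b \<in> B\<close> and \<open>b B b\<^sup>* = B b b\<^sup>*\<close>.\<close>

definition normalizes :: "('z \<times> 'h) measure \<Rightarrow> 'z measure \<Rightarrow> ('z \<times> 'h) oper \<Rightarrow> bool" where
  "normalizes H Z b \<longleftrightarrow> (let b' = adjoint_op H b in
     partial_isometry_op H b \<and>
     (\<exists>f\<in>Linf Z. op_eq H (b \<circ> b') (mult_op f)) \<and> (\<exists>f\<in>Linf Z. op_eq H (b' \<circ> b) (mult_op f)) \<and>
     (\<forall>f\<in>Linf Z. \<exists>f'\<in>Linf Z. op_eq H (b \<circ> mult_op f \<circ> b') (mult_op f' \<circ> (b \<circ> b'))) \<and>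
     (\<forall>f'\<in>Linf Z. \<exists>f\<in>Linf Z. op_eq H (b \<circ> mult_op f \<circ> b') (mult_op f' \<circ> (b \<circ> b'))))"

definition scalar_multiple_of_partial_isometry ::
    "'a measure \<Rightarrow> 'a oper set \<Rightarrow> 'a oper \<Rightarrow> bool" where
  "scalar_multiple_of_partial_isometry H P b \<longleftrightarrow>
     (\<exists>c V. V \<in> P \<and> partial_isometry_op H V \<and> op_eq H b (scale_op c V))"

definition no_nontrivial_finite_normal :: "('g, 'm) monoid_scheme \<Rightarrow> bool" where
  "no_nontrivial_finite_normal G \<longleftrightarrow> (\<forall>K. K \<lhd> G \<and> finite K \<longrightarrow> K = {\<one>\<^bsub>G\<^esub>})"

end

theory Submission
  imports Defs
begin

text \<open>
  The element \<open>b\<close> is composition with the map \<open>\<Phi> t = v(t)\<^sup>-\<^sup>1 \<Delta>(t)\<close>, which the cocycle identity makes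
  equivariant: \<open>\<Phi>(g t) = \<delta>(g) \<Phi>(t)\<close>. The number of points in a fibre of \<open>\<Phi>\<close> is therefore
  \<open>\<Gamma>\<close>-invariant and integrable, hence by ergodicity a constant \<open>m\<close>, so that \<open>b\<^sup>* b\<close> is \<open>m\<close> times the
  indicator of the image \<open>E\<close> of \<open>\<Phi>\<close>; the fibres are the classes of the relation \<open>\<K>\<close>. If \<open>\<K>\<close> lies in
  the orbit relation of \<open>\<sigma>\<close>, freeness forces the fibres to be the orbits of \<open>ker \<delta>\<close>. After
  amplification, a local orbit equivalence becomes an embedding of the same kind whose image is all
  of the restricted orbit relation, so both cases are treated by one argument; there the translates
  of \<open>E\<close> indexed by the cosets of \<open>\<delta>(\<Gamma>)\<close> partition the space, which gives the index.
\<close>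

subsection \<open>Operators on square integrable functions\<close>

text \<open>As an infinite series \<open>b\<close> has no bound a priori. The bound comes from
  counting: integrated over the target space, the number of preimages gives back the measure of
  \<open>S\<close>, so fibres are finite almost everywhere, and once their size is a constant
  \<open>m\<close>, mass transport bounds the square of the norm of \<open>b\<close> by
  \<open>m\<close>. The pulled back action is given by the choice of a unique point, so it obeys the
  group laws only off a null set. The common argument is therefore carried out for actions up to
  null sets, and exceptional sets are made invariant under the countable groups before any point is
  moved along its orbit. Since \<open>adjoint_op\<close> is a choice, and supports are compared with
  arbitrary projections, adjoints of all bounded operators on representatives have to be
  constructed; this is the purpose of the completeness and Riesz arguments. Finiteness of the kernel
  is asserted before an amplification is chosen, so it gets an argument of its own that works with
  \<open>\<Delta>\<close> alone.\<close>

lemma L2_measurable: "f \<in> L2 M \<Longrightarrow> f \<in> borel_measurable M"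
  by (simp add: L2_def)

lemma L2_integrable: "f \<in> L2 M \<Longrightarrow> integrable M (\<lambda>x. (cmod (f x))\<^sup>2)"
  by (simp add: L2_def)

lemma L2_bound:
  assumes "f \<in> borel_measurable M" "integrable M g" "AE x in M. (cmod (f x))\<^sup>2 \<le> g x"
  shows "f \<in> L2 M"
proof -
  have "integrable M (\<lambda>x. (cmod (f x))\<^sup>2)"
    by (rule Bochner_Integration.integrable_bound[OF assms(2)]) (use assms in auto)
  then show ?thesis using assms by (simp add: L2_def)
qed

lemma cmod_add_sq: "(cmod (a + b))\<^sup>2 \<le> 2 * (cmod a)\<^sup>2 + 2 * (cmod b)\<^sup>2"
proof -
  have "(cmod (a + b))\<^sup>2 \<le> (cmod a + cmod b)\<^sup>2"
    by (simp add: norm_triangle_ineq power_mono)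
  also have "\<dots> \<le> 2 * (cmod a)\<^sup>2 + 2 * (cmod b)\<^sup>2"
    using sum_squares_bound[of "cmod a" "cmod b"] by (simp add: power2_sum)
  finally show ?thesis .
qed

lemma L2_add: "f \<in> L2 M \<Longrightarrow> g \<in> L2 M \<Longrightarrow> (\<lambda>x. f x + g x) \<in> L2 M"
  by (rule L2_bound[where g="\<lambda>x. 2 * (cmod (f x))\<^sup>2 + 2 * (cmod (g x))\<^sup>2"])
     (auto simp: L2_def cmod_add_sq)

lemma L2_scale: "f \<in> L2 M \<Longrightarrow> (\<lambda>x. c * f x) \<in> L2 M"
  by (auto simp: L2_def norm_mult power_mult_distrib)

lemma L2_lin: "f \<in> L2 M \<Longrightarrow> g \<in> L2 M \<Longrightarrow> (\<lambda>x. c * f x + g x) \<in> L2 M"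
  by (intro L2_add L2_scale)

lemma L2_diff: "f \<in> L2 M \<Longrightarrow> g \<in> L2 M \<Longrightarrow> (\<lambda>x. f x - g x) \<in> L2 M"
  using L2_lin[of g M f "-1"] by (simp add: algebra_simps)

lemma L2_zero: "(\<lambda>x. 0) \<in> L2 M"
  by (simp add: L2_def)

lemma L2_sum: "finite I \<Longrightarrow> (\<And>i. i \<in> I \<Longrightarrow> f i \<in> L2 M) \<Longrightarrow> (\<lambda>x. \<Sum>i\<in>I. f i x) \<in> L2 M"
  by (induction I rule: finite_induct) (auto intro: L2_zero L2_add)

lemma l2_norm_nonneg: "0 \<le> l2_norm M f"
  by (simp add: l2_norm_def)

lemma l2_norm_sq: "(l2_norm M f)\<^sup>2 = (\<integral>x. (cmod (f x))\<^sup>2 \<partial>M)"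
  by (simp add: l2_norm_def)

lemma borel_measurable_times_cnj:
  fixes f g :: "'a \<Rightarrow> complex"
  assumes [measurable]: "f \<in> borel_measurable M" "g \<in> borel_measurable M"
  shows "(\<lambda>x. f x * cnj (g x)) \<in> borel_measurable M"
proof -
  have [measurable]: "cnj \<in> borel_measurable borel"
    by (intro borel_measurable_continuous_onI continuous_intros)
  show ?thesis by measurable
qed

lemma L2_inner_integrable:
  assumes "f \<in> L2 M" "g \<in> L2 M"
  shows "integrable M (\<lambda>x. f x * cnj (g x))"
proof (rule Bochner_Integration.integrable_bound)
  show "integrable M (\<lambda>x. (cmod (f x))\<^sup>2 + (cmod (g x))\<^sup>2)"
    using assms by (auto simp: L2_def)
  show "(\<lambda>x. f x * cnj (g x)) \<in> borel_measurable M"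
    using assms[THEN L2_measurable] by (rule borel_measurable_times_cnj)
  have "cmod (f x) * cmod (g x) \<le> (cmod (f x))\<^sup>2 + (cmod (g x))\<^sup>2" for x
    using sum_squares_bound[of "cmod (f x)" "cmod (g x)"] mult_nonneg_nonneg[of "cmod (f x)" "cmod (g x)"]
    by (simp del: mult_nonneg_nonneg)
  then show "AE x in M. norm (f x * cnj (g x)) \<le> norm ((cmod (f x))\<^sup>2 + (cmod (g x))\<^sup>2)"
    by (simp add: norm_mult)
qed

lemma l2_inner_cnj: "l2_inner M f g = cnj (l2_inner M g f)"
  unfolding l2_inner_def Bochner_Integration.integral_cnj[symmetric] by (simp add: mult.commute)

lemma l2_inner_lin_left:
  assumes "f \<in> L2 M" "g \<in> L2 M" "h \<in> L2 M"
  shows "l2_inner M (\<lambda>x. c * f x + g x) h = c * l2_inner M f h + l2_inner M g h"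
proof -
  have "l2_inner M (\<lambda>x. c * f x + g x) h = (\<integral>x. c * (f x * cnj (h x)) + g x * cnj (h x) \<partial>M)"
    by (simp add: l2_inner_def algebra_simps)
  also have "\<dots> = c * l2_inner M f h + l2_inner M g h"
    using assms by (simp add: l2_inner_def L2_inner_integrable)
  finally show ?thesis .
qed

lemma l2_inner_lin_right:
  assumes "f \<in> L2 M" "g \<in> L2 M" "h \<in> L2 M"
  shows "l2_inner M h (\<lambda>x. c * f x + g x) = cnj c * l2_inner M h f + l2_inner M h g"
  using l2_inner_lin_left[OF assms, of c]
  by (subst (1 2 3) l2_inner_cnj) simp

lemma l2_inner_scale_left: "l2_inner M (\<lambda>x. c * f x) h = c * l2_inner M f h"
  by (simp add: l2_inner_def mult.assoc)

lemma l2_inner_scale_right: "l2_inner M h (\<lambda>x. c * f x) = cnj c * l2_inner M h f"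
  by (subst (1 2) l2_inner_cnj) (simp add: l2_inner_scale_left)

lemma l2_inner_cong:
  assumes "ae_eq M f f'" "ae_eq M g g'"
    and "f \<in> L2 M" "f' \<in> L2 M" "g \<in> L2 M" "g' \<in> L2 M"
  shows "l2_inner M f g = l2_inner M f' g'"
  unfolding l2_inner_def
proof (rule integral_cong_AE)
  show "AE x in M. f x * cnj (g x) = f' x * cnj (g' x)"
    using assms(1,2) by (auto simp: ae_eq_def)
qed (use assms in \<open>auto intro: borel_measurable_times_cnj L2_measurable\<close>)

lemma l2_norm_zero:
  assumes "f \<in> L2 M" "(\<integral>x. (cmod (f x))\<^sup>2 \<partial>M) \<le> 0"
  shows "ae_eq M f (\<lambda>x. 0)"
proof -
  have "0 \<le> (\<integral>x. (cmod (f x))\<^sup>2 \<partial>M)" by simp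
  then have "(\<integral>x. (cmod (f x))\<^sup>2 \<partial>M) = 0" using assms(2) by linarith
  then have "AE x in M. (cmod (f x))\<^sup>2 = 0"
    using integral_nonneg_eq_0_iff_AE[OF L2_integrable[OF assms(1)]] by simp
  then show ?thesis by (simp add: ae_eq_def)
qed

text \<open>The difference \<open>f - g\<close> is itself an admissible test function, and testing
  against it makes its norm vanish. Identities between a chosen adjoint and an explicit formula are
  reduced to inner products in this way.\<close>

lemma l2_inner_ext:
  assumes f: "f \<in> L2 M" and g: "g \<in> L2 M"
    and eq: "\<And>h. h \<in> L2 M \<Longrightarrow> l2_inner M f h = l2_inner M g h"
  shows "ae_eq M f g"
proof -
  let ?d = "\<lambda>x. f x - g x"
  have d: "?d \<in> L2 M" by (rule L2_diff[OF f g])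
  have "l2_inner M ?d ?d = 0"
    using l2_inner_lin_left[OF g f d, of "-1"] eq[OF d] by (simp add: algebra_simps)
  also have "l2_inner M ?d ?d = complex_of_real (\<integral>x. (cmod (?d x))\<^sup>2 \<partial>M)"
    unfolding l2_inner_def by (simp only: complex_norm_square[symmetric] integral_complex_of_real)
  finally have "ae_eq M ?d (\<lambda>x. 0)" using l2_norm_zero[OF d] by simp
  then show ?thesis by (simp add: ae_eq_def)
qed

section \<open>Bounded operators acting on representatives\<close>

lemma ae_eq_refl: "ae_eq M f f" by (simp add: ae_eq_def)

lemma ae_eq_sym: "ae_eq M f g \<Longrightarrow> ae_eq M g f" by (auto simp: ae_eq_def)

lemma ae_eq_trans: "ae_eq M f g \<Longrightarrow> ae_eq M g h \<Longrightarrow> ae_eq M f h" by (auto simp: ae_eq_def)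

lemma bounded_opD:
  assumes "bounded_op M F"
  shows "f \<in> L2 M \<Longrightarrow> F f \<in> L2 M"
    and "f \<in> L2 M \<Longrightarrow> g \<in> L2 M \<Longrightarrow> ae_eq M f g \<Longrightarrow> ae_eq M (F f) (F g)"
    and "f \<in> L2 M \<Longrightarrow> g \<in> L2 M \<Longrightarrow> ae_eq M (F (\<lambda>x. c * f x + g x)) (\<lambda>x. c * F f x + F g x)"
  using assms by (auto simp: bounded_op_def)

text \<open>Squaring settles the sign of the constant, which \<open>bounded_op\<close> leaves open,
  and replaces norms by the integrals in which later estimates are obtained.\<close>

lemma bounded_op_sq_bound:
  assumes "bounded_op M F"
  obtains C where "C \<ge> 0" "\<And>f. f \<in> L2 M \<Longrightarrow> (\<integral>x. (cmod (F f x))\<^sup>2 \<partial>M) \<le> C * (\<integral>x. (cmod (f x))\<^sup>2 \<partial>M)"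
proof -
  obtain C where C: "\<And>f. f \<in> L2 M \<Longrightarrow> l2_norm M (F f) \<le> C * l2_norm M f"
    using assms unfolding bounded_op_def by meson
  have "(\<integral>x. (cmod (F f x))\<^sup>2 \<partial>M) \<le> C\<^sup>2 * (\<integral>x. (cmod (f x))\<^sup>2 \<partial>M)" if "f \<in> L2 M" for f
    using power_mono[OF C[OF that] l2_norm_nonneg, of 2] by (simp add: power_mult_distrib l2_norm_sq)
  then show ?thesis using that[of "C\<^sup>2"] by simp
qed

lemma bounded_opI:
  assumes "\<And>f. f \<in> L2 M \<Longrightarrow> F f \<in> L2 M"
    and "\<And>f g. f \<in> L2 M \<Longrightarrow> g \<in> L2 M \<Longrightarrow> ae_eq M f g \<Longrightarrow> ae_eq M (F f) (F g)"
    and "\<And>f g c. f \<in> L2 M \<Longrightarrow> g \<in> L2 M \<Longrightarrow> ae_eq M (F (\<lambda>x. c * f x + g x)) (\<lambda>x. c * F f x + F g x)"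
    and "C \<ge> 0"
    and "\<And>f. f \<in> L2 M \<Longrightarrow> (\<integral>x. (cmod (F f x))\<^sup>2 \<partial>M) \<le> C * (\<integral>x. (cmod (f x))\<^sup>2 \<partial>M)"
  shows "bounded_op M F"
proof -
  have "l2_norm M (F f) \<le> sqrt C * l2_norm M f" if "f \<in> L2 M" for f
    unfolding l2_norm_def using assms(5)[OF that] by (simp add: real_sqrt_mult[symmetric])
  then show ?thesis using assms unfolding bounded_op_def by blast
qed

lemma bounded_op_diff:
  assumes "bounded_op M F" "f \<in> L2 M" "g \<in> L2 M"
  shows "ae_eq M (F (\<lambda>x. f x - g x)) (\<lambda>x. F f x - F g x)"
  using bounded_opD(3)[OF assms(1,3,2), of "-1"] by (simp add: algebra_simps)

lemma bounded_op_comp: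
  assumes F: "bounded_op M F" and G: "bounded_op M G"
  shows "bounded_op M (F \<circ> G)"
proof -
  obtain A where A: "A \<ge> 0" "\<And>f. f \<in> L2 M \<Longrightarrow> (\<integral>x. (cmod (F f x))\<^sup>2 \<partial>M) \<le> A * (\<integral>x. (cmod (f x))\<^sup>2 \<partial>M)"
    using bounded_op_sq_bound[OF F] by metis
  obtain B where B: "B \<ge> 0" "\<And>f. f \<in> L2 M \<Longrightarrow> (\<integral>x. (cmod (G f x))\<^sup>2 \<partial>M) \<le> B * (\<integral>x. (cmod (f x))\<^sup>2 \<partial>M)"
    using bounded_op_sq_bound[OF G] by metis
  show ?thesis
  proof (rule bounded_opI[where C="A * B"])
    fix f g c assume f: "f \<in> L2 M" and g: "g \<in> L2 M"
    have "ae_eq M (F (G (\<lambda>x. c * f x + g x))) (F (\<lambda>x. c * G f x + G g x))"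
      by (intro bounded_opD(2)[OF F] bounded_opD[OF G] L2_lin f g)
    then show "ae_eq M ((F \<circ> G) (\<lambda>x. c * f x + g x)) (\<lambda>x. c * (F \<circ> G) f x + (F \<circ> G) g x)"
      using bounded_opD(3)[OF F bounded_opD(1)[OF G f] bounded_opD(1)[OF G g], of c]
      by (auto intro: ae_eq_trans)
  next
    fix f assume f: "f \<in> L2 M"
    show "(\<integral>x. (cmod ((F \<circ> G) f x))\<^sup>2 \<partial>M) \<le> A * B * (\<integral>x. (cmod (f x))\<^sup>2 \<partial>M)"
      using order_trans[OF A(2)[OF bounded_opD(1)[OF G f]] mult_left_mono[OF B(2)[OF f] A(1)]]
      by (simp add: mult.assoc)
  qed (use A B bounded_opD[OF F] bounded_opD[OF G] in auto)
qed

lemma bounded_op_scale: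
  assumes F: "bounded_op M F"
  shows "bounded_op M (scale_op c F)"
proof -
  obtain A where A: "A \<ge> 0" "\<And>f. f \<in> L2 M \<Longrightarrow> (\<integral>x. (cmod (F f x))\<^sup>2 \<partial>M) \<le> A * (\<integral>x. (cmod (f x))\<^sup>2 \<partial>M)"
    using bounded_op_sq_bound[OF F] by metis
  show ?thesis
  proof (rule bounded_opI[where C="(cmod c)\<^sup>2 * A"])
    fix f g d assume "f \<in> L2 M" and "g \<in> L2 M"
    from bounded_opD(3)[OF F this, of d]
    show "ae_eq M (scale_op c F (\<lambda>x. d * f x + g x)) (\<lambda>x. d * scale_op c F f x + scale_op c F g x)"
      by (auto simp: scale_op_def ae_eq_def algebra_simps)
  next
    fix f g assume "f \<in> L2 M" "g \<in> L2 M" "ae_eq M f g"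
    from bounded_opD(2)[OF F this] show "ae_eq M (scale_op c F f) (scale_op c F g)"
      by (auto simp: scale_op_def ae_eq_def)
  next
    fix f assume f: "f \<in> L2 M"
    show "(\<integral>x. (cmod (scale_op c F f x))\<^sup>2 \<partial>M) \<le> (cmod c)\<^sup>2 * A * (\<integral>x. (cmod (f x))\<^sup>2 \<partial>M)"
      using mult_left_mono[OF A(2)[OF f], of "(cmod c)\<^sup>2"]
      by (simp add: scale_op_def norm_mult power_mult_distrib mult.assoc)
  qed (use A in \<open>auto simp: scale_op_def intro: L2_scale bounded_opD(1)[OF F]\<close>)
qed

text \<open>Congruence under composition needs no bound on the inner map: \<open>op_eq\<close> is
  tested on \<open>L2\<close> only, so it suffices that the inner map does not leave
  \<open>L2\<close>.\<close>

definition preserves_L2 :: "'a measure \<Rightarrow> 'a oper \<Rightarrow> bool" where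
  "preserves_L2 M F \<longleftrightarrow> (\<forall>f\<in>L2 M. F f \<in> L2 M)"

lemma bounded_op_preserves: "bounded_op M F \<Longrightarrow> preserves_L2 M F"
  by (simp add: preserves_L2_def bounded_op_def)

lemma op_eq_sym: "op_eq M F G \<Longrightarrow> op_eq M G F" by (auto simp: op_eq_def intro: ae_eq_sym)

lemma op_eq_trans: "op_eq M F G \<Longrightarrow> op_eq M G H \<Longrightarrow> op_eq M F H"
  unfolding op_eq_def using ae_eq_trans by blast

lemma op_eq_comp_right: "op_eq M F F' \<Longrightarrow> preserves_L2 M G \<Longrightarrow> op_eq M (F \<circ> G) (F' \<circ> G)"
  by (auto simp: op_eq_def preserves_L2_def)

text \<open>Unlike composition on the right, this uses boundedness of \<open>F\<close>: a map on
  representatives need not respect equality almost everywhere, and \<open>bounded_op\<close>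
  contains that clause.\<close>

lemma op_eq_comp_left:
  "op_eq M G G' \<Longrightarrow> bounded_op M F \<Longrightarrow> preserves_L2 M G \<Longrightarrow> preserves_L2 M G' \<Longrightarrow> op_eq M (F \<circ> G) (F \<circ> G')"
  by (auto simp: op_eq_def preserves_L2_def bounded_op_def)

lemma op_eq_scale: "op_eq M F G \<Longrightarrow> op_eq M (scale_op c F) (scale_op c G)"
  by (auto simp: op_eq_def scale_op_def ae_eq_def)

text \<open>A relation that can be checked for an explicit candidate, in place of the chosen value
  \<open>adjoint_op\<close>; \<open>adjoint_op_eq\<close> converts one into the other.\<close>

definition adjoint_pair :: "'a measure \<Rightarrow> 'a oper \<Rightarrow> 'a oper \<Rightarrow> bool" where
  "adjoint_pair M F G \<longleftrightarrow> bounded_op M F \<and> bounded_op M G \<and>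
     (\<forall>f\<in>L2 M. \<forall>g\<in>L2 M. l2_inner M (F f) g = l2_inner M f (G g))"

lemma adjoint_pair_bounded:
  "adjoint_pair M F G \<Longrightarrow> bounded_op M F" "adjoint_pair M F G \<Longrightarrow> bounded_op M G"
  by (simp_all add: adjoint_pair_def)

lemma adjoint_pair_inner:
  "adjoint_pair M F G \<Longrightarrow> f \<in> L2 M \<Longrightarrow> g \<in> L2 M \<Longrightarrow> l2_inner M (F f) g = l2_inner M f (G g)"
  by (simp add: adjoint_pair_def)

lemma adjoint_pair_unique:
  assumes "adjoint_pair M F G" "adjoint_pair M F G'"
  shows "op_eq M G G'"
  unfolding op_eq_def
proof
  fix f assume f: "f \<in> L2 M"
  show "ae_eq M (G f) (G' f)"
  proof (rule l2_inner_ext)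
    fix h assume h: "h \<in> L2 M"
    show "l2_inner M (G f) h = l2_inner M (G' f) h"
      using adjoint_pair_inner[OF assms(1) h f] adjoint_pair_inner[OF assms(2) h f]
      by (subst (1 2) l2_inner_cnj) simp
  qed (use f assms in \<open>auto simp: adjoint_pair_def bounded_op_def\<close>)
qed

lemma adjoint_pair_adjoint_op:
  assumes "adjoint_pair M F G"
  shows "adjoint_pair M F (adjoint_op M F)"
proof -
  have "bounded_op M (adjoint_op M F) \<and>
      (\<forall>f\<in>L2 M. \<forall>g\<in>L2 M. l2_inner M (F f) g = l2_inner M f (adjoint_op M F g))"
    unfolding adjoint_op_def by (rule someI[of _ G]) (use assms in \<open>simp add: adjoint_pair_def\<close>)
  then show ?thesis using assms by (simp add: adjoint_pair_def)
qed

lemma adjoint_op_eq: "adjoint_pair M F G \<Longrightarrow> op_eq M (adjoint_op M F) G"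
  by (rule adjoint_pair_unique[OF adjoint_pair_adjoint_op])

lemma adjoint_pair_scale:
  assumes "adjoint_pair M F G"
  shows "adjoint_pair M (scale_op c F) (scale_op (cnj c) G)"
  using assms unfolding adjoint_pair_def
  by (auto simp: scale_op_def l2_inner_scale_left l2_inner_scale_right
      intro: bounded_op_scale[unfolded scale_op_def])

lemma projection_opI:
  assumes "adjoint_pair M E E" "op_eq M (E \<circ> E) E"
  shows "projection_op M E"
  using assms adjoint_op_eq[OF assms(1)] by (auto simp: projection_op_def adjoint_pair_def)

text \<open>Equality almost everywhere with a measurable function does not make the values of
  \<open>G\<close> measurable; \<open>preserves_L2\<close> supplies that, and everything else is
  inherited from \<open>F\<close>.\<close>

lemma bounded_op_cong:
  assumes F: "bounded_op M F" and eq: "op_eq M F G" and G: "preserves_L2 M G"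
  shows "bounded_op M G"
proof -
  obtain A where A: "A \<ge> 0" "\<And>f. f \<in> L2 M \<Longrightarrow> (\<integral>x. (cmod (F f x))\<^sup>2 \<partial>M) \<le> A * (\<integral>x. (cmod (f x))\<^sup>2 \<partial>M)"
    using bounded_op_sq_bound[OF F] by metis
  have e: "ae_eq M (F f) (G f)" if "f \<in> L2 M" for f using eq that by (auto simp: op_eq_def)
  have p: "G f \<in> L2 M" if "f \<in> L2 M" for f using G that by (auto simp: preserves_L2_def)
  show ?thesis
  proof (rule bounded_opI[OF p _ _ A(1)])
    fix f g assume fg: "f \<in> L2 M" "g \<in> L2 M"
    { assume "ae_eq M f g" then show "ae_eq M (G f) (G g)"
        using bounded_opD(2)[OF F fg] e[OF fg(1)] e[OF fg(2)] ae_eq_trans ae_eq_sym by meson }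
    { fix c show "ae_eq M (G (\<lambda>x. c * f x + g x)) (\<lambda>x. c * G f x + G g x)"
        using bounded_opD(3)[OF F fg, of c] e[OF fg(1)] e[OF fg(2)] e[OF L2_lin[OF fg, of c]]
        by (auto simp: ae_eq_def) }
  next
    fix f assume f: "f \<in> L2 M"
    have "(\<integral>x. (cmod (F f x))\<^sup>2 \<partial>M) = (\<integral>x. (cmod (G f x))\<^sup>2 \<partial>M)"
      by (rule integral_cong_AE)
         (use e[OF f] L2_measurable[OF p[OF f]] L2_measurable[OF bounded_opD(1)[OF F f]] in \<open>auto simp: ae_eq_def\<close>)
    then show "(\<integral>x. (cmod (G f x))\<^sup>2 \<partial>M) \<le> A * (\<integral>x. (cmod (f x))\<^sup>2 \<partial>M)" using A(2)[OF f] by simp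
  qed
qed

section \<open>Completeness, the Riesz theorem and existence of adjoints\<close>

lemma L2_fast_Cauchy:
  assumes f: "\<And>n. f n \<in> L2 M"
    and d: "\<And>n. (\<integral>x. (cmod (f (Suc n) x - f n x))\<^sup>2 \<partial>M) \<le> C * (1/16)^n"
  obtains F w where "F \<in> L2 M" "integrable M w" "AE x in M. (\<lambda>n. f n x) \<longlonglongrightarrow> F x"
    "AE x in M. \<forall>n. (cmod (f n x))\<^sup>2 \<le> w x"
proof -
  have C: "C \<ge> 0" using order_trans[OF _ d[of 0], of 0] by simp
  \<comment> \<open>The factor \<open>4^n\<close> splits the decay \<open>(1/16)^n\<close> in two:
    the integrals of \<open>t n\<close> still sum geometrically, and finiteness of the sum at a
    point bounds the increments there by a multiple of \<open>(1/2)^n\<close>.\<close>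
  define t where "t n x = 4^n * (cmod (f (Suc n) x - f n x))\<^sup>2" for n x
  have [measurable]: "f n \<in> borel_measurable M" for n using f L2_measurable by blast
  have ti: "integrable M (t n)" for n
    using L2_integrable[OF L2_diff[OF f f]] by (auto simp: t_def[abs_def])
  have tn: "t n x \<ge> 0" for n x by (simp add: t_def)
  have tm[measurable]: "t n \<in> borel_measurable M" for n using ti by auto
  define G where "G x = (\<Sum>n. ennreal (t n x))" for x
  have Gm[measurable]: "G \<in> borel_measurable M" unfolding G_def by measurable
  have "(\<integral>\<^sup>+x. G x \<partial>M) = (\<Sum>n. \<integral>\<^sup>+x. ennreal (t n x) \<partial>M)"
    unfolding G_def by (rule nn_integral_suminf) measurable
  also have "\<dots> \<le> (\<Sum>n. ennreal (C * (1/4)^n))"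
  proof (rule suminf_le)
    fix n
    have "(\<integral>x. t n x \<partial>M) = 4^n * (\<integral>x. (cmod (f (Suc n) x - f n x))\<^sup>2 \<partial>M)" by (simp add: t_def)
    also have "\<dots> \<le> 4^n * (C * (1/16)^n)" by (intro mult_left_mono d) simp
    also have "\<dots> = C * (1/4)^n" by (simp add: power_divide field_simps power_mult_distrib[symmetric])
    finally show "(\<integral>\<^sup>+x. ennreal (t n x) \<partial>M) \<le> ennreal (C * (1/4)^n)"
      using nn_integral_eq_integral[OF ti[of n]] tn by (simp add: ennreal_leI)
  qed auto
  also have "\<dots> = ennreal (\<Sum>n. C * (1/4)^n)"
    using C by (intro suminf_ennreal2) (auto intro: summable_mult summable_geometric)
  also have "\<dots> < \<infinity>" by simp
  finally have Gfin: "(\<integral>\<^sup>+x. G x \<partial>M) < \<infinity>" .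
  then have GAE: "AE x in M. G x \<noteq> \<infinity>" by (intro nn_integral_PInf_AE) auto
  define g where "g x = enn2real (G x)" for x
  have gi: "integrable M g"
  proof (rule integrableI_nonneg)
    have "(\<integral>\<^sup>+x. ennreal (g x) \<partial>M) = (\<integral>\<^sup>+x. G x \<partial>M)"
      by (rule nn_integral_cong_AE) (use GAE in \<open>auto simp: g_def less_top\<close>)
    then show "(\<integral>\<^sup>+x. ennreal (g x) \<partial>M) < \<infinity>" using Gfin by simp
  qed (auto simp: g_def[abs_def])
  have g0: "g x \<ge> 0" for x by (simp add: g_def)
  have step: "AE x in M. \<forall>n. cmod (f (Suc n) x - f n x) \<le> sqrt (g x) * (1/2)^n"
    using GAE
  proof eventually_elim
    fix x assume fin: "G x \<noteq> \<infinity>"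
    show "\<forall>n. cmod (f (Suc n) x - f n x) \<le> sqrt (g x) * (1/2)^n"
    proof
      fix n
      have "ennreal (t n x) \<le> G x" unfolding G_def
        using sum_le_suminf[of "\<lambda>n. ennreal (t n x)" "{n}"] by auto
      also have "G x = ennreal (g x)" using fin by (simp add: g_def less_top)
      finally have "t n x \<le> g x" using g0 by simp
      then have "(2^n * cmod (f (Suc n) x - f n x))\<^sup>2 \<le> g x"
        by (simp add: t_def power_mult_distrib power_mult[symmetric] mult.commute[of n] power_mult)
      then have "2^n * cmod (f (Suc n) x - f n x) \<le> sqrt (g x)"
        by (rule real_le_rsqrt)
      then show "cmod (f (Suc n) x - f n x) \<le> sqrt (g x) * (1/2)^n"
        by (simp add: power_divide field_simps)
    qed
  qed
  have conv: "AE x in M. convergent (\<lambda>n. f n x) \<and> (\<forall>n. cmod (f n x - f 0 x) \<le> 2 * sqrt (g x))"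
    using step
  proof eventually_elim
    fix x assume s: "\<forall>n. cmod (f (Suc n) x - f n x) \<le> sqrt (g x) * (1/2)^n"
    have sm: "summable (\<lambda>n. sqrt (g x) * (1/2)^n)" by (intro summable_mult summable_geometric) simp
    have sd: "summable (\<lambda>n. f (Suc n) x - f n x)"
      by (rule summable_comparison_test[OF _ sm]) (use s in auto)
    have tel: "(\<Sum>k<n. f (Suc k) x - f k x) = f n x - f 0 x" for n
      by (rule sum_lessThan_telescope)
    have "convergent (\<lambda>n. f n x - f 0 x)"
      using sd[THEN summable_LIMSEQ] unfolding tel by (auto simp: convergent_def)
    then have c: "convergent (\<lambda>n. f n x)"
      using convergent_diff_const_right_iff by blast
    have "cmod (f n x - f 0 x) \<le> 2 * sqrt (g x)" for n
    proof -
      have "cmod (f n x - f 0 x) \<le> (\<Sum>k<n. sqrt (g x) * (1/2)^k)"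
        unfolding tel[symmetric] by (rule sum_norm_le) (use s in auto)
      also have "\<dots> \<le> (\<Sum>k. sqrt (g x) * (1/2)^k)"
        by (rule sum_le_suminf[OF sm]) (auto simp: g0)
      also have "\<dots> = 2 * sqrt (g x)"
        by (subst suminf_mult) (auto simp: suminf_geometric summable_geometric)
      finally show ?thesis .
    qed
    with c show "convergent (\<lambda>n. f n x) \<and> (\<forall>n. cmod (f n x - f 0 x) \<le> 2 * sqrt (g x))" by blast
  qed
  \<comment> \<open>Since \<open>2 * sqrt (g x)\<close> bounds the distance of \<open>f n x\<close>
    from \<open>f 0 x\<close>, this integrable function majorises the squared moduli of all
    \<open>f n x\<close> at once, which is what dominated convergence will ask for.\<close>
  define w where "w x = 2 * (cmod (f 0 x))\<^sup>2 + 2 * (4 * g x)" for x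
  define F where "F x = lim (\<lambda>n. f n x)" for x
  have wi: "integrable M w" using gi L2_integrable[OF f[of 0]] by (auto simp: w_def[abs_def])
  have w: "AE x in M. \<forall>n. (cmod (f n x))\<^sup>2 \<le> w x"
    using conv
  proof eventually_elim
    fix x assume "convergent (\<lambda>n. f n x) \<and> (\<forall>n. cmod (f n x - f 0 x) \<le> 2 * sqrt (g x))"
    then have "(cmod (f n x - f 0 x))\<^sup>2 \<le> 4 * g x" for n
      using power_mono[of "cmod (f n x - f 0 x)" "2 * sqrt (g x)" 2] g0 by (simp add: power_mult_distrib)
    moreover have "(cmod (f n x))\<^sup>2 \<le> 2 * (cmod (f 0 x))\<^sup>2 + 2 * (cmod (f n x - f 0 x))\<^sup>2" for n
      using cmod_add_sq[of "f 0 x" "f n x - f 0 x"] by simp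
    ultimately show "\<forall>n. (cmod (f n x))\<^sup>2 \<le> w x" unfolding w_def by (smt (verit))
  qed
  have lim: "AE x in M. (\<lambda>n. f n x) \<longlonglongrightarrow> F x"
    using conv by eventually_elim (auto simp: F_def convergent_LIMSEQ_iff)
  have "F \<in> L2 M"
  proof (rule L2_bound[OF _ wi])
    show "F \<in> borel_measurable M" unfolding F_def by measurable
    show "AE x in M. (cmod (F x))\<^sup>2 \<le> w x"
      using lim w
    proof eventually_elim
      fix x assume l: "(\<lambda>n. f n x) \<longlonglongrightarrow> F x" and b: "\<forall>n. (cmod (f n x))\<^sup>2 \<le> w x"
      have "(\<lambda>n. (cmod (f n x))\<^sup>2) \<longlonglongrightarrow> (cmod (F x))\<^sup>2" by (intro tendsto_intros l)
      then show "(cmod (F x))\<^sup>2 \<le> w x" by (rule LIMSEQ_le_const2) (use b in auto)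
    qed
  qed
  then show thesis using that wi lim w by blast
qed

(* The representing vector is the limit of a minimising sequence of J. *)
lemma L2_Riesz:
  fixes \<phi> :: "('a \<Rightarrow> complex) \<Rightarrow> complex"
  assumes lin: "\<And>f g c. f \<in> L2 M \<Longrightarrow> g \<in> L2 M \<Longrightarrow> \<phi> (\<lambda>x. c * f x + g x) = c * \<phi> f + \<phi> g"
    and bd: "\<And>f. f \<in> L2 M \<Longrightarrow> (cmod (\<phi> f))\<^sup>2 \<le> C * (\<integral>x. (cmod (f x))\<^sup>2 \<partial>M)"
  shows "\<exists>h\<in>L2 M. \<forall>g\<in>L2 M. \<phi> g = l2_inner M g h"
proof -
  define N where "N f = (\<integral>x. (cmod (f x))\<^sup>2 \<partial>M)" for f
  \<comment> \<open>If \<open>h\<close> represents \<open>\<phi>\<close>, then \<open>J f\<close> is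
    the squared distance from \<open>f\<close> to \<open>h\<close> minus the squared norm of
    \<open>h\<close>; minimising \<open>J\<close> therefore searches for \<open>h\<close>.\<close>
  define J where "J f = N f - 2 * Re (\<phi> f)" for f
  have N0: "N f \<ge> 0" for f by (simp add: N_def)
  have expand: "N (\<lambda>x. c * g x + f x) = (cmod c)\<^sup>2 * N g + N f + 2 * Re (c * l2_inner M g f)"
    if f: "f \<in> L2 M" and g: "g \<in> L2 M" for f g c
  proof -
    have sq: "(cmod (c * g x + f x))\<^sup>2 = (cmod c)\<^sup>2 * (cmod (g x))\<^sup>2 + (cmod (f x))\<^sup>2 + 2 * Re (c * (g x * cnj (f x)))" for x
      unfolding cmod_power2 by (simp add: algebra_simps power2_eq_square)
    note [simp] = L2_integrable[OF f] L2_integrable[OF g] L2_inner_integrable[OF g f]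
    have "integrable M (\<lambda>x. c * (g x * cnj (f x)))" by simp
    then have "(\<integral>x. Re (c * (g x * cnj (f x))) \<partial>M) = Re (c * l2_inner M g f)"
      "integrable M (\<lambda>x. Re (c * (g x * cnj (f x))))"
      by (simp_all add: l2_inner_def del: times_complex.sel)
    then show ?thesis unfolding N_def sq by (simp del: times_complex.sel)
  qed
  have Jexp: "J (\<lambda>x. c * g x + f x) = (cmod c)\<^sup>2 * N g + J f + 2 * Re (c * (l2_inner M g f - \<phi> g))"
    if f: "f \<in> L2 M" and g: "g \<in> L2 M" for f g c
    unfolding J_def expand[OF that] lin[OF g f] by (simp add: algebra_simps)
  \<comment> \<open>The parallelogram identity. The linear terms cancel because
    \<open>\<phi>\<close> at the midpoint is the mean of its two values, so two near-minimisers of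
    \<open>J\<close> are close to each other.\<close>
  have par: "N (\<lambda>x. f x - g x) = 2 * J f + 2 * J g - 4 * J (\<lambda>x. (1/2) * f x + (1/2) * g x)"
    if f: "f \<in> L2 M" and g: "g \<in> L2 M" for f g
  proof -
    have a: "N (\<lambda>x. f x - g x) = N g + N f - 2 * Re (l2_inner M g f)"
      using expand[OF f g, of "-1"] by simp
    have hg: "(\<lambda>x. (1/2) * g x) \<in> L2 M" by (rule L2_scale[OF g])
    have b: "N (\<lambda>x. (1/2) * f x + (1/2) * g x) = (1/4) * N f + (1/4) * N g + (1/2) * Re (l2_inner M g f)"
    proof -
      have "N (\<lambda>x. (1/2) * f x + (1/2) * g x) = (1/4) * N f + N (\<lambda>x. (1/2) * g x) + Re (l2_inner M f (\<lambda>x. (1/2) * g x))"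
        using expand[OF hg f, of "1/2"] by (simp add: norm_divide power_divide)
      also have "N (\<lambda>x. (1/2) * g x) = (1/4) * N g"
        by (simp add: N_def norm_mult power_mult_distrib norm_divide power_divide)
      also have "Re (l2_inner M f (\<lambda>x. (1/2) * g x)) = (1/2) * Re (l2_inner M g f)"
        unfolding l2_inner_scale_right[of M f "1/2" g] by (subst l2_inner_cnj) simp
      finally show ?thesis by simp
    qed
    have c: "\<phi> (\<lambda>x. (1/2) * f x + (1/2) * g x) = (1/2) * \<phi> f + (1/2) * \<phi> g"
      using lin[OF f hg, of "1/2"] lin[OF g L2_zero, of "1/2"] lin[OF L2_zero L2_zero, of 1] by simp
    show ?thesis unfolding J_def a b c by (simp add: field_simps)
  qed
  \<comment> \<open>From
    \<open>2 * sqrt (\<bar>C\<bar> * N f) \<le> \<bar>C\<bar> + N f\<close>.\<close>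
  have low: "J f \<ge> - \<bar>C\<bar>" if f: "f \<in> L2 M" for f
  proof -
    have "(Re (\<phi> f))\<^sup>2 \<le> (cmod (\<phi> f))\<^sup>2"
      by (simp add: cmod_power2)
    also have "\<dots> \<le> \<bar>C\<bar> * N f"
      using order_trans[OF bd[OF f, folded N_def] mult_right_mono[OF abs_ge_self N0]] .
    finally have a: "\<bar>Re (\<phi> f)\<bar> \<le> sqrt (\<bar>C\<bar> * N f)" by (simp add: real_le_rsqrt)
    have "2 * (sqrt \<bar>C\<bar> * sqrt (N f)) \<le> \<bar>C\<bar> + N f"
      using sum_squares_bound[of "sqrt \<bar>C\<bar>" "sqrt (N f)"] N0 by simp
    with a show ?thesis by (simp add: J_def real_sqrt_mult)
  qed
  define I where "I = Inf (J ` L2 M)"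
  have bb: "bdd_below (J ` L2 M)" using low by (auto intro!: bdd_belowI)
  have Ile: "I \<le> J f" if "f \<in> L2 M" for f unfolding I_def by (rule cInf_lower[OF _ bb]) (use that in auto)
  \<comment> \<open>The rate is dictated by \<open>L2_fast_Cauchy\<close>; the parallelogram
    identity loses only a constant factor.\<close>
  have "\<exists>f\<in>L2 M. J f < I + (1/16)^n" for n :: nat
  proof -
    have "J ` L2 M \<noteq> {}" using L2_zero by blast
    from cInf_lessD[OF this, of "I + (1/16)^n"] show ?thesis by (auto simp: I_def)
  qed
  then obtain f where f: "\<And>n. f n \<in> L2 M" and fJ: "\<And>n. J (f n) < I + (1/16)^n" by metis
  have "(\<integral>x. (cmod (f (Suc n) x - f n x))\<^sup>2 \<partial>M) \<le> 4 * (1/16)^n" for n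
  proof -
    have "N (\<lambda>x. f (Suc n) x - f n x) \<le> 2 * J (f (Suc n)) + 2 * J (f n) - 4 * I"
      unfolding par[OF f f] using Ile[OF L2_lin[OF f L2_scale[OF f]], of "1/2" "Suc n" "1/2" n] by simp
    also have "\<dots> \<le> 2 * (1/16)^Suc n + 2 * (1/16)^n" using fJ[of n] fJ[of "Suc n"] by simp
    also have "\<dots> \<le> 4 * (1/16)^n" by simp
    finally show ?thesis by (simp add: N_def)
  qed
  then have d: "\<And>n. (\<integral>x. (cmod (f (Suc n) x - f n x))\<^sup>2 \<partial>M) \<le> 4 * (1/16)^n" .
  obtain h w where h: "h \<in> L2 M" and w: "integrable M w"
    and lim: "AE x in M. (\<lambda>n. f n x) \<longlonglongrightarrow> h x" and dom: "AE x in M. \<forall>n. (cmod (f n x))\<^sup>2 \<le> w x"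
    by (rule L2_fast_Cauchy[OF f d])
  have "\<phi> g = l2_inner M g h" if g: "g \<in> L2 M" for g
  proof -
    define \<psi> where "\<psi> n = l2_inner M g (f n) - \<phi> g" for n
    have small: "(cmod (\<psi> n))\<^sup>2 * (2 - (1/4)^n * N g) \<le> (1/4)^n" for n
    proof -
      \<comment> \<open>The step length is the square root of the excess allowed for
        \<open>J (f n)\<close>. Moving from \<open>f n\<close> by \<open>c\<close> times
        \<open>g\<close> gains \<open>2 * s\<close> times the squared modulus of
        \<open>\<psi> n\<close>, at a second order cost involving \<open>N g\<close>, and the net
        gain cannot exceed the excess \<open>s * s\<close>.\<close>
      define s :: real where "s = (1/4)^n"
      have s: "s > 0" "s * s = (1/16)^n" by (auto simp: s_def power_mult_distrib[symmetric])
      define c where "c = - (complex_of_real s * cnj (\<psi> n))"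
      have "I \<le> J (\<lambda>x. c * g x + f n x)" by (rule Ile[OF L2_lin[OF g f]])
      also have "\<dots> = (cmod c)\<^sup>2 * N g + J (f n) + 2 * Re (c * \<psi> n)"
        using Jexp[OF f g, of c n] by (simp add: \<psi>_def)
      also have "(cmod c)\<^sup>2 = s * s * (cmod (\<psi> n))\<^sup>2"
        using s by (simp add: c_def norm_mult power_mult_distrib power2_eq_square)
      also have "Re (c * \<psi> n) = - s * (cmod (\<psi> n))\<^sup>2"
      proof -
        have "c * \<psi> n = complex_of_real (- s * (cmod (\<psi> n))\<^sup>2)"
          unfolding c_def of_real_mult complex_norm_square by (simp add: mult_ac)
        then show ?thesis by simp
      qed
      finally have "0 \<le> s * s * (cmod (\<psi> n))\<^sup>2 * N g + s * s - 2 * s * (cmod (\<psi> n))\<^sup>2"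
        using fJ[of n] s by simp
      then have "s * ((cmod (\<psi> n))\<^sup>2 * (2 - s * N g)) \<le> s * s" by (simp add: algebra_simps)
      then show ?thesis using s by (simp add: s_def)
    qed
    have z: "(\<lambda>n. (1/4 :: real)^n) \<longlonglongrightarrow> 0" by (rule LIMSEQ_realpow_zero) auto
    have "(\<lambda>n. (1/4)^n * N g) \<longlonglongrightarrow> 0 * N g" by (intro tendsto_intros z)
    then have ev: "\<forall>\<^sub>F n in sequentially. (1/4)^n * N g < 1"
      by (simp add: order_tendstoD(2))
    have "(\<lambda>n. (cmod (\<psi> n))\<^sup>2) \<longlonglongrightarrow> 0"
    proof (rule tendsto_sandwich[OF _ _ tendsto_const z])
      show "\<forall>\<^sub>F n in sequentially. (cmod (\<psi> n))\<^sup>2 \<le> (1/4)^n"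
        using ev
      proof eventually_elim
        fix n assume "(1/4)^n * N g < 1"
        then have "(cmod (\<psi> n))\<^sup>2 * 1 \<le> (cmod (\<psi> n))\<^sup>2 * (2 - (1/4)^n * N g)"
          by (intro mult_left_mono) auto
        then show "(cmod (\<psi> n))\<^sup>2 \<le> (1/4)^n" using small[of n] by simp
      qed
    qed simp
    then have "\<psi> \<longlonglongrightarrow> 0" using tendsto_norm_zero_cancel[of \<psi>] by simp
    then have 1: "(\<lambda>n. l2_inner M g (f n)) \<longlonglongrightarrow> \<phi> g"
      using tendsto_add[of \<psi> 0 sequentially "\<lambda>_. \<phi> g"] by (simp add: \<psi>_def[abs_def])
    have 2: "(\<lambda>n. l2_inner M g (f n)) \<longlonglongrightarrow> l2_inner M g h"
      unfolding l2_inner_def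
    proof (rule integral_dominated_convergence)
      show "(\<lambda>x. g x * cnj (h x)) \<in> borel_measurable M"
        "\<And>n. (\<lambda>x. g x * cnj (f n x)) \<in> borel_measurable M"
        by (intro borel_measurable_times_cnj L2_measurable g h f)+
      show "integrable M (\<lambda>x. (cmod (g x))\<^sup>2 + w x)" using L2_integrable[OF g] w by simp
      show "AE x in M. (\<lambda>n. g x * cnj (f n x)) \<longlonglongrightarrow> g x * cnj (h x)"
        using lim by eventually_elim (intro tendsto_intros)
      show "AE x in M. norm (g x * cnj (f n x)) \<le> (cmod (g x))\<^sup>2 + w x" for n
        using dom
      proof eventually_elim
        fix x assume "\<forall>n. (cmod (f n x))\<^sup>2 \<le> w x"
        then have "(cmod (f n x))\<^sup>2 \<le> w x" by blast
        moreover have "cmod (g x) * cmod (f n x) \<le> (cmod (g x))\<^sup>2 + (cmod (f n x))\<^sup>2"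
          using sum_squares_bound[of "cmod (g x)" "cmod (f n x)"] mult_nonneg_nonneg[of "cmod (g x)" "cmod (f n x)"]
          by (simp del: mult_nonneg_nonneg)
        ultimately show "norm (g x * cnj (f n x)) \<le> (cmod (g x))\<^sup>2 + w x" by (simp add: norm_mult)
      qed
    qed
    show ?thesis by (rule LIMSEQ_unique[OF 1 2])
  qed
  then show ?thesis using h by blast
qed

text \<open>The integral of the square of \<open>r * cmod (f x) + cmod (g x)\<close> is a quadratic
  in \<open>r\<close> without negative values, and its discriminant gives the bound.\<close>

lemma L2_Cauchy_Schwarz:
  assumes "f \<in> L2 M" "g \<in> L2 M"
  shows "(cmod (l2_inner M f g))\<^sup>2 \<le> (\<integral>x. (cmod (f x))\<^sup>2 \<partial>M) * (\<integral>x. (cmod (g x))\<^sup>2 \<partial>M)"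
proof -
  let ?N = "\<lambda>f. \<integral>x. (cmod (f x))\<^sup>2 \<partial>M"
  have i: "integrable M (\<lambda>x. cmod (f x) * cmod (g x))"
    using integrable_norm[OF L2_inner_integrable[OF assms]] by (simp add: norm_mult)
  have "cmod (l2_inner M f g) \<le> (\<integral>x. cmod (f x) * cmod (g x) \<partial>M)"
    unfolding l2_inner_def using integral_norm_bound[of M "\<lambda>x. f x * cnj (g x)"] by (simp add: norm_mult)
  then have "(cmod (l2_inner M f g))\<^sup>2 \<le> (\<integral>x. cmod (f x) * cmod (g x) \<partial>M)\<^sup>2"
    by (rule power_mono) simp
  also have "\<dots> \<le> ?N f * ?N g"
  proof -
    let ?p = "\<integral>x. cmod (f x) * cmod (g x) \<partial>M"
    have q: "0 \<le> r\<^sup>2 * ?N f + 2 * r * ?p + ?N g" for r :: real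
    proof -
      have "0 \<le> (\<integral>x. (r * cmod (f x) + cmod (g x))\<^sup>2 \<partial>M)" by simp
      also have "\<dots> = (\<integral>x. r\<^sup>2 * (cmod (f x))\<^sup>2 + 2 * r * (cmod (f x) * cmod (g x)) + (cmod (g x))\<^sup>2 \<partial>M)"
        by (simp add: power2_eq_square algebra_simps)
      also have "\<dots> = r\<^sup>2 * ?N f + 2 * r * ?p + ?N g"
        using i assms by (simp add: L2_integrable)
      finally show ?thesis .
    qed
    have F0: "?N f \<ge> 0" "?N g \<ge> 0" by simp_all
    show ?thesis
    proof (cases "?N f = 0")
      case True
      have "?p = 0"
      proof (rule ccontr)
        assume "?p \<noteq> 0"
        \<comment> \<open>The quadratic has become affine, and at this \<open>r\<close> its value is
          \<open>-1\<close>.\<close>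
        then show False using q[of "- (?N g + 1) / (2 * ?p)"] True F0 by (simp add: field_simps)
      qed
      then show ?thesis using F0 by simp
    next
      case False
      then have "?N f > 0" using F0(1) by (simp only: less_le) simp
      \<comment> \<open>The point where the quadratic is minimal.\<close>
      then show ?thesis using q[of "- ?p / ?N f"] by (simp add: field_simps power2_eq_square)
    qed
  qed
  finally show ?thesis .
qed

lemma le_of_self_mult_le:
  fixes a b :: real
  assumes "a * a \<le> a * b" "0 \<le> a" "0 \<le> b"
  shows "a \<le> b"
  using assms by (cases "a = 0") auto

text \<open>For fixed \<open>g\<close> the functional sending \<open>f\<close> to the inner product
  of \<open>F f\<close> with \<open>g\<close> is bounded, and Riesz provides \<open>G g\<close>.
  That \<open>G\<close> is linear and respects null sets follows from \<open>l2_inner_ext\<close>,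
  because inner products determine a vector up to a null set.\<close>

lemma adjoint_exists:
  assumes F: "bounded_op M F"
  shows "adjoint_pair M F (adjoint_op M F)"
proof -
  let ?N = "\<lambda>f. \<integral>x. (cmod (f x))\<^sup>2 \<partial>M"
  obtain C where C: "C \<ge> 0" "\<And>f. f \<in> L2 M \<Longrightarrow> ?N (F f) \<le> C * ?N f"
    using bounded_op_sq_bound[OF F] by metis
  note FL = bounded_opD(1)[OF F]
  have "\<exists>h\<in>L2 M. \<forall>f\<in>L2 M. l2_inner M (F f) g = l2_inner M f h" if g: "g \<in> L2 M" for g
  proof (rule L2_Riesz)
    fix f f' c assume f: "f \<in> L2 M" "f' \<in> L2 M"
    have "l2_inner M (F (\<lambda>x. c * f x + f' x)) g = l2_inner M (\<lambda>x. c * F f x + F f' x) g"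
      by (rule l2_inner_cong) (use f g FL bounded_opD(3)[OF F] in \<open>auto intro: L2_lin ae_eq_refl\<close>)
    then show "l2_inner M (F (\<lambda>x. c * f x + f' x)) g = c * l2_inner M (F f) g + l2_inner M (F f') g"
      using l2_inner_lin_left[OF FL[OF f(1)] FL[OF f(2)] g] by simp
  next
    fix f assume f: "f \<in> L2 M"
    have "(cmod (l2_inner M (F f) g))\<^sup>2 \<le> ?N (F f) * ?N g" by (rule L2_Cauchy_Schwarz[OF FL[OF f] g])
    also have "\<dots> \<le> C * ?N f * ?N g" by (intro mult_right_mono C f) simp
    finally show "(cmod (l2_inner M (F f) g))\<^sup>2 \<le> C * ?N g * ?N f" by (simp add: algebra_simps)
  qed
  then obtain G where GL: "\<And>g. g \<in> L2 M \<Longrightarrow> G g \<in> L2 M"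
    and G: "\<And>f g. f \<in> L2 M \<Longrightarrow> g \<in> L2 M \<Longrightarrow> l2_inner M (F f) g = l2_inner M f (G g)"
    by metis
  have "adjoint_pair M F G"
    unfolding adjoint_pair_def
  proof (intro conjI F ballI G)
    show "bounded_op M G"
    proof (rule bounded_opI[OF GL _ _ C(1)])
      fix f g assume f: "f \<in> L2 M" and g: "g \<in> L2 M"
      { assume e: "ae_eq M f g"
        show "ae_eq M (G f) (G g)"
        proof (rule l2_inner_ext)
          fix h assume h: "h \<in> L2 M"
          have "l2_inner M (F h) f = l2_inner M (F h) g"
            by (rule l2_inner_cong) (use e f g h FL in \<open>auto intro: ae_eq_refl\<close>)
          then have "l2_inner M h (G f) = l2_inner M h (G g)" using G f g h by simp
          then show "l2_inner M (G f) h = l2_inner M (G g) h" by (subst (1 2) l2_inner_cnj) simp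
        qed (use f g GL in auto) }
      { fix c
        show "ae_eq M (G (\<lambda>x. c * f x + g x)) (\<lambda>x. c * G f x + G g x)"
        proof (rule l2_inner_ext)
          fix h assume h: "h \<in> L2 M"
          have "l2_inner M h (G (\<lambda>x. c * f x + g x)) = l2_inner M h (\<lambda>x. c * G f x + G g x)"
            using f g h GL FL by (simp add: G[symmetric] L2_lin l2_inner_lin_right)
          then show "l2_inner M (G (\<lambda>x. c * f x + g x)) h = l2_inner M (\<lambda>x. c * G f x + G g x) h"
            by (subst (1 2) l2_inner_cnj) simp
        qed (use f g GL in \<open>auto intro: L2_lin\<close>) }
    next
      fix g assume g: "g \<in> L2 M"
      \<comment> \<open>Testing against \<open>G g\<close> itself turns its squared norm into an
        inner product with \<open>g\<close>. One factor \<open>?N (G g)\<close> is cancelled at the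
        end, which leaves the constant of \<open>F\<close>.\<close>
      have "complex_of_real (?N (G g)) = l2_inner M (G g) (G g)"
        unfolding l2_inner_def by (simp only: complex_norm_square[symmetric] integral_complex_of_real)
      also have "\<dots> = l2_inner M (F (G g)) g" using G[OF GL[OF g] g] by simp
      finally have e: "l2_inner M (F (G g)) g = complex_of_real (?N (G g))" ..
      have "(?N (G g))\<^sup>2 = (cmod (l2_inner M (F (G g)) g))\<^sup>2"
        unfolding e norm_of_real power2_abs ..
      also have "\<dots> \<le> ?N (F (G g)) * ?N g" by (rule L2_Cauchy_Schwarz[OF FL[OF GL[OF g]] g])
      also have "\<dots> \<le> C * ?N (G g) * ?N g" by (intro mult_right_mono C GL g) simp
      finally have "?N (G g) * ?N (G g) \<le> ?N (G g) * (C * ?N g)" by (simp add: power2_eq_square algebra_simps)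
      moreover have "0 \<le> ?N (G g)" "0 \<le> C * ?N g" using C(1) by simp_all
      ultimately show "?N (G g) \<le> C * ?N g"
        by (rule le_of_self_mult_le)
    qed
  qed auto
  then show ?thesis by (rule adjoint_pair_adjoint_op)
qed

text \<open>\<open>projection_op\<close> compares \<open>E\<close> with a chosen value. Only because
  an adjoint exists does that value satisfy the adjoint equation, and hence \<open>E\<close> is
  self-adjoint in the usual sense.\<close>

lemma projection_op_adjoint_pair:
  assumes "projection_op M E"
  shows "adjoint_pair M E E"
proof -
  have b: "bounded_op M E" and e: "op_eq M (adjoint_op M E) E"
    using assms by (auto simp: projection_op_def)
  have p: "adjoint_pair M E (adjoint_op M E)" by (rule adjoint_exists[OF b])
  have "l2_inner M (E f) g = l2_inner M f (E g)" if "f \<in> L2 M" "g \<in> L2 M" for f g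
  proof -
    have "l2_inner M f (adjoint_op M E g) = l2_inner M f (E g)"
      by (rule l2_inner_cong)
         (use that e p b in \<open>auto simp: op_eq_def adjoint_pair_def bounded_op_def intro: ae_eq_refl\<close>)
    then show ?thesis using adjoint_pair_inner[OF p that] by simp
  qed
  then show ?thesis using b by (simp add: adjoint_pair_def)
qed

text \<open>The chosen adjoints of \<open>E\<close> and \<open>F\<close> are not directly related,
  so self-adjointness is carried from one to the other through inner products.\<close>

lemma projection_op_cong:
  assumes E: "projection_op M E" and eq: "op_eq M E F" and F: "preserves_L2 M F"
  shows "projection_op M F"
proof (rule projection_opI)
  have bE: "bounded_op M E" and bF: "bounded_op M F"
    using E(1) bounded_op_cong[OF _ eq F] by (auto simp: projection_op_def)
  note aE = projection_op_adjoint_pair[OF E]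
  show "adjoint_pair M F F"
    unfolding adjoint_pair_def
  proof (intro conjI bF ballI)
    fix f g assume f: "f \<in> L2 M" and g: "g \<in> L2 M"
    have e: "ae_eq M (E f) (F f)" "ae_eq M (E g) (F g)" using eq f g by (auto simp: op_eq_def)
    have "l2_inner M (F f) g = l2_inner M (E f) g"
      by (rule l2_inner_cong) (use e f g bounded_opD(1)[OF bE] bounded_opD(1)[OF bF] in \<open>auto intro: ae_eq_sym ae_eq_refl\<close>)
    also have "\<dots> = l2_inner M f (E g)" by (rule adjoint_pair_inner[OF aE f g])
    also have "\<dots> = l2_inner M f (F g)"
      by (rule l2_inner_cong) (use e f g bounded_opD(1)[OF bE] bounded_opD(1)[OF bF] in \<open>auto intro: ae_eq_sym ae_eq_refl\<close>)
    finally show "l2_inner M (F f) g = l2_inner M f (F g)" .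
  qed
  have "op_eq M (F \<circ> F) (E \<circ> F)" by (rule op_eq_comp_right[OF op_eq_sym[OF eq] F])
  moreover have "op_eq M (E \<circ> F) (E \<circ> E)"
    by (rule op_eq_comp_left[OF op_eq_sym[OF eq] bE F bounded_op_preserves[OF bE]])
  moreover have "op_eq M (E \<circ> E) E" using E(1) by (simp add: projection_op_def)
  ultimately show "op_eq M (F \<circ> F) F" using eq op_eq_trans by metis
qed

subsection \<open>Sums over countable groups and measure preserving maps\<close>

lemma measurable_pair_countable:
  assumes "countable C" "\<And>h. h \<in> C \<Longrightarrow> (\<lambda>x. f (x, h)) \<in> measurable M N"
  shows "f \<in> measurable (M \<Otimes>\<^sub>M count_space C) N"
proof -
  have "(\<lambda>p. f (fst p, snd p)) \<in> measurable (M \<Otimes>\<^sub>M count_space C) N"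
    by (rule measurable_compose_countable'[where f="\<lambda>h p. f (fst p, h)" and g=snd, OF _ measurable_snd assms(1)])
       (rule measurable_compose[OF measurable_fst assms(2)])
  then show ?thesis by simp
qed

lemma nn_integral_count_swap:
  assumes "sigma_finite_measure M" "countable C" "\<And>h. h \<in> C \<Longrightarrow> g h \<in> borel_measurable M"
  shows "(\<integral>\<^sup>+x. (\<integral>\<^sup>+h. g h x \<partial>count_space C) \<partial>M) = (\<integral>\<^sup>+h. (\<integral>\<^sup>+x. g h x \<partial>M) \<partial>count_space C)"
proof -
  interpret M: sigma_finite_measure M by fact
  interpret C: sigma_finite_measure "count_space C" by (rule sigma_finite_measure_count_space_countable[OF assms(2)])
  interpret pair_sigma_finite M "count_space C" ..
  have m: "(\<lambda>p. g (snd p) (fst p)) \<in> borel_measurable (M \<Otimes>\<^sub>M count_space C)"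
    by (rule measurable_pair_countable[OF assms(2)]) (use assms(3) in simp)
  show ?thesis using nn_integral_snd[OF m] C.nn_integral_fst[OF m] by simp
qed

text \<open>Mass transport in its discrete form: exchange sum and integral, substitute in the
  summand of index \<open>h\<close> by its own map \<open>\<tau> h\<close>, and exchange
  back.\<close>

lemma nn_integral_count_mp:
  assumes M: "sigma_finite_measure M" and C: "countable C"
    and g: "\<And>h. h \<in> C \<Longrightarrow> g h \<in> borel_measurable M"
    and \<tau>: "\<And>h. h \<in> C \<Longrightarrow> \<tau> h \<in> measurable M M" "\<And>h. h \<in> C \<Longrightarrow> distr M M (\<tau> h) = M"
  shows "(\<integral>\<^sup>+x. (\<integral>\<^sup>+h. g h x \<partial>count_space C) \<partial>M) = (\<integral>\<^sup>+x. (\<integral>\<^sup>+h. g h (\<tau> h x) \<partial>count_space C) \<partial>M)"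
proof -
  have "(\<integral>\<^sup>+x. g h x \<partial>M) = (\<integral>\<^sup>+x. g h (\<tau> h x) \<partial>M)" if "h \<in> C" for h
    using nn_integral_distr[OF \<tau>(1)[OF that], of "g h"] g[OF that] \<tau>(2)[OF that] by simp
  then have "(\<integral>\<^sup>+h. (\<integral>\<^sup>+x. g h x \<partial>M) \<partial>count_space C) = (\<integral>\<^sup>+h. (\<integral>\<^sup>+x. g h (\<tau> h x) \<partial>M) \<partial>count_space C)"
    by (rule nn_integral_cong) (simp only: space_count_space)
  moreover have "(\<lambda>x. g h (\<tau> h x)) \<in> borel_measurable M" if "h \<in> C" for h
    by (rule measurable_compose[OF \<tau>(1)[OF that] g[OF that]])
  ultimately show ?thesis using nn_integral_count_swap[OF M C] g by simp
qed

lemma integral_count_swap: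
  fixes g :: "'h \<Rightarrow> 'a \<Rightarrow> complex"
  assumes "sigma_finite_measure M" "countable C" "\<And>h. h \<in> C \<Longrightarrow> g h \<in> borel_measurable M"
    and fin: "(\<integral>\<^sup>+x. (\<integral>\<^sup>+h. norm (g h x) \<partial>count_space C) \<partial>M) < \<infinity>"
  shows "integrable M (\<lambda>x. \<integral>h. g h x \<partial>count_space C)"
    and "(\<integral>x. (\<integral>h. g h x \<partial>count_space C) \<partial>M) = (\<integral>h. (\<integral>x. g h x \<partial>M) \<partial>count_space C)"
proof -
  interpret M: sigma_finite_measure M by fact
  interpret C: sigma_finite_measure "count_space C" by (rule sigma_finite_measure_count_space_countable[OF assms(2)])
  interpret pair_sigma_finite M "count_space C" ..
  have m[measurable]: "(\<lambda>(x, h). g h x) \<in> borel_measurable (M \<Otimes>\<^sub>M count_space C)"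
    by (rule measurable_pair_countable[OF assms(2)]) (use assms(3) in simp)
  have "(\<integral>\<^sup>+p. norm (case p of (x, h) \<Rightarrow> g h x) \<partial>(M \<Otimes>\<^sub>M count_space C)) < \<infinity>"
    using fin by (subst C.nn_integral_fst[symmetric]) auto
  then have i: "integrable (M \<Otimes>\<^sub>M count_space C) (\<lambda>(x, h). g h x)"
    by (intro integrableI_bounded m)
  show "integrable M (\<lambda>x. \<integral>h. g h x \<partial>count_space C)" using integrable_fst[OF i] .
  show "(\<integral>x. (\<integral>h. g h x \<partial>count_space C) \<partial>M) = (\<integral>h. (\<integral>x. g h x \<partial>M) \<partial>count_space C)"
    using integral_fst[OF i] integral_snd[OF i] by simp
qed

text \<open>The nonnegative version carries the finiteness of the absolute integral across the
  substitution, so that the exchange is justified on both sides.\<close>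

lemma integral_count_mp:
  fixes g :: "'h \<Rightarrow> 'a \<Rightarrow> complex"
  assumes M: "sigma_finite_measure M" and C: "countable C"
    and g: "\<And>h. h \<in> C \<Longrightarrow> g h \<in> borel_measurable M"
    and \<tau>: "\<And>h. h \<in> C \<Longrightarrow> \<tau> h \<in> measurable M M" "\<And>h. h \<in> C \<Longrightarrow> distr M M (\<tau> h) = M"
    and fin: "(\<integral>\<^sup>+x. (\<integral>\<^sup>+h. norm (g h x) \<partial>count_space C) \<partial>M) < \<infinity>"
  shows "integrable M (\<lambda>x. \<integral>h. g h (\<tau> h x) \<partial>count_space C)"
    and "(\<integral>x. (\<integral>h. g h x \<partial>count_space C) \<partial>M) = (\<integral>x. (\<integral>h. g h (\<tau> h x) \<partial>count_space C) \<partial>M)"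
proof -
  have m: "(\<lambda>x. g h (\<tau> h x)) \<in> borel_measurable M" if "h \<in> C" for h
    by (rule measurable_compose[OF \<tau>(1)[OF that] g[OF that]])
  have "(\<integral>\<^sup>+x. (\<integral>\<^sup>+h. norm (g h (\<tau> h x)) \<partial>count_space C) \<partial>M) < \<infinity>"
    using fin nn_integral_count_mp[OF M C _ \<tau>, of "\<lambda>h x. ennreal (norm (g h x))"] g by simp
  note i = integral_count_swap[OF M C m this] and i' = integral_count_swap[OF M C g fin]
  show "integrable M (\<lambda>x. \<integral>h. g h (\<tau> h x) \<partial>count_space C)" by (rule i(1))
  have "(\<integral>x. g h x \<partial>M) = (\<integral>x. g h (\<tau> h x) \<partial>M)" if "h \<in> C" for h
    using integral_distr[OF \<tau>(1)[OF that], of "g h"] g[OF that] \<tau>(2)[OF that] by simp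
  then have "(\<integral>h. (\<integral>x. g h x \<partial>M) \<partial>count_space C) = (\<integral>h. (\<integral>x. g h (\<tau> h x) \<partial>M) \<partial>count_space C)"
    by (rule Bochner_Integration.integral_cong[OF refl]) (simp only: space_count_space)
  then show "(\<integral>x. (\<integral>h. g h x \<partial>count_space C) \<partial>M) = (\<integral>x. (\<integral>h. g h (\<tau> h x) \<partial>count_space C) \<partial>M)"
    using i(2) i'(2) by simp
qed

lemma integral_count_space_subset:
  fixes F :: "'h \<Rightarrow> complex"
  assumes "finite J" "J \<subseteq> C"
  shows "(\<integral>h. (if h \<in> J then F h else 0) \<partial>count_space C) = (\<Sum>h\<in>J. F h)"
proof -
  have "(\<integral>h. (if h \<in> J then F h else 0) \<partial>count_space C) =
      (\<Sum>h | h \<in> C \<and> (if h \<in> J then F h else 0) \<noteq> 0. (if h \<in> J then F h else 0))"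
    by (rule lebesgue_integral_count_space_finite_support) (use assms in auto)
  also have "\<dots> = (\<Sum>h\<in>J. F h)"
    by (rule sum.mono_neutral_cong_left) (use assms in auto)
  finally show ?thesis .
qed

lemma nn_integral_count_space_subset:
  fixes F :: "'h \<Rightarrow> ennreal"
  assumes "finite J" "J \<subseteq> C"
  shows "(\<integral>\<^sup>+h. (if h \<in> J then F h else 0) \<partial>count_space C) = (\<Sum>h\<in>J. F h)"
  using nn_integral_count_space'[of J C "\<lambda>h. if h \<in> J then F h else 0"] assms by simp

text \<open>A sum over a finite set depending on \<open>y\<close> becomes an integral over the fixed
  countable set \<open>C\<close>. Since a sum over an infinite set is 0 by convention, the two agree
  only where \<open>J y\<close> is finite, and that set has to be measurable as well.\<close>

lemma borel_measurable_sum_varying: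
  fixes F :: "'h \<Rightarrow> 'a \<Rightarrow> complex"
  assumes C: "countable C" and J: "\<And>y. y \<in> space M \<Longrightarrow> J y \<subseteq> C"
    and JM: "\<And>h. h \<in> C \<Longrightarrow> {y \<in> space M. h \<in> J y} \<in> sets M"
    and F: "\<And>h. h \<in> C \<Longrightarrow> F h \<in> borel_measurable M"
  shows "(\<lambda>y. \<Sum>h\<in>J y. F h y) \<in> borel_measurable M" and "{y \<in> space M. finite (J y)} \<in> sets M"
proof -
  interpret C: sigma_finite_measure "count_space C" by (rule sigma_finite_measure_count_space_countable[OF C])
  have m: "(\<lambda>(y, h). if h \<in> J y then F h y else 0) \<in> borel_measurable (M \<Otimes>\<^sub>M count_space C)"
  proof (rule measurable_pair_countable[OF C])
    fix h assume h: "h \<in> C"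
    show "(\<lambda>y. case (y, h) of (y, h) \<Rightarrow> if h \<in> J y then F h y else 0) \<in> borel_measurable M"
      using JM[OF h] F[OF h] by (simp add: measurable_If)
  qed
  have m2: "(\<lambda>(y, h). if h \<in> J y then (1::ennreal) else 0) \<in> borel_measurable (M \<Otimes>\<^sub>M count_space C)"
  proof (rule measurable_pair_countable[OF C])
    fix h assume h: "h \<in> C"
    show "(\<lambda>y. case (y, h) of (y, h) \<Rightarrow> if h \<in> J y then (1::ennreal) else 0) \<in> borel_measurable M"
      using JM[OF h] by (simp add: measurable_If)
  qed
  have I: "(\<lambda>y. \<integral>h. (if h \<in> J y then F h y else 0) \<partial>count_space C) \<in> borel_measurable M"
    using C.borel_measurable_lebesgue_integral[of "\<lambda>y h. if h \<in> J y then F h y else 0"] m by simp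
  have N: "(\<lambda>y. \<integral>\<^sup>+h. (if h \<in> J y then 1 else 0) \<partial>count_space C) \<in> borel_measurable M"
    using C.borel_measurable_nn_integral[of "\<lambda>y h. if h \<in> J y then 1 else 0"] m2 by simp
  have e: "(\<integral>\<^sup>+h. (if h \<in> J y then 1 else 0) \<partial>count_space C) < \<infinity> \<longleftrightarrow> finite (J y)" if y: "y \<in> space M" for y
  proof -
    have "(\<integral>\<^sup>+h. (if h \<in> J y then 1 else 0) \<partial>count_space C) = (\<integral>\<^sup>+h. indicator (J y) h \<partial>count_space C)"
      by (rule nn_integral_cong) (simp add: indicator_def)
    also have "\<dots> = emeasure (count_space C) (J y)"
      using J[OF y] by (intro nn_integral_indicator) auto
    finally show ?thesis using J[OF y] by (simp add: emeasure_count_space less_top[symmetric])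
  qed
  have "{y \<in> space M. finite (J y)} = {y \<in> space M. (\<integral>\<^sup>+h. (if h \<in> J y then 1 else 0) \<partial>count_space C) < \<infinity>}"
    using e by auto
  also have "\<dots> \<in> sets M" using N by measurable
  finally show fm: "{y \<in> space M. finite (J y)} \<in> sets M" .
  have "(\<lambda>y. if finite (J y) then \<integral>h. (if h \<in> J y then F h y else 0) \<partial>count_space C else 0) \<in> borel_measurable M"
    by (rule measurable_If[OF I _ fm]) simp
  moreover have "(\<Sum>h\<in>J y. F h y) =
      (if finite (J y) then \<integral>h. (if h \<in> J y then F h y else 0) \<partial>count_space C else 0)"
    if "y \<in> space M" for y
    by (simp add: integral_count_space_subset[OF _ J[OF that]])
  ultimately show "(\<lambda>y. \<Sum>h\<in>J y. F h y) \<in> borel_measurable M"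
    by (subst measurable_cong[where g="\<lambda>y. if finite (J y)
      then \<integral>h. (if h \<in> J y then F h y else 0) \<partial>count_space C else 0"]) auto
qed

lemma Linf_measurable: "f \<in> Linf M \<Longrightarrow> f \<in> borel_measurable M"
  by (simp add: Linf_def)

lemma LinfI: "f \<in> borel_measurable M \<Longrightarrow> AE x in M. cmod (f x) \<le> C \<Longrightarrow> f \<in> Linf M"
  by (auto simp: Linf_def)

lemma Linf_bound:
  assumes "f \<in> Linf M"
  obtains C where "C \<ge> 0" "AE x in M. cmod (f x) \<le> C"
proof -
  obtain C where "AE x in M. cmod (f x) \<le> C" using assms by (auto simp: Linf_def)
  then have "AE x in M. cmod (f x) \<le> \<bar>C\<bar>" by eventually_elim simp
  then show ?thesis using that[of "\<bar>C\<bar>"] by simp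
qed

lemma Linf_indicator: "E \<in> sets M \<Longrightarrow> indicator E \<in> Linf M"
  by (rule LinfI[where C=1]) (auto simp: indicator_def)

subsection \<open>Near actions of countable groups\<close>

text \<open>Group laws and freeness are required only almost everywhere, to admit the pull back of
  an action. Each single map \<open>T h\<close> is nevertheless a measurable map on the whole
  space.\<close>

locale near_action =
  fixes \<Lambda> :: "('h, 'n) monoid_scheme" (structure) and Z :: "'z measure" and T :: "'h \<Rightarrow> 'z \<Rightarrow> 'z"
  assumes grp: "group \<Lambda>" and cnt: "countable (carrier \<Lambda>)" and prob: "prob_space Z"
    and T_meas: "h \<in> carrier \<Lambda> \<Longrightarrow> T h \<in> measurable Z Z"
    and T_distr: "h \<in> carrier \<Lambda> \<Longrightarrow> distr Z Z (T h) = Z"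
    and T_mult: "AE z in Z. \<forall>h\<in>carrier \<Lambda>. \<forall>k\<in>carrier \<Lambda>. T h (T k z) = T (h \<otimes> k) z"
    and T_one: "AE z in Z. T \<one> z = z"
    and T_free: "AE z in Z. \<forall>h\<in>carrier \<Lambda>. T h z = z \<longrightarrow> h = \<one>"
begin

sublocale L: group \<Lambda> by (rule grp)
sublocale PZ: prob_space Z by (rule prob)

abbreviation H :: "('z \<times> 'h) measure" where "H \<equiv> gms_measure \<Lambda> Z"

lemma sigma_finite_count: "sigma_finite_measure (count_space (carrier \<Lambda>))"
  by (rule sigma_finite_measure_count_space_countable[OF cnt])

lemma sigma_finite_H: "sigma_finite_measure H"
proof -
  interpret C: sigma_finite_measure "count_space (carrier \<Lambda>)" by (rule sigma_finite_count)
  interpret pair_sigma_finite Z "count_space (carrier \<Lambda>)" ..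
  show ?thesis unfolding gms_measure_def by (rule sigma_finite_pair_measure[OF PZ.sigma_finite_measure_axioms sigma_finite_count])
qed

lemma space_H: "space H = space Z \<times> carrier \<Lambda>"
  by (simp add: gms_measure_def space_pair_measure)

lemma H_measurableI:
  assumes "\<And>k. k \<in> carrier \<Lambda> \<Longrightarrow> (\<lambda>z. f (z, k)) \<in> measurable Z N"
  shows "f \<in> measurable H N"
  unfolding gms_measure_def by (rule measurable_pair_countable[OF cnt]) (rule assms)

lemma H_measurableD:
  assumes "f \<in> measurable H N" "k \<in> carrier \<Lambda>"
  shows "(\<lambda>z. f (z, k)) \<in> measurable Z N"
proof -
  have "(\<lambda>z. (z, k)) \<in> measurable Z H" unfolding gms_measure_def using assms(2) by simp
  from measurable_compose[OF this assms(1)] show ?thesis .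
qed

text \<open>A null set of \<open>Z\<close> times the countable group is null in \<open>H\<close>.
  Together with \<open>AE_HD\<close> this reduces statements about almost all pairs to statements
  about almost all \<open>z\<close>, with the group coordinate universally quantified.\<close>

lemma AE_HI:
  assumes "AE z in Z. \<forall>k\<in>carrier \<Lambda>. P (z, k)"
  shows "AE p in H. P p"
proof -
  obtain N where N: "N \<in> sets Z" "emeasure Z N = 0" "{z \<in> space Z. \<not> (\<forall>k\<in>carrier \<Lambda>. P (z, k))} \<subseteq> N"
    using assms by (auto elim: AE_E)
  interpret C: sigma_finite_measure "count_space (carrier \<Lambda>)" by (rule sigma_finite_count)
  have "emeasure H (N \<times> carrier \<Lambda>) = 0"
    unfolding gms_measure_def using N by (subst C.emeasure_pair_measure_Times) auto
  moreover have "N \<times> carrier \<Lambda> \<in> sets H" unfolding gms_measure_def using N by simp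
  moreover have "{p \<in> space H. \<not> P p} \<subseteq> N \<times> carrier \<Lambda>" using N(3) by (auto simp: space_H)
  ultimately show ?thesis by (intro AE_I)
qed

lemma AE_HD:
  assumes "AE p in H. P p"
  shows "AE z in Z. \<forall>k\<in>carrier \<Lambda>. P (z, k)"
proof -
  interpret C: sigma_finite_measure "count_space (carrier \<Lambda>)" by (rule sigma_finite_count)
  interpret pair_sigma_finite Z "count_space (carrier \<Lambda>)" ..
  show ?thesis using AE_pair[OF assms[unfolded gms_measure_def]] by (simp add: AE_count_space)
qed

text \<open>Gathers the countably many exceptional sets into one. By \<open>good_T\<close> the
  remaining set is invariant, so a computation that starts at a good point never leaves it.\<close>

definition good :: "'z \<Rightarrow> bool" where
  "good z \<longleftrightarrow> z \<in> space Z \<and> (\<forall>h\<in>carrier \<Lambda>. \<forall>k\<in>carrier \<Lambda>. T h (T k z) = T (h \<otimes> k) z) \<and> T \<one> z = z \<and>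
     (\<forall>h\<in>carrier \<Lambda>. T h z = z \<longrightarrow> h = \<one>)"

lemma AE_good: "AE z in Z. good z"
  using T_mult T_one T_free AE_space by eventually_elim (simp add: good_def)

lemma good_mult: "good z \<Longrightarrow> h \<in> carrier \<Lambda> \<Longrightarrow> k \<in> carrier \<Lambda> \<Longrightarrow> T h (T k z) = T (h \<otimes> k) z"
  by (simp add: good_def)

lemma good_one: "good z \<Longrightarrow> T \<one> z = z"
  by (simp add: good_def)

lemma good_inv: "good z \<Longrightarrow> h \<in> carrier \<Lambda> \<Longrightarrow> T (inv h) (T h z) = z" "good z \<Longrightarrow> h \<in> carrier \<Lambda> \<Longrightarrow> T h (T (inv h) z) = z"
  by (simp_all add: good_mult good_one)

lemma good_inj:
  assumes "good z" "h \<in> carrier \<Lambda>" "k \<in> carrier \<Lambda>" "T h z = T k z"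
  shows "h = k"
proof -
  have "T (inv k \<otimes> h) z = T (inv k) (T k z)" using assms by (simp add: good_mult[symmetric])
  then have "T (inv k \<otimes> h) z = z" using assms good_inv by simp
  then have "inv k \<otimes> h = \<one>" using assms unfolding good_def by (meson L.inv_closed L.m_closed)
  then show ?thesis using assms by (metis L.inv_equality L.inv_inv L.inv_closed)
qed

lemma good_T:
  assumes z: "good z" and h: "h \<in> carrier \<Lambda>"
  shows "good (T h z)"
  unfolding good_def
proof (intro conjI ballI impI)
  show "T h z \<in> space Z" using z T_meas[OF h] by (auto simp: good_def dest: measurable_space)
  show "T \<one> (T h z) = T h z" using z h by (simp add: good_mult)
  fix k l assume k: "k \<in> carrier \<Lambda>"
  { assume l: "l \<in> carrier \<Lambda>"
    show "T k (T l (T h z)) = T (k \<otimes> l) (T h z)"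
      using z h k l by (simp add: good_mult L.m_assoc) }
  { assume "T k (T h z) = T h z"
    then have "k \<otimes> h = h" using z h k by (intro good_inj[OF z]) (auto simp: good_mult)
    then show "k = \<one>" using h k by (simp add: L.r_cancel_one) }
qed

text \<open>The basic device for null sets: a property that holds almost everywhere may be imposed
  on the whole orbit, because the group is countable and each \<open>T h\<close> preserves the
  measure.\<close>

lemma AE_T:
  assumes "AE z in Z. P z"
  shows "AE z in Z. \<forall>h\<in>carrier \<Lambda>. P (T h z)"
proof -
  have "AE z in Z. P (T h z)" if h: "h \<in> carrier \<Lambda>" for h
    by (rule AE_distrD[OF T_meas[OF h]]) (simp only: T_distr[OF h] assms)
  then show ?thesis using cnt by (simp add: AE_ball_countable)
qed

text \<open>The diagonal translation of the space on which the crossed product acts;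
  \<open>v_op \<Lambda> T h\<close> is composition with \<open>shift (inv h)\<close>.\<close>

definition shift :: "'h \<Rightarrow> 'z \<times> 'h \<Rightarrow> 'z \<times> 'h" where
  "shift h = (\<lambda>(z, k). (T h z, h \<otimes> k))"

lemma shift_measurable: "h \<in> carrier \<Lambda> \<Longrightarrow> shift h \<in> measurable H H"
proof (rule H_measurableI)
  fix k assume h: "h \<in> carrier \<Lambda>" and k: "k \<in> carrier \<Lambda>"
  note [measurable] = T_meas[OF h]
  show "(\<lambda>z. shift h (z, k)) \<in> measurable Z H"
    unfolding shift_def gms_measure_def using h k by simp
qed

text \<open>On each slice \<open>T h\<close> preserves the measure, and left multiplication by
  \<open>h\<close> permutes the slices.\<close>

lemma nn_integral_shift:
  assumes h: "h \<in> carrier \<Lambda>" and f: "f \<in> borel_measurable H"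
  shows "(\<integral>\<^sup>+p. f (shift h p) \<partial>H) = (\<integral>\<^sup>+p. f p \<partial>H)"
proof -
  interpret C: sigma_finite_measure "count_space (carrier \<Lambda>)" by (rule sigma_finite_count)
  interpret pair_sigma_finite Z "count_space (carrier \<Lambda>)" ..
  have f': "f \<in> borel_measurable (Z \<Otimes>\<^sub>M count_space (carrier \<Lambda>))" using f by (simp add: gms_measure_def)
  have fs: "(\<lambda>p. f (shift h p)) \<in> borel_measurable (Z \<Otimes>\<^sub>M count_space (carrier \<Lambda>))"
    using measurable_compose[OF shift_measurable[OF h] f] by (simp add: gms_measure_def)
  have "(\<integral>\<^sup>+p. f (shift h p) \<partial>H) = (\<integral>\<^sup>+k. (\<integral>\<^sup>+z. f (T h z, h \<otimes> k) \<partial>Z) \<partial>count_space (carrier \<Lambda>))"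
    unfolding gms_measure_def using nn_integral_snd[OF fs] by (simp add: shift_def)
  also have "\<dots> = (\<integral>\<^sup>+k. (\<integral>\<^sup>+z. f (z, h \<otimes> k) \<partial>Z) \<partial>count_space (carrier \<Lambda>))"
  proof (rule nn_integral_cong)
    fix k assume "k \<in> space (count_space (carrier \<Lambda>))"
    then have k: "h \<otimes> k \<in> carrier \<Lambda>" using h by simp
    show "(\<integral>\<^sup>+z. f (T h z, h \<otimes> k) \<partial>Z) = (\<integral>\<^sup>+z. f (z, h \<otimes> k) \<partial>Z)"
      using nn_integral_distr[OF T_meas[OF h], of "\<lambda>z. f (z, h \<otimes> k)"] H_measurableD[OF f k] T_distr[OF h] by simp
  qed
  also have "\<dots> = (\<integral>\<^sup>+k. (\<integral>\<^sup>+z. f (z, k) \<partial>Z) \<partial>count_space (carrier \<Lambda>))"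
  proof (rule nn_integral_bij_count_space)
    show "bij_betw (\<lambda>k. h \<otimes> k) (carrier \<Lambda>) (carrier \<Lambda>)"
      by (rule bij_betw_byWitness[where f'="\<lambda>k. inv h \<otimes> k"]) (use h in \<open>auto simp: L.m_assoc[symmetric]\<close>)
  qed
  also have "\<dots> = (\<integral>\<^sup>+p. f p \<partial>H)"
    unfolding gms_measure_def by (rule nn_integral_snd[OF f'])
  finally show ?thesis .
qed

lemma shift_distr:
  assumes h: "h \<in> carrier \<Lambda>"
  shows "distr H H (shift h) = H"
proof (rule measure_eqI)
  fix A assume "A \<in> sets (distr H H (shift h))"
  then have A: "A \<in> sets H" by simp
  have "emeasure (distr H H (shift h)) A = (\<integral>\<^sup>+p. indicator A p \<partial>distr H H (shift h))"
    using A by simp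
  also have "\<dots> = (\<integral>\<^sup>+p. indicator A (shift h p) \<partial>H)"
    by (rule nn_integral_distr[OF shift_measurable[OF h]]) (use A in simp)
  also have "\<dots> = emeasure H A" using nn_integral_shift[OF h, of "indicator A"] A by simp
  finally show "emeasure (distr H H (shift h)) A = emeasure H A" .
qed simp

lemma ae_eq_HI: "AE z in Z. \<forall>k\<in>carrier \<Lambda>. f (z, k) = g (z, k) \<Longrightarrow> ae_eq H f g"
  unfolding ae_eq_def by (rule AE_HI)

lemma ae_eq_HD: "ae_eq H f g \<Longrightarrow> AE z in Z. \<forall>k\<in>carrier \<Lambda>. f (z, k) = g (z, k)"
  unfolding ae_eq_def by (rule AE_HD)

lemma mult_op_measurable:
  assumes f: "f \<in> borel_measurable Z" and x: "\<xi> \<in> borel_measurable H"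
  shows "mult_op f \<xi> \<in> borel_measurable H"
  by (rule H_measurableI) (use f H_measurableD[OF x] in \<open>simp add: mult_op_def\<close>)

lemma mult_op_L2_le:
  assumes f: "f \<in> borel_measurable Z" and C: "AE z in Z. cmod (f z) \<le> C" "C \<ge> 0" and x: "\<xi> \<in> L2 H"
  shows "mult_op f \<xi> \<in> L2 H" "(\<integral>p. (cmod (mult_op f \<xi> p))\<^sup>2 \<partial>H) \<le> C\<^sup>2 * (\<integral>p. (cmod (\<xi> p))\<^sup>2 \<partial>H)"
proof -
  have i: "integrable H (\<lambda>p. C\<^sup>2 * (cmod (\<xi> p))\<^sup>2)" using L2_integrable[OF x] by simp
  have "AE z in Z. \<forall>k\<in>carrier \<Lambda>. (cmod (mult_op f \<xi> (z, k)))\<^sup>2 \<le> C\<^sup>2 * (cmod (\<xi> (z, k)))\<^sup>2"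
    using C(1) by eventually_elim (auto simp: mult_op_def norm_mult power_mult_distrib intro!: mult_right_mono power_mono)
  then have b: "AE p in H. (cmod (mult_op f \<xi> p))\<^sup>2 \<le> C\<^sup>2 * (cmod (\<xi> p))\<^sup>2" by (rule AE_HI)
  show m: "mult_op f \<xi> \<in> L2 H"
    by (rule L2_bound[OF mult_op_measurable[OF f L2_measurable[OF x]] i b])
  have "(\<integral>p. (cmod (mult_op f \<xi> p))\<^sup>2 \<partial>H) \<le> (\<integral>p. C\<^sup>2 * (cmod (\<xi> p))\<^sup>2 \<partial>H)"
    by (rule integral_mono_AE[OF L2_integrable[OF m] i b])
  then show "(\<integral>p. (cmod (mult_op f \<xi> p))\<^sup>2 \<partial>H) \<le> C\<^sup>2 * (\<integral>p. (cmod (\<xi> p))\<^sup>2 \<partial>H)" by simp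
qed

lemma mult_op_bounded:
  assumes f: "f \<in> Linf Z"
  shows "bounded_op H (mult_op f)"
proof -
  obtain C where C: "C \<ge> 0" "AE z in Z. cmod (f z) \<le> C" by (rule Linf_bound[OF f])
  show ?thesis
    by (rule bounded_opI[where C="C\<^sup>2"])
       (use mult_op_L2_le[OF Linf_measurable[OF f] C(2,1)] in
         \<open>auto simp: ae_eq_def mult_op_def algebra_simps case_prod_beta elim: AE_mp\<close>)
qed

lemma mult_op_adjoint:
  assumes f: "f \<in> Linf Z"
  shows "adjoint_pair H (mult_op f) (mult_op (\<lambda>z. cnj (f z)))"
proof -
  have [measurable]: "cnj \<in> borel_measurable borel"
    by (intro borel_measurable_continuous_onI continuous_intros)
  have "(\<lambda>z. cnj (f z)) \<in> Linf Z" using f by (auto simp: Linf_def)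
  then show ?thesis using mult_op_bounded f
    unfolding adjoint_pair_def by (auto simp: l2_inner_def mult_op_def case_prod_beta algebra_simps)
qed

lemma projection_indicator:
  assumes E: "E \<in> sets Z"
  shows "projection_op H (mult_op (indicator E))"
proof (rule projection_opI)
  show "adjoint_pair H (mult_op (indicator E)) (mult_op (indicator E))"
    using mult_op_adjoint[OF Linf_indicator[OF E]]
    by (simp add: if_distrib[of cnj] indicator_def[abs_def] of_bool_def cong: if_cong)
qed (auto simp: op_eq_def ae_eq_def mult_op_def indicator_def)

lemma v_op_eq: "v_op \<Lambda> T h \<xi> = (\<lambda>p. \<xi> (shift (inv h) p))"
  by (auto simp: v_op_def shift_def)

lemma comp_shift_L2:
  assumes h: "h \<in> carrier \<Lambda>" and x: "\<xi> \<in> L2 H"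
  shows "(\<lambda>p. \<xi> (shift h p)) \<in> L2 H"
proof -
  have "integrable (distr H H (shift h)) (\<lambda>p. (cmod (\<xi> p))\<^sup>2)"
    using L2_integrable[OF x] shift_distr[OF h] by simp
  then have "integrable H (\<lambda>p. (cmod (\<xi> (shift h p)))\<^sup>2)"
    by (subst (asm) integrable_distr_eq[OF shift_measurable[OF h]]) (use L2_measurable[OF x] in auto)
  then show ?thesis
    using measurable_compose[OF shift_measurable[OF h] L2_measurable[OF x]] by (simp add: L2_def)
qed

end

text \<open>The squared norm of \<open>F f - g\<close> is at most twice the constant of
  \<open>F\<close> times that of \<open>f - fn n\<close>, plus twice that of
  \<open>g - gn n\<close>. This lets an operator that commutes with every partial sum of a series
  commute with the series itself.\<close>

lemma bounded_op_limit:
  assumes F: "bounded_op M F" and f: "f \<in> L2 M" "\<And>n. fn n \<in> L2 M" and g: "g \<in> L2 M" "\<And>n. gn n \<in> L2 M"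
    and eq: "\<And>n. ae_eq M (F (fn n)) (gn n)"
    and cf: "(\<lambda>n. \<integral>x. (cmod (f x - fn n x))\<^sup>2 \<partial>M) \<longlonglongrightarrow> 0"
    and cg: "(\<lambda>n. \<integral>x. (cmod (g x - gn n x))\<^sup>2 \<partial>M) \<longlonglongrightarrow> 0"
  shows "ae_eq M (F f) g"
proof -
  let ?N = "\<lambda>f. \<integral>x. (cmod (f x))\<^sup>2 \<partial>M"
  obtain C where C: "C \<ge> 0" "\<And>f. f \<in> L2 M \<Longrightarrow> ?N (F f) \<le> C * ?N f"
    using bounded_op_sq_bound[OF F] by metis
  note FL = bounded_opD(1)[OF F]
  have d: "(\<lambda>x. F f x - g x) \<in> L2 M" by (intro L2_diff FL f g)
  have "?N (\<lambda>x. F f x - g x) \<le> 2 * (C * ?N (\<lambda>x. f x - fn n x)) + 2 * ?N (\<lambda>x. g x - gn n x)" for n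
  proof -
    have fd: "(\<lambda>x. f x - fn n x) \<in> L2 M" and gd: "(\<lambda>x. g x - gn n x) \<in> L2 M"
      by (intro L2_diff f g)+
    have "?N (\<lambda>x. F f x - g x) \<le> (\<integral>x. 2 * (cmod (F (\<lambda>x. f x - fn n x) x))\<^sup>2 + 2 * (cmod (g x - gn n x))\<^sup>2 \<partial>M)"
    proof (rule integral_mono_AE)
      show "integrable M (\<lambda>x. (cmod (F f x - g x))\<^sup>2)" by (rule L2_integrable[OF d])
      show "integrable M (\<lambda>x. 2 * (cmod (F (\<lambda>x. f x - fn n x) x))\<^sup>2 + 2 * (cmod (g x - gn n x))\<^sup>2)"
        using L2_integrable[OF FL[OF fd]] L2_integrable[OF gd] by simp
      show "AE x in M. (cmod (F f x - g x))\<^sup>2 \<le> 2 * (cmod (F (\<lambda>x. f x - fn n x) x))\<^sup>2 + 2 * (cmod (g x - gn n x))\<^sup>2"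
        using bounded_op_diff[OF F f(1) f(2)[of n]] eq[of n] unfolding ae_eq_def
      proof eventually_elim
        fix x assume a: "F (\<lambda>x. f x - fn n x) x = F f x - F (fn n) x" "F (fn n) x = gn n x"
        show "(cmod (F f x - g x))\<^sup>2 \<le> 2 * (cmod (F (\<lambda>x. f x - fn n x) x))\<^sup>2 + 2 * (cmod (g x - gn n x))\<^sup>2"
          using cmod_add_sq[of "F f x - F (fn n) x" "gn n x - g x"] a by (simp add: norm_minus_commute)
      qed
    qed
    also have "\<dots> = 2 * ?N (F (\<lambda>x. f x - fn n x)) + 2 * ?N (\<lambda>x. g x - gn n x)"
      using L2_integrable[OF FL[OF fd]] L2_integrable[OF gd] by simp
    also have "\<dots> \<le> 2 * (C * ?N (\<lambda>x. f x - fn n x)) + 2 * ?N (\<lambda>x. g x - gn n x)"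
      using C(2)[OF fd] by simp
    finally show ?thesis .
  qed
  moreover have "(\<lambda>n. 2 * (C * ?N (\<lambda>x. f x - fn n x)) + 2 * ?N (\<lambda>x. g x - gn n x)) \<longlonglongrightarrow> 2 * (C * 0) + 2 * 0"
    by (intro tendsto_intros cf cg)
  ultimately have "?N (\<lambda>x. F f x - g x) \<le> 2 * (C * 0) + 2 * 0"
    by (intro LIMSEQ_le_const) auto
  then have "?N (\<lambda>x. F f x - g x) \<le> 0" by simp
  from l2_norm_zero[OF d this] show ?thesis by (simp add: ae_eq_def)
qed

lemma bounded_op_sum:
  assumes F: "bounded_op M F" and I: "finite I" and f: "\<And>i. i \<in> I \<Longrightarrow> f i \<in> L2 M"
  shows "ae_eq M (F (\<lambda>x. \<Sum>i\<in>I. f i x)) (\<lambda>x. \<Sum>i\<in>I. F (f i) x)"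
  using I f
proof (induction I rule: finite_induct)
  case empty
  have "ae_eq M (F (\<lambda>x. - 1 * 0 + 0)) (\<lambda>x. -1 * F (\<lambda>x. 0) x + F (\<lambda>x. 0) x)"
    by (rule bounded_opD(3)[OF F L2_zero L2_zero])
  then show ?case by simp
next
  case (insert i I)
  have s: "(\<lambda>x. \<Sum>i\<in>I. f i x) \<in> L2 M" using insert by (intro L2_sum) auto
  have "ae_eq M (F (\<lambda>x. 1 * f i x + (\<Sum>i\<in>I. f i x))) (\<lambda>x. 1 * F (f i) x + F (\<lambda>x. \<Sum>i\<in>I. f i x) x)"
    by (rule bounded_opD(3)[OF F _ s]) (use insert in auto)
  moreover have "ae_eq M (F (\<lambda>x. \<Sum>i\<in>I. f i x)) (\<lambda>x. \<Sum>i\<in>I. F (f i) x)" using insert by auto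
  ultimately show ?case using insert(1,2) by (auto simp: ae_eq_def)
qed

subsection \<open>The operator of a partially defined map along the orbits\<close>

text \<open>The label \<open>c z\<close> is the element that leads back from \<open>\<phi> z\<close>
  to \<open>z\<close>. It is a measurable group element on all of \<open>Z\<close>, so
  \<open>\<phi>\<close> is a total measurable map, although only its restriction to \<open>S\<close>
  matters for \<open>b\<close>.\<close>

locale section_map = near_action \<Lambda> Z T
  for \<Lambda> :: "('h, 'n) monoid_scheme" (structure) and Z :: "'z measure" and T +
  fixes S :: "'z set" and c :: "'z \<Rightarrow> 'h"
  assumes S_sets: "S \<in> sets Z" and c_meas: "c \<in> measurable Z (count_space (carrier \<Lambda>))"
begin

definition \<phi> :: "'z \<Rightarrow> 'z" where "\<phi> z = T (inv (c z)) z"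

text \<open>For good \<open>y\<close>, freeness makes this the set of those \<open>h\<close> for
  which \<open>T h y\<close> lies in \<open>S\<close> and \<open>\<phi>\<close> sends it to
  \<open>y\<close>. Fibres are described by labels rather than points so that sums run over subsets
  of a fixed countable set.\<close>

definition J :: "'z \<Rightarrow> 'h set" where "J y = {h \<in> carrier \<Lambda>. T h y \<in> S \<and> c (T h y) = h}"

definition bop :: "('z \<times> 'h) oper" where
  "bop \<xi> = (\<lambda>(z, k). if z \<in> S then \<xi> (\<phi> z, inv (c z) \<otimes> k) else 0)"

text \<open>The formula mass transport predicts for the adjoint: values along a fibre are collected
  at its base point.\<close>

definition badj :: "('z \<times> 'h) oper" where
  "badj \<eta> = (\<lambda>(y, k). \<Sum>h\<in>J y. \<eta> (T h y, h \<otimes> k))"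

lemma S_space: "z \<in> S \<Longrightarrow> z \<in> space Z"
  using S_sets sets.sets_into_space by blast

lemma c_closed: "z \<in> space Z \<Longrightarrow> c z \<in> carrier \<Lambda>"
  using c_meas by (auto dest: measurable_space)

lemma J_closed: "J y \<subseteq> carrier \<Lambda>" by (auto simp: J_def)

lemma level_sets: "h \<in> carrier \<Lambda> \<Longrightarrow> {z \<in> S. c z = h} \<in> sets Z"
proof -
  assume h: "h \<in> carrier \<Lambda>"
  have "{z \<in> S. c z = h} = S \<inter> (c -` {h} \<inter> space Z)" using S_space by auto
  also have "\<dots> \<in> sets Z" using S_sets measurable_sets[OF c_meas, of "{h}"] h by auto
  finally show ?thesis .
qed

lemma J_sets: "h \<in> carrier \<Lambda> \<Longrightarrow> {y \<in> space Z. h \<in> J y} \<in> sets Z"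
proof -
  assume h: "h \<in> carrier \<Lambda>"
  have "{y \<in> space Z. h \<in> J y} = T h -` {z \<in> S. c z = h} \<inter> space Z" using h by (auto simp: J_def)
  then show ?thesis using measurable_sets[OF T_meas[OF h] level_sets[OF h]] by simp
qed

lemma J_\<phi>: "good y \<Longrightarrow> h \<in> J y \<Longrightarrow> \<phi> (T h y) = y"
  by (auto simp: J_def \<phi>_def good_inv)

lemma good_\<phi>: "good z \<Longrightarrow> good (\<phi> z)"
  unfolding \<phi>_def by (intro good_T L.inv_closed c_closed) (auto simp: good_def)

lemma T_c_\<phi>: "good z \<Longrightarrow> T (c z) (\<phi> z) = z"
  unfolding \<phi>_def by (rule good_inv) (auto simp: good_def c_closed)

lemma c_in_J: "good z \<Longrightarrow> z \<in> S \<Longrightarrow> c z \<in> J (\<phi> z)"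
  by (simp add: J_def T_c_\<phi> c_closed S_space)

lemma AE_\<phi>:
  assumes "AE y in Z. P y"
  shows "AE z in Z. P (\<phi> z)"
  using AE_T[OF assms] AE_space by eventually_elim (simp add: \<phi>_def c_closed)

lemma \<phi>_measurable: "\<phi> \<in> measurable Z Z"
  unfolding \<phi>_def[abs_def]
  by (rule measurable_compose_countable'[where f="\<lambda>h z. T (inv h) z", OF _ c_meas cnt]) (simp add: T_meas)

text \<open>Each point of \<open>S\<close> sends its mass to its image under \<open>\<phi>\<close>,
  and the base point \<open>y\<close> collects what arrives. The proof splits \<open>S\<close> into
  the level sets of \<open>c\<close> and substitutes \<open>T h y\<close> for \<open>z\<close> on
  the level \<open>h\<close>.\<close>

lemma nn_transport:
  assumes f: "f \<in> borel_measurable Z"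
  shows "(\<integral>\<^sup>+z. indicator S z * f z \<partial>Z) = (\<integral>\<^sup>+y. (\<integral>\<^sup>+h. (if h \<in> J y then f (T h y) else 0) \<partial>count_space (carrier \<Lambda>)) \<partial>Z)"
proof -
  let ?g = "\<lambda>h z. if z \<in> S \<and> c z = h then f z else 0"
  have 1: "(\<integral>\<^sup>+h. ?g h z \<partial>count_space (carrier \<Lambda>)) = indicator S z * f z" if "z \<in> space Z" for z
  proof (cases "z \<in> S")
    case True
    have "(\<integral>\<^sup>+h. ?g h z \<partial>count_space (carrier \<Lambda>)) = (\<integral>\<^sup>+h. (if h \<in> {c z} then f z else 0) \<partial>count_space (carrier \<Lambda>))"
      using True by (intro nn_integral_cong) auto
    also have "\<dots> = f z" by (subst nn_integral_count_space_subset) (auto simp: c_closed that)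
    finally show ?thesis using True by simp
  qed simp
  have "(\<integral>\<^sup>+z. indicator S z * f z \<partial>Z) = (\<integral>\<^sup>+z. (\<integral>\<^sup>+h. ?g h z \<partial>count_space (carrier \<Lambda>)) \<partial>Z)"
    by (rule nn_integral_cong) (simp only: 1)
  also have "\<dots> = (\<integral>\<^sup>+y. (\<integral>\<^sup>+h. ?g h (T h y) \<partial>count_space (carrier \<Lambda>)) \<partial>Z)"
  proof (rule nn_integral_count_mp[OF PZ.sigma_finite_measure_axioms cnt _ T_meas T_distr])
    fix h assume h: "h \<in> carrier \<Lambda>"
    have "{z \<in> space Z. z \<in> S \<and> c z = h} = {z \<in> S. c z = h}" using S_space by auto
    then show "(\<lambda>z. if z \<in> S \<and> c z = h then f z else 0) \<in> borel_measurable Z"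
      using level_sets[OF h] f by (intro measurable_If) auto
  qed
  also have "\<dots> = (\<integral>\<^sup>+y. (\<integral>\<^sup>+h. (if h \<in> J y then f (T h y) else 0) \<partial>count_space (carrier \<Lambda>)) \<partial>Z)"
  proof (rule nn_integral_cong, rule nn_integral_cong)
    fix y h assume "h \<in> space (count_space (carrier \<Lambda>))"
    then show "?g h (T h y) = (if h \<in> J y then f (T h y) else 0)" by (simp add: J_def)
  qed
  finally show ?thesis .
qed

text \<open>Transport of the constant 1 shows that the number of labels has integral equal to the
  measure of \<open>S\<close>, so it cannot be infinite on a set of positive measure.\<close>

lemma AE_finite_J: "AE y in Z. finite (J y)"
proof -
  let ?N = "\<lambda>y. \<integral>\<^sup>+h. (if h \<in> J y then 1 else 0) \<partial>count_space (carrier \<Lambda>)"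
  interpret C: sigma_finite_measure "count_space (carrier \<Lambda>)" by (rule sigma_finite_count)
  have "(\<lambda>(y, h). if h \<in> J y then (1::ennreal) else 0) \<in> borel_measurable (Z \<Otimes>\<^sub>M count_space (carrier \<Lambda>))"
    by (rule measurable_pair_countable[OF cnt]) (use J_sets in \<open>simp add: measurable_If\<close>)
  then have m: "?N \<in> borel_measurable Z"
    using C.borel_measurable_nn_integral[of "\<lambda>y h. if h \<in> J y then (1::ennreal) else 0" Z] by simp
  have "(\<integral>\<^sup>+y. ?N y \<partial>Z) = (\<integral>\<^sup>+z. indicator S z * 1 \<partial>Z)" by (subst nn_transport) auto
  also have "\<dots> = emeasure Z S" using S_sets by simp
  finally have "(\<integral>\<^sup>+y. ?N y \<partial>Z) \<noteq> \<infinity>" by simp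
  then have "AE y in Z. ?N y \<noteq> \<infinity>" by (rule nn_integral_PInf_AE[OF m])
  then show ?thesis
  proof eventually_elim
    fix y assume a: "?N y \<noteq> \<infinity>"
    have "?N y = (\<integral>\<^sup>+h. indicator (J y) h \<partial>count_space (carrier \<Lambda>))"
      by (rule nn_integral_cong) (simp add: indicator_def)
    also have "\<dots> = emeasure (count_space (carrier \<Lambda>)) (J y)"
      using J_closed by (intro nn_integral_indicator) auto
    finally show "finite (J y)" using a J_closed[of y] by (auto simp: emeasure_count_space split: if_splits)
  qed
qed

lemma sum_J_measurable:
  assumes "\<And>h. h \<in> carrier \<Lambda> \<Longrightarrow> F h \<in> borel_measurable Z"
  shows "(\<lambda>y. (\<Sum>h\<in>J y. F h y) :: complex) \<in> borel_measurable Z"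
  by (rule borel_measurable_sum_varying(1)[OF cnt J_closed J_sets assms])

lemma fst_S_level:
  assumes h: "h \<in> carrier \<Lambda>"
  shows "{p \<in> space H. fst p \<in> S \<and> c (fst p) = h} \<in> sets H"
proof -
  have "{p \<in> space H. fst p \<in> S \<and> c (fst p) = h} = fst -` {z \<in> S. c z = h} \<inter> space H" by auto
  also have "\<dots> \<in> sets H"
    by (rule measurable_sets[OF _ level_sets[OF h]]) (simp add: gms_measure_def)
  finally show ?thesis .
qed

text \<open>The same transport one level up, with \<open>shift h\<close> in place of
  \<open>T h\<close>; the condition on labels concerns the first coordinate only.\<close>

lemma nn_transport_H:
  assumes f: "f \<in> borel_measurable H"
  shows "(\<integral>\<^sup>+p. (\<integral>\<^sup>+h. (if fst p \<in> S \<and> c (fst p) = h then f p else 0) \<partial>count_space (carrier \<Lambda>)) \<partial>H) =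
    (\<integral>\<^sup>+p. (\<integral>\<^sup>+h. (if h \<in> J (fst p) then f (shift h p) else 0) \<partial>count_space (carrier \<Lambda>)) \<partial>H)"
proof -
  have "(\<integral>\<^sup>+p. (\<integral>\<^sup>+h. (if fst p \<in> S \<and> c (fst p) = h then f p else 0) \<partial>count_space (carrier \<Lambda>)) \<partial>H) =
    (\<integral>\<^sup>+p. (\<integral>\<^sup>+h. (if fst (shift h p) \<in> S \<and> c (fst (shift h p)) = h then f (shift h p) else 0) \<partial>count_space (carrier \<Lambda>)) \<partial>H)"
    by (rule nn_integral_count_mp[OF sigma_finite_H cnt _ shift_measurable shift_distr])
       (use f fst_S_level in \<open>auto intro!: measurable_If\<close>)
  also have "\<dots> = (\<integral>\<^sup>+p. (\<integral>\<^sup>+h. (if h \<in> J (fst p) then f (shift h p) else 0) \<partial>count_space (carrier \<Lambda>)) \<partial>H)"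
  proof (rule nn_integral_cong, rule nn_integral_cong)
    fix p h assume "h \<in> space (count_space (carrier \<Lambda>))"
    then show "(if fst (shift h p) \<in> S \<and> c (fst (shift h p)) = h then f (shift h p) else 0) =
        (if h \<in> J (fst p) then f (shift h p) else 0)"
      by (auto simp: J_def shift_def case_prod_beta)
  qed
  finally show ?thesis .
qed

lemma nn_count_level:
  assumes "p \<in> space H"
  shows "(\<integral>\<^sup>+h. (if fst p \<in> S \<and> c (fst p) = h then x else 0) \<partial>count_space (carrier \<Lambda>)) = (if fst p \<in> S then x else 0)"
proof (cases "fst p \<in> S")
  case True
  have "(\<integral>\<^sup>+h. (if fst p \<in> S \<and> c (fst p) = h then x else 0) \<partial>count_space (carrier \<Lambda>)) =
      (\<integral>\<^sup>+h. (if h \<in> {c (fst p)} then x else 0) \<partial>count_space (carrier \<Lambda>))"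
    using True by (intro nn_integral_cong) auto
  also have "\<dots> = x" by (subst nn_integral_count_space_subset) (auto simp: c_closed True S_space)
  finally show ?thesis using True by simp
qed simp

lemma integral_count_level:
  assumes "p \<in> space H"
  shows "(\<integral>h. (if fst p \<in> S \<and> c (fst p) = h then x else 0) \<partial>count_space (carrier \<Lambda>)) = (if fst p \<in> S then x else (0::complex))"
proof (cases "fst p \<in> S")
  case True
  have "(\<integral>h. (if fst p \<in> S \<and> c (fst p) = h then x else 0) \<partial>count_space (carrier \<Lambda>)) =
      (\<integral>h. (if h \<in> {c (fst p)} then x else 0) \<partial>count_space (carrier \<Lambda>))"
    using True by (intro Bochner_Integration.integral_cong) auto
  also have "\<dots> = x" by (subst integral_count_space_subset) (auto simp: c_closed True S_space)
  finally show ?thesis using True by simp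
qed simp

text \<open>The version for inner products. The absolute integral over labels collapses to that of
  \<open>F\<close>, because each point has exactly one label, and this supplies the integrability
  needed to substitute.\<close>

lemma integral_transport_H:
  fixes F :: "'z \<times> 'h \<Rightarrow> complex"
  assumes F: "integrable H F" and F0: "\<And>p.  fst p \<notin> S \<Longrightarrow> F p = 0"
  shows "(\<integral>p. F p \<partial>H) = (\<integral>p. (\<Sum>h\<in>J (fst p). F (shift h p)) \<partial>H)"
proof -
  have Fm: "F \<in> borel_measurable H" using F by auto
  let ?g = "\<lambda>h p. if fst p \<in> S \<and> c (fst p) = h then F p else 0"
  have gm: "?g h \<in> borel_measurable H" if "h \<in> carrier \<Lambda>" for h
    using Fm fst_S_level[OF that] by (intro measurable_If) auto
  have "(\<integral>\<^sup>+p. (\<integral>\<^sup>+h. norm (?g h p) \<partial>count_space (carrier \<Lambda>)) \<partial>H) =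
      (\<integral>\<^sup>+p. (\<integral>\<^sup>+h. (if fst p \<in> S \<and> c (fst p) = h then ennreal (norm (F p)) else 0) \<partial>count_space (carrier \<Lambda>)) \<partial>H)"
    by (intro nn_integral_cong) simp
  also have "\<dots> = (\<integral>\<^sup>+p. norm (F p) \<partial>H)"
    by (rule nn_integral_cong) (simp add: nn_count_level F0)
  also have "\<dots> < \<infinity>" using F by (simp add: integrable_iff_bounded)
  finally have fin: "(\<integral>\<^sup>+p. (\<integral>\<^sup>+h. norm (?g h p) \<partial>count_space (carrier \<Lambda>)) \<partial>H) < \<infinity>" .
  note i = integral_count_mp[OF sigma_finite_H cnt gm shift_measurable shift_distr fin]
  have "(\<integral>p. F p \<partial>H) = (\<integral>p. (\<integral>h. ?g h p \<partial>count_space (carrier \<Lambda>)) \<partial>H)"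
    by (rule Bochner_Integration.integral_cong) (auto simp: integral_count_level F0)
  also have "\<dots> = (\<integral>p. (\<integral>h. ?g h (shift h p) \<partial>count_space (carrier \<Lambda>)) \<partial>H)" by (rule i(2))
  also have "\<dots> = (\<integral>p. (\<Sum>h\<in>J (fst p). F (shift h p)) \<partial>H)"
  proof (rule integral_cong_AE)
    show "(\<lambda>p. \<integral>h. ?g h (shift h p) \<partial>count_space (carrier \<Lambda>)) \<in> borel_measurable H"
      using i(1) by auto
    show "(\<lambda>p. \<Sum>h\<in>J (fst p). F (shift h p)) \<in> borel_measurable H"
    proof (rule H_measurableI)
      fix k assume k: "k \<in> carrier \<Lambda>"
      show "(\<lambda>z. \<Sum>h\<in>J (fst (z, k)). F (shift h (z, k))) \<in> borel_measurable Z"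
        unfolding fst_conv
        by (rule sum_J_measurable) (rule H_measurableD[OF measurable_compose[OF shift_measurable Fm] k])
    qed
    have "AE z in Z. \<forall>k\<in>carrier \<Lambda>. finite (J (fst (z, k)))" using AE_finite_J by auto
    then have "AE p in H. finite (J (fst p))" by (rule AE_HI)
    then show "AE p in H. (\<integral>h. ?g h (shift h p) \<partial>count_space (carrier \<Lambda>)) = (\<Sum>h\<in>J (fst p). F (shift h p))"
    proof eventually_elim
      fix p :: "'z \<times> 'h" assume f: "finite (J (fst p))"
      have "(\<integral>h. ?g h (shift h p) \<partial>count_space (carrier \<Lambda>)) =
          (\<integral>h. (if h \<in> J (fst p) then F (shift h p) else 0) \<partial>count_space (carrier \<Lambda>))"
        by (intro Bochner_Integration.integral_cong) (auto simp: J_def shift_def case_prod_beta)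
      then show "(\<integral>h. ?g h (shift h p) \<partial>count_space (carrier \<Lambda>)) = (\<Sum>h\<in>J (fst p). F (shift h p))"
        using integral_count_space_subset[OF f J_closed] by simp
    qed
  qed
  finally show ?thesis .
qed

lemma bop_measurable: "\<xi> \<in> borel_measurable H \<Longrightarrow> bop \<xi> \<in> borel_measurable H"
proof (rule H_measurableI)
  fix k assume x: "\<xi> \<in> borel_measurable H" and k: "k \<in> carrier \<Lambda>"
  have "(\<lambda>z. \<xi> (T (inv (c z)) z, inv (c z) \<otimes> k)) \<in> borel_measurable Z"
  proof (rule measurable_compose_countable'[where f="\<lambda>h z. \<xi> (T (inv h) z, inv h \<otimes> k)", OF _ c_meas cnt])
    fix h assume h: "h \<in> carrier \<Lambda>"
    show "(\<lambda>z. \<xi> (T (inv h) z, inv h \<otimes> k)) \<in> borel_measurable Z"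
      using H_measurableD[OF measurable_compose[OF shift_measurable x] k, of "inv h"] h by (simp add: shift_def)
  qed
  then show "(\<lambda>z. bop \<xi> (z, k)) \<in> borel_measurable Z"
    using S_sets by (simp add: bop_def \<phi>_def measurable_If_set)
qed

text \<open>The label of the translated point undoes the translation, so \<open>bop \<xi>\<close> is
  constant along a fibre.\<close>

lemma bop_shift:
  assumes "good y" "h \<in> J y" "k \<in> carrier \<Lambda>"
  shows "bop \<xi> (shift h (y, k)) = \<xi> (y, k)"
  using assms J_\<phi>[OF assms(1,2)] by (auto simp: bop_def shift_def J_def L.m_assoc[symmetric])

lemma badj_eq: "badj \<eta> p = (\<Sum>h\<in>J (fst p). \<eta> (shift h p))"
  by (simp add: badj_def shift_def case_prod_beta)

lemma badj_measurable: "\<eta> \<in> borel_measurable H \<Longrightarrow> badj \<eta> \<in> borel_measurable H"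
proof (rule H_measurableI)
  fix k assume x: "\<eta> \<in> borel_measurable H" and k: "k \<in> carrier \<Lambda>"
  show "(\<lambda>z. badj \<eta> (z, k)) \<in> borel_measurable Z"
    unfolding badj_eq fst_conv
    by (rule sum_J_measurable) (rule H_measurableD[OF measurable_compose[OF shift_measurable x] k])
qed

end

text \<open>A constant fibre size is what makes the series a bounded operator: \<open>b\<close> then
  becomes the square root of \<open>m\<close> times a partial isometry with support on the image of
  \<open>\<phi>\<close>.\<close>

locale regular_section = section_map \<Lambda> Z T S c
  for \<Lambda> :: "('h, 'n) monoid_scheme" (structure) and Z :: "'z measure" and T S c +
  fixes m :: nat
  assumes m_pos: "m > 0"
    and card_J: "AE y in Z. J y \<noteq> {} \<longrightarrow> card (J y) = m"
begin

definition E :: "'z set" where "E = {y \<in> space Z. J y \<noteq> {}}"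

lemma E_sets: "E \<in> sets Z"
proof -
  have "E = (\<Union>h\<in>carrier \<Lambda>. {y \<in> space Z. h \<in> J y})" using J_closed by (auto simp: E_def)
  then show ?thesis using cnt J_sets by (simp add: sets.countable_UN'')
qed

lemma AE_reg: "AE y in Z. good y \<and> finite (J y) \<and> (J y \<noteq> {} \<longrightarrow> card (J y) = m)"
  using AE_good AE_finite_J card_J by eventually_elim simp

lemma AE_reg_H: "AE p in H. snd p \<in> carrier \<Lambda> \<and> good (fst p) \<and> finite (J (fst p)) \<and> (J (fst p) \<noteq> {} \<longrightarrow> card (J (fst p)) = m)"
  by (rule AE_HI) (use AE_reg in auto)

text \<open>Transported to the base, the squared modulus has the same value at every label, and
  there are \<open>m\<close> labels or none.\<close>

lemma nn_bop:
  assumes x: "\<xi> \<in> borel_measurable H"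
  shows "(\<integral>\<^sup>+p. ennreal ((cmod (bop \<xi> p))\<^sup>2) \<partial>H) \<le> ennreal (real m) * (\<integral>\<^sup>+p. ennreal ((cmod (\<xi> p))\<^sup>2) \<partial>H)"
proof -
  let ?f = "\<lambda>p. ennreal ((cmod (bop \<xi> p))\<^sup>2)"
  have fm: "?f \<in> borel_measurable H" using bop_measurable[OF x] by measurable
  have "(\<integral>\<^sup>+p. ?f p \<partial>H) = (\<integral>\<^sup>+p. (\<integral>\<^sup>+h. (if fst p \<in> S \<and> c (fst p) = h then ?f p else 0) \<partial>count_space (carrier \<Lambda>)) \<partial>H)"
    by (rule nn_integral_cong) (auto simp: nn_count_level bop_def)
  also have "\<dots> = (\<integral>\<^sup>+p. (\<integral>\<^sup>+h. (if h \<in> J (fst p) then ?f (shift h p) else 0) \<partial>count_space (carrier \<Lambda>)) \<partial>H)"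
    by (rule nn_transport_H[OF fm])
  also have "\<dots> \<le> (\<integral>\<^sup>+p. ennreal (real m) * ennreal ((cmod (\<xi> p))\<^sup>2) \<partial>H)"
  proof (rule nn_integral_mono_AE)
    show "AE p in H. (\<integral>\<^sup>+h. (if h \<in> J (fst p) then ?f (shift h p) else 0) \<partial>count_space (carrier \<Lambda>)) \<le>
        ennreal (real m) * ennreal ((cmod (\<xi> p))\<^sup>2)"
      using AE_reg_H
    proof eventually_elim
      fix p assume a: "snd p \<in> carrier \<Lambda> \<and> good (fst p) \<and> finite (J (fst p)) \<and> (J (fst p) \<noteq> {} \<longrightarrow> card (J (fst p)) = m)"
      have b: "?f (shift h p) = ennreal ((cmod (\<xi> p))\<^sup>2)" if "h \<in> J (fst p)" for h
        using bop_shift[of "fst p" h "snd p" \<xi>] a that by simp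
      have "(\<integral>\<^sup>+h. (if h \<in> J (fst p) then ?f (shift h p) else 0) \<partial>count_space (carrier \<Lambda>)) = (\<Sum>h\<in>J (fst p). ?f (shift h p))"
        by (rule nn_integral_count_space_subset) (use a J_closed in auto)
      also have "\<dots> = of_nat (card (J (fst p))) * ennreal ((cmod (\<xi> p))\<^sup>2)" using b by simp
      also have "\<dots> \<le> ennreal (real m) * ennreal ((cmod (\<xi> p))\<^sup>2)"
        using a by (cases "J (fst p) = {}") (auto simp: ennreal_of_nat_eq_real_of_nat)
      finally show "(\<integral>\<^sup>+h. (if h \<in> J (fst p) then ?f (shift h p) else 0) \<partial>count_space (carrier \<Lambda>)) \<le>
        ennreal (real m) * ennreal ((cmod (\<xi> p))\<^sup>2)" .
    qed
  qed
  also have "\<dots> = ennreal (real m) * (\<integral>\<^sup>+p. ennreal ((cmod (\<xi> p))\<^sup>2) \<partial>H)"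
    by (rule nn_integral_cmult) (use x in measurable)
  finally show ?thesis .
qed

lemma bop_L2:
  assumes x: "\<xi> \<in> L2 H"
  shows "bop \<xi> \<in> L2 H" "(\<integral>p. (cmod (bop \<xi> p))\<^sup>2 \<partial>H) \<le> real m * (\<integral>p. (cmod (\<xi> p))\<^sup>2 \<partial>H)"
proof -
  note b = nn_bop[OF L2_measurable[OF x]]
  note bm = bop_measurable[OF L2_measurable[OF x]]
  have xi: "(\<integral>\<^sup>+p. ennreal ((cmod (\<xi> p))\<^sup>2) \<partial>H) = ennreal (\<integral>p. (cmod (\<xi> p))\<^sup>2 \<partial>H)"
    by (rule nn_integral_eq_integral[OF L2_integrable[OF x]]) simp
  have "integrable H (\<lambda>p. (cmod (bop \<xi> p))\<^sup>2)"
  proof (rule integrableI_nonneg)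
    show "(\<integral>\<^sup>+p. ennreal ((cmod (bop \<xi> p))\<^sup>2) \<partial>H) < \<infinity>"
      using b unfolding xi by (auto simp: ennreal_mult[symmetric] intro: le_less_trans)
  qed (use bm in auto)
  then show L: "bop \<xi> \<in> L2 H" using bm by (simp add: L2_def)
  have "ennreal (\<integral>p. (cmod (bop \<xi> p))\<^sup>2 \<partial>H) = (\<integral>\<^sup>+p. ennreal ((cmod (bop \<xi> p))\<^sup>2) \<partial>H)"
    by (rule nn_integral_eq_integral[OF L2_integrable[OF L], symmetric]) simp
  also have "\<dots> \<le> ennreal (real m * (\<integral>p. (cmod (\<xi> p))\<^sup>2 \<partial>H))"
    using b unfolding xi by (simp add: ennreal_mult)
  finally show "(\<integral>p. (cmod (bop \<xi> p))\<^sup>2 \<partial>H) \<le> real m * (\<integral>p. (cmod (\<xi> p))\<^sup>2 \<partial>H)"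
    by (subst (asm) ennreal_le_iff) auto
qed

lemma bop_bounded: "bounded_op H bop"
proof (rule bounded_opI[where C="real m"])
  fix f g assume "ae_eq H f g"
  then have "AE z in Z. \<forall>k\<in>carrier \<Lambda>. f (z, k) = g (z, k)" by (rule ae_eq_HD)
  note f = AE_\<phi>[OF this]
  show "ae_eq H (bop f) (bop g)"
    by (rule ae_eq_HI) (use f AE_space in eventually_elim, auto simp: bop_def c_closed)
qed (auto simp: bop_L2, auto simp: ae_eq_def bop_def)

text \<open>Cauchy-Schwarz over the labels of a fibre costs a factor \<open>m\<close>; transport
  then turns the fibre sums of squared moduli back into an integral over the part of
  \<open>H\<close> above \<open>S\<close>.\<close>

lemma badj_L2:
  assumes x: "\<eta> \<in> L2 H"
  shows "badj \<eta> \<in> L2 H"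
proof -
  let ?f = "\<lambda>p. ennreal ((cmod (\<eta> p))\<^sup>2)"
  have \<eta>m: "\<eta> \<in> borel_measurable H" by (rule L2_measurable[OF x])
  have bm: "badj \<eta> \<in> borel_measurable H" by (rule badj_measurable[OF \<eta>m])
  interpret C: sigma_finite_measure "count_space (carrier \<Lambda>)" by (rule sigma_finite_count)
  have Nm: "(\<lambda>p. \<integral>\<^sup>+h. (if h \<in> J (fst p) then ?f (shift h p) else 0) \<partial>count_space (carrier \<Lambda>)) \<in> borel_measurable H"
  proof -
    have "(\<lambda>(p, h). if h \<in> J (fst p) then ?f (shift h p) else 0) \<in> borel_measurable (H \<Otimes>\<^sub>M count_space (carrier \<Lambda>))"
    proof (rule measurable_pair_countable[OF cnt])
      fix h assume h: "h \<in> carrier \<Lambda>"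
      have [measurable]: "(\<lambda>p. \<eta> (shift h p)) \<in> borel_measurable H"
        by (rule measurable_compose[OF shift_measurable[OF h] \<eta>m])
      have "{p \<in> space H. h \<in> J (fst p)} = fst -` {y \<in> space Z. h \<in> J y} \<inter> space H" by (auto simp: space_H)
      also have "\<dots> \<in> sets H"
        by (rule measurable_sets[OF _ J_sets[OF h]]) (simp add: gms_measure_def)
      finally have "{p \<in> space H. h \<in> J (fst p)} \<in> sets H" .
      then show "(\<lambda>p. case (p, h) of (p, h) \<Rightarrow> if h \<in> J (fst p) then ?f (shift h p) else 0) \<in> borel_measurable H"
        unfolding prod.case by (intro measurable_If) auto
    qed
    from C.borel_measurable_nn_integral[OF this] show ?thesis by simp
  qed
  have "(\<integral>\<^sup>+p. ennreal ((cmod (badj \<eta> p))\<^sup>2) \<partial>H) \<le>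
      (\<integral>\<^sup>+p. ennreal (real m) * (\<integral>\<^sup>+h. (if h \<in> J (fst p) then ?f (shift h p) else 0) \<partial>count_space (carrier \<Lambda>)) \<partial>H)"
  proof (rule nn_integral_mono_AE)
    show "AE p in H. ennreal ((cmod (badj \<eta> p))\<^sup>2) \<le>
        ennreal (real m) * (\<integral>\<^sup>+h. (if h \<in> J (fst p) then ?f (shift h p) else 0) \<partial>count_space (carrier \<Lambda>))"
      using AE_reg_H
    proof eventually_elim
      fix p assume a: "snd p \<in> carrier \<Lambda> \<and> good (fst p) \<and> finite (J (fst p)) \<and> (J (fst p) \<noteq> {} \<longrightarrow> card (J (fst p)) = m)"
      have "(cmod (badj \<eta> p))\<^sup>2 \<le> (\<Sum>h\<in>J (fst p). 1 * cmod (\<eta> (shift h p)))\<^sup>2"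
        unfolding badj_eq by (intro power_mono) (auto intro: sum_norm_le)
      also have "\<dots> \<le> (\<Sum>h\<in>J (fst p). 1\<^sup>2) * (\<Sum>h\<in>J (fst p). (cmod (\<eta> (shift h p)))\<^sup>2)"
        by (rule Cauchy_Schwarz_ineq_sum)
      also have "\<dots> \<le> real m * (\<Sum>h\<in>J (fst p). (cmod (\<eta> (shift h p)))\<^sup>2)"
        using a by (cases "J (fst p) = {}") auto
      finally have "ennreal ((cmod (badj \<eta> p))\<^sup>2) \<le> ennreal (real m) * ennreal (\<Sum>h\<in>J (fst p). (cmod (\<eta> (shift h p)))\<^sup>2)"
        by (simp add: ennreal_mult[symmetric] sum_nonneg ennreal_leI)
      also have "ennreal (\<Sum>h\<in>J (fst p). (cmod (\<eta> (shift h p)))\<^sup>2) =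
          (\<integral>\<^sup>+h. (if h \<in> J (fst p) then ?f (shift h p) else 0) \<partial>count_space (carrier \<Lambda>))"
        by (subst nn_integral_count_space_subset) (use a J_closed in \<open>auto simp: sum_ennreal\<close>)
      finally show "ennreal ((cmod (badj \<eta> p))\<^sup>2) \<le>
        ennreal (real m) * (\<integral>\<^sup>+h. (if h \<in> J (fst p) then ?f (shift h p) else 0) \<partial>count_space (carrier \<Lambda>))" .
    qed
  qed
  also have "\<dots> = ennreal (real m) * (\<integral>\<^sup>+p. (\<integral>\<^sup>+h. (if h \<in> J (fst p) then ?f (shift h p) else 0) \<partial>count_space (carrier \<Lambda>)) \<partial>H)"
    by (rule nn_integral_cmult[OF Nm])
  also have "\<dots> = ennreal (real m) * (\<integral>\<^sup>+p. (\<integral>\<^sup>+h. (if fst p \<in> S \<and> c (fst p) = h then ?f p else 0) \<partial>count_space (carrier \<Lambda>)) \<partial>H)"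
    by (subst nn_transport_H) (use \<eta>m in auto)
  also have "\<dots> \<le> ennreal (real m) * (\<integral>\<^sup>+p. ?f p \<partial>H)"
    by (intro mult_left_mono nn_integral_mono) (auto simp: nn_count_level)
  also have "\<dots> < \<infinity>"
    using nn_integral_eq_integral[OF L2_integrable[OF x]] by (simp add: ennreal_mult[symmetric] ennreal_mult_less_top)
  finally have "integrable H (\<lambda>p. (cmod (badj \<eta> p))\<^sup>2)"
    by (intro integrableI_nonneg) (use bm in auto)
  then show ?thesis using bm by (simp add: L2_def)
qed

lemma bop_badj_inner:
  assumes x: "\<xi> \<in> L2 H" and y: "\<eta> \<in> L2 H"
  shows "l2_inner H (bop \<xi>) \<eta> = l2_inner H \<xi> (badj \<eta>)"
proof -
  have "l2_inner H (bop \<xi>) \<eta> = (\<integral>p. (\<Sum>h\<in>J (fst p). bop \<xi> (shift h p) * cnj (\<eta> (shift h p))) \<partial>H)"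
    unfolding l2_inner_def
    by (rule integral_transport_H[OF L2_inner_integrable[OF bop_L2(1)[OF x] y]]) (auto simp: bop_def)
  also have "\<dots> = l2_inner H \<xi> (badj \<eta>)"
    unfolding l2_inner_def
  proof (rule integral_cong_AE)
    show "(\<lambda>p. \<xi> p * cnj (badj \<eta> p)) \<in> borel_measurable H"
      by (intro borel_measurable_times_cnj L2_measurable x badj_L2 y)
    show "(\<lambda>p. \<Sum>h\<in>J (fst p). bop \<xi> (shift h p) * cnj (\<eta> (shift h p))) \<in> borel_measurable H"
    proof (rule H_measurableI)
      fix k assume k: "k \<in> carrier \<Lambda>"
      have m: "(\<lambda>p. bop \<xi> p * cnj (\<eta> p)) \<in> borel_measurable H"
        by (intro borel_measurable_times_cnj L2_measurable bop_L2 x y)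
      show "(\<lambda>z. \<Sum>h\<in>J (fst (z, k)). bop \<xi> (shift h (z, k)) * cnj (\<eta> (shift h (z, k)))) \<in> borel_measurable Z"
        unfolding fst_conv
        by (rule sum_J_measurable) (rule H_measurableD[OF measurable_compose[OF shift_measurable m] k])
    qed
    show "AE p in H. (\<Sum>h\<in>J (fst p). bop \<xi> (shift h p) * cnj (\<eta> (shift h p))) = \<xi> p * cnj (badj \<eta> p)"
      using AE_reg_H
    proof eventually_elim
      fix p assume a: "snd p \<in> carrier \<Lambda> \<and> good (fst p) \<and> finite (J (fst p)) \<and> (J (fst p) \<noteq> {} \<longrightarrow> card (J (fst p)) = m)"
      have "bop \<xi> (shift h p) = \<xi> p" if "h \<in> J (fst p)" for h
        using bop_shift[of "fst p" h "snd p" \<xi>] a that by simp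
      then show "(\<Sum>h\<in>J (fst p). bop \<xi> (shift h p) * cnj (\<eta> (shift h p))) = \<xi> p * cnj (badj \<eta> p)"
        by (simp add: badj_eq sum_distrib_left)
    qed
  qed
  finally show ?thesis .
qed

text \<open>The adjoint exists by Riesz and \<open>badj\<close> has the same inner products.
  Boundedness of \<open>badj\<close> is afterwards inherited from the adjoint instead of being
  estimated.\<close>

lemma badj_op_eq: "op_eq H (adjoint_op H bop) badj"
  unfolding op_eq_def
proof
  fix \<eta> assume y: "\<eta> \<in> L2 H"
  have p: "adjoint_pair H bop (adjoint_op H bop)" by (rule adjoint_exists[OF bop_bounded])
  show "ae_eq H (adjoint_op H bop \<eta>) (badj \<eta>)"
  proof (rule l2_inner_ext)
    fix \<xi> assume x: "\<xi> \<in> L2 H"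
    show "l2_inner H (adjoint_op H bop \<eta>) \<xi> = l2_inner H (badj \<eta>) \<xi>"
      using adjoint_pair_inner[OF p x y] bop_badj_inner[OF x y]
      by (subst (1 2) l2_inner_cnj) simp
  qed (use y p badj_L2 in \<open>auto simp: adjoint_pair_def bounded_op_def\<close>)
qed

lemma adjoint_bounded: "bounded_op H (adjoint_op H bop)"
  by (rule adjoint_pair_bounded[OF adjoint_exists[OF bop_bounded]])

lemma badj_bounded: "bounded_op H badj"
  by (rule bounded_op_cong[OF adjoint_bounded badj_op_eq]) (simp add: preserves_L2_def badj_L2)

text \<open>Along a fibre \<open>bop \<xi>\<close> takes the single value at the base point, which
  therefore factors out and leaves the fibre sum of \<open>f\<close> as a multiplier.\<close>

lemma badj_mult_bop:
  "op_eq H (badj \<circ> mult_op f \<circ> bop) (mult_op (\<lambda>y. \<Sum>h\<in>J y. f (T h y)))"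
  unfolding op_eq_def
proof (intro ballI ae_eq_HI)
  fix \<xi> assume "\<xi> \<in> L2 H"
  show "AE z in Z. \<forall>k\<in>carrier \<Lambda>. (badj \<circ> mult_op f \<circ> bop) \<xi> (z, k) = mult_op (\<lambda>y. \<Sum>h\<in>J y. f (T h y)) \<xi> (z, k)"
    using AE_good
  proof eventually_elim
    fix z assume g: "good z"
    show "\<forall>k\<in>carrier \<Lambda>. (badj \<circ> mult_op f \<circ> bop) \<xi> (z, k) = mult_op (\<lambda>y. \<Sum>h\<in>J y. f (T h y)) \<xi> (z, k)"
    proof
      fix k assume k: "k \<in> carrier \<Lambda>"
      have "(badj \<circ> mult_op f \<circ> bop) \<xi> (z, k) = (\<Sum>h\<in>J z. f (T h z) * bop \<xi> (shift h (z, k)))"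
        by (simp add: badj_eq mult_op_def shift_def)
      also have "\<dots> = (\<Sum>h\<in>J z. f (T h z) * \<xi> (z, k))"
        using bop_shift[OF g _ k] by simp
      finally show "(badj \<circ> mult_op f \<circ> bop) \<xi> (z, k) = mult_op (\<lambda>y. \<Sum>h\<in>J y. f (T h y)) \<xi> (z, k)"
        by (simp add: mult_op_def sum_distrib_right)
    qed
  qed
qed

lemma adjoint_mult_bop:
  assumes f: "f \<in> Linf Z"
  shows "op_eq H (adjoint_op H bop \<circ> mult_op f \<circ> bop) (mult_op (\<lambda>y. \<Sum>h\<in>J y. f (T h y)))"
proof -
  have "op_eq H (adjoint_op H bop \<circ> (mult_op f \<circ> bop)) (badj \<circ> (mult_op f \<circ> bop))"
    by (rule op_eq_comp_right[OF badj_op_eq]) (intro bounded_op_preserves bounded_op_comp mult_op_bounded f bop_bounded)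
  then show ?thesis using badj_mult_bop[of f] by (auto simp: o_assoc intro: op_eq_trans)
qed

lemma mult_sum_J_one: "op_eq H (mult_op (\<lambda>y. \<Sum>h\<in>J y. 1)) (scale_op (of_nat m) (mult_op (indicator E)))"
  unfolding op_eq_def
proof (intro ballI ae_eq_HI)
  fix \<xi> assume "\<xi> \<in> L2 H"
  show "AE z in Z. \<forall>k\<in>carrier \<Lambda>. mult_op (\<lambda>y. \<Sum>h\<in>J y. 1) \<xi> (z, k) = scale_op (of_nat m) (mult_op (indicator E)) \<xi> (z, k)"
    using AE_reg by eventually_elim (auto simp: mult_op_def scale_op_def E_def good_def indicator_def)
qed

lemma adjoint_bop: "op_eq H (adjoint_op H bop \<circ> bop) (scale_op (of_nat m) (mult_op (indicator E)))"
proof -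
  have "(\<lambda>z. 1) \<in> Linf Z" by (auto simp: Linf_def)
  from adjoint_mult_bop[OF this] have "op_eq H (adjoint_op H bop \<circ> mult_op (\<lambda>z. 1) \<circ> bop) (mult_op (\<lambda>y. \<Sum>h\<in>J y. 1))" .
  moreover have "mult_op (\<lambda>z. 1) = (id :: ('z \<times> 'h) oper)" by (auto simp: mult_op_def fun_eq_iff)
  ultimately show ?thesis using mult_sum_J_one by (auto intro: op_eq_trans)
qed

section \<open>Membership in the crossed product\<close>

definition truncate :: "nat \<Rightarrow> 'h set" where "truncate n = from_nat_into (carrier \<Lambda>) ` {..<n}"

lemma truncate_finite: "finite (truncate n)" by (simp add: truncate_def)

lemma truncate_subset: "truncate n \<subseteq> carrier \<Lambda>"
  unfolding truncate_def using from_nat_into[of "carrier \<Lambda>"] L.one_closed by auto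

lemma truncate_eventually:
  assumes "h \<in> carrier \<Lambda>"
  shows "\<forall>\<^sub>F n in sequentially. h \<in> truncate n"
proof -
  obtain i where i: "from_nat_into (carrier \<Lambda>) i = h"
    using assms from_nat_into_surj[OF cnt] by blast
  have "h \<in> truncate n" if "n > i" for n using that i by (auto simp: truncate_def)
  then show ?thesis unfolding eventually_sequentially by (intro exI[of _ "Suc i"]) auto
qed

definition bterm :: "'h \<Rightarrow> ('z \<times> 'h) oper" where
  "bterm h \<xi> = mult_op (indicator {z \<in> S. c z = h}) (v_op \<Lambda> T h \<xi>)"

lemma bterm_L2: "h \<in> carrier \<Lambda> \<Longrightarrow> \<xi> \<in> L2 H \<Longrightarrow> bterm h \<xi> \<in> L2 H"
  unfolding bterm_def v_op_eq
  by (intro bounded_opD(1)[OF mult_op_bounded] Linf_indicator level_sets comp_shift_L2 L.inv_closed)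

lemma sum_bterm_L2:
  assumes x: "\<xi> \<in> L2 H"
  shows "(\<lambda>p. \<Sum>h\<in>truncate n. bterm h \<xi> p) \<in> L2 H"
proof (rule L2_sum[OF truncate_finite])
  fix h assume "h \<in> truncate n"
  then show "bterm h \<xi> \<in> L2 H" using truncate_subset bterm_L2[OF _ x] by auto
qed

lemma sum_bterm:
  "(\<Sum>h\<in>truncate n. bterm h \<xi> (z, k)) = (if c z \<in> truncate n then bop \<xi> (z, k) else 0)"
proof -
  have "bterm h \<xi> (z, k) = (if c z = h then bop \<xi> (z, k) else 0)" for h
    by (auto simp: bterm_def mult_op_def v_op_def bop_def \<phi>_def indicator_def)
  then show ?thesis using truncate_finite[of n] by simp
qed

text \<open>Only one label is active at each point, so a truncation either keeps the value of
  \<open>bop \<xi>\<close> there or drops it. The error is thus dominated by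
  \<open>bop \<xi>\<close> and eventually zero at every point.\<close>

lemma truncation_converges:
  assumes x: "\<xi> \<in> L2 H"
  shows "(\<lambda>n. \<integral>p. (cmod (bop \<xi> p - (\<Sum>h\<in>truncate n. bterm h \<xi> p)))\<^sup>2 \<partial>H) \<longlonglongrightarrow> 0"
proof -
  have e: "(cmod (bop \<xi> p - (\<Sum>h\<in>truncate n. bterm h \<xi> p)))\<^sup>2 = (if c (fst p) \<in> truncate n then 0 else (cmod (bop \<xi> p))\<^sup>2)" for n p
    using sum_bterm[where \<xi>=\<xi> and n=n and z="fst p" and k="snd p"] by simp
  have "(\<lambda>n. \<integral>p. (cmod (bop \<xi> p - (\<Sum>h\<in>truncate n. bterm h \<xi> p)))\<^sup>2 \<partial>H) \<longlonglongrightarrow> (\<integral>p. 0 \<partial>H)"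
  proof (rule integral_dominated_convergence)
    show "integrable H (\<lambda>p. (cmod (bop \<xi> p))\<^sup>2)" by (rule L2_integrable[OF bop_L2(1)[OF x]])
    show "(\<lambda>p. (cmod (bop \<xi> p - (\<Sum>h\<in>truncate n. bterm h \<xi> p)))\<^sup>2) \<in> borel_measurable H" for n
      using L2_integrable[OF L2_diff[OF bop_L2(1)[OF x] sum_bterm_L2[OF x]]] by (rule borel_measurable_integrable)
    show "AE p in H. norm ((cmod (bop \<xi> p - (\<Sum>h\<in>truncate n. bterm h \<xi> p)))\<^sup>2) \<le> (cmod (bop \<xi> p))\<^sup>2" for n
      unfolding e by simp
    show "AE p in H. (\<lambda>n. (cmod (bop \<xi> p - (\<Sum>h\<in>truncate n. bterm h \<xi> p)))\<^sup>2) \<longlonglongrightarrow> 0"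
    proof (rule AE_I2)
      fix p assume "p \<in> space H"
      then have "c (fst p) \<in> carrier \<Lambda>" by (auto simp: space_H c_closed)
      from truncate_eventually[OF this]
      have "\<forall>\<^sub>F n in sequentially. (cmod (bop \<xi> p - (\<Sum>h\<in>truncate n. bterm h \<xi> p)))\<^sup>2 = 0"
        by eventually_elim (simp only: e if_True)
      then show "(\<lambda>n. (cmod (bop \<xi> p - (\<Sum>h\<in>truncate n. bterm h \<xi> p)))\<^sup>2) \<longlonglongrightarrow> 0"
        by (rule tendsto_eventually)
    qed
  qed simp
  then show ?thesis by simp
qed

text \<open>An operator in the commutant passes through each multiplication and each
  \<open>v_op\<close>, hence through the finite partial sums; \<open>bounded_op_limit\<close>
  extends this to the series.\<close>

lemma bop_commutes:
  assumes F: "F \<in> commutant H (mult_op ` Linf Z \<union> v_op \<Lambda> T ` carrier \<Lambda>)" and x: "\<xi> \<in> L2 H"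
  shows "ae_eq H (F (bop \<xi>)) (bop (F \<xi>))"
proof -
  have bF: "bounded_op H F" using F by (simp add: commutant_def)
  have com: "ae_eq H (F (G \<xi>)) (G (F \<xi>))" if "G \<in> mult_op ` Linf Z \<union> v_op \<Lambda> T ` carrier \<Lambda>" "\<xi> \<in> L2 H" for G \<xi>
    using F that unfolding commutant_def op_eq_def by auto
  have Fx: "F \<xi> \<in> L2 H" by (rule bounded_opD(1)[OF bF x])
  have comm_term: "ae_eq H (F (bterm h \<xi>)) (bterm h (F \<xi>))" if h: "h \<in> carrier \<Lambda>" for h
  proof -
    let ?q = "indicator {z \<in> S. c z = h} :: 'z \<Rightarrow> complex"
    have q: "?q \<in> Linf Z" by (intro Linf_indicator level_sets h)
    have v: "v_op \<Lambda> T h \<xi> \<in> L2 H" unfolding v_op_eq by (intro comp_shift_L2 L.inv_closed h x)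
    have v': "v_op \<Lambda> T h (F \<xi>) \<in> L2 H" unfolding v_op_eq by (intro comp_shift_L2 L.inv_closed h Fx)
    have "ae_eq H (F (mult_op ?q (v_op \<Lambda> T h \<xi>))) (mult_op ?q (F (v_op \<Lambda> T h \<xi>)))"
      by (rule com[OF _ v]) (use q in auto)
    moreover have "ae_eq H (mult_op ?q (F (v_op \<Lambda> T h \<xi>))) (mult_op ?q (v_op \<Lambda> T h (F \<xi>)))"
      by (rule bounded_opD(2)[OF mult_op_bounded[OF q] bounded_opD(1)[OF bF v] v']) (use com[OF _ x] h in auto)
    ultimately show ?thesis unfolding bterm_def by (rule ae_eq_trans)
  qed
  show ?thesis
  proof (rule bounded_op_limit[OF bF bop_L2(1)[OF x] sum_bterm_L2[OF x] bop_L2(1)[OF Fx] sum_bterm_L2[OF Fx] _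
        truncation_converges[OF x] truncation_converges[OF Fx]])
    fix n
    have "ae_eq H (F (\<lambda>p. \<Sum>h\<in>truncate n. bterm h \<xi> p)) (\<lambda>p. \<Sum>h\<in>truncate n. F (bterm h \<xi>) p)"
      by (rule bounded_op_sum[OF bF truncate_finite bterm_L2[OF _ x]]) (use truncate_subset in auto)
    moreover have "ae_eq H (\<lambda>p. \<Sum>h\<in>truncate n. F (bterm h \<xi>) p) (\<lambda>p. \<Sum>h\<in>truncate n. bterm h (F \<xi>) p)"
    proof -
      have "AE p in H. \<forall>h\<in>truncate n. F (bterm h \<xi>) p = bterm h (F \<xi>) p"
        using comm_term truncate_subset[of n] truncate_finite[of n]
        by (intro AE_finite_allI) (auto simp: ae_eq_def)
      then show ?thesis unfolding ae_eq_def by eventually_elim simp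
    qed
    ultimately show "ae_eq H (F (\<lambda>p. \<Sum>h\<in>truncate n. bterm h \<xi> p)) (\<lambda>p. \<Sum>h\<in>truncate n. bterm h (F \<xi>) p)"
      by (rule ae_eq_trans)
  qed
qed

lemma scale_bop_in_crossed_product: "scale_op d bop \<in> crossed_product \<Lambda> Z T"
proof -
  let ?C = "commutant H (mult_op ` Linf Z \<union> v_op \<Lambda> T ` carrier \<Lambda>)"
  have "op_eq H (scale_op d bop \<circ> F) (F \<circ> scale_op d bop)" if F: "F \<in> ?C" for F
    unfolding op_eq_def
  proof
    fix \<xi> assume x: "\<xi> \<in> L2 H"
    have bF: "bounded_op H F" using F by (simp add: commutant_def)
    \<comment> \<open>\<open>bounded_op\<close> states homogeneity and additivity in one clause.
      Taking 0 as second summand leaves a term \<open>F (\<lambda>x. 0)\<close>, and the next fact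
      shows that this term vanishes almost everywhere.\<close>
    have "ae_eq H (F (\<lambda>p. d * bop \<xi> p + 0)) (\<lambda>p. d * F (bop \<xi>) p + F (\<lambda>x. 0) p)"
      by (rule bounded_opD(3)[OF bF bop_L2(1)[OF x] L2_zero])
    moreover have "ae_eq H (F (\<lambda>x. -1 * 0 + 0)) (\<lambda>x. -1 * F (\<lambda>x. 0) x + F (\<lambda>x. 0) x)"
      by (rule bounded_opD(3)[OF bF L2_zero L2_zero])
    ultimately show "ae_eq H ((scale_op d bop \<circ> F) \<xi>) ((F \<circ> scale_op d bop) \<xi>)"
      using bop_commutes[OF F x] by (auto simp: ae_eq_def scale_op_def)
  qed
  then show ?thesis
    unfolding crossed_product_def commutant_def[of H "commutant _ _"]
    using bounded_op_scale[OF bop_bounded] by blast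
qed

lemma bop_in_crossed_product: "bop \<in> crossed_product \<Lambda> Z T"
  using scale_bop_in_crossed_product[of 1] by (simp add: scale_op_def)

lemma scale_bop_partial_isometry:
  assumes d: "cnj d * d * of_nat m = 1"
  shows "partial_isometry_op H (scale_op d bop)"
proof -
  let ?V = "scale_op d bop" and ?Q = "mult_op (indicator E) :: ('z \<times> 'h) oper"
  have bV: "bounded_op H ?V" by (rule bounded_op_scale[OF bop_bounded])
  have aV: "bounded_op H (adjoint_op H ?V)" by (rule adjoint_pair_bounded[OF adjoint_exists[OF bV]])
  have "adjoint_pair H bop badj"
    using bop_bounded badj_bounded bop_badj_inner by (simp add: adjoint_pair_def)
  from adjoint_op_eq[OF adjoint_pair_scale[OF this, of d]]
  have "op_eq H (adjoint_op H ?V \<circ> ?V) (scale_op (cnj d) badj \<circ> ?V)"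
    by (rule op_eq_comp_right) (rule bounded_op_preserves[OF bV])
  also have "scale_op (cnj d) badj \<circ> ?V = scale_op (cnj d * d) (badj \<circ> mult_op (\<lambda>_. 1) \<circ> bop)"
    by (auto simp: fun_eq_iff scale_op_def badj_def mult_op_def sum_distrib_left mult.assoc)
  finally have 1: "op_eq H (adjoint_op H ?V \<circ> ?V) (scale_op (cnj d * d) (badj \<circ> mult_op (\<lambda>_. 1) \<circ> bop))" .
  have 2: "op_eq H (scale_op (cnj d * d) (badj \<circ> mult_op (\<lambda>_. 1) \<circ> bop)) (scale_op (cnj d * d) (scale_op (of_nat m) ?Q))"
    by (intro op_eq_scale op_eq_trans[OF badj_mult_bop mult_sum_J_one])
  have 3: "scale_op (cnj d * d) (scale_op (of_nat m) ?Q) = ?Q"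
    using d by (simp add: scale_op_def mult.assoc[symmetric])
  have "op_eq H ?Q (adjoint_op H ?V \<circ> ?V)"
    using op_eq_trans[OF 1 2] unfolding 3 by (rule op_eq_sym)
  then have "projection_op H (adjoint_op H ?V \<circ> ?V)"
    by (rule projection_op_cong[OF projection_indicator[OF E_sets]])
       (intro bounded_op_preserves bounded_op_comp aV bV)
  then show ?thesis using bV by (simp add: partial_isometry_op_def)
qed

lemma bop_scalar_multiple: "scalar_multiple_of_partial_isometry H (crossed_product \<Lambda> Z T) bop"
proof -
  \<comment> \<open>The adjoint of \<open>bop\<close> composed with \<open>bop\<close> is
    \<open>m\<close> times a projection; dividing \<open>bop\<close> by the square root of
    \<open>m\<close> makes it that projection.\<close>
  define r where "r = sqrt (real m)"
  have r: "r > 0" "r * r = real m" using m_pos by (auto simp: r_def)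
  have "cnj (1 / complex_of_real r) * (1 / complex_of_real r) * of_nat m = complex_of_real (1 / r * (1 / r) * real m)"
    by simp
  also have "1 / r * (1 / r) * real m = 1" unfolding r(2)[symmetric] using r(1) by (simp add: field_simps)
  finally have "partial_isometry_op H (scale_op (1 / complex_of_real r) bop)"
    by (intro scale_bop_partial_isometry) simp
  moreover have "op_eq H bop (scale_op (complex_of_real r) (scale_op (1 / complex_of_real r) bop))"
    using r by (simp add: op_eq_def ae_eq_def scale_op_def)
  ultimately show ?thesis
    unfolding scalar_multiple_of_partial_isometry_def using scale_bop_in_crossed_product by blast
qed

section \<open>The right support\<close>

lemma \<phi>_in_E: "good z \<Longrightarrow> z \<in> S \<Longrightarrow> \<phi> z \<in> E"
  using c_in_J[of z] good_\<phi>[of z] by (auto simp: E_def good_def)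

text \<open>If \<open>bop \<circ> F\<close> equals \<open>bop\<close>, composing with the adjoint of
  \<open>bop\<close> gives \<open>m\<close> times \<open>Q \<circ> F\<close> equal to
  \<open>m\<close> times \<open>Q\<close>, where \<open>Q\<close> projects onto \<open>E\<close>.
  Cancelling \<open>m\<close> and taking adjoints gives \<open>F \<circ> Q\<close> equal to
  \<open>Q\<close>.\<close>

lemma bop_right_support: "right_support H bop (mult_op (indicator E))"
  unfolding right_support_def
proof (intro conjI allI impI)
  let ?Q = "mult_op (indicator E) :: ('z \<times> 'h) oper"
  show pQ: "projection_op H ?Q" by (rule projection_indicator[OF E_sets])
  show "op_eq H (bop \<circ> ?Q) bop"
    unfolding op_eq_def
  proof (intro ballI ae_eq_HI)
    fix \<xi> :: "'z \<times> 'h \<Rightarrow> complex"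
    show "AE z in Z. \<forall>k\<in>carrier \<Lambda>. (bop \<circ> ?Q) \<xi> (z, k) = bop \<xi> (z, k)"
      using AE_good by eventually_elim (auto simp: bop_def mult_op_def \<phi>_in_E)
  qed
  fix F assume F: "projection_op H F \<and> op_eq H (bop \<circ> F) bop"
  have bF: "bounded_op H F" using F by (auto simp: projection_op_def)
  have QF: "ae_eq H (?Q (F \<xi>)) (?Q \<xi>)" if x: "\<xi> \<in> L2 H" for \<xi>
  proof -
    have Fx: "F \<xi> \<in> L2 H" by (rule bounded_opD(1)[OF bF x])
    have b: "ae_eq H (adjoint_op H bop (bop \<eta>)) (\<lambda>p. of_nat m * ?Q \<eta> p)" if "\<eta> \<in> L2 H" for \<eta>
      using adjoint_bop that by (simp add: op_eq_def scale_op_def)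
    have "ae_eq H (adjoint_op H bop (bop (F \<xi>))) (adjoint_op H bop (bop \<xi>))"
      using F x by (intro bounded_opD(2)[OF adjoint_bounded] bop_L2 Fx) (auto simp: op_eq_def)
    from ae_eq_trans[OF ae_eq_sym[OF b[OF Fx]] ae_eq_trans[OF this b[OF x]]]
    have "ae_eq H (\<lambda>p. of_nat m * ?Q (F \<xi>) p) (\<lambda>p. of_nat m * ?Q \<xi> p)" .
    then show ?thesis using m_pos by (auto simp: ae_eq_def)
  qed
  have aF: "adjoint_pair H F F" using F projection_op_adjoint_pair by blast
  have aQ: "adjoint_pair H ?Q ?Q" by (rule projection_op_adjoint_pair[OF pQ])
  note QL = bounded_opD(1)[OF adjoint_pair_bounded(1)[OF aQ]] and FL = bounded_opD(1)[OF bF]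
  show "op_eq H (F \<circ> ?Q) ?Q"
    unfolding op_eq_def
  proof (intro ballI l2_inner_ext)
    fix \<xi> \<eta> assume x: "\<xi> \<in> L2 H" and y: "\<eta> \<in> L2 H"
    have "l2_inner H ((F \<circ> ?Q) \<xi>) \<eta> = l2_inner H (?Q \<xi>) (F \<eta>)"
      using adjoint_pair_inner[OF aF QL[OF x] y] by simp
    also have "\<dots> = l2_inner H \<xi> (?Q (F \<eta>))" by (rule adjoint_pair_inner[OF aQ x FL[OF y]])
    also have "\<dots> = l2_inner H \<xi> (?Q \<eta>)"
      by (rule l2_inner_cong) (auto intro: ae_eq_refl QF x y QL FL)
    also have "\<dots> = l2_inner H (?Q \<xi>) \<eta>" by (rule adjoint_pair_inner[OF aQ x y, symmetric])
    finally show "l2_inner H ((F \<circ> ?Q) \<xi>) \<eta> = l2_inner H (?Q \<xi>) \<eta>" .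
  qed (auto intro: QL FL)
qed

end

subsection \<open>Orbit maps with cohomologically trivial cocycle\<close>

lemma standard_space: "standard_prob_space M \<Longrightarrow> space M = UNIV"
  unfolding standard_prob_space_def by (metis sets_eq_imp_space_eq space_borel)

lemma mp_action_apply:
  assumes "mp_action G M \<sigma>" "standard_prob_space M" "g \<in> carrier G" "h \<in> carrier G"
  shows "\<sigma> g (\<sigma> h t) = \<sigma> (g \<otimes>\<^bsub>G\<^esub> h) t" "\<sigma> \<one>\<^bsub>G\<^esub> t = t"
proof -
  interpret group_action G "space M" \<sigma>
    using assms by (simp add: mp_action_def)
  have t: "t \<in> space M" using standard_space[OF assms(2)] by simp
  show "\<sigma> g (\<sigma> h t) = \<sigma> (g \<otimes>\<^bsub>G\<^esub> h) t" using composition_rule[OF t] assms by simp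
  show "\<sigma> \<one>\<^bsub>G\<^esub> t = t" using id_eq_one t by (metis restrict_apply)
qed

lemma mp_action_near_action:
  assumes "mp_action G M \<sigma>" "standard_prob_space M" "free_action G M \<sigma>"
  shows "near_action G M \<sigma>"
proof (rule near_action.intro)
  have "group_action G (space M) \<sigma>" using assms by (simp add: mp_action_def)
  then show "group G" using group_action.group_hom group_hom.axioms(1) by blast
  show "prob_space M" using assms by (simp add: standard_prob_space_def)
  then have "\<one>\<^bsub>G\<^esub> \<in> carrier G" using \<open>group G\<close> by (simp add: group.is_monoid)
  then show "AE z in M. \<sigma> \<one>\<^bsub>G\<^esub> z = z" using mp_action_apply(2)[OF assms(1,2)] by simp
  show "AE z in M. \<forall>h\<in>carrier G. \<forall>k\<in>carrier G. \<sigma> h (\<sigma> k z) = \<sigma> (h \<otimes>\<^bsub>G\<^esub> k) z"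
    using mp_action_apply(1)[OF assms(1,2)] by simp
  show "AE z in M. \<forall>h\<in>carrier G. \<sigma> h z = z \<longrightarrow> h = \<one>\<^bsub>G\<^esub>"
    using assms(3) by (simp add: free_action_def)
qed (use assms in \<open>auto simp: mp_action_def\<close>)

text \<open>For an embedding, \<open>Z\<close> is \<open>Y\<close> with the given action and
  \<open>\<iota>\<close> is \<open>\<Delta>\<close>; for a local orbit equivalence, \<open>Z\<close>
  is the amplified space with the pulled back action and \<open>\<iota>\<close> the inclusion of the
  first copy of \<open>X\<close>. In both, \<open>S\<close> is the copy of \<open>X\<close> inside
  \<open>Z\<close>. Orbits are only assumed to be mapped into orbits; \<open>same_orbits\<close>
  expresses the converse.\<close>

locale oe_cocycle = near_action \<Lambda> Z T
  for \<Lambda> :: "('h, 'n) monoid_scheme" (structure) and Z :: "'z measure" and T +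
  fixes \<Gamma> :: "('g, 'm) monoid_scheme" and \<mu> :: "'x::polish_space measure"
    and \<sigma> :: "'g \<Rightarrow> 'x \<Rightarrow> 'x" and S :: "'z set" and \<iota> :: "'x \<Rightarrow> 'z" and \<pi> :: "'z \<Rightarrow> 'x"
    and \<delta> :: "'g \<Rightarrow> 'h" and v :: "'x \<Rightarrow> 'h"
  assumes \<mu>_std: "standard_prob_space \<mu>" and \<sigma>_act: "mp_action \<Gamma> \<mu> \<sigma>"
    and \<sigma>_free: "free_action \<Gamma> \<mu> \<sigma>" and \<sigma>_erg: "ergodic_action \<Gamma> \<mu> \<sigma>"
    and S_meas: "S \<in> sets Z" and S_pos: "measure Z S > 0"
    and \<iota>_mp: "mp_map \<mu> (uniform_measure Z S) \<iota>"
    and \<pi>_inv: "mod_null_inverse \<mu> (uniform_measure Z S) \<iota> \<pi>"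
    and orbit_map: "AE t in \<mu>. \<forall>g\<in>carrier \<Gamma>. \<exists>h\<in>carrier \<Lambda>. \<iota> (\<sigma> g t) = T h (\<iota> t)"
    and \<delta>_hom: "\<delta> \<in> hom \<Gamma> \<Lambda>" and v_meas: "v \<in> measurable \<mu> (count_space (carrier \<Lambda>))"
    and cocycle: "\<forall>g\<in>carrier \<Gamma>. AE t in \<mu>.
       inv (v t) \<otimes> zimmer_cocycle \<Gamma> \<Lambda> \<sigma> T \<iota> t g \<otimes> v (\<sigma> (inv\<^bsub>\<Gamma>\<^esub> g) t) = \<delta> g"
begin

sublocale GA: near_action \<Gamma> \<mu> \<sigma>
  by (rule mp_action_near_action[OF \<sigma>_act \<mu>_std \<sigma>_free])

lemma space_\<mu>: "space \<mu> = UNIV" by (rule standard_space[OF \<mu>_std])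

lemma \<sigma>_mult: "g \<in> carrier \<Gamma> \<Longrightarrow> h \<in> carrier \<Gamma> \<Longrightarrow> \<sigma> g (\<sigma> h t) = \<sigma> (g \<otimes>\<^bsub>\<Gamma>\<^esub> h) t"
  by (rule mp_action_apply(1)[OF \<sigma>_act \<mu>_std])

lemma \<sigma>_one: "\<sigma> \<one>\<^bsub>\<Gamma>\<^esub> t = t"
  using mp_action_apply(2)[OF \<sigma>_act \<mu>_std] GA.L.one_closed by blast

lemma \<sigma>_inv: "g \<in> carrier \<Gamma> \<Longrightarrow> \<sigma> g (\<sigma> (inv\<^bsub>\<Gamma>\<^esub> g) t) = t" "g \<in> carrier \<Gamma> \<Longrightarrow> \<sigma> (inv\<^bsub>\<Gamma>\<^esub> g) (\<sigma> g t) = t"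
  by (simp_all add: \<sigma>_mult \<sigma>_one)

lemma v_closed: "v t \<in> carrier \<Lambda>"
  using measurable_space[OF v_meas, of t] by (simp add: space_\<mu>)

lemma \<delta>_closed: "g \<in> carrier \<Gamma> \<Longrightarrow> \<delta> g \<in> carrier \<Lambda>"
  using \<delta>_hom by (auto simp: hom_def)

lemma \<delta>_group_hom: "group_hom \<Gamma> \<Lambda> \<delta>"
  by (simp add: group_hom_def group_hom_axioms_def GA.grp grp \<delta>_hom)

lemma \<delta>_mult: "g \<in> carrier \<Gamma> \<Longrightarrow> h \<in> carrier \<Gamma> \<Longrightarrow> \<delta> (g \<otimes>\<^bsub>\<Gamma>\<^esub> h) = \<delta> g \<otimes> \<delta> h"
  using \<delta>_hom by (auto simp: hom_def)

lemma \<delta>_inv: "g \<in> carrier \<Gamma> \<Longrightarrow> \<delta> (inv\<^bsub>\<Gamma>\<^esub> g) = inv (\<delta> g)"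
  by (rule group_hom.hom_inv[OF \<delta>_group_hom])

lemma S_emeasure: "emeasure Z S \<noteq> 0" "emeasure Z S < \<infinity>"
  using S_pos by (auto simp: PZ.emeasure_eq_measure)

lemma \<iota>_meas: "\<iota> \<in> measurable \<mu> Z"
  using \<iota>_mp by (simp add: mp_map_def cong: measurable_cong_sets)

lemma \<pi>_meas: "\<pi> \<in> measurable Z \<mu>"
  using \<pi>_inv by (simp add: mod_null_inverse_def cong: measurable_cong_sets)

lemma AE_\<iota>:
  assumes "AE z in Z. z \<in> S \<longrightarrow> P z"
  shows "AE t in \<mu>. P (\<iota> t)"
proof -
  have "AE z in uniform_measure Z S. P z"
    by (rule AE_uniform_measureI[OF S_meas assms])
  moreover have d: "distr \<mu> (uniform_measure Z S) \<iota> = uniform_measure Z S" and i: "\<iota> \<in> measurable \<mu> (uniform_measure Z S)"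
    using \<iota>_mp by (simp_all add: mp_map_def)
  ultimately show ?thesis by (intro AE_distrD[OF i]) (simp only: d)
qed

text \<open>The image of the uniform measure on \<open>S\<close> under \<open>\<pi>\<close> is
  \<open>\<mu>\<close>, because \<open>\<pi> \<circ> \<iota>\<close> is the identity almost
  everywhere.\<close>

lemma AE_\<pi>:
  assumes "AE t in \<mu>. P t"
  shows "AE z in Z. z \<in> S \<longrightarrow> P (\<pi> z)"
proof -
  let ?U = "uniform_measure Z S"
  have i: "\<iota> \<in> measurable \<mu> ?U" "distr \<mu> ?U \<iota> = ?U" using \<iota>_mp by (auto simp: mp_map_def)
  have p: "\<pi> \<in> measurable ?U \<mu>" using \<pi>_inv by (simp add: mod_null_inverse_def)
  have "distr ?U \<mu> \<pi> = distr (distr \<mu> ?U \<iota>) \<mu> \<pi>" using i by simp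
  also have "\<dots> = distr \<mu> \<mu> (\<pi> \<circ> \<iota>)" by (rule distr_distr[OF p i(1)])
  also have "\<dots> = distr \<mu> \<mu> (\<lambda>t. t)"
    by (rule distr_cong_AE) (use \<pi>_inv measurable_comp[OF i(1) p] in \<open>auto simp: mod_null_inverse_def\<close>)
  also have "\<dots> = \<mu>" by (rule distr_id)
  finally have "AE t in distr ?U \<mu> \<pi>. P t" using assms by (simp only:)
  from AE_distrD[OF p this] have "AE z in ?U. P (\<pi> z)" .
  then show ?thesis by (subst (asm) AE_uniform_measure) (use S_emeasure in auto)
qed

abbreviation w :: "'x \<Rightarrow> 'g \<Rightarrow> 'h" where "w \<equiv> zimmer_cocycle \<Gamma> \<Lambda> \<sigma> T \<iota>"

text \<open>The map \<open>\<phi>\<close> of the section read on \<open>X\<close>; the two are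
  identified by \<open>\<phi>_\<iota>\<close>.\<close>

definition \<Phi> :: "'x \<Rightarrow> 'z" where "\<Phi> t = T (inv (v t)) (\<iota> t)"

sublocale section_map \<Lambda> Z T S "\<lambda>z. v (\<pi> z)"
proof
  show "S \<in> sets Z" by (rule S_meas)
  show "(\<lambda>z. v (\<pi> z)) \<in> measurable Z (count_space (carrier \<Lambda>))"
    by (rule measurable_compose[OF \<pi>_meas v_meas])
qed

lemma \<Phi>_meas: "\<Phi> \<in> measurable \<mu> Z"
  unfolding \<Phi>_def[abs_def]
  by (rule measurable_compose_countable'[where f="\<lambda>h t. T (inv h) (\<iota> t)", OF _ v_meas cnt])
     (auto intro: measurable_compose[OF \<iota>_meas] T_meas)

text \<open>The default of \<open>the_unique\<close> is the unit, so the cocycle stays in the group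
  also on the null set where no unique element exists.\<close>

lemma w_closed: "w t g \<in> carrier \<Lambda>"
proof -
  have "the_unique \<one> (\<lambda>h. h \<in> carrier \<Lambda> \<and> P h) \<in> carrier \<Lambda>" for P
  proof (cases "\<exists>!h. h \<in> carrier \<Lambda> \<and> P h")
    case True
    then show ?thesis using theI'[OF True] by (simp add: the_unique_def)
  qed (auto simp: the_unique_def)
  then show ?thesis by (simp add: zimmer_cocycle_def)
qed

definition GX :: "'x \<Rightarrow> bool" where
  "GX t \<longleftrightarrow> \<iota> t \<in> S \<and> \<pi> (\<iota> t) = t \<and> good (\<iota> t) \<and> GA.good t \<and>
     (\<forall>g\<in>carrier \<Gamma>. \<Phi> (\<sigma> g t) = T (\<delta> g) (\<Phi> t) \<and> T (inv (w t g)) (\<iota> t) = \<iota> (\<sigma> (inv\<^bsub>\<Gamma>\<^esub> g) t) \<and>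
        w t g \<otimes> v (\<sigma> (inv\<^bsub>\<Gamma>\<^esub> g) t) = v t \<otimes> \<delta> g)"

text \<open>Freeness at \<open>\<iota> t\<close> makes the group element unique, so
  \<open>the_unique\<close> returns it and not its default.\<close>

lemma w_eq:
  assumes "good (\<iota> t)" "h \<in> carrier \<Lambda>" "\<iota> (\<sigma> (inv\<^bsub>\<Gamma>\<^esub> g) t) = T h (\<iota> t)"
  shows "T (inv (w t g)) (\<iota> t) = \<iota> (\<sigma> (inv\<^bsub>\<Gamma>\<^esub> g) t)"
proof -
  let ?P = "\<lambda>h. h \<in> carrier \<Lambda> \<and> \<iota> (\<sigma> (inv\<^bsub>\<Gamma>\<^esub> g) t) = T (inv h) (\<iota> t)"
  have ex: "\<exists>!h. ?P h"
  proof (rule ex1I[of _ "inv h"])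
    show "?P (inv h)" using assms by simp
    fix k assume "?P k"
    then have "inv k = h" using assms good_inj[of "\<iota> t" "inv k" h] by simp
    then show "k = inv h" using \<open>?P k\<close> by auto
  qed
  then have "w t g = (THE h. ?P h)" by (simp add: zimmer_cocycle_def the_unique_def)
  with theI'[OF ex] show ?thesis by simp
qed

lemma AE_GX: "AE t in \<mu>. GX t"
proof -
  have "AE t in \<mu>. \<iota> t \<in> S" by (rule AE_\<iota>) simp
  moreover have "AE t in \<mu>. \<pi> (\<iota> t) = t" using \<pi>_inv by (simp add: mod_null_inverse_def)
  moreover have "AE t in \<mu>. good (\<iota> t)" using AE_good by (intro AE_\<iota>) auto
  moreover have "AE t in \<mu>. GA.good t" by (rule GA.AE_good)
  moreover have "AE t in \<mu>. \<forall>g\<in>carrier \<Gamma>. inv (v t) \<otimes> w t g \<otimes> v (\<sigma> (inv\<^bsub>\<Gamma>\<^esub> g) t) = \<delta> g"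
    using cocycle GA.cnt by (simp add: AE_ball_countable)
  ultimately show ?thesis using orbit_map
  proof eventually_elim
    fix t assume S: "\<iota> t \<in> S" and p: "\<pi> (\<iota> t) = t" and g: "good (\<iota> t)" and gt: "GA.good t"
      and co: "\<forall>g\<in>carrier \<Gamma>. inv (v t) \<otimes> w t g \<otimes> v (\<sigma> (inv\<^bsub>\<Gamma>\<^esub> g) t) = \<delta> g"
      and orb: "\<forall>g\<in>carrier \<Gamma>. \<exists>h\<in>carrier \<Lambda>. \<iota> (\<sigma> g t) = T h (\<iota> t)"
    have wt: "T (inv (w t g)) (\<iota> t) = \<iota> (\<sigma> (inv\<^bsub>\<Gamma>\<^esub> g) t)" if gg: "g \<in> carrier \<Gamma>" for g
    proof -
      obtain h where "h \<in> carrier \<Lambda>" "\<iota> (\<sigma> (inv\<^bsub>\<Gamma>\<^esub> g) t) = T h (\<iota> t)" using orb gg GA.L.inv_closed by blast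
      then show ?thesis by (rule w_eq[OF g])
    qed
    have wv: "w t g \<otimes> v (\<sigma> (inv\<^bsub>\<Gamma>\<^esub> g) t) = v t \<otimes> \<delta> g" if gg: "g \<in> carrier \<Gamma>" for g
    proof -
      have "v t \<otimes> \<delta> g = v t \<otimes> (inv (v t) \<otimes> w t g \<otimes> v (\<sigma> (inv\<^bsub>\<Gamma>\<^esub> g) t))" using co gg by simp
      also have "\<dots> = (v t \<otimes> inv (v t)) \<otimes> w t g \<otimes> v (\<sigma> (inv\<^bsub>\<Gamma>\<^esub> g) t)"
        by (simp only: L.m_assoc v_closed w_closed L.inv_closed L.m_closed)
      also have "\<dots> = w t g \<otimes> v (\<sigma> (inv\<^bsub>\<Gamma>\<^esub> g) t)" by (simp add: v_closed w_closed)
      finally show ?thesis by simp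
    qed
    have eq: "\<Phi> (\<sigma> g t) = T (\<delta> g) (\<Phi> t)" if gg: "g \<in> carrier \<Gamma>" for g
    proof -
      have ig: "inv\<^bsub>\<Gamma>\<^esub> g \<in> carrier \<Gamma>" and ii: "inv\<^bsub>\<Gamma>\<^esub> (inv\<^bsub>\<Gamma>\<^esub> g) = g" using gg by auto
      \<comment> \<open>The cocycle at \<open>g\<close> compares \<open>t\<close> with its translate
        by the inverse of \<open>g\<close>; for \<open>\<Phi> (\<sigma> g t)\<close> it has to be
        evaluated at the inverse.\<close>
      let ?w = "w t (inv\<^bsub>\<Gamma>\<^esub> g)"
      have 1: "?w \<otimes> v (\<sigma> g t) = v t \<otimes> inv (\<delta> g)"
        using wv[OF ig] ii \<delta>_inv[OF gg] by simp
      have "inv (v (\<sigma> g t)) \<otimes> inv ?w = inv (?w \<otimes> v (\<sigma> g t))"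
        by (rule L.inv_mult_group[symmetric]) (auto simp: v_closed w_closed)
      also have "\<dots> = \<delta> g \<otimes> inv (v t)"
        unfolding 1 using gg by (simp add: L.inv_mult_group v_closed \<delta>_closed)
      finally have 2: "inv (v (\<sigma> g t)) \<otimes> inv ?w = \<delta> g \<otimes> inv (v t)" .
      have "\<Phi> (\<sigma> g t) = T (inv (v (\<sigma> g t))) (T (inv ?w) (\<iota> t))"
        using wt[OF ig] ii by (simp add: \<Phi>_def)
      also have "\<dots> = T (\<delta> g \<otimes> inv (v t)) (\<iota> t)"
        using good_mult[OF g, of "inv (v (\<sigma> g t))" "inv ?w"] 2 v_closed w_closed by simp
      also have "\<dots> = T (\<delta> g) (\<Phi> t)"
        using good_mult[OF g, of "\<delta> g" "inv (v t)"] gg by (simp add: \<Phi>_def v_closed \<delta>_closed)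
      finally show ?thesis .
    qed
    show "GX t" unfolding GX_def using S p g gt wt wv eq by blast
  qed
qed

definition GX1 :: "'x \<Rightarrow> bool" where "GX1 t \<longleftrightarrow> (\<forall>g\<in>carrier \<Gamma>. GX (\<sigma> g t))"

lemma AE_GX1: "AE t in \<mu>. GX1 t"
  unfolding GX1_def by (rule GA.AE_T[OF AE_GX])

lemma GX1_GX: "GX1 t \<Longrightarrow> GX t"
  unfolding GX1_def using \<sigma>_one GA.L.one_closed by metis

lemma GX1_\<sigma>: "GX1 t \<Longrightarrow> g \<in> carrier \<Gamma> \<Longrightarrow> GX1 (\<sigma> g t)"
  unfolding GX1_def by (simp add: \<sigma>_mult)

text \<open>The condition is placed on all translates, so it is invariant under \<open>T\<close>,
  and every point met in the fibre over such a \<open>y\<close> is well behaved in \<open>X\<close>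
  together with its \<open>\<Gamma>\<close>-orbit.\<close>

definition GY :: "'z \<Rightarrow> bool" where
  "GY y \<longleftrightarrow> good y \<and> (\<forall>h\<in>carrier \<Lambda>. T h y \<in> S \<longrightarrow> \<iota> (\<pi> (T h y)) = T h y \<and> GX1 (\<pi> (T h y)))"

lemma AE_\<iota>_\<pi>: "AE z in Z. z \<in> S \<longrightarrow> \<iota> (\<pi> z) = z"
  using \<pi>_inv S_emeasure by (simp add: mod_null_inverse_def AE_uniform_measure)

lemma AE_GY: "AE y in Z. GY y"
proof -
  have "AE z in Z. z \<in> S \<longrightarrow> \<iota> (\<pi> z) = z \<and> GX1 (\<pi> z)"
    using AE_\<iota>_\<pi> AE_\<pi>[OF AE_GX1] by eventually_elim simp
  from AE_T[OF this] AE_good show ?thesis by eventually_elim (simp add: GY_def)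
qed

lemma GY_T: "GY y \<Longrightarrow> h \<in> carrier \<Lambda> \<Longrightarrow> GY (T h y)"
  unfolding GY_def by (auto simp: good_mult good_T)

lemma GY_good: "GY y \<Longrightarrow> good y"
  by (simp add: GY_def)

definition G :: "'x \<Rightarrow> bool" where "G t \<longleftrightarrow> GX1 t \<and> GY (\<iota> t)"

lemma AE_G: "AE t in \<mu>. G t"
proof -
  have "AE t in \<mu>. GY (\<iota> t)" using AE_GY by (intro AE_\<iota>) auto
  then show ?thesis using AE_GX1 by eventually_elim (simp add: G_def)
qed

lemma G_GX: "G t \<Longrightarrow> GX t"
  by (simp add: G_def GX1_GX)

lemma G_facts:
  assumes "G t"
  shows "\<iota> t \<in> S" "\<pi> (\<iota> t) = t" "good (\<iota> t)" "GA.good t"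
    and "g \<in> carrier \<Gamma> \<Longrightarrow> \<Phi> (\<sigma> g t) = T (\<delta> g) (\<Phi> t)"
    and "g \<in> carrier \<Gamma> \<Longrightarrow> T (inv (w t g)) (\<iota> t) = \<iota> (\<sigma> (inv\<^bsub>\<Gamma>\<^esub> g) t)"
    and "g \<in> carrier \<Gamma> \<Longrightarrow> w t g \<otimes> v (\<sigma> (inv\<^bsub>\<Gamma>\<^esub> g) t) = v t \<otimes> \<delta> g"
  using G_GX[OF assms] by (auto simp: GX_def)

lemma G_\<sigma>:
  assumes t: "G t" and g: "g \<in> carrier \<Gamma>"
  shows "G (\<sigma> g t)"
proof -
  have "\<iota> (\<sigma> g t) = T (inv (w t (inv\<^bsub>\<Gamma>\<^esub> g))) (\<iota> t)"
    using G_facts(6)[OF t, of "inv\<^bsub>\<Gamma>\<^esub> g"] g by simp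
  then show ?thesis
    using t g GX1_\<sigma> GY_T[of "\<iota> t" "inv (w t (inv\<^bsub>\<Gamma>\<^esub> g))"] w_closed by (simp add: G_def)
qed

lemma \<phi>_\<iota>: "GX t \<Longrightarrow> \<phi> (\<iota> t) = \<Phi> t"
  by (simp add: \<phi>_def \<Phi>_def GX_def)

lemma GY_\<Phi>: "G t \<Longrightarrow> GY (\<Phi> t)"
  unfolding \<Phi>_def by (rule GY_T) (auto simp: G_def v_closed)

lemma T_v_\<Phi>: "G t \<Longrightarrow> T (v t) (\<Phi> t) = \<iota> t"
  unfolding \<Phi>_def by (rule good_inv) (auto simp: G_facts v_closed)

section \<open>Fibres of the equivariant map and their size\<close>

definition F :: "'z \<Rightarrow> 'x set" where "F y = {s. G s \<and> \<Phi> s = y}"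

lemma J_point:
  assumes y: "GY y" and h: "h \<in> J y"
  shows "\<pi> (T h y) \<in> F y" "v (\<pi> (T h y)) = h" "\<iota> (\<pi> (T h y)) = T h y"
proof -
  have hc: "h \<in> carrier \<Lambda>" "T h y \<in> S" "v (\<pi> (T h y)) = h" using h by (auto simp: J_def)
  have a: "\<iota> (\<pi> (T h y)) = T h y" "GX1 (\<pi> (T h y))" using y hc by (auto simp: GY_def)
  then have "G (\<pi> (T h y))" using y hc GY_T by (simp add: G_def)
  moreover have "\<Phi> (\<pi> (T h y)) = y"
    using a hc good_inv(1)[OF GY_good[OF y]] by (simp add: \<Phi>_def)
  ultimately show "\<pi> (T h y) \<in> F y" by (simp add: F_def)
  show "v (\<pi> (T h y)) = h" "\<iota> (\<pi> (T h y)) = T h y" using a hc by auto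
qed

lemma F_point:
  assumes s: "s \<in> F y"
  shows "v s \<in> J y" "\<pi> (T (v s) y) = s" "T (v s) y = \<iota> s"
proof -
  have g: "G s" and e: "y = \<Phi> s" using s by (auto simp: F_def)
  show a: "T (v s) y = \<iota> s" using T_v_\<Phi>[OF g] e by simp
  show "\<pi> (T (v s) y) = s" using a G_facts(2)[OF g] by simp
  then show "v s \<in> J y" using a G_facts(1)[OF g] by (simp add: J_def v_closed)
qed

text \<open>The labelling is inverted by \<open>v\<close>. Sums over labels, as in
  \<open>badj\<close>, are thereby sums over the points of a fibre.\<close>

lemma fiber_bij: "GY y \<Longrightarrow> bij_betw (\<lambda>h. \<pi> (T h y)) (J y) (F y)"
  by (rule bij_betw_byWitness[where f'=v]) (use J_point F_point in auto)

lemma card_J_F: "GY y \<Longrightarrow> card (J y) = card (F y)"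
  by (rule bij_betw_same_card[OF fiber_bij])

lemma F_self: "G t \<Longrightarrow> t \<in> F (\<Phi> t)"
  by (simp add: F_def)

lemma F_\<sigma>:
  assumes s: "s \<in> F y" and g: "g \<in> carrier \<Gamma>"
  shows "\<sigma> g s \<in> F (T (\<delta> g) y)"
  using s g G_\<sigma> G_facts(5) by (auto simp: F_def)

text \<open>The second inclusion is the first one for the inverse of \<open>g\<close>, applied at
  the translated base point.\<close>

lemma F_equivariant:
  assumes y: "good y" and g: "g \<in> carrier \<Gamma>"
  shows "F (T (\<delta> g) y) = \<sigma> g ` F y"
proof
  show "\<sigma> g ` F y \<subseteq> F (T (\<delta> g) y)" using F_\<sigma> g by blast
  show "F (T (\<delta> g) y) \<subseteq> \<sigma> g ` F y"
  proof
    fix s assume s: "s \<in> F (T (\<delta> g) y)"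
    have "\<sigma> (inv\<^bsub>\<Gamma>\<^esub> g) s \<in> F (T (\<delta> (inv\<^bsub>\<Gamma>\<^esub> g)) (T (\<delta> g) y))" using F_\<sigma>[OF s] g by simp
    also have "T (\<delta> (inv\<^bsub>\<Gamma>\<^esub> g)) (T (\<delta> g) y) = y" using good_inv(1)[OF y] g by (simp add: \<delta>_inv \<delta>_closed)
    finally show "s \<in> \<sigma> g ` F y" using \<sigma>_inv(1)[OF g, of s] by (metis imageI)
  qed
qed

lemma \<sigma>_inj: "g \<in> carrier \<Gamma> \<Longrightarrow> inj_on (\<sigma> g) A"
  by (rule inj_on_inverseI[of _ "\<sigma> (inv\<^bsub>\<Gamma>\<^esub> g)"]) (simp add: \<sigma>_inv)

lemma card_J_equivariant:
  assumes y: "GY y" and g: "g \<in> carrier \<Gamma>"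
  shows "card (J (T (\<delta> g) y)) = card (J y)"
  using card_J_F[OF y] card_J_F[OF GY_T[OF y \<delta>_closed[OF g]]] F_equivariant[OF GY_good[OF y] g]
  by (simp add: card_image \<sigma>_inj g)

text \<open>The cardinality is written as a complex sum of ones, to which the measurability of sums
  over labels applies.\<close>

lemma card_J_sets: "{y \<in> space Z. card (J y) = k} \<in> sets Z"
proof -
  have "(\<lambda>y. \<Sum>h\<in>J y. (1::complex)) \<in> borel_measurable Z" by (rule sum_J_measurable) simp
  then have m: "(\<lambda>y. complex_of_nat (card (J y))) \<in> borel_measurable Z" by simp
  have "{y \<in> space Z. complex_of_nat (card (J y)) = complex_of_nat k} \<in> sets Z"
    by (rule measurable_equality_set[OF m]) simp
  then show ?thesis by (simp only: of_nat_eq_iff)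
qed

lemma ex_mlt: "\<exists>k>0. AE y in Z. J y \<noteq> {} \<longrightarrow> card (J y) = k"
proof -
  define L where "L k = {t. card (J (\<Phi> t)) = k}" for k
  have L: "L k \<in> sets \<mu>" for k
  proof -
    have "L k = \<Phi> -` {y \<in> space Z. card (J y) = k} \<inter> space \<mu>"
      using measurable_space[OF \<Phi>_meas] by (auto simp: L_def space_\<mu>)
    then show ?thesis using measurable_sets[OF \<Phi>_meas card_J_sets] by simp
  qed
  have inv: "AE t in \<mu>. \<sigma> g t \<in> L k \<longleftrightarrow> t \<in> L k" if g: "g \<in> carrier \<Gamma>" for g k
    using AE_G by eventually_elim (simp add: L_def G_facts(5) g card_J_equivariant GY_\<Phi>)
  \<comment> \<open>The level sets are countably many, cover the space and are null or conull by
    ergodicity; they cannot all be null.\<close>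
  have "\<exists>k. AE t in \<mu>. t \<in> L k"
  proof (rule ccontr)
    assume "\<not> (\<exists>k. AE t in \<mu>. t \<in> L k)"
    then have "AE t in \<mu>. t \<notin> L k" for k
      using \<sigma>_erg L[of k] inv[of _ k] unfolding ergodic_action_def by blast
    then have "AE t in \<mu>. \<forall>k. t \<notin> L k" by (simp add: AE_all_countable)
    then have "AE t in \<mu>. False" by (simp add: L_def)
    then show False using GA.PZ.AE_False by blast
  qed
  then obtain k where k: "AE t in \<mu>. card (J (\<Phi> t)) = k" by (auto simp: L_def)
  have fin: "AE t in \<mu>. finite (J (\<Phi> t))"
  proof -
    have "AE t in \<mu>. finite (J (\<phi> (\<iota> t)))" using AE_\<phi>[OF AE_finite_J] by (intro AE_\<iota>) auto
    then show ?thesis using AE_GX by eventually_elim (simp add: \<phi>_\<iota>)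
  qed
  \<comment> \<open>\<open>card\<close> is 0 on infinite sets too, so it takes finiteness of the
    fibre as well as the presence of \<open>t\<close> in it to exclude 0.\<close>
  have "k > 0"
  proof (rule ccontr)
    assume "\<not> k > 0"
    have "AE t in \<mu>. False" using k fin AE_G
    proof eventually_elim
      fix t assume "card (J (\<Phi> t)) = k" "finite (J (\<Phi> t))" and t: "G t"
      then have "J (\<Phi> t) = {}" using \<open>\<not> k > 0\<close> by simp
      then show False using F_point(1)[OF F_self[OF t]] by simp
    qed
    then show False using GA.PZ.AE_False by blast
  qed
  \<comment> \<open>From \<open>X\<close> to \<open>Z\<close>: a base point with a label
    \<open>h\<close> is the image under \<open>\<Phi>\<close> of the point
    \<open>\<pi> (T h y)\<close>, where the count is known.\<close>
  moreover have "AE y in Z. J y \<noteq> {} \<longrightarrow> card (J y) = k"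
  proof -
    have "AE y in Z. \<forall>h\<in>carrier \<Lambda>. T h y \<in> S \<longrightarrow> card (J (\<Phi> (\<pi> (T h y)))) = k"
      by (rule AE_T[OF AE_\<pi>[OF k]])
    then show ?thesis using AE_GY
    proof eventually_elim
      fix y assume a: "\<forall>h\<in>carrier \<Lambda>. T h y \<in> S \<longrightarrow> card (J (\<Phi> (\<pi> (T h y)))) = k" and y: "GY y"
      show "J y \<noteq> {} \<longrightarrow> card (J y) = k"
      proof
        assume "J y \<noteq> {}"
        then obtain h where h: "h \<in> J y" by blast
        then have "\<Phi> (\<pi> (T h y)) = y" using J_point(1)[OF y h] by (simp add: F_def)
        then show "card (J y) = k" using a h by (auto simp: J_def)
      qed
    qed
  qed
  ultimately show ?thesis by blast
qed

text \<open>The common fibre size as a term of the context, so that \<open>regular_section\<close>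
  can be interpreted with it.\<close>

definition mlt :: nat where "mlt = (SOME k. k > 0 \<and> (AE y in Z. J y \<noteq> {} \<longrightarrow> card (J y) = k))"

sublocale regular_section \<Lambda> Z T S "\<lambda>z. v (\<pi> z)" mlt
proof -
  have "mlt > 0 \<and> (AE y in Z. J y \<noteq> {} \<longrightarrow> card (J y) = mlt)"
    unfolding mlt_def by (rule someI_ex) (use ex_mlt in blast)
  then show "regular_section \<Lambda> Z T S (\<lambda>z. v (\<pi> z)) mlt"
    by unfold_locales auto
qed

end

text \<open>All summands but the one with \<open>h = c (\<pi> z)\<close> vanish at \<open>z\<close>,
  so the infinite sum reduces to a single term without a summability argument.\<close>

lemma coeff_op_apply:
  assumes "c (\<pi> z) \<in> carrier G"
  shows "coeff_op G T S \<pi> c \<xi> (z, k) =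
    (if z \<in> S then \<xi> (T (inv\<^bsub>G\<^esub> c (\<pi> z)) z, inv\<^bsub>G\<^esub> c (\<pi> z) \<otimes>\<^bsub>G\<^esub> k) else 0)"
proof -
  let ?f = "\<lambda>h. mult_op (transport S \<pi> (indicator {t. c t = h})) (v_op G T h \<xi>) (z, k)"
  have "infsum ?f (carrier G) = infsum ?f {c (\<pi> z)}"
    by (rule infsum_cong_neutral) (use assms in \<open>auto simp: mult_op_def transport_def\<close>)
  then show ?thesis by (simp add: coeff_op_def mult_op_def transport_def v_op_def)
qed

lemma (in group) inv_mult_eq_one: "a \<in> carrier G \<Longrightarrow> k \<in> carrier G \<Longrightarrow> inv a \<otimes> k = \<one> \<longleftrightarrow> k = a"
  by (metis inv_closed inv_inv inv_equality l_inv r_inv inv_unique)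

lemma AE_conull:
  assumes "AE t in M. P t"
  obtains E where "conull M E" "\<And>t. t \<in> E \<Longrightarrow> P t"
proof -
  obtain N where N: "N \<in> sets M" "emeasure M N = 0" "{t \<in> space M. \<not> P t} \<subseteq> N"
    using assms by (auto elim: AE_E)
  have "AE t in M. t \<notin> N" using N by (intro AE_not_in) auto
  then have "AE t in M. t \<in> space M - N" using AE_space by eventually_elim auto
  then have "conull M (space M - N)" using N(1) by (auto simp: conull_def)
  then show thesis using that N(3) by blast
qed

lemma (in near_action) one_vec_L2: "one_vec \<Lambda> \<in> L2 H"
proof -
  interpret C: sigma_finite_measure "count_space (carrier \<Lambda>)" by (rule sigma_finite_count)
  have m: "one_vec \<Lambda> \<in> borel_measurable H"
    by (rule H_measurableI) (simp add: one_vec_def)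
  have "emeasure H (space Z \<times> {\<one>}) = emeasure Z (space Z) * emeasure (count_space (carrier \<Lambda>)) {\<one>}"
    unfolding gms_measure_def by (rule C.emeasure_pair_measure_Times) auto
  also have "\<dots> < \<infinity>" by (simp add: PZ.emeasure_space_1)
  finally have f: "emeasure H (space Z \<times> {\<one>}) < \<infinity>" .
  have s: "space Z \<times> {\<one>} \<in> sets H" unfolding gms_measure_def by auto
  have "integrable H (indicator (space Z \<times> {\<one>}) :: _ \<Rightarrow> real)"
    using f s by (simp add: integrable_indicator_iff)
  also have "?this \<longleftrightarrow> integrable H (\<lambda>x. (cmod (one_vec \<Lambda> x))\<^sup>2)"
    by (rule Bochner_Integration.integrable_cong) (auto simp: space_H one_vec_def indicator_def split: if_splits)
  finally show ?thesis using m by (simp add: L2_def)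
qed

section \<open>The intertwining relation and the isomorphism\<close>

context oe_cocycle
begin

lemma bop_coeff: "coeff_op \<Lambda> T S \<pi> v = bop"
  by (auto simp: fun_eq_iff coeff_op_apply v_closed bop_def \<phi>_def)

definition u :: "'g \<Rightarrow> ('z \<times> 'h) oper" where "u g = coeff_op \<Lambda> T S \<pi> (\<lambda>t. w t g)"

lemma u_apply: "u g \<xi> (z, k) = (if z \<in> S then \<xi> (T (inv (w (\<pi> z) g)) z, inv (w (\<pi> z) g) \<otimes> k) else 0)"
  unfolding u_def by (rule coeff_op_apply) (rule w_closed)

lemma bv_L2: "coeff_op \<Lambda> T S \<pi> v (one_vec \<Lambda>) \<in> L2 H"
  unfolding bop_coeff by (rule bop_L2(1)[OF one_vec_L2])

lemma S_point:
  assumes "GY z" "z \<in> S"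
  shows "G (\<pi> z)" "\<iota> (\<pi> z) = z" "\<phi> z = \<Phi> (\<pi> z)"
proof -
  have "T \<one> z = z" using assms good_one GY_good by blast
  then have a: "\<iota> (\<pi> z) = z" "GX1 (\<pi> z)" using assms L.one_closed unfolding GY_def by metis+
  then show "G (\<pi> z)" "\<iota> (\<pi> z) = z" using assms by (auto simp: G_def)
  then show "\<phi> z = \<Phi> (\<pi> z)" using \<phi>_\<iota>[OF G_GX, of "\<pi> z"] by simp
qed

text \<open>Above a point \<open>s\<close> both sides are the indicator of one group element:
  \<open>w s g\<close> times the value of \<open>v\<close> at the translate on the left, and
  \<open>v s\<close> times \<open>\<delta> g\<close> on the right. The cocycle identity says that
  these elements agree.\<close>

lemma u_bv:
  assumes g: "g \<in> carrier \<Gamma>"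
  shows "ae_eq H (u g (coeff_op \<Lambda> T S \<pi> v (one_vec \<Lambda>))) (right_v \<Lambda> (\<delta> g) (coeff_op \<Lambda> T S \<pi> v (one_vec \<Lambda>)))"
  unfolding bop_coeff
proof (rule ae_eq_HI)
  show "AE z in Z. \<forall>k\<in>carrier \<Lambda>. u g (bop (one_vec \<Lambda>)) (z, k) = right_v \<Lambda> (\<delta> g) (bop (one_vec \<Lambda>)) (z, k)"
    using AE_GY
  proof eventually_elim
    fix z assume z: "GY z"
    show "\<forall>k\<in>carrier \<Lambda>. u g (bop (one_vec \<Lambda>)) (z, k) = right_v \<Lambda> (\<delta> g) (bop (one_vec \<Lambda>)) (z, k)"
    proof (cases "z \<in> S")
      case True
      define s where "s = \<pi> z"
      define s' where "s' = \<sigma> (inv\<^bsub>\<Gamma>\<^esub> g) s"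
      have s: "G s" "\<iota> s = z" using S_point[OF z True] by (auto simp: s_def)
      have s': "G s'" using G_\<sigma>[OF s(1)] g by (simp add: s'_def)
      have wz: "T (inv (w s g)) z = \<iota> s'" using G_facts(6)[OF s(1) g] s by (simp add: s'_def)
      have wv: "w s g \<otimes> v s' = v s \<otimes> \<delta> g" using G_facts(7)[OF s(1) g] by (simp add: s'_def)
      show ?thesis
      proof
        fix k assume k: "k \<in> carrier \<Lambda>"
        have "u g (bop (one_vec \<Lambda>)) (z, k) = (if inv (v s') \<otimes> (inv (w s g) \<otimes> k) = \<one> then 1 else 0)"
          using True G_facts(1,2)[OF s'] by (simp add: u_apply s_def[symmetric] wz bop_def one_vec_def)
        moreover have "inv (v s') \<otimes> (inv (w s g) \<otimes> k) = \<one> \<longleftrightarrow> k = w s g \<otimes> v s'"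
          using L.inv_mult_eq_one[of "w s g \<otimes> v s'" k] k
          by (simp add: v_closed w_closed L.inv_mult_group L.m_assoc)
        moreover have "right_v \<Lambda> (\<delta> g) (bop (one_vec \<Lambda>)) (z, k) = (if inv (v s) \<otimes> (k \<otimes> inv (\<delta> g)) = \<one> then 1 else 0)"
          using True by (simp add: right_v_def bop_def one_vec_def s_def)
        moreover have "inv (v s) \<otimes> (k \<otimes> inv (\<delta> g)) = \<one> \<longleftrightarrow> k = v s \<otimes> \<delta> g"
        proof -
          have "inv (v s) \<otimes> (k \<otimes> inv (\<delta> g)) = \<one> \<longleftrightarrow> k \<otimes> inv (\<delta> g) = v s"
            using L.inv_mult_eq_one[of "v s" "k \<otimes> inv (\<delta> g)"] k g by (simp add: v_closed \<delta>_closed)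
          also have "\<dots> \<longleftrightarrow> k = v s \<otimes> \<delta> g"
            using L.inv_solve_right'[of "v s" k "\<delta> g"] k g by (auto simp: v_closed \<delta>_closed)
          finally show ?thesis .
        qed
        ultimately show "u g (bop (one_vec \<Lambda>)) (z, k) = right_v \<Lambda> (\<delta> g) (bop (one_vec \<Lambda>)) (z, k)"
          using wv by simp
      qed
    qed (simp add: u_apply right_v_def bop_def)
  qed
qed

text \<open>The average of \<open>a\<close> over the fibre of \<open>\<Phi>\<close> above
  \<open>y\<close>; for functions constant on fibres it is descent to the image.\<close>

definition \<alpha> :: "('x \<Rightarrow> complex) \<Rightarrow> 'z \<Rightarrow> complex" where
  "\<alpha> a y = (1 / of_nat mlt) * (\<Sum>h\<in>J y. a (\<pi> (T h y)))"

lemma transport_Linf: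
  assumes a: "a \<in> Linf \<mu>"
  shows "transport S \<pi> a \<in> Linf Z"
proof -
  obtain C where C: "C \<ge> 0" "AE t in \<mu>. cmod (a t) \<le> C" by (rule Linf_bound[OF a])
  have "AE z in Z. z \<in> S \<longrightarrow> cmod (a (\<pi> z)) \<le> C" by (rule AE_\<pi>[OF C(2)])
  then have b: "AE z in Z. cmod (transport S \<pi> a z) \<le> C"
    by eventually_elim (auto simp: transport_def C)
  have "(\<lambda>z. a (\<pi> z)) \<in> borel_measurable Z" by (rule measurable_compose[OF \<pi>_meas Linf_measurable[OF a]])
  then have "transport S \<pi> a \<in> borel_measurable Z"
    unfolding transport_def[abs_def] using S_meas by (simp add: measurable_If_set)
  then show ?thesis using b by (rule LinfI)
qed

lemma implements_\<alpha>:
  assumes A: "A \<subseteq> Linf \<mu>"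
  shows "implements H bop (1 / of_nat mlt) S \<pi> A \<alpha>"
  unfolding implements_def
proof
  fix a assume "a \<in> A"
  then have "transport S \<pi> a \<in> Linf Z" using A transport_Linf by blast
  from op_eq_scale[OF adjoint_mult_bop[OF this], of "1 / of_nat mlt"]
  have "op_eq H (scale_op (1 / of_nat mlt) (adjoint_op H bop \<circ> mult_op (transport S \<pi> a) \<circ> bop))
    (scale_op (1 / of_nat mlt) (mult_op (\<lambda>y. \<Sum>h\<in>J y. transport S \<pi> a (T h y))))" .
  also have "(\<lambda>y. \<Sum>h\<in>J y. transport S \<pi> a (T h y)) = (\<lambda>y. \<Sum>h\<in>J y. a (\<pi> (T h y)))"
    by (auto simp: transport_def J_def intro!: sum.cong)
  also have "scale_op (1 / of_nat mlt) (mult_op (\<lambda>y. \<Sum>h\<in>J y. a (\<pi> (T h y)))) = (mult_op (\<alpha> a) :: ('z \<times> 'h) oper)"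
    by (auto simp: fun_eq_iff scale_op_def mult_op_def \<alpha>_def)
  finally show "op_eq H (scale_op (1 / of_nat mlt) (adjoint_op H bop \<circ> mult_op (transport S \<pi> a) \<circ> bop)) (mult_op (\<alpha> a))" .
qed

text \<open>Taken on the whole space, so that it is an equivalence relation without exception; that
  its classes are finite and lie in orbits holds only off a null set.\<close>

definition KK :: "('x \<times> 'x) set" where "KK = {(s, t). \<Phi> s = \<Phi> t}"

lemma AE_\<Phi>:
  assumes "AE y in Z. P y"
  shows "AE t in \<mu>. P (\<Phi> t)"
proof -
  have "AE t in \<mu>. P (\<phi> (\<iota> t))" using AE_\<phi>[OF assms] by (intro AE_\<iota>) auto
  then show ?thesis using AE_GX by eventually_elim (simp add: \<phi>_\<iota>)
qed

text \<open>Each point of the fibre is \<open>\<pi> (T h y)\<close> for a label \<open>h\<close>, so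
  controlling all translates of \<open>y\<close> at once controls the whole fibre.\<close>

lemma AE_fiber:
  assumes "AE t in \<mu>. P t"
  shows "AE y in Z. \<forall>s\<in>F y. P s"
  using AE_T[OF AE_\<pi>[OF assms]]
proof eventually_elim
  fix y assume a: "\<forall>h\<in>carrier \<Lambda>. T h y \<in> S \<longrightarrow> P (\<pi> (T h y))"
  show "\<forall>s\<in>F y. P s"
  proof
    fix s assume s: "s \<in> F y"
    then show "P s" using a F_point[OF s] by (auto simp: J_def)
  qed
qed

lemma AE_all: "AE y in Z. GY y \<and> finite (J y) \<and> (J y \<noteq> {} \<longrightarrow> card (J y) = mlt)"
  using AE_GY AE_reg by eventually_elim simp

lemma J_F_empty: "GY y \<Longrightarrow> J y = {} \<longleftrightarrow> F y = {}"
  using J_point(1) F_point(1) by blast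

abbreviation AK :: "('x \<Rightarrow> complex) set" where "AK \<equiv> rel_fixed_alg \<mu> KK"

lemma AK_Linf: "a \<in> AK \<Longrightarrow> a \<in> Linf \<mu>"
  by (simp add: rel_fixed_alg_def)

text \<open>Membership in \<open>AK\<close> gives constancy on classes inside a conull set. For
  almost every \<open>y\<close> the whole fibre lies in that set, and averaging equal values over
  its \<open>mlt\<close> points returns them.\<close>

lemma AK_value:
  assumes a: "a \<in> AK"
  shows "AE y in Z. (\<forall>s\<in>F y. a s = \<alpha> a y) \<and> (J y = {} \<longrightarrow> \<alpha> a y = 0)"
proof -
  obtain E where E: "conull \<mu> E" "\<forall>(s, t)\<in>restrict_rel KK E. a s = a t"
    using a by (auto simp: rel_fixed_alg_def)
  have "AE y in Z. \<forall>s\<in>F y. s \<in> E" using E(1) by (intro AE_fiber) (simp add: conull_def)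
  then show ?thesis using AE_all
  proof eventually_elim
    fix y assume sE: "\<forall>s\<in>F y. s \<in> E" and y: "GY y \<and> finite (J y) \<and> (J y \<noteq> {} \<longrightarrow> card (J y) = mlt)"
    have eq: "a s = a t" if "s \<in> F y" "t \<in> F y" for s t
    proof -
      have "(s, t) \<in> restrict_rel KK E" using that sE by (simp add: restrict_rel_def KK_def F_def)
      then show ?thesis using E(2) by blast
    qed
    have "a s = \<alpha> a y" if s: "s \<in> F y" for s
    proof -
      have "(\<Sum>h\<in>J y. a (\<pi> (T h y))) = (\<Sum>h\<in>J y. a s)"
        using J_point(1) y by (intro sum.cong refl eq s) auto
      also have "\<dots> = of_nat mlt * a s" using y F_point(1)[OF s] by auto
      finally show ?thesis using m_pos by (simp add: \<alpha>_def)
    qed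
    then show "(\<forall>s\<in>F y. a s = \<alpha> a y) \<and> (J y = {} \<longrightarrow> \<alpha> a y = 0)" by (simp add: \<alpha>_def)
  qed
qed

lemma AK_\<alpha>_\<Phi>:
  assumes a: "a \<in> AK"
  shows "AE t in \<mu>. \<alpha> a (\<Phi> t) = a t"
  using AE_\<Phi>[OF AK_value[OF a]] AE_G by eventually_elim (auto dest: F_self)

lemma \<alpha>_measurable: "a \<in> borel_measurable \<mu> \<Longrightarrow> \<alpha> a \<in> borel_measurable Z"
  unfolding \<alpha>_def[abs_def]
  by (intro borel_measurable_times borel_measurable_const sum_J_measurable)
     (rule measurable_compose[OF T_meas measurable_compose[OF \<pi>_meas]])

lemma J_eq_E: "GY y \<Longrightarrow> J y \<noteq> {} \<longleftrightarrow> y \<in> E"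
  by (auto simp: E_def GY_def good_def)

lemma \<alpha>_corner:
  assumes a: "a \<in> AK"
  shows "\<alpha> a \<in> corner Z E"
proof -
  obtain C where C: "C \<ge> 0" "AE t in \<mu>. cmod (a t) \<le> C" by (rule Linf_bound[OF AK_Linf[OF a]])
  have "AE y in Z. cmod (\<alpha> a y) \<le> C"
    using AE_fiber[OF C(2)] AK_value[OF a] AE_GY
  proof eventually_elim
    fix y assume *: "\<forall>s\<in>F y. cmod (a s) \<le> C" "(\<forall>s\<in>F y. a s = \<alpha> a y) \<and> (J y = {} \<longrightarrow> \<alpha> a y = 0)" "GY y"
    show "cmod (\<alpha> a y) \<le> C"
    proof (cases "J y = {}")
      case False
      then obtain s where "s \<in> F y" using J_F_empty[OF *(3)] by blast
      then show ?thesis using * by metis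
    qed (use * C in simp)
  qed
  then have "\<alpha> a \<in> Linf Z" using \<alpha>_measurable Linf_measurable[OF AK_Linf[OF a]] by (intro LinfI)
  moreover have "ae_eq Z (\<lambda>z. \<alpha> a z * indicator E z) (\<alpha> a)"
    unfolding ae_eq_def using AK_value[OF a] AE_GY
    by eventually_elim (use J_eq_E in \<open>auto simp: indicator_def\<close>)
  ultimately show ?thesis by (simp add: corner_def)
qed

lemma conull_UNIV: "conull \<mu> UNIV"
  using sets.top[of \<mu>] by (simp add: conull_def space_\<mu>)

text \<open>Composition with \<open>\<Phi>\<close> is the inverse of \<open>\<alpha>\<close>, and
  this shows that it lands in the right algebra.\<close>

lemma comp_\<Phi>_AK:
  assumes f: "f \<in> Linf Z"
  shows "(\<lambda>t. f (\<Phi> t)) \<in> AK"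
proof -
  obtain C where C: "AE y in Z. cmod (f y) \<le> C" using Linf_bound[OF f] by metis
  have "(\<lambda>t. f (\<Phi> t)) \<in> Linf \<mu>"
    by (rule LinfI[OF measurable_compose[OF \<Phi>_meas Linf_measurable[OF f]] AE_\<Phi>[OF C]])
  then show ?thesis
    using conull_UNIV by (auto simp: rel_fixed_alg_def restrict_rel_def KK_def intro!: exI[of _ UNIV])
qed

lemma \<alpha>_comp_\<Phi>:
  assumes f: "f \<in> corner Z E"
  shows "ae_eq Z (\<alpha> (\<lambda>t. f (\<Phi> t))) f"
proof -
  have "ae_eq Z (\<lambda>z. f z * indicator E z) f" using f by (simp add: corner_def)
  then show ?thesis
    unfolding ae_eq_def using AE_all
  proof eventually_elim
    fix y assume e: "f y * indicator E y = f y" and y: "GY y \<and> finite (J y) \<and> (J y \<noteq> {} \<longrightarrow> card (J y) = mlt)"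
    have "(\<Sum>h\<in>J y. f (\<Phi> (\<pi> (T h y)))) = (\<Sum>h\<in>J y. f y)"
      using J_point(1) y by (intro sum.cong refl) (auto simp: F_def)
    also have "\<dots> = of_nat mlt * f y"
      using y e J_eq_E[of y] by (cases "J y = {}") (auto simp: indicator_def)
    finally show "\<alpha> (\<lambda>t. f (\<Phi> t)) y = f y" using m_pos by (simp add: \<alpha>_def)
  qed
qed

text \<open>Linearity and compatibility with conjugation hold for every average. Multiplicativity
  and injectivity rest on \<open>AK_value\<close>, surjectivity on composition with
  \<open>\<Phi>\<close>.\<close>

lemma \<alpha>_alg_iso: "alg_iso \<mu> AK Z (corner Z E) \<alpha>"
  unfolding alg_iso_def
proof (intro conjI ballI allI)
  fix a assume a: "a \<in> AK"
  show "\<alpha> a \<in> corner Z E" by (rule \<alpha>_corner[OF a])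
  show "ae_eq Z (\<alpha> (\<lambda>t. cnj (a t))) (\<lambda>z. cnj (\<alpha> a z))"
    by (simp add: \<alpha>_def[abs_def] ae_eq_refl)
  fix a' assume a': "a' \<in> AK"
  show "ae_eq \<mu> a a' \<longleftrightarrow> ae_eq Z (\<alpha> a) (\<alpha> a')"
  proof
    assume "ae_eq \<mu> a a'"
    then have "AE t in \<mu>. a t = a' t" by (simp add: ae_eq_def)
    from AE_fiber[OF this] AE_GY show "ae_eq Z (\<alpha> a) (\<alpha> a')"
      unfolding ae_eq_def by eventually_elim (auto simp: \<alpha>_def J_point(1) intro!: sum.cong)
  next
    assume "ae_eq Z (\<alpha> a) (\<alpha> a')"
    then have "AE t in \<mu>. \<alpha> a (\<Phi> t) = \<alpha> a' (\<Phi> t)" unfolding ae_eq_def by (rule AE_\<Phi>)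
    then show "ae_eq \<mu> a a'"
      unfolding ae_eq_def using AK_\<alpha>_\<Phi>[OF a] AK_\<alpha>_\<Phi>[OF a'] by eventually_elim simp
  qed
  show "ae_eq Z (\<alpha> (\<lambda>t. c * a t + a' t)) (\<lambda>z. c * \<alpha> a z + \<alpha> a' z)" for c
  proof -
    have "\<alpha> (\<lambda>t. c * a t + a' t) = (\<lambda>z. c * \<alpha> a z + \<alpha> a' z)"
      by (simp add: fun_eq_iff \<alpha>_def sum.distrib add_divide_distrib flip: sum_distrib_left)
    then show ?thesis by (simp add: ae_eq_refl)
  qed
  show "ae_eq Z (\<alpha> (\<lambda>t. a t * a' t)) (\<lambda>z. \<alpha> a z * \<alpha> a' z)"
    unfolding ae_eq_def using AK_value[OF a] AK_value[OF a'] AE_all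
  proof eventually_elim
    fix y assume *: "(\<forall>s\<in>F y. a s = \<alpha> a y) \<and> (J y = {} \<longrightarrow> \<alpha> a y = 0)"
      "(\<forall>s\<in>F y. a' s = \<alpha> a' y) \<and> (J y = {} \<longrightarrow> \<alpha> a' y = 0)"
      and y: "GY y \<and> finite (J y) \<and> (J y \<noteq> {} \<longrightarrow> card (J y) = mlt)"
    have "(\<Sum>h\<in>J y. a (\<pi> (T h y)) * a' (\<pi> (T h y))) = (\<Sum>h\<in>J y. \<alpha> a y * \<alpha> a' y)"
      using * J_point(1) y by (intro sum.cong refl) auto
    also have "\<dots> = of_nat mlt * (\<alpha> a y * \<alpha> a' y)"
      using y * by (cases "J y = {}") auto
    finally show "\<alpha> (\<lambda>t. a t * a' t) y = \<alpha> a y * \<alpha> a' y" using m_pos by (simp add: \<alpha>_def[of "\<lambda>t. a t * a' t"])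
  qed
next
  fix f assume f: "f \<in> corner Z E"
  then have "f \<in> Linf Z" by (simp add: corner_def)
  then show "\<exists>a\<in>AK. ae_eq Z (\<alpha> a) f"
    using comp_\<Phi>_AK \<alpha>_comp_\<Phi>[OF f] by blast
qed

section \<open>Equivariance and the quotient by the kernel\<close>

lemma koopman_AK:
  assumes a: "a \<in> AK" and g: "g \<in> carrier \<Gamma>"
  shows "koopman \<Gamma> \<sigma> g a \<in> AK"
proof -
  have ig: "inv\<^bsub>\<Gamma>\<^esub> g \<in> carrier \<Gamma>" using g by simp
  obtain C where C: "AE t in \<mu>. cmod (a t) \<le> C" using Linf_bound[OF AK_Linf[OF a]] by metis
  have "AE t in \<mu>. cmod (koopman \<Gamma> \<sigma> g a t) \<le> C"
    using GA.AE_T[OF C] by eventually_elim (simp add: koopman_def ig)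
  moreover have "koopman \<Gamma> \<sigma> g a \<in> borel_measurable \<mu>"
    unfolding koopman_def by (rule measurable_compose[OF GA.T_meas[OF ig] Linf_measurable[OF AK_Linf[OF a]]])
  ultimately have 1: "koopman \<Gamma> \<sigma> g a \<in> Linf \<mu>" by (intro LinfI)
  obtain E where E: "conull \<mu> E" "\<forall>(s, t)\<in>restrict_rel KK E. a s = a t"
    using a by (auto simp: rel_fixed_alg_def)
  have "AE t in \<mu>. t \<in> E" using E(1) by (simp add: conull_def)
  then have "AE t in \<mu>. G t \<and> \<sigma> (inv\<^bsub>\<Gamma>\<^esub> g) t \<in> E"
    using GA.AE_T[of "\<lambda>t. t \<in> E"] AE_G by (auto simp: ig elim: AE_mp)
  then obtain E' where E': "conull \<mu> E'" "\<And>t. t \<in> E' \<Longrightarrow> G t \<and> \<sigma> (inv\<^bsub>\<Gamma>\<^esub> g) t \<in> E" by (rule AE_conull) blast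
  have "koopman \<Gamma> \<sigma> g a s = koopman \<Gamma> \<sigma> g a t" if "(s, t) \<in> restrict_rel KK E'" for s t
  proof -
    have "(\<sigma> (inv\<^bsub>\<Gamma>\<^esub> g) s, \<sigma> (inv\<^bsub>\<Gamma>\<^esub> g) t) \<in> restrict_rel KK E"
      using that E'(2) G_facts(5)[OF _ ig] by (auto simp: restrict_rel_def KK_def)
    then show ?thesis using E(2) unfolding koopman_def by blast
  qed
  then show ?thesis using 1 E'(1) by (auto simp: rel_fixed_alg_def)
qed

text \<open>Translation by the inverse of \<open>g\<close> carries the fibre over \<open>y\<close>
  onto the fibre over the corresponding translate of \<open>y\<close>, and an element of
  \<open>AK\<close> is read off from a single point of a fibre. Empty fibres correspond as well,
  where both sides are 0.\<close>

lemma \<alpha>_koopman: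
  assumes a: "a \<in> AK" and g: "g \<in> carrier \<Gamma>"
  shows "ae_eq Z (\<alpha> (koopman \<Gamma> \<sigma> g a)) (koopman \<Lambda> T (\<delta> g) (\<alpha> a))"
proof -
  have ig: "inv\<^bsub>\<Gamma>\<^esub> g \<in> carrier \<Gamma>" using g by simp
  show ?thesis
    unfolding ae_eq_def using AK_value[OF koopman_AK[OF a g]] AE_T[OF AK_value[OF a]] AE_GY
  proof eventually_elim
    fix y assume 1: "(\<forall>s\<in>F y. koopman \<Gamma> \<sigma> g a s = \<alpha> (koopman \<Gamma> \<sigma> g a) y) \<and> (J y = {} \<longrightarrow> \<alpha> (koopman \<Gamma> \<sigma> g a) y = 0)"
      and 2: "\<forall>h\<in>carrier \<Lambda>. (\<forall>s\<in>F (T h y). a s = \<alpha> a (T h y)) \<and> (J (T h y) = {} \<longrightarrow> \<alpha> a (T h y) = 0)"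
      and y: "GY y"
    define y' where "y' = T (\<delta> (inv\<^bsub>\<Gamma>\<^esub> g)) y"
    have F': "F y' = \<sigma> (inv\<^bsub>\<Gamma>\<^esub> g) ` F y" unfolding y'_def by (rule F_equivariant[OF GY_good[OF y] ig])
    have y': "GY y'" unfolding y'_def by (rule GY_T[OF y \<delta>_closed[OF ig]])
    have 3: "(\<forall>s\<in>F y'. a s = \<alpha> a y') \<and> (J y' = {} \<longrightarrow> \<alpha> a y' = 0)"
      using 2 \<delta>_closed[OF ig] by (simp add: y'_def)
    have k: "koopman \<Lambda> T (\<delta> g) (\<alpha> a) y = \<alpha> a y'" by (simp add: koopman_def y'_def \<delta>_inv g)
    show "\<alpha> (koopman \<Gamma> \<sigma> g a) y = koopman \<Lambda> T (\<delta> g) (\<alpha> a) y"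
    proof (cases "J y = {}")
      case True
      then have "J y' = {}" using J_F_empty[OF y] J_F_empty[OF y'] F' by simp
      then show ?thesis using 1 3 True k by simp
    next
      case False
      then obtain s where s: "s \<in> F y" using J_F_empty[OF y] by blast
      then have "\<sigma> (inv\<^bsub>\<Gamma>\<^esub> g) s \<in> F y'" using F' by simp
      then have "a (\<sigma> (inv\<^bsub>\<Gamma>\<^esub> g) s) = \<alpha> a y'" using 3 by blast
      moreover have "koopman \<Gamma> \<sigma> g a s = \<alpha> (koopman \<Gamma> \<sigma> g a) y" using 1 s by blast
      ultimately show ?thesis using k by (simp add: koopman_def)
    qed
  qed
qed

lemma \<alpha>_conjugates: "conjugates \<Gamma> \<Lambda> \<delta> \<sigma> T Z AK \<alpha>"
  by (simp add: conjugates_def koopman_AK \<alpha>_koopman)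

abbreviation K :: "'g set" where "K \<equiv> kernel \<Gamma> \<Lambda> \<delta>"

text \<open>Elements of a coset of the kernel differ by elements sent to the unit, so the image of
  the coset is a singleton.\<close>

lemma the_elem_\<delta>:
  assumes C: "C \<in> carrier (\<Gamma> Mod K)" and g: "g \<in> C"
  shows "g \<in> carrier \<Gamma>" "the_elem (\<delta> ` C) = \<delta> g"
proof -
  obtain g' where g': "g' \<in> carrier \<Gamma>" "C = K #>\<^bsub>\<Gamma>\<^esub> g'"
    using C by (auto simp: FactGroup_def RCOSETS_def)
  have e: "x \<in> carrier \<Gamma> \<and> \<delta> x = \<delta> g'" if "x \<in> C" for x
    using that g' \<delta>_closed[OF g'(1)] by (auto simp: r_coset_def kernel_def \<delta>_mult)
  show "g \<in> carrier \<Gamma>" using e[OF g] by simp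
  have "\<delta> ` C = {\<delta> g}" using e g by force
  then show "the_elem (\<delta> ` C) = \<delta> g" by simp
qed

lemma \<alpha>_quotient_conjugates: "quotient_conjugates \<Gamma> K \<Lambda> (\<lambda>C. the_elem (\<delta> ` C)) \<sigma> T Z AK \<alpha>"
  by (simp add: quotient_conjugates_def the_elem_\<delta> koopman_AK \<alpha>_koopman)

lemma E_invariant:
  assumes "h \<in> \<delta> ` carrier \<Gamma>"
  shows "ae_eq Z (koopman \<Lambda> T h (indicator E)) (indicator E)"
proof -
  obtain g where g: "g \<in> carrier \<Gamma>" "h = \<delta> g" using assms by blast
  have ig: "inv\<^bsub>\<Gamma>\<^esub> g \<in> carrier \<Gamma>" using g by simp
  show ?thesis
    unfolding ae_eq_def using AE_GY
  proof eventually_elim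
    fix y assume y: "GY y"
    have y': "GY (T (\<delta> (inv\<^bsub>\<Gamma>\<^esub> g)) y)" by (rule GY_T[OF y \<delta>_closed[OF ig]])
    have "T (\<delta> (inv\<^bsub>\<Gamma>\<^esub> g)) y \<in> E \<longleftrightarrow> y \<in> E"
      using J_eq_E[OF y] J_eq_E[OF y'] J_F_empty[OF y] J_F_empty[OF y'] F_equivariant[OF GY_good[OF y] ig] by auto
    then show "koopman \<Lambda> T h (indicator E) y = indicator E y"
      by (simp add: koopman_def g \<delta>_inv indicator_def)
  qed
qed

text \<open>Class sizes are counted after restriction to a conull set, and removing a null set may
  cut points out of classes. What is needed is a conull set that contains with each point its whole
  fibre.\<close>

lemma ex_saturated:
  assumes "AE t in \<mu>. P t"
  shows "\<exists>E'. conull \<mu> E' \<and> (\<forall>t\<in>E'. P t \<and> G t \<and> finite (F (\<Phi> t)) \<and> card (F (\<Phi> t)) = mlt) \<and>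
    (\<forall>t\<in>E'. F (\<Phi> t) \<subseteq> E')"
proof -
  have "AE t in \<mu>. P t \<and> G t \<and> finite (F (\<Phi> t)) \<and> card (F (\<Phi> t)) = mlt"
    using assms AE_G AE_\<Phi>[OF AE_all]
  proof eventually_elim
    fix t assume t: "P t" "G t" and y: "GY (\<Phi> t) \<and> finite (J (\<Phi> t)) \<and> (J (\<Phi> t) \<noteq> {} \<longrightarrow> card (J (\<Phi> t)) = mlt)"
    have "J (\<Phi> t) \<noteq> {}" using F_point(1)[OF F_self[OF t(2)]] by blast
    then show "P t \<and> G t \<and> finite (F (\<Phi> t)) \<and> card (F (\<Phi> t)) = mlt"
      using t y card_J_F bij_betw_finite[OF fiber_bij] by metis
  qed
  then obtain E0 where E0: "conull \<mu> E0" "\<And>t. t \<in> E0 \<Longrightarrow> P t \<and> G t \<and> finite (F (\<Phi> t)) \<and> card (F (\<Phi> t)) = mlt"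
    by (rule AE_conull) blast
  have E0s: "E0 \<in> sets \<mu>" and E0a: "AE t in \<mu>. t \<in> E0" using E0(1) by (auto simp: conull_def)
  \<comment> \<open>Base points whose entire fibre survives in \<open>E0\<close>. The fibre is
    tested through labels, which makes this a countable and hence measurable condition.\<close>
  define B where "B = {y \<in> space Z. \<forall>h\<in>carrier \<Lambda>. h \<in> J y \<longrightarrow> \<pi> (T h y) \<in> E0}"
  have "B \<in> sets Z"
    unfolding B_def
  proof (rule sets.sets_Collect_countable_All'[OF _ cnt], rule sets.sets_Collect_imp)
    fix h assume h: "h \<in> carrier \<Lambda>"
    show "{y \<in> space Z. h \<in> J y} \<in> sets Z" by (rule J_sets[OF h])
    have "{y \<in> space Z. \<pi> (T h y) \<in> E0} = (\<lambda>y. \<pi> (T h y)) -` E0 \<inter> space Z" by auto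
    then show "{y \<in> space Z. \<pi> (T h y) \<in> E0} \<in> sets Z"
      using measurable_sets[OF measurable_compose[OF T_meas[OF h] \<pi>_meas] E0s] by simp
  qed
  then have "\<Phi> -` B \<inter> space \<mu> \<in> sets \<mu>" by (rule measurable_sets[OF \<Phi>_meas])
  then have 1: "E0 \<inter> (\<Phi> -` B) \<in> sets \<mu>" using E0s by (simp add: space_\<mu>)
  have "AE y in Z. y \<in> B"
    using AE_fiber[OF E0a] AE_GY
    by eventually_elim (auto simp: B_def J_point(1) GY_def good_def)
  from AE_\<Phi>[OF this] E0a have "AE t in \<mu>. t \<in> E0 \<inter> (\<Phi> -` B)" by eventually_elim simp
  then have c: "conull \<mu> (E0 \<inter> (\<Phi> -` B))" using 1 by (simp add: conull_def)
  have sat: "s \<in> E0 \<inter> (\<Phi> -` B)" if "t \<in> E0 \<inter> (\<Phi> -` B)" and s: "s \<in> F (\<Phi> t)" for t s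
  proof -
    have "\<Phi> t \<in> B" using that by simp
    then have "\<pi> (T (v s) (\<Phi> t)) \<in> E0" using F_point(1)[OF s] by (auto simp: B_def v_closed)
    then show ?thesis using F_point(2)[OF s] that by (auto simp: F_def)
  qed
  show ?thesis
  proof (intro exI[of _ "E0 \<inter> (\<Phi> -` B)"] conjI c ballI subsetI)
    fix t assume "t \<in> E0 \<inter> (\<Phi> -` B)"
    then have "t \<in> E0" by simp
    from E0(2)[OF this] show "P t" "G t" "finite (F (\<Phi> t))" "card (F (\<Phi> t)) = mlt" by blast+
  qed (rule sat)
qed

lemma restrict_KK_F:
  assumes "\<And>t. t \<in> E' \<Longrightarrow> G t" "\<And>t s. t \<in> E' \<Longrightarrow> s \<in> F (\<Phi> t) \<Longrightarrow> s \<in> E'" "t \<in> E'"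
  shows "restrict_rel KK E' `` {t} = F (\<Phi> t)"
proof -
  have "restrict_rel KK E' `` {t} = {s \<in> E'. \<Phi> t = \<Phi> s}"
    using assms(3) by (auto simp: restrict_rel_def KK_def)
  also have "\<dots> = F (\<Phi> t)"
  proof (intro equalityI subsetI)
    fix s assume "s \<in> {s \<in> E'. \<Phi> t = \<Phi> s}"
    then show "s \<in> F (\<Phi> t)" using assms(1)[of s] by (simp add: F_def)
  next
    fix s assume s: "s \<in> F (\<Phi> t)"
    show "s \<in> {s \<in> E'. \<Phi> t = \<Phi> s}" using assms(2)[OF assms(3) s] s by (simp add: F_def)
  qed
  finally show ?thesis .
qed

lemma KK_orbits_have_card: "orbits_have_card \<mu> KK mlt"
proof -
  have "AE t in \<mu>. True" by simp
  from ex_saturated[OF this] obtain E' where E': "conull \<mu> E'"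
    and EP: "\<forall>t\<in>E'. True \<and> G t \<and> finite (F (\<Phi> t)) \<and> card (F (\<Phi> t)) = mlt"
    and sat: "\<forall>t\<in>E'. F (\<Phi> t) \<subseteq> E'" by (elim exE conjE)
  have e: "restrict_rel KK E' `` {t} = F (\<Phi> t)" if "t \<in> E'" for t
    by (rule restrict_KK_F) (use EP sat that in auto)
  show ?thesis
    unfolding orbits_have_card_def
  proof (intro exI[of _ E'] conjI ballI E')
    fix t assume t: "t \<in> E'"
    show "finite (restrict_rel KK E' `` {t})" "card (restrict_rel KK E' `` {t}) = mlt"
      unfolding e[OF t] using EP t by auto
  qed
qed

lemma KK_equiv: "equiv (space \<mu>) KK"
  by (rule equivI) (auto simp: KK_def space_\<mu> refl_on_def sym_def trans_def)

lemma KK_orbit: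
  assumes "G s" "G t" "\<Phi> s = \<Phi> t"
  shows "\<exists>h\<in>carrier \<Lambda>. \<iota> t = T h (\<iota> s)"
proof
  show "v t \<otimes> inv (v s) \<in> carrier \<Lambda>" by (simp add: v_closed)
  show "\<iota> t = T (v t \<otimes> inv (v s)) (\<iota> s)"
    using T_v_\<Phi>[OF assms(2)] good_mult[OF G_facts(3)[OF assms(1)], of "v t" "inv (v s)"] assms(3)
    by (simp add: v_closed \<Phi>_def)
qed

lemma KK_finite_invariant:
  assumes KKm: "KK \<in> sets (\<mu> \<Otimes>\<^sub>M \<mu>)" and R: "AE s in \<mu>. \<forall>t. \<iota> s \<in> S \<and> \<iota> t \<in> S \<and> (\<exists>h\<in>carrier \<Lambda>. \<iota> t = T h (\<iota> s)) \<longrightarrow> (s, t) \<in> R"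
  shows "finite_invariant_subrel \<Gamma> \<mu> \<sigma> R KK"
proof -
  from ex_saturated[OF R] obtain E' where E': "conull \<mu> E'"
    and EP: "\<forall>t\<in>E'. (\<forall>t'. \<iota> t \<in> S \<and> \<iota> t' \<in> S \<and> (\<exists>h\<in>carrier \<Lambda>. \<iota> t' = T h (\<iota> t)) \<longrightarrow> (t, t') \<in> R) \<and>
      G t \<and> finite (F (\<Phi> t)) \<and> card (F (\<Phi> t)) = mlt"
    and sat: "\<forall>t\<in>E'. F (\<Phi> t) \<subseteq> E'" by (elim exE conjE)
  have EG: "G t" if "t \<in> E'" for t using EP that by blast
  have e: "restrict_rel KK E' `` {t} = F (\<Phi> t)" if "t \<in> E'" for t
    by (rule restrict_KK_F) (use EG sat that in auto)
  have "restrict_rel KK E' \<subseteq> R"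
  proof
    fix p assume p: "p \<in> restrict_rel KK E'"
    obtain s t where st: "p = (s, t)" "s \<in> E'" "t \<in> E'" "\<Phi> s = \<Phi> t"
      using p by (auto simp: restrict_rel_def KK_def)
    note g = EG[OF st(2)] EG[OF st(3)]
    from KK_orbit[OF g st(4)] EP st(2) G_facts(1)[OF g(1)] G_facts(1)[OF g(2)]
    show "p \<in> R" unfolding st(1) by blast
  qed
  moreover have "\<forall>t\<in>E'. finite (restrict_rel KK E' `` {t})"
    using EP e by simp
  moreover have "\<forall>g\<in>carrier \<Gamma>. \<forall>(s, t)\<in>restrict_rel KK E'. (\<sigma> g s, \<sigma> g t) \<in> KK"
    using G_facts(5)[OF EG] by (auto simp: restrict_rel_def KK_def)
  ultimately show ?thesis
    unfolding finite_invariant_subrel_def by (intro conjI KKm KK_equiv exI[of _ E'] E')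
qed

lemma RK_subrel: "ae_subrel \<mu> (orbit_rel (\<Gamma>\<lparr>carrier := K\<rparr>) \<sigma>) KK"
proof -
  obtain E' where E': "conull \<mu> E'" "\<And>t. t \<in> E' \<Longrightarrow> G t" by (rule AE_conull[OF AE_G]) blast
  have "restrict_rel (orbit_rel (\<Gamma>\<lparr>carrier := K\<rparr>) \<sigma>) E' \<subseteq> KK"
  proof
    fix p assume "p \<in> restrict_rel (orbit_rel (\<Gamma>\<lparr>carrier := K\<rparr>) \<sigma>) E'"
    then obtain s k where p: "p = (s, \<sigma> k s)" "s \<in> E'" "k \<in> carrier \<Gamma>" "\<delta> k = \<one>"
      by (auto simp: restrict_rel_def orbit_rel_def orbit_def kernel_def)
    have "\<Phi> (\<sigma> k s) = \<Phi> s"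
      using G_facts(5)[OF E'(2)[OF p(2)] p(3)] p(4) good_one[OF GY_good[OF GY_\<Phi>[OF E'(2)[OF p(2)]]]] by simp
    then show "p \<in> KK" by (simp add: p KK_def)
  qed
  then show ?thesis using E'(1) by (auto simp: ae_subrel_def)
qed

end

text \<open>The situation in which points with the same image under \<open>\<Phi>\<close> lie in one
  \<open>\<Gamma>\<close>-orbit. It is met in the local case by \<open>same_orbits\<close>, and in
  the embedding case under the additional hypothesis on invariant subrelations.\<close>

locale oe_cocycle_fibred = oe_cocycle \<Lambda> Z T \<Gamma> \<mu> \<sigma> S \<iota> \<pi> \<delta> v
  for \<Lambda> :: "('h, 'n) monoid_scheme" (structure) and Z :: "'z measure" and T
    and \<Gamma> :: "('g, 'm) monoid_scheme" and \<mu> :: "'x::polish_space measure" and \<sigma> S \<iota> \<pi> \<delta> v +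
  assumes KK_sub: "ae_subrel \<mu> KK (orbit_rel \<Gamma> \<sigma>)"
begin

lemma K_closed: "k \<in> K \<Longrightarrow> k \<in> carrier \<Gamma>" "k \<in> K \<Longrightarrow> \<delta> k = \<one>"
  by (auto simp: kernel_def)

lemma K_inv: "k \<in> K \<Longrightarrow> inv\<^bsub>\<Gamma>\<^esub> k \<in> K"
  by (simp add: kernel_def \<delta>_inv)

text \<open>If \<open>\<sigma> g s\<close> and \<open>s\<close> have the same image
  \<open>y\<close>, equivariance gives \<open>T (\<delta> g) y = y\<close>, and freeness at
  \<open>y\<close> puts \<open>g\<close> into the kernel.\<close>

lemma AE_fiber_orbit: "AE y in Z. \<forall>s\<in>F y. F y = (\<lambda>k. \<sigma> k s) ` K"
proof -
  obtain E' where E': "conull \<mu> E'" "restrict_rel KK E' \<subseteq> orbit_rel \<Gamma> \<sigma>"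
    using KK_sub by (auto simp: ae_subrel_def)
  have "AE y in Z. \<forall>s\<in>F y. s \<in> E'" using E'(1) by (intro AE_fiber) (simp add: conull_def)
  then show ?thesis using AE_GY
  proof eventually_elim
    fix y assume sE: "\<forall>s\<in>F y. s \<in> E'" and y: "GY y"
    show "\<forall>s\<in>F y. F y = (\<lambda>k. \<sigma> k s) ` K"
    proof (intro ballI equalityI subsetI)
      fix s t assume s: "s \<in> F y" and t: "t \<in> F y"
      have "(s, t) \<in> restrict_rel KK E'" using s t sE by (simp add: restrict_rel_def KK_def F_def)
      then have "(s, t) \<in> orbit_rel \<Gamma> \<sigma>" using E'(2) by blast
      then obtain g where g: "g \<in> carrier \<Gamma>" "t = \<sigma> g s" by (auto simp: orbit_rel_def orbit_def)
      have "T (\<delta> g) y = y" using G_facts(5)[of s g] s t g by (auto simp: F_def)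
      then have "\<delta> g = \<one>" using GY_good[OF y] \<delta>_closed[OF g(1)] by (simp add: good_def)
      then show "t \<in> (\<lambda>k. \<sigma> k s) ` K" using g by (auto simp: kernel_def)
    next
      fix s t assume s: "s \<in> F y" and "t \<in> (\<lambda>k. \<sigma> k s) ` K"
      then obtain k where k: "k \<in> K" "t = \<sigma> k s" by blast
      show "t \<in> F y" using F_\<sigma>[OF s K_closed(1)[OF k(1)]] K_closed(2)[OF k(1)] k(2) good_one[OF GY_good[OF y]] by simp
    qed
  qed
qed

lemma orbit_inj:
  assumes "G s"
  shows "inj_on (\<lambda>k. \<sigma> k s) K"
  using GA.good_inj[OF G_facts(4)[OF assms]] by (auto simp: inj_on_def K_closed)

text \<open>Fibres are orbits of the kernel, which acts freely, so the kernel has as many elements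
  as a fibre. The claim does not mention the point, hence it holds once it holds almost
  everywhere.\<close>

lemma K_finite: "finite K" and mlt_card: "mlt = card K"
proof -
  have "AE t in \<mu>. finite K \<and> mlt = card K"
    using AE_G AE_\<Phi>[OF AE_fiber_orbit] AE_\<Phi>[OF AE_all]
  proof eventually_elim
    fix t assume t: "G t" and f: "\<forall>s\<in>F (\<Phi> t). F (\<Phi> t) = (\<lambda>k. \<sigma> k s) ` K"
      and y: "GY (\<Phi> t) \<and> finite (J (\<Phi> t)) \<and> (J (\<Phi> t) \<noteq> {} \<longrightarrow> card (J (\<Phi> t)) = mlt)"
    have e: "F (\<Phi> t) = (\<lambda>k. \<sigma> k t) ` K" using f F_self[OF t] by blast
    have "finite (F (\<Phi> t))" using y bij_betw_finite[OF fiber_bij] by blast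
    then have "finite K" using e finite_imageD[OF _ orbit_inj[OF t]] by simp
    moreover have "J (\<Phi> t) \<noteq> {}" using F_point(1)[OF F_self[OF t]] by blast
    then have "mlt = card K"
      using y card_J_F[of "\<Phi> t"] e card_image[OF orbit_inj[OF t]] by simp
    ultimately show "finite K \<and> mlt = card K" ..
  qed
  then have "finite K \<and> mlt = card K" by (simp add: GA.PZ.AE_const)
  then show "finite K" "mlt = card K" by auto
qed

lemma KK_sub_RK: "ae_subrel \<mu> KK (orbit_rel (\<Gamma>\<lparr>carrier := K\<rparr>) \<sigma>)"
proof -
  have "AE t in \<mu>. G t \<and> (\<forall>s\<in>F (\<Phi> t). F (\<Phi> t) = (\<lambda>k. \<sigma> k s) ` K)"
    using AE_G AE_\<Phi>[OF AE_fiber_orbit] by eventually_elim simp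
  then obtain E' where E': "conull \<mu> E'"
    "\<And>t. t \<in> E' \<Longrightarrow> G t \<and> (\<forall>s\<in>F (\<Phi> t). F (\<Phi> t) = (\<lambda>k. \<sigma> k s) ` K)" by (rule AE_conull) blast
  have "restrict_rel KK E' \<subseteq> orbit_rel (\<Gamma>\<lparr>carrier := K\<rparr>) \<sigma>"
  proof
    fix p assume "p \<in> restrict_rel KK E'"
    then obtain s t where p: "p = (s, t)" "s \<in> E'" "t \<in> E'" "\<Phi> s = \<Phi> t"
      by (auto simp: restrict_rel_def KK_def)
    have "t \<in> F (\<Phi> s)" "s \<in> F (\<Phi> s)" using p E'(2) by (auto simp: F_def)
    then have "t \<in> (\<lambda>k. \<sigma> k s) ` K" using E'(2)[OF p(2)] by blast
    then show "p \<in> orbit_rel (\<Gamma>\<lparr>carrier := K\<rparr>) \<sigma>" using p by (auto simp: orbit_rel_def orbit_def)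
  qed
  then show ?thesis using E'(1) by (auto simp: ae_subrel_def)
qed

text \<open>One inclusion merges the null sets of the countably many elements of the kernel into
  one. In the other, \<open>AK_value\<close> compares \<open>t\<close> with its translate, both in
  the same fibre.\<close>

lemma fixed_alg_eq: "fixed_alg \<Gamma> \<mu> \<sigma> K = AK"
proof
  have cK: "countable K" using GA.cnt by (rule countable_subset[rotated]) (auto simp: kernel_def)
  show "fixed_alg \<Gamma> \<mu> \<sigma> K \<subseteq> AK"
  proof
    fix a assume a: "a \<in> fixed_alg \<Gamma> \<mu> \<sigma> K"
    have "AE t in \<mu>. a (\<sigma> (inv\<^bsub>\<Gamma>\<^esub> k) t) = a t" if "k \<in> K" for k
      using a that by (auto simp: fixed_alg_def ae_eq_def koopman_def)
    then have "AE t in \<mu>. \<forall>k\<in>K. a (\<sigma> (inv\<^bsub>\<Gamma>\<^esub> k) t) = a t" using cK by (simp add: AE_ball_countable)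
    then have "AE t in \<mu>. \<forall>k\<in>K. a (\<sigma> k t) = a t"
    proof eventually_elim
      fix t assume *: "\<forall>k\<in>K. a (\<sigma> (inv\<^bsub>\<Gamma>\<^esub> k) t) = a t"
      show "\<forall>k\<in>K. a (\<sigma> k t) = a t"
      proof
        fix k assume "k \<in> K"
        then show "a (\<sigma> k t) = a t" using *[rule_format, OF K_inv] K_closed by simp
      qed
    qed
    then obtain E1 where E1: "conull \<mu> E1" "\<And>t. t \<in> E1 \<Longrightarrow> \<forall>k\<in>K. a (\<sigma> k t) = a t" by (rule AE_conull) blast
    obtain E2 where E2: "conull \<mu> E2" "restrict_rel KK E2 \<subseteq> orbit_rel (\<Gamma>\<lparr>carrier := K\<rparr>) \<sigma>"
      using KK_sub_RK by (auto simp: ae_subrel_def)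
    have "conull \<mu> (E1 \<inter> E2)" using E1(1) E2(1) by (auto simp: conull_def)
    moreover have "a s = a t" if st: "(s, t) \<in> restrict_rel KK (E1 \<inter> E2)" for s t
    proof -
      have "(s, t) \<in> orbit_rel (\<Gamma>\<lparr>carrier := K\<rparr>) \<sigma>" using st E2(2) by (auto simp: restrict_rel_def)
      then obtain k where "k \<in> K" "t = \<sigma> k s" by (auto simp: orbit_rel_def orbit_def)
      then show ?thesis using E1(2)[of s] st by (auto simp: restrict_rel_def)
    qed
    moreover have "a \<in> Linf \<mu>" using a by (simp add: fixed_alg_def)
    ultimately show "a \<in> AK" by (auto simp: rel_fixed_alg_def)
  qed
  show "AK \<subseteq> fixed_alg \<Gamma> \<mu> \<sigma> K"
  proof
    fix a assume a: "a \<in> AK"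
    have "ae_eq \<mu> (koopman \<Gamma> \<sigma> k a) a" if k: "k \<in> K" for k
      unfolding ae_eq_def using AE_\<Phi>[OF AK_value[OF a]] AE_\<Phi>[OF AE_fiber_orbit] AE_G
    proof eventually_elim
      fix t assume v: "(\<forall>s\<in>F (\<Phi> t). a s = \<alpha> a (\<Phi> t)) \<and> (J (\<Phi> t) = {} \<longrightarrow> \<alpha> a (\<Phi> t) = 0)"
        and f: "\<forall>s\<in>F (\<Phi> t). F (\<Phi> t) = (\<lambda>k. \<sigma> k s) ` K" and t: "G t"
      have "\<sigma> (inv\<^bsub>\<Gamma>\<^esub> k) t \<in> F (\<Phi> t)" using f F_self[OF t] K_inv[OF k] by blast
      then show "koopman \<Gamma> \<sigma> k a t = a t" using v F_self[OF t] by (simp add: koopman_def)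
    qed
    then show "a \<in> fixed_alg \<Gamma> \<mu> \<sigma> K" using AK_Linf[OF a] by (simp add: fixed_alg_def)
  qed
qed

text \<open>Above \<open>z\<close> the composition sums over the fibre containing the point of
  \<open>X\<close> at \<open>z\<close>. That fibre is parametrised both by labels, as in
  \<open>badj\<close>, and by the kernel, as in the sum of the \<open>u k\<close>; the proof changes
  from one parametrisation to the other.\<close>

lemma bop_adjoint: "op_eq H (bop \<circ> adjoint_op H bop) (\<lambda>\<xi> x. \<Sum>k\<in>K. u k \<xi> x)"
proof -
  have "op_eq H (bop \<circ> adjoint_op H bop) (bop \<circ> badj)"
    by (rule op_eq_comp_left[OF badj_op_eq bop_bounded])
       (intro bounded_op_preserves adjoint_bounded badj_bounded)+
  moreover have "op_eq H (bop \<circ> badj) (\<lambda>\<xi> x. \<Sum>k\<in>K. u k \<xi> x)"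
    unfolding op_eq_def
  proof (intro ballI ae_eq_HI)
    fix \<xi> :: "'z \<times> 'h \<Rightarrow> complex"
    show "AE z in Z. \<forall>l\<in>carrier \<Lambda>. (bop \<circ> badj) \<xi> (z, l) = (\<Sum>k\<in>K. u k \<xi> (z, l))"
      using AE_GY AE_\<phi>[OF AE_fiber_orbit]
    proof eventually_elim
      fix z assume z: "GY z" and f: "\<forall>s\<in>F (\<phi> z). F (\<phi> z) = (\<lambda>k. \<sigma> k s) ` K"
      show "\<forall>l\<in>carrier \<Lambda>. (bop \<circ> badj) \<xi> (z, l) = (\<Sum>k\<in>K. u k \<xi> (z, l))"
      proof (cases "z \<in> S")
        case True
        define s where "s = \<pi> z"
        have s: "G s" "\<iota> s = z" "\<phi> z = \<Phi> s" using S_point[OF z True] by (auto simp: s_def)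
        have orb: "F (\<Phi> s) = (\<lambda>k. \<sigma> k s) ` K" using f s F_self[OF s(1)] by simp
        \<comment> \<open>The operator \<open>u k\<close> looks at the translate by the inverse of
          \<open>k\<close>, so the kernel is traversed through inverses.\<close>
        have orb': "F (\<Phi> s) = (\<lambda>k. \<sigma> (inv\<^bsub>\<Gamma>\<^esub> k) s) ` K"
        proof -
          have "(\<lambda>k. inv\<^bsub>\<Gamma>\<^esub> k) ` K = K"
          proof (intro equalityI subsetI)
            fix k assume "k \<in> K"
            then show "k \<in> (\<lambda>k. inv\<^bsub>\<Gamma>\<^esub> k) ` K"
              using K_inv[of k] K_closed(1)[of k] by (intro image_eqI[of _ _ "inv\<^bsub>\<Gamma>\<^esub> k"]) auto
          qed (auto simp: K_inv)
          then show ?thesis using orb image_image[of "\<lambda>k. \<sigma> k s" "\<lambda>k. inv\<^bsub>\<Gamma>\<^esub> k" K] by simp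
        qed
        have inj: "inj_on (\<lambda>k. \<sigma> (inv\<^bsub>\<Gamma>\<^esub> k) s) K"
        proof (rule inj_onI)
          fix k l assume k: "k \<in> K" and l: "l \<in> K" and e: "\<sigma> (inv\<^bsub>\<Gamma>\<^esub> k) s = \<sigma> (inv\<^bsub>\<Gamma>\<^esub> l) s"
          have "inv\<^bsub>\<Gamma>\<^esub> k = inv\<^bsub>\<Gamma>\<^esub> l"
            using inj_onD[OF orbit_inj[OF s(1)] e] K_inv k l by blast
          then show "k = l" using K_closed(1) k l by (metis GA.L.inv_inv)
        qed
        have b1: "bij_betw (\<lambda>k. \<sigma> (inv\<^bsub>\<Gamma>\<^esub> k) s) K (F (\<Phi> s))"
          using inj orb' by (simp add: bij_betw_def)
        have b2: "bij_betw (\<lambda>h. \<pi> (T h (\<Phi> s))) (J (\<Phi> s)) (F (\<Phi> s))" by (rule fiber_bij[OF GY_\<Phi>[OF s(1)]])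
        show ?thesis
        proof
          fix l assume l: "l \<in> carrier \<Lambda>"
          define f where "f t = \<xi> (\<iota> t, v t \<otimes> (inv (v s) \<otimes> l))" for t
          have "(bop \<circ> badj) \<xi> (z, l) = (\<Sum>h\<in>J (\<Phi> s). \<xi> (T h (\<Phi> s), h \<otimes> (inv (v s) \<otimes> l)))"
            using True by (simp add: bop_def badj_def s(3) s_def)
          also have "\<dots> = (\<Sum>h\<in>J (\<Phi> s). f (\<pi> (T h (\<Phi> s))))"
            using J_point(2,3)[OF GY_\<Phi>[OF s(1)]] by (simp add: f_def)
          also have "\<dots> = (\<Sum>t\<in>F (\<Phi> s). f t)" by (rule sum.reindex_bij_betw[OF b2])
          also have "\<dots> = (\<Sum>k\<in>K. f (\<sigma> (inv\<^bsub>\<Gamma>\<^esub> k) s))" by (rule sum.reindex_bij_betw[OF b1, symmetric])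
          also have "\<dots> = (\<Sum>k\<in>K. u k \<xi> (z, l))"
          proof (rule sum.cong[OF refl])
            fix k assume k: "k \<in> K"
            define s' where "s' = \<sigma> (inv\<^bsub>\<Gamma>\<^esub> k) s"
            have "T (inv (w s k)) z = \<iota> s'" using G_facts(6)[OF s(1) K_closed(1)[OF k]] s by (simp add: s'_def)
            \<comment> \<open>The cocycle identity with \<open>\<delta> k\<close> equal to the
              unit.\<close>
            moreover have "w s k \<otimes> v s' = v s"
              using G_facts(7)[OF s(1) K_closed(1)[OF k]] K_closed(2)[OF k] by (simp add: s'_def v_closed)
            then have "inv (w s k) = v s' \<otimes> inv (v s)"
              by (metis L.inv_solve_right L.inv_solve_left L.inv_closed L.m_closed v_closed w_closed)
            ultimately show "f (\<sigma> (inv\<^bsub>\<Gamma>\<^esub> k) s) = u k \<xi> (z, l)"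
              using True l by (simp add: u_apply f_def s_def[symmetric] s'_def[symmetric] L.m_assoc v_closed)
          qed
          finally show "(bop \<circ> badj) \<xi> (z, l) = (\<Sum>k\<in>K. u k \<xi> (z, l))" .
        qed
      qed (simp add: bop_def u_apply)
    qed
  qed
  ultimately show ?thesis by (rule op_eq_trans)
qed

lemma adjoint_bop_K: "op_eq H (adjoint_op H bop \<circ> bop) (scale_op (of_nat (card K)) (mult_op (indicator E)))"
  using adjoint_bop by (simp add: mlt_card)

section \<open>The case of a trivial kernel\<close>

lemma mlt_one: "K = {\<one>\<^bsub>\<Gamma>\<^esub>} \<Longrightarrow> mlt = 1"
  by (simp add: mlt_card)

text \<open>The sum is reduced to \<open>u\<close> at the unit. Its cocycle value fixes
  \<open>z\<close>, so it is the unit by freeness, and \<open>u\<close> at the unit is the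
  projection onto \<open>S\<close>.\<close>

lemma bop_adjoint_one:
  assumes K: "K = {\<one>\<^bsub>\<Gamma>\<^esub>}"
  shows "op_eq H (bop \<circ> adjoint_op H bop) (mult_op (indicator S))"
proof -
  have "op_eq H (\<lambda>\<xi> x. \<Sum>k\<in>K. u k \<xi> x) (mult_op (indicator S))"
    unfolding op_eq_def
  proof (intro ballI ae_eq_HI)
    fix \<xi> :: "'z \<times> 'h \<Rightarrow> complex"
    show "AE z in Z. \<forall>l\<in>carrier \<Lambda>. (\<Sum>k\<in>K. u k \<xi> (z, l)) = mult_op (indicator S) \<xi> (z, l)"
      using AE_GY
    proof eventually_elim
      fix z assume z: "GY z"
      show "\<forall>l\<in>carrier \<Lambda>. (\<Sum>k\<in>K. u k \<xi> (z, l)) = mult_op (indicator S) \<xi> (z, l)"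
      proof (cases "z \<in> S")
        case True
        note s = S_point[OF z True]
        have "T (inv (w (\<pi> z) \<one>\<^bsub>\<Gamma>\<^esub>)) z = z"
          using G_facts(6)[OF s(1) GA.L.one_closed] s(2) by (simp add: \<sigma>_one)
        then have "inv (w (\<pi> z) \<one>\<^bsub>\<Gamma>\<^esub>) = \<one>"
          using GY_good[OF z] L.inv_closed[OF w_closed] by (simp add: good_def)
        then show ?thesis
          using True good_one[OF GY_good[OF z]] by (simp add: K u_apply mult_op_def)
      qed (simp add: u_apply mult_op_def)
    qed
  qed
  from op_eq_trans[OF bop_adjoint this] show ?thesis .
qed

lemma adjoint_bop_one:
  assumes K: "K = {\<one>\<^bsub>\<Gamma>\<^esub>}"
  shows "op_eq H (adjoint_op H bop \<circ> bop) (mult_op (indicator E))"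
  using adjoint_bop mlt_one[OF K] by (simp add: scale_op_def)

lemma bop_partial_isometry_one:
  assumes K: "K = {\<one>\<^bsub>\<Gamma>\<^esub>}"
  shows "partial_isometry_op H bop"
  using scale_bop_partial_isometry[of 1] mlt_one[OF K] by (simp add: scale_op_def)

text \<open>The projection \<open>Q\<close> onto \<open>S\<close> equals \<open>bop\<close> composed
  with its adjoint, so a projection fixing \<open>bop\<close> from the left also fixes
  \<open>Q\<close>.\<close>

lemma bop_left_support_one:
  assumes K: "K = {\<one>\<^bsub>\<Gamma>\<^esub>}"
  shows "left_support H bop (mult_op (indicator S))"
  unfolding left_support_def
proof (intro conjI allI impI)
  let ?Q = "mult_op (indicator S) :: ('z \<times> 'h) oper"
  show pQ: "projection_op H ?Q" by (rule projection_indicator[OF S_meas])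
  show "op_eq H (?Q \<circ> bop) bop"
    by (auto simp: op_eq_def ae_eq_def mult_op_def bop_def)
  fix P assume P: "projection_op H P \<and> op_eq H (P \<circ> bop) bop"
  have bP: "bounded_op H P" and bQ: "bounded_op H ?Q" using P pQ by (auto simp: projection_op_def)
  let ?b' = "adjoint_op H bop"
  have pb: "preserves_L2 H (bop \<circ> ?b')" by (intro bounded_op_preserves bounded_op_comp bop_bounded adjoint_bounded)
  have 1: "op_eq H (P \<circ> ?Q) (P \<circ> (bop \<circ> ?b'))"
    by (rule op_eq_comp_left[OF op_eq_sym[OF bop_adjoint_one[OF K]] bP bounded_op_preserves[OF bQ] pb])
  have 2: "op_eq H ((P \<circ> bop) \<circ> ?b') (bop \<circ> ?b')"
    by (rule op_eq_comp_right) (use P adjoint_bounded in \<open>auto intro: bounded_op_preserves\<close>)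
  show "op_eq H (P \<circ> ?Q) ?Q"
    using op_eq_trans[OF 1 op_eq_trans[OF 2[unfolded o_assoc[symmetric]] bop_adjoint_one[OF K]]] .
qed

lemma J_singleton:
  assumes "mlt = 1" "GY z \<and> finite (J z) \<and> (J z \<noteq> {} \<longrightarrow> card (J z) = mlt)" "h \<in> J z"
  shows "J z = {h}"
  using assms by (metis card_1_singletonE empty_iff singletonD)

lemma bop_normalizes_one:
  assumes K: "K = {\<one>\<^bsub>\<Gamma>\<^esub>}"
  shows "normalizes H Z bop"
  unfolding normalizes_def Let_def
proof (intro conjI ballI)
  let ?b' = "adjoint_op H bop"
  note m1 = mlt_one[OF K]
  show "partial_isometry_op H bop" by (rule bop_partial_isometry_one[OF K])
  show "\<exists>f\<in>Linf Z. op_eq H (bop \<circ> ?b') (mult_op f)"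
    using bop_adjoint_one[OF K] Linf_indicator[OF S_meas] by blast
  show "\<exists>f\<in>Linf Z. op_eq H (?b' \<circ> bop) (mult_op f)"
    using adjoint_bop_one[OF K] Linf_indicator[OF E_sets] by blast
  \<comment> \<open>Moving \<open>f\<close> through \<open>bop\<close> turns it into
    \<open>f (\<phi> z)\<close> on \<open>S\<close>; both clauses on the normalised algebra
    therefore amount to solving \<open>f (\<phi> z) = f' z\<close> on \<open>S\<close>, for one
    function given the other.\<close>
  have red: "op_eq H (bop \<circ> mult_op f \<circ> ?b') (mult_op f' \<circ> (bop \<circ> ?b'))"
    if f: "f \<in> Linf Z" and f': "f' \<in> Linf Z" and e: "AE z in Z. z \<in> S \<longrightarrow> f (\<phi> z) = f' z" for f f'
  proof -
    have "op_eq H (bop \<circ> mult_op f) (mult_op f' \<circ> bop)"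
      unfolding op_eq_def
    proof (intro ballI ae_eq_HI)
      fix \<xi> :: "'z \<times> 'h \<Rightarrow> complex"
      show "AE z in Z. \<forall>k\<in>carrier \<Lambda>. (bop \<circ> mult_op f) \<xi> (z, k) = (mult_op f' \<circ> bop) \<xi> (z, k)"
        using e by eventually_elim (auto simp: bop_def mult_op_def)
    qed
    from op_eq_comp_right[OF this bounded_op_preserves[OF adjoint_bounded]]
    show ?thesis by (simp add: o_assoc)
  qed
  { fix f assume f: "f \<in> Linf Z"
    obtain C where C: "C \<ge> 0" "AE z in Z. cmod (f z) \<le> C" by (rule Linf_bound[OF f])
    have "(\<lambda>z. f (\<phi> z)) \<in> Linf Z"
      by (rule LinfI[OF measurable_compose[OF \<phi>_measurable Linf_measurable[OF f]] AE_\<phi>[OF C(2)]])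
    from red[OF f this] show "\<exists>f'\<in>Linf Z. op_eq H (bop \<circ> mult_op f \<circ> ?b') (mult_op f' \<circ> (bop \<circ> ?b'))"
      using \<open>(\<lambda>z. f (\<phi> z)) \<in> Linf Z\<close> by auto }
  { fix f' assume f': "f' \<in> Linf Z"
    obtain C where C: "C \<ge> 0" "AE z in Z. cmod (f' z) \<le> C" by (rule Linf_bound[OF f'])
    \<comment> \<open>With fibres of one point the sum has at most one term, and it is the inverse
      of composition with \<open>\<phi>\<close>.\<close>
    define f where "f y = (\<Sum>h\<in>J y. f' (T h y))" for y
    have fm: "f \<in> borel_measurable Z"
      unfolding f_def by (rule sum_J_measurable) (rule measurable_compose[OF T_meas Linf_measurable[OF f']])
    have "AE y in Z. cmod (f y) \<le> C"
      using AE_all AE_T[OF C(2)]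
    proof eventually_elim
      fix y assume y: "GY y \<and> finite (J y) \<and> (J y \<noteq> {} \<longrightarrow> card (J y) = mlt)"
        and b: "\<forall>h\<in>carrier \<Lambda>. cmod (f' (T h y)) \<le> C"
      show "cmod (f y) \<le> C"
      proof (cases "J y = {}")
        case False
        then obtain h where h: "h \<in> J y" by blast
        then show ?thesis using J_singleton[OF m1 y h] b J_closed by (auto simp: f_def)
      qed (simp add: f_def C)
    qed
    then have f: "f \<in> Linf Z" by (rule LinfI[OF fm])
    have "AE z in Z. z \<in> S \<longrightarrow> f (\<phi> z) = f' z"
      using AE_\<phi>[OF AE_all] AE_GY
    proof eventually_elim
      fix z assume y: "GY (\<phi> z) \<and> finite (J (\<phi> z)) \<and> (J (\<phi> z) \<noteq> {} \<longrightarrow> card (J (\<phi> z)) = mlt)" and z: "GY z"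
      show "z \<in> S \<longrightarrow> f (\<phi> z) = f' z"
        using J_singleton[OF m1 y c_in_J[OF GY_good[OF z]]] T_c_\<phi>[OF GY_good[OF z]] by (simp add: f_def)
    qed
    from red[OF f f' this] show "\<exists>f\<in>Linf Z. op_eq H (bop \<circ> mult_op f \<circ> ?b') (mult_op f' \<circ> (bop \<circ> ?b'))"
      using f by blast }
qed

lemma fixed_alg_one:
  assumes K: "K = {\<one>\<^bsub>\<Gamma>\<^esub>}"
  shows "Linf \<mu> = AK"
proof -
  have "fixed_alg \<Gamma> \<mu> \<sigma> K = Linf \<mu>"
    by (auto simp: fixed_alg_def K koopman_def \<sigma>_one ae_eq_refl)
  then show ?thesis using fixed_alg_eq by simp
qed

lemma \<delta>_iso_one:
  assumes K: "K = {\<one>\<^bsub>\<Gamma>\<^esub>}"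
  shows "\<delta> \<in> iso \<Gamma> (\<Lambda>\<lparr>carrier := \<delta> ` carrier \<Gamma>\<rparr>)"
  using group_hom.trivial_ker_imp_inj[OF \<delta>_group_hom K] \<delta>_mult
  by (auto simp: iso_def hom_def bij_betw_def)

end

section \<open>Measure of the image and the index\<close>

context oe_cocycle
begin

text \<open>Transport of the indicator of \<open>A\<close> composed with \<open>\<phi>\<close>:
  every base point in \<open>E \<inter> A\<close> receives one unit of mass for each of its
  \<open>mlt\<close> labels.\<close>

lemma emeasure_\<phi>_vimage:
  assumes A: "A \<in> sets Z"
  shows "emeasure Z (S \<inter> \<phi> -` A) = ennreal (real mlt) * emeasure Z (E \<inter> A)"
proof -
  have "\<phi> -` A \<inter> space Z \<in> sets Z" by (rule measurable_sets[OF \<phi>_measurable A])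
  moreover have SA: "S \<inter> \<phi> -` A = S \<inter> (\<phi> -` A \<inter> space Z)" using S_space by auto
  ultimately have s: "S \<inter> \<phi> -` A \<in> sets Z" using S_meas by simp
  have fm: "(\<lambda>z. indicator A (\<phi> z) :: ennreal) \<in> borel_measurable Z"
    by (rule measurable_compose[OF \<phi>_measurable borel_measurable_indicator[OF A]])
  have "emeasure Z (S \<inter> \<phi> -` A) = (\<integral>\<^sup>+z. indicator (S \<inter> \<phi> -` A) z \<partial>Z)" using s by simp
  also have "\<dots> = (\<integral>\<^sup>+z. indicator S z * indicator A (\<phi> z) \<partial>Z)"
    by (rule nn_integral_cong) (auto simp: indicator_def)
  also have "\<dots> = (\<integral>\<^sup>+y. (\<integral>\<^sup>+h. (if h \<in> J y then indicator A (\<phi> (T h y)) else 0) \<partial>count_space (carrier \<Lambda>)) \<partial>Z)"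
    by (rule nn_transport[OF fm])
  also have "\<dots> = (\<integral>\<^sup>+y. ennreal (real mlt) * indicator (E \<inter> A) y \<partial>Z)"
  proof (rule nn_integral_cong_AE)
    show "AE y in Z. (\<integral>\<^sup>+h. (if h \<in> J y then indicator A (\<phi> (T h y)) else 0) \<partial>count_space (carrier \<Lambda>)) =
        ennreal (real mlt) * indicator (E \<inter> A) y"
      using AE_all
    proof eventually_elim
      fix y assume y: "GY y \<and> finite (J y) \<and> (J y \<noteq> {} \<longrightarrow> card (J y) = mlt)"
      have "(\<integral>\<^sup>+h. (if h \<in> J y then indicator A (\<phi> (T h y)) else 0) \<partial>count_space (carrier \<Lambda>)) =
          (\<Sum>h\<in>J y. indicator A (\<phi> (T h y)))"
        by (rule nn_integral_count_space_subset) (use y J_closed in auto)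
      also have "\<dots> = (\<Sum>h\<in>J y. indicator A y)"
        using y by (intro sum.cong refl) (simp add: J_\<phi> GY_good)
      also have "\<dots> = ennreal (real mlt) * indicator (E \<inter> A) y"
        using y J_eq_E[of y] by (cases "J y = {}") (auto simp: indicator_def ennreal_of_nat_eq_real_of_nat)
      finally show "(\<integral>\<^sup>+h. (if h \<in> J y then indicator A (\<phi> (T h y)) else 0) \<partial>count_space (carrier \<Lambda>)) =
        ennreal (real mlt) * indicator (E \<inter> A) y" .
    qed
  qed
  also have "\<dots> = ennreal (real mlt) * emeasure Z (E \<inter> A)"
    using A E_sets by (simp add: nn_integral_cmult)
  finally show ?thesis .
qed

lemma measure_E: "measure Z S = real mlt * measure Z E"
proof -
  have "S \<inter> \<phi> -` space Z = S" using measurable_space[OF \<phi>_measurable] S_space by auto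
  moreover have "E \<inter> space Z = E" by (auto simp: E_def)
  ultimately have "emeasure Z S = ennreal (real mlt) * emeasure Z E"
    using emeasure_\<phi>_vimage[of "space Z"] by simp
  then show ?thesis by (simp add: PZ.emeasure_eq_measure ennreal_mult[symmetric])
qed

lemma measure_E_pos: "measure Z E > 0"
  using measure_E S_pos m_pos by (simp add: zero_less_mult_iff)

lemma \<Phi>_mp_iso:
  assumes m1: "mlt = 1"
  shows "mp_iso \<mu> (uniform_measure Z E) \<Phi>"
proof -
  let ?U = "uniform_measure Z E" and ?US = "uniform_measure Z S"
  have E0: "emeasure Z E \<noteq> 0" "emeasure Z E < \<infinity>" using measure_E_pos by (auto simp: PZ.emeasure_eq_measure)
  have SE: "emeasure Z S = emeasure Z E" using measure_E m1 by (simp add: PZ.emeasure_eq_measure)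
  have \<Phi>U: "\<Phi> \<in> measurable \<mu> ?U" using \<Phi>_meas by (simp cong: measurable_cong_sets)
  have d: "distr \<mu> ?U \<Phi> = ?U"
  proof (rule measure_eqI)
    fix A assume "A \<in> sets (distr \<mu> ?U \<Phi>)"
    then have A: "A \<in> sets Z" by simp
    have vA: "\<phi> -` A \<inter> space Z \<in> sets Z" by (rule measurable_sets[OF \<phi>_measurable A])
    have "emeasure (distr \<mu> ?U \<Phi>) A = emeasure \<mu> (\<Phi> -` A \<inter> space \<mu>)"
      by (rule emeasure_distr[OF \<Phi>U]) (use A in simp)
    also have "\<dots> = emeasure \<mu> (\<iota> -` (\<phi> -` A \<inter> space Z) \<inter> space \<mu>)"
    proof (rule emeasure_eq_AE)
      show "AE t in \<mu>. t \<in> \<Phi> -` A \<inter> space \<mu> \<longleftrightarrow> t \<in> \<iota> -` (\<phi> -` A \<inter> space Z) \<inter> space \<mu>"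
        using AE_G by eventually_elim (use \<phi>_\<iota>[OF G_GX] measurable_space[OF \<iota>_meas] in \<open>auto simp: space_\<mu>\<close>)
    qed (use measurable_sets[OF \<Phi>_meas A] measurable_sets[OF \<iota>_meas vA] in auto)
    also have "\<dots> = emeasure (distr \<mu> ?US \<iota>) (\<phi> -` A \<inter> space Z)"
      using \<iota>_mp vA by (subst emeasure_distr) (auto simp: mp_map_def)
    also have "\<dots> = emeasure ?US (\<phi> -` A \<inter> space Z)" using \<iota>_mp by (simp only: mp_map_def)
    also have "\<dots> = emeasure Z (S \<inter> (\<phi> -` A \<inter> space Z)) / emeasure Z S"
      using vA S_meas by (simp add: emeasure_uniform_measure)
    also have "S \<inter> (\<phi> -` A \<inter> space Z) = S \<inter> \<phi> -` A" using S_space by auto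
    also have "emeasure Z (S \<inter> \<phi> -` A) / emeasure Z S = emeasure ?U A"
      using emeasure_\<phi>_vimage[OF A] m1 A E_sets by (simp add: SE)
    finally show "emeasure (distr \<mu> ?U \<Phi>) A = emeasure ?U A" .
  qed simp
  \<comment> \<open>The label has to be selected measurably to invert \<open>\<Phi>\<close>.
    \<open>P h y\<close> says that \<open>h\<close> is the only label of \<open>y\<close>, a
    countable condition; elsewhere \<open>\<tau>\<close> is the unit, which keeps it
    measurable.\<close>
  define P where "P h y \<longleftrightarrow> h \<in> J y \<and> (\<forall>k\<in>carrier \<Lambda>. k \<in> J y \<longrightarrow> k = h)" for h y
  define \<tau> where "\<tau> y = (if \<exists>h\<in>carrier \<Lambda>. P h y then THE h. P h y else \<one>)" for y
  have Pu: "(THE h. P h y) = h" if "P h y" for h y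
    using that by (intro the_equality) (auto simp: P_def J_def)
  have Pm: "{y \<in> space Z. P h y} \<in> sets Z" if h: "h \<in> carrier \<Lambda>" for h
    unfolding P_def
    by (intro sets.sets_Collect_conj sets.sets_Collect_countable_All' sets.sets_Collect_imp J_sets h cnt sets.sets_Collect_const)
  have \<tau>m: "\<tau> \<in> measurable Z (count_space (carrier \<Lambda>))"
  proof (subst measurable_count_space_eq_countable[OF cnt], intro conjI Pi_I ballI)
    fix y show "\<tau> y \<in> carrier \<Lambda>" using Pu by (auto simp: \<tau>_def)
  next
    fix h assume h: "h \<in> carrier \<Lambda>"
    have none: "{y \<in> space Z. \<not> (\<exists>k\<in>carrier \<Lambda>. P k y)} \<in> sets Z"
      by (intro sets.sets_Collect_neg sets.sets_Collect_countable_Ex' Pm cnt)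
    have "\<tau> -` {h} \<inter> space Z = {y \<in> space Z. P h y} \<union> (if h = \<one> then {y \<in> space Z. \<not> (\<exists>k\<in>carrier \<Lambda>. P k y)} else {})"
      using Pu h by (auto simp: \<tau>_def split: if_splits)
    then show "\<tau> -` {h} \<inter> space Z \<in> sets Z" using Pm[OF h] none by (auto split: if_splits)
  qed
  define g where "g y = \<pi> (T (\<tau> y) y)" for y
  have gm: "g \<in> measurable ?U \<mu>"
  proof -
    have "g \<in> measurable Z \<mu>" unfolding g_def
      by (rule measurable_compose_countable'[where f="\<lambda>h y. \<pi> (T h y)", OF _ \<tau>m cnt])
         (rule measurable_compose[OF T_meas \<pi>_meas])
    then show ?thesis by (simp cong: measurable_cong_sets)
  qed
  have \<tau>J: "\<tau> y = h" if "J y = {h}" for y h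
  proof -
    have "P h y" "h \<in> carrier \<Lambda>" using that J_closed[of y] by (auto simp: P_def)
    then show ?thesis using Pu by (auto simp: \<tau>_def)
  qed
  have sing: "J y = {h}" if "GY y \<and> finite (J y) \<and> (J y \<noteq> {} \<longrightarrow> card (J y) = mlt)" "h \<in> J y" for y h
    using that m1 by (metis card_1_singletonE empty_iff singletonD)
  have "AE t in \<mu>. g (\<Phi> t) = t"
    using AE_G AE_\<Phi>[OF AE_all]
  proof eventually_elim
    fix t assume t: "G t" and y: "GY (\<Phi> t) \<and> finite (J (\<Phi> t)) \<and> (J (\<Phi> t) \<noteq> {} \<longrightarrow> card (J (\<Phi> t)) = mlt)"
    show "g (\<Phi> t) = t"
      using \<tau>J[OF sing[OF y F_point(1)[OF F_self[OF t]]]] F_point(2)[OF F_self[OF t]] by (simp add: g_def)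
  qed
  moreover have "AE y in ?U. \<Phi> (g y) = y"
  proof (rule AE_uniform_measureI[OF E_sets])
    show "AE y in Z. y \<in> E \<longrightarrow> \<Phi> (g y) = y"
      using AE_all
    proof eventually_elim
      fix y assume y: "GY y \<and> finite (J y) \<and> (J y \<noteq> {} \<longrightarrow> card (J y) = mlt)"
      show "y \<in> E \<longrightarrow> \<Phi> (g y) = y"
      proof
        assume "y \<in> E"
        then obtain h where h: "h \<in> J y" by (auto simp: E_def)
        then show "\<Phi> (g y) = y" using \<tau>J[OF sing[OF y h]] J_point(1)[of y h] y by (simp add: g_def F_def)
      qed
    qed
  qed
  ultimately show ?thesis
    unfolding mp_iso_def mp_map_def mod_null_inverse_def using \<Phi>U d gm by blast
qed

text \<open>The converse of \<open>orbit_map\<close>: a \<open>\<Lambda>\<close>-translate of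
  \<open>\<iota> t\<close> that returns to \<open>S\<close> comes from a
  \<open>\<Gamma>\<close>-translate of \<open>t\<close>.\<close>

definition same_orbits :: bool where
  "same_orbits \<longleftrightarrow> (AE t in \<mu>. \<forall>h\<in>carrier \<Lambda>. T h (\<iota> t) \<in> S \<longrightarrow> (\<exists>g\<in>carrier \<Gamma>. T h (\<iota> t) = \<iota> (\<sigma> g t)))"

lemma same_orbits_KK:
  assumes so: same_orbits
  shows "ae_subrel \<mu> KK (orbit_rel \<Gamma> \<sigma>)"
proof -
  have "AE t in \<mu>. G t \<and> (\<forall>h\<in>carrier \<Lambda>. T h (\<iota> t) \<in> S \<longrightarrow> (\<exists>g\<in>carrier \<Gamma>. T h (\<iota> t) = \<iota> (\<sigma> g t)))"
    using so[unfolded same_orbits_def] AE_G by eventually_elim simp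
  then obtain E' where E': "conull \<mu> E'" "\<And>t. t \<in> E' \<Longrightarrow> G t \<and> (\<forall>h\<in>carrier \<Lambda>. T h (\<iota> t) \<in> S \<longrightarrow> (\<exists>g\<in>carrier \<Gamma>. T h (\<iota> t) = \<iota> (\<sigma> g t)))"
    by (rule AE_conull) blast
  have "restrict_rel KK E' \<subseteq> orbit_rel \<Gamma> \<sigma>"
  proof
    fix p assume "p \<in> restrict_rel KK E'"
    then obtain s t where p: "p = (s, t)" "s \<in> E'" "t \<in> E'" "\<Phi> s = \<Phi> t"
      by (auto simp: restrict_rel_def KK_def)
    have g: "G s" "G t" using p E'(2) by auto
    obtain h where h: "h \<in> carrier \<Lambda>" "\<iota> t = T h (\<iota> s)" using KK_orbit[OF g p(4)] by blast
    then obtain k where k: "k \<in> carrier \<Gamma>" "\<iota> t = \<iota> (\<sigma> k s)" using E'(2)[OF p(2)] G_facts(1)[OF g(2)] by metis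
    then have "t = \<sigma> k s" using G_facts(2)[OF g(2)] G_facts(2)[OF G_\<sigma>[OF g(1) k(1)]] by metis
    then show "p \<in> orbit_rel \<Gamma> \<sigma>" using p k by (auto simp: orbit_rel_def orbit_def)
  qed
  then show ?thesis using E'(1) by (auto simp: ae_subrel_def)
qed

text \<open>Almost every \<open>y\<close> has exactly one right coset whose representative moves it
  into \<open>E\<close>. It has one because some translate lies in \<open>S\<close> and
  \<open>\<Phi>\<close> takes the corresponding point of \<open>X\<close> into \<open>E\<close>
  along the same orbit. It has only one because two such translates come from a single
  \<open>\<Gamma>\<close>-orbit by \<open>same_orbits\<close>, hence differ by an element of the
  image of \<open>\<delta>\<close>.\<close>

lemma index_formula:
  assumes so: same_orbits and cs: "AE y in Z. \<exists>h\<in>carrier \<Lambda>. T h y \<in> S"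
  shows "finite (rcosets (\<delta> ` carrier \<Gamma>))" "real (card (rcosets (\<delta> ` carrier \<Gamma>))) * measure Z E = 1"
proof -
  define L0 where "L0 = \<delta> ` carrier \<Gamma>"
  define R where "R = rcosets L0"
  have sg: "subgroup L0 \<Lambda>" unfolding L0_def using \<delta>_group_hom by (rule group_hom.img_is_subgroup)
  have L0: "L0 \<subseteq> carrier \<Lambda>" using \<delta>_closed by (auto simp: L0_def)
  \<comment> \<open>The representative depends on the coset alone. Another choice would change
    \<open>T (r C) y\<close> by an element of the image of \<open>\<delta>\<close>, under which
    \<open>E\<close> is invariant up to null sets.\<close>
  define r where "r C = (SOME h. h \<in> C)" for C :: "'h set"
  have rep: "r (L0 #> h) \<in> carrier \<Lambda>" "\<exists>g\<in>carrier \<Gamma>. r (L0 #> h) = \<delta> g \<otimes> h" if h: "h \<in> carrier \<Lambda>" for h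
  proof -
    have "h \<in> L0 #> h" using L.rcos_self[OF h sg] .
    then have "r (L0 #> h) \<in> L0 #> h" unfolding r_def by (rule someI)
    then show "\<exists>g\<in>carrier \<Gamma>. r (L0 #> h) = \<delta> g \<otimes> h" by (auto simp: r_coset_def L0_def)
    then show "r (L0 #> h) \<in> carrier \<Lambda>" using h \<delta>_closed by auto
  qed
  have Rr: "r C \<in> carrier \<Lambda>" "C = L0 #> r C" if CR: "C \<in> R" for C
  proof -
    obtain h where h: "h \<in> carrier \<Lambda>" "C = L0 #> h" using CR by (auto simp: R_def RCOSETS_def)
    show "r C \<in> carrier \<Lambda>" using rep(1)[OF h(1)] h(2) by simp
    obtain g where g: "g \<in> carrier \<Gamma>" "r C = \<delta> g \<otimes> h" using rep(2)[OF h(1)] h(2) by auto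
    have "r C \<in> L0 #> h" using g by (auto simp: r_coset_def L0_def)
    then show "C = L0 #> r C" using L.repr_independence[OF _ h(1) sg] h(2) by blast
  qed
  have cR: "countable R"
  proof -
    have "R = (\<lambda>h. L0 #> h) ` carrier \<Lambda>" by (auto simp: R_def RCOSETS_def)
    then show ?thesis using cnt by simp
  qed
  have so': "AE y in Z. \<forall>h\<in>carrier \<Lambda>. T h y \<in> S \<longrightarrow>
      (\<forall>k\<in>carrier \<Lambda>. T k (\<iota> (\<pi> (T h y))) \<in> S \<longrightarrow> (\<exists>g\<in>carrier \<Gamma>. T k (\<iota> (\<pi> (T h y))) = \<iota> (\<sigma> g (\<pi> (T h y)))))"
    by (rule AE_T[OF AE_\<pi>[OF so[unfolded same_orbits_def]]])
  have uniq: "AE y in Z. \<exists>!C. C \<in> R \<and> T (r C) y \<in> E"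
    using AE_GY cs so'
  proof eventually_elim
    fix y assume y: "GY y" and ex: "\<exists>h\<in>carrier \<Lambda>. T h y \<in> S"
      and so: "\<forall>h\<in>carrier \<Lambda>. T h y \<in> S \<longrightarrow>
      (\<forall>k\<in>carrier \<Lambda>. T k (\<iota> (\<pi> (T h y))) \<in> S \<longrightarrow> (\<exists>g\<in>carrier \<Gamma>. T k (\<iota> (\<pi> (T h y))) = \<iota> (\<sigma> g (\<pi> (T h y)))))"
    note gy = GY_good[OF y]
    show "\<exists>!C. C \<in> R \<and> T (r C) y \<in> E"
    proof (rule ex_ex1I)
      obtain h where h: "h \<in> carrier \<Lambda>" "T h y \<in> S" using ex by blast
      define s where "s = \<pi> (T h y)"
      have s: "G s" "\<iota> s = T h y" using S_point[OF GY_T[OF y h(1)] h(2)] by (auto simp: s_def)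
      define k where "k = inv (v s) \<otimes> h"
      have k: "k \<in> carrier \<Lambda>" using h by (simp add: k_def v_closed)
      have \<Phi>k: "\<Phi> s = T k y" using good_mult[OF gy, of "inv (v s)" h] h by (simp add: \<Phi>_def s(2) k_def v_closed)
      obtain g where g: "g \<in> carrier \<Gamma>" "r (L0 #> k) = \<delta> g \<otimes> k" using rep(2)[OF k] by blast
      have "T (r (L0 #> k)) y = \<Phi> (\<sigma> g s)"
        using good_mult[OF gy \<delta>_closed[OF g(1)] k] G_facts(5)[OF s(1) g(1)] \<Phi>k g(2) by simp
      moreover have "\<Phi> (\<sigma> g s) \<in> E"
        using J_eq_E[OF GY_\<Phi>[OF G_\<sigma>[OF s(1) g(1)]]] F_point(1)[OF F_self[OF G_\<sigma>[OF s(1) g(1)]]] by blast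
      moreover have "L0 #> k \<in> R" using k by (auto simp: R_def RCOSETS_def)
      ultimately show "\<exists>C. C \<in> R \<and> T (r C) y \<in> E" by metis
    next
      \<comment> \<open>Lift both translates to points \<open>s\<close>, \<open>t\<close> of
        \<open>X\<close>; their images in \<open>S\<close> lie in one
        \<open>\<Lambda>\<close>-orbit, so \<open>t\<close> is a \<open>\<Gamma>\<close>-translate
        of \<open>s\<close> and the two representatives lie in the same coset.\<close>
      fix C D assume C: "C \<in> R \<and> T (r C) y \<in> E" and D: "D \<in> R \<and> T (r D) y \<in> E"
      have yC: "GY (T (r C) y)" and yD: "GY (T (r D) y)" using GY_T[OF y] Rr(1) C D by auto
      obtain s where s: "s \<in> F (T (r C) y)" using J_eq_E[OF yC] J_F_empty[OF yC] C by blast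
      obtain t where t: "t \<in> F (T (r D) y)" using J_eq_E[OF yD] J_F_empty[OF yD] D by blast
      have gs: "G s" "\<Phi> s = T (r C) y" and gt: "G t" "\<Phi> t = T (r D) y" using s t by (auto simp: F_def)
      define h where "h = v s \<otimes> r C"
      define k where "k = v t \<otimes> r D"
      have hk: "h \<in> carrier \<Lambda>" "k \<in> carrier \<Lambda>" using Rr(1) C D by (auto simp: h_def k_def v_closed)
      have ih: "\<iota> s = T h y" using F_point(3)[OF s] good_mult[OF gy v_closed, of "r C"] Rr(1) C by (simp add: h_def)
      have ik: "\<iota> t = T k y" using F_point(3)[OF t] good_mult[OF gy v_closed, of "r D"] Rr(1) D by (simp add: k_def)
      have hS: "T h y \<in> S" "\<pi> (T h y) = s" using G_facts(1,2)[OF gs(1)] ih by auto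
      have "T (k \<otimes> inv h) (\<iota> s) = \<iota> t"
        unfolding ih ik using good_mult[OF gy, of "k \<otimes> inv h" h] hk by (simp add: L.m_assoc)
      moreover have "T (k \<otimes> inv h) (\<iota> s) \<in> S \<longrightarrow> (\<exists>g\<in>carrier \<Gamma>. T (k \<otimes> inv h) (\<iota> s) = \<iota> (\<sigma> g s))"
        using so[rule_format, OF hk(1) hS(1), of "k \<otimes> inv h"] hk hS(2) by simp
      ultimately obtain g where g: "g \<in> carrier \<Gamma>" "\<iota> t = \<iota> (\<sigma> g s)" using G_facts(1)[OF gt(1)] by auto
      then have "t = \<sigma> g s" using G_facts(2)[OF gt(1)] G_facts(2)[OF G_\<sigma>[OF gs(1) g(1)]] by metis
      then have "T (r D) y = T (\<delta> g) (T (r C) y)" using gs gt G_facts(5)[OF gs(1) g(1)] by simp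
      also have "\<dots> = T (\<delta> g \<otimes> r C) y" using good_mult[OF gy \<delta>_closed[OF g(1)]] Rr(1) C by simp
      finally have "r D = \<delta> g \<otimes> r C" using good_inj[OF gy] Rr(1) C D \<delta>_closed[OF g(1)] by simp
      then have "r D \<in> L0 #> r C" using g by (auto simp: r_coset_def L0_def)
      then have "L0 #> r C = L0 #> r D"
        by (rule L.repr_independence[OF _ _ sg]) (use Rr(1) C in blast)
      moreover have "C = L0 #> r C" "D = L0 #> r D" using Rr(2) C D by blast+
      ultimately show "C = D" by (simp only:)
    qed
  qed
  have Tm: "{y \<in> space Z. T (r C) y \<in> E} \<in> sets Z" if "C \<in> R" for C
  proof -
    have "{y \<in> space Z. T (r C) y \<in> E} = T (r C) -` E \<inter> space Z" by auto
    then show ?thesis using measurable_sets[OF T_meas[OF Rr(1)[OF that]] E_sets] by simp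
  qed
  \<comment> \<open>Integrate the number of successful cosets, which is 1, and exchange: each coset
    contributes the measure of \<open>E\<close>, so there are finitely many.\<close>
  have "1 = (\<integral>\<^sup>+y. 1 \<partial>Z)" by (simp add: PZ.emeasure_space_1)
  also have "\<dots> = (\<integral>\<^sup>+y. (\<integral>\<^sup>+C. (if T (r C) y \<in> E then 1 else 0) \<partial>count_space R) \<partial>Z)"
  proof (rule nn_integral_cong_AE)
    show "AE y in Z. 1 = (\<integral>\<^sup>+C. (if T (r C) y \<in> E then 1 else 0) \<partial>count_space R)"
      using uniq
    proof eventually_elim
      fix y assume "\<exists>!C. C \<in> R \<and> T (r C) y \<in> E"
      then obtain C where C: "C \<in> R" "T (r C) y \<in> E" "\<forall>D. D \<in> R \<and> T (r D) y \<in> E \<longrightarrow> D = C"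
        unfolding Ex1_def by (elim exE conjE)
      have "(\<integral>\<^sup>+D. (if T (r D) y \<in> E then 1 else 0) \<partial>count_space R) = (\<integral>\<^sup>+D. (if D \<in> {C} then 1 else 0) \<partial>count_space R)"
      proof (rule nn_integral_cong)
        fix D assume "D \<in> space (count_space R)"
        then have D: "D \<in> R" by simp
        have "T (r D) y \<in> E \<longleftrightarrow> D \<in> {C}"
        proof
          assume "T (r D) y \<in> E"
          with D have "D \<in> R \<and> T (r D) y \<in> E" ..
          from C(3)[THEN spec, THEN mp, OF this] show "D \<in> {C}" by (simp only: singleton_iff)
        next
          assume "D \<in> {C}"
          then have "D = C" by (rule singletonD)
          then show "T (r D) y \<in> E" by (rule ssubst) (rule C(2))
        qed
        then show "(if T (r D) y \<in> E then 1 else 0) = (if D \<in> {C} then 1 else 0 :: ennreal)" by (simp only:)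
      qed
      also have "\<dots> = 1" by (subst nn_integral_count_space_subset) (use C(1) in auto)
      finally show "1 = (\<integral>\<^sup>+C. (if T (r C) y \<in> E then 1 else 0) \<partial>count_space R)" by simp
    qed
  qed
  also have "\<dots> = (\<integral>\<^sup>+C. (\<integral>\<^sup>+y. (if T (r C) y \<in> E then 1 else 0) \<partial>Z) \<partial>count_space R)"
    by (rule nn_integral_count_swap[OF PZ.sigma_finite_measure_axioms cR]) (use Tm in \<open>auto intro!: measurable_If\<close>)
  also have "\<dots> = (\<integral>\<^sup>+C. emeasure Z E \<partial>count_space R)"
  proof (rule nn_integral_cong)
    fix C assume "C \<in> space (count_space R)"
    then have C: "r C \<in> carrier \<Lambda>" using Rr(1) by simp
    have "(\<integral>\<^sup>+y. (if T (r C) y \<in> E then 1 else 0) \<partial>Z) = (\<integral>\<^sup>+y. indicator E (T (r C) y) \<partial>Z)"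
      by (rule nn_integral_cong) (simp add: indicator_def)
    also have "\<dots> = (\<integral>\<^sup>+y. indicator E y \<partial>distr Z Z (T (r C)))"
      by (rule nn_integral_distr[symmetric, OF T_meas[OF C]]) (use E_sets in simp)
    also have "\<dots> = emeasure Z E" using E_sets by (simp add: T_distr[OF C])
    finally show "(\<integral>\<^sup>+y. (if T (r C) y \<in> E then 1 else 0) \<partial>Z) = emeasure Z E" .
  qed
  also have "\<dots> = emeasure Z E * emeasure (count_space R) R" by simp
  finally have e: "1 = emeasure Z E * emeasure (count_space R) R" .
  have fR: "finite R"
  proof (rule ccontr)
    assume "infinite R"
    then have "emeasure Z E * emeasure (count_space R) R = \<infinity>"
      using measure_E_pos by (simp add: PZ.emeasure_eq_measure ennreal_mult_top)
    then show False using e by simp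
  qed
  then show "finite (rcosets (\<delta> ` carrier \<Gamma>))" by (simp add: R_def L0_def)
  have "ennreal 1 = ennreal (measure Z E * real (card R))"
    using e fR by (simp add: PZ.emeasure_eq_measure emeasure_count_space_finite ennreal_of_nat_eq_real_of_nat ennreal_mult)
  then have "1 = measure Z E * real (card R)"
    by (subst (asm) ennreal_inj) (auto simp: measure_nonneg)
  then show "real (card (rcosets (\<delta> ` carrier \<Gamma>))) * measure Z E = 1" by (simp add: R_def L0_def mult.commute)
qed

end

subsection \<open>Amplification of a local orbit equivalence\<close>

lemma the_unique_eq:
  assumes "\<exists>!x. P x" "P a"
  shows "the_unique d P = a"
  using assms the1_equality[OF assms] by (simp add: the_unique_def)

lemma nn_integral_count_space_subset_eq:
  fixes f :: "'a \<Rightarrow> ennreal"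
  assumes "V \<subseteq> C"
  shows "(\<integral>\<^sup>+q. (if q \<in> V then f q else 0) \<partial>count_space C) = (\<integral>\<^sup>+q. f q \<partial>count_space V)"
proof -
  have "(\<integral>\<^sup>+q. (if q \<in> V then f q else 0) \<partial>count_space C) = (\<integral>\<^sup>+q. f q * indicator V q \<partial>count_space C)"
    by (rule nn_integral_cong) simp
  also have "\<dots> = (\<integral>\<^sup>+q. f q \<partial>restrict_space (count_space C) V)"
    by (rule nn_integral_restrict_space[symmetric]) (use assms in auto)
  also have "restrict_space (count_space C) V = count_space V"
    using assms by (simp add: restrict_count_space Int_absorb2)
  finally show ?thesis .
qed

lemma AE_uniform_measure_trans:
  assumes "mp_map M (uniform_measure N A) f" "A \<in> sets N" "AE y in N. P y"
  shows "AE x in M. P (f x)"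
proof -
  have f: "f \<in> measurable M (uniform_measure N A)" and d: "distr M (uniform_measure N A) f = uniform_measure N A"
    using assms(1) by (auto simp: mp_map_def)
  have "AE y in uniform_measure N A. P y"
    by (rule AE_uniform_measureI[OF assms(2)]) (use assms(3) in eventually_elim, simp)
  then show ?thesis by (intro AE_distrD[OF f]) (simp only: d)
qed

lemma AE_uniform_measure_in:
  assumes "mp_map M (uniform_measure N A) f" "A \<in> sets N"
  shows "AE x in M. f x \<in> A"
proof -
  have f: "f \<in> measurable M (uniform_measure N A)" and d: "distr M (uniform_measure N A) f = uniform_measure N A"
    using assms(1) by (auto simp: mp_map_def)
  have "AE y in uniform_measure N A. y \<in> A"
    by (rule AE_uniform_measureI[OF assms(2)]) simp
  then show ?thesis by (intro AE_distrD[OF f]) (simp only: d)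
qed

locale amplified =
  fixes \<Gamma> :: "('g, 'm) monoid_scheme" and \<Lambda> :: "('h, 'n) monoid_scheme" (structure)
    and \<mu> :: "'x::polish_space measure" and \<nu> :: "'y::polish_space measure"
    and \<sigma> :: "'g \<Rightarrow> 'x \<Rightarrow> 'x" and \<theta> :: "'h \<Rightarrow> 'y \<Rightarrow> 'y"
    and Y0 :: "'y set" and \<Delta> :: "'x \<Rightarrow> 'y" and Yp :: "nat \<Rightarrow> 'y set" and \<psi> :: "nat \<Rightarrow> 'y \<Rightarrow> 'y" and n :: real
  assumes \<mu>_std: "standard_prob_space \<mu>" and \<nu>_std: "standard_prob_space \<nu>"
    and \<sigma>_act: "mp_action \<Gamma> \<mu> \<sigma>" and \<sigma>_free: "free_action \<Gamma> \<mu> \<sigma>"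
    and \<theta>_act: "mp_action \<Lambda> \<nu> \<theta>" and \<theta>_free: "free_action \<Lambda> \<nu> \<theta>"
    and Y0: "Y0 \<in> sets \<nu>" and Y0_pos: "measure \<nu> Y0 > 0"
    and loc: "local_OE \<mu> (orbit_rel \<Gamma> \<sigma>) \<nu> (orbit_rel \<Lambda> \<theta>) Y0 \<Delta>"
    and amp: "amplification_data \<nu> (orbit_rel \<Lambda> \<theta>) Y0 Yp \<psi>"
    and n: "n = 1 / measure \<nu> Y0"
begin

sublocale GA: near_action \<Gamma> \<mu> \<sigma> by (rule mp_action_near_action[OF \<sigma>_act \<mu>_std \<sigma>_free])
sublocale LA: near_action \<Lambda> \<nu> \<theta> by (rule mp_action_near_action[OF \<theta>_act \<nu>_std \<theta>_free])

abbreviation "Xn \<equiv> amp_set Yp \<psi> \<Delta>"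
abbreviation "\<mu>n \<equiv> amp_measure n \<mu> Xn"
abbreviation "Rn \<equiv> amp_rel (orbit_rel \<Gamma> \<sigma>) Xn"
abbreviation "D \<equiv> amp_map Yp \<psi> \<Delta>"
abbreviation "\<theta>' \<equiv> pull_back Rn D \<theta>"
abbreviation "\<kappa> \<equiv> \<mu> \<Otimes>\<^sub>M count_space (UNIV :: nat set)"

lemma space_\<mu>: "space \<mu> = UNIV" and space_\<nu>: "space \<nu> = UNIV"
  using standard_space \<mu>_std \<nu>_std by blast+

lemma \<sigma>_mult: "g \<in> carrier \<Gamma> \<Longrightarrow> h \<in> carrier \<Gamma> \<Longrightarrow> \<sigma> g (\<sigma> h t) = \<sigma> (g \<otimes>\<^bsub>\<Gamma>\<^esub> h) t"
  by (rule mp_action_apply(1)[OF \<sigma>_act \<mu>_std])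

lemma \<sigma>_one: "\<sigma> \<one>\<^bsub>\<Gamma>\<^esub> t = t"
  using mp_action_apply(2)[OF \<sigma>_act \<mu>_std] GA.L.one_closed by blast

lemma \<theta>_mult: "g \<in> carrier \<Lambda> \<Longrightarrow> h \<in> carrier \<Lambda> \<Longrightarrow> \<theta> g (\<theta> h t) = \<theta> (g \<otimes> h) t"
  by (rule mp_action_apply(1)[OF \<theta>_act \<nu>_std])

lemma \<theta>_one: "\<theta> \<one> t = t"
  using mp_action_apply(2)[OF \<theta>_act \<nu>_std] LA.L.one_closed by blast

lemma \<Delta>_mp: "mp_map \<mu> (uniform_measure \<nu> Y0) \<Delta>" using loc by (simp add: local_OE_def)

lemma \<Delta>_meas: "\<Delta> \<in> measurable \<mu> \<nu>"
  using \<Delta>_mp by (simp add: mp_map_def cong: measurable_cong_sets)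

lemma Yp_sets: "i \<ge> 1 \<Longrightarrow> Yp i \<in> sets \<nu>"
  and Yp_cover: "AE y in \<nu>. \<exists>i\<ge>1. y \<in> Yp i"
  and Yp_one: "Yp 1 = Y0" "y \<in> Y0 \<Longrightarrow> \<psi> 1 y = y"
  and \<psi>_inj: "i \<ge> 1 \<Longrightarrow> inj_on (\<psi> i) (Yp i)"
  and \<psi>_orbit: "i \<ge> 1 \<Longrightarrow> y \<in> Yp i \<Longrightarrow> (y, \<psi> i y) \<in> orbit_rel \<Lambda> \<theta>"
  and \<psi>_image: "i \<ge> 1 \<Longrightarrow> A \<in> sets \<nu> \<Longrightarrow> A \<subseteq> Yp i \<Longrightarrow> \<psi> i ` A \<in> sets \<nu>"
    "i \<ge> 1 \<Longrightarrow> A \<in> sets \<nu> \<Longrightarrow> A \<subseteq> Yp i \<Longrightarrow> emeasure \<nu> (\<psi> i ` A) = emeasure \<nu> A"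
  using amp unfolding amplification_data_def by (blast, blast, blast, blast, blast, blast, blast, blast)

lemma Yp_disj: "i \<ge> 1 \<Longrightarrow> j \<ge> 1 \<Longrightarrow> y \<in> Yp i \<Longrightarrow> y \<in> Yp j \<Longrightarrow> i = j"
proof -
  assume i: "i \<ge> 1" "j \<ge> 1" "y \<in> Yp i" "y \<in> Yp j"
  have "disjoint_family_on Yp {1..}" using amp unfolding amplification_data_def by blast
  then show "i = j" using i disjoint_family_onD[of Yp "{1..}" i j] by (cases "i = j") auto
qed

lemma \<psi>_Y0: "i \<ge> 1 \<Longrightarrow> y \<in> Yp i \<Longrightarrow> \<psi> i y \<in> Y0"
proof -
  assume i: "i \<ge> 1" and y: "y \<in> Yp i"
  have "\<psi> i \<in> measurable (restrict_space \<nu> (Yp i)) (restrict_space \<nu> Y0)"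
    using amp i unfolding amplification_data_def by blast
  from measurable_space[OF this, of y] y show "\<psi> i y \<in> Y0"
    by (simp add: space_restrict_space space_\<nu>)
qed

lemma Xn_iff: "(x, i) \<in> Xn \<longleftrightarrow> i \<ge> 1 \<and> \<Delta> x \<in> \<psi> i ` Yp i"
  by (simp add: amp_set_def)

lemma D_apply: "D (x, i) = inv_into (Yp i) (\<psi> i) (\<Delta> x)"
  by (simp add: amp_map_def)

lemma D_Yp: "(x, i) \<in> Xn \<Longrightarrow> D (x, i) \<in> Yp i" "(x, i) \<in> Xn \<Longrightarrow> \<psi> i (D (x, i)) = \<Delta> x"
  by (auto simp: Xn_iff D_apply inv_into_into f_inv_into_f)

lemma D_eq: "i \<ge> 1 \<Longrightarrow> y \<in> Yp i \<Longrightarrow> \<Delta> x = \<psi> i y \<Longrightarrow> (x, i) \<in> Xn \<and> D (x, i) = y"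
  using \<psi>_inj by (auto simp: Xn_iff D_apply)

lemma X1: "\<Delta> x \<in> Y0 \<Longrightarrow> (x, 1) \<in> Xn \<and> D (x, 1) = \<Delta> x"
  by (rule D_eq) (simp_all del: One_nat_def add: Yp_one)

lemma Rn_iff: "((x, i), (x', j)) \<in> Rn \<longleftrightarrow> (x, i) \<in> Xn \<and> (x', j) \<in> Xn \<and> (\<exists>g\<in>carrier \<Gamma>. x' = \<sigma> g x)"
  by (auto simp: amp_rel_def orbit_rel_def orbit_def)

text \<open>The pieces cover only almost every point. Requiring every translate to lie in some piece
  makes the condition invariant under \<open>\<theta>\<close>.\<close>

definition QY :: "'y \<Rightarrow> bool" where
  "QY y \<longleftrightarrow> LA.good y \<and> (\<forall>h\<in>carrier \<Lambda>. \<exists>i\<ge>1. \<theta> h y \<in> Yp i)"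

lemma AE_QY: "AE y in \<nu>. QY y"
  using LA.AE_T[OF Yp_cover] LA.AE_good by eventually_elim (simp add: QY_def)

lemma QY_\<theta>: "QY y \<Longrightarrow> h \<in> carrier \<Lambda> \<Longrightarrow> QY (\<theta> h y)"
  by (auto simp: QY_def \<theta>_mult LA.good_T)

text \<open>The bijection in \<open>local_OE\<close> is unfolded into orbits going into orbits,
  surjectivity onto the part in \<open>Y0\<close>, and injectivity, each phrased through group
  elements.\<close>

definition QX :: "'x \<Rightarrow> bool" where
  "QX t \<longleftrightarrow> \<Delta> t \<in> Y0 \<and> QY (\<Delta> t) \<and> GA.good t \<and>
     (\<forall>g\<in>carrier \<Gamma>. \<exists>h\<in>carrier \<Lambda>. \<Delta> (\<sigma> g t) = \<theta> h (\<Delta> t)) \<and>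
     (\<forall>h\<in>carrier \<Lambda>. \<theta> h (\<Delta> t) \<in> Y0 \<longrightarrow> (\<exists>g\<in>carrier \<Gamma>. \<Delta> (\<sigma> g t) = \<theta> h (\<Delta> t))) \<and>
     (\<forall>g\<in>carrier \<Gamma>. \<forall>g'\<in>carrier \<Gamma>. \<Delta> (\<sigma> g t) = \<Delta> (\<sigma> g' t) \<longrightarrow> \<sigma> g t = \<sigma> g' t)"

lemma AE_QX: "AE t in \<mu>. QX t"
proof -
  have "AE t in \<mu>. bij_betw \<Delta> (orbit_rel \<Gamma> \<sigma> `` {t}) (restrict_rel (orbit_rel \<Lambda> \<theta>) Y0 `` {\<Delta> t})"
    using loc by (simp add: local_OE_def)
  then show ?thesis
    using AE_uniform_measure_trans[OF \<Delta>_mp Y0 AE_QY] AE_uniform_measure_in[OF \<Delta>_mp Y0] GA.AE_good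
  proof eventually_elim
    fix t assume b: "bij_betw \<Delta> (orbit_rel \<Gamma> \<sigma> `` {t}) (restrict_rel (orbit_rel \<Lambda> \<theta>) Y0 `` {\<Delta> t})"
      and q: "QY (\<Delta> t)" "\<Delta> t \<in> Y0" "GA.good t"
    have o: "orbit_rel \<Gamma> \<sigma> `` {t} = {\<sigma> g t | g. g \<in> carrier \<Gamma>}"
      by (auto simp: orbit_rel_def orbit_def)
    have o': "restrict_rel (orbit_rel \<Lambda> \<theta>) Y0 `` {\<Delta> t} = {\<theta> h (\<Delta> t) | h. h \<in> carrier \<Lambda> \<and> \<theta> h (\<Delta> t) \<in> Y0}"
      using q(2) by (auto simp: restrict_rel_def orbit_rel_def orbit_def)
    have im: "\<Delta> ` {\<sigma> g t | g. g \<in> carrier \<Gamma>} = {\<theta> h (\<Delta> t) | h. h \<in> carrier \<Lambda> \<and> \<theta> h (\<Delta> t) \<in> Y0}"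
      and inj: "inj_on \<Delta> {\<sigma> g t | g. g \<in> carrier \<Gamma>}"
      using b unfolding o o' by (auto simp: bij_betw_def)
    have 1: "\<forall>g\<in>carrier \<Gamma>. \<exists>h\<in>carrier \<Lambda>. \<Delta> (\<sigma> g t) = \<theta> h (\<Delta> t)"
    proof
      fix g assume "g \<in> carrier \<Gamma>"
      then have "\<Delta> (\<sigma> g t) \<in> \<Delta> ` {\<sigma> g t | g. g \<in> carrier \<Gamma>}" by blast
      then show "\<exists>h\<in>carrier \<Lambda>. \<Delta> (\<sigma> g t) = \<theta> h (\<Delta> t)" unfolding im by blast
    qed
    have 2: "\<forall>h\<in>carrier \<Lambda>. \<theta> h (\<Delta> t) \<in> Y0 \<longrightarrow> (\<exists>g\<in>carrier \<Gamma>. \<Delta> (\<sigma> g t) = \<theta> h (\<Delta> t))"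
    proof (intro ballI impI)
      fix h assume "h \<in> carrier \<Lambda>" "\<theta> h (\<Delta> t) \<in> Y0"
      then have "\<theta> h (\<Delta> t) \<in> \<Delta> ` {\<sigma> g t | g. g \<in> carrier \<Gamma>}" unfolding im by blast
      then show "\<exists>g\<in>carrier \<Gamma>. \<Delta> (\<sigma> g t) = \<theta> h (\<Delta> t)" by force
    qed
    have 3: "\<forall>g\<in>carrier \<Gamma>. \<forall>g'\<in>carrier \<Gamma>. \<Delta> (\<sigma> g t) = \<Delta> (\<sigma> g' t) \<longrightarrow> \<sigma> g t = \<sigma> g' t"
      using inj unfolding inj_on_def by blast
    show "QX t" unfolding QX_def using q 1 2 3 by blast
  qed
qed

definition Q :: "'x \<Rightarrow> bool" where "Q t \<longleftrightarrow> (\<forall>g\<in>carrier \<Gamma>. QX (\<sigma> g t))"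

lemma AE_Q: "AE t in \<mu>. Q t"
  unfolding Q_def by (rule GA.AE_T[OF AE_QX])

lemma Q_QX: "Q t \<Longrightarrow> QX t"
  unfolding Q_def using \<sigma>_one GA.L.one_closed by metis

lemma Q_\<sigma>: "Q t \<Longrightarrow> g \<in> carrier \<Gamma> \<Longrightarrow> Q (\<sigma> g t)"
  unfolding Q_def by (simp add: \<sigma>_mult)

lemma Q_facts:
  assumes "Q t"
  shows "\<Delta> t \<in> Y0" "QY (\<Delta> t)" "GA.good t"
    and "g \<in> carrier \<Gamma> \<Longrightarrow> \<exists>h\<in>carrier \<Lambda>. \<Delta> (\<sigma> g t) = \<theta> h (\<Delta> t)"
    and "h \<in> carrier \<Lambda> \<Longrightarrow> \<theta> h (\<Delta> t) \<in> Y0 \<Longrightarrow> \<exists>g\<in>carrier \<Gamma>. \<Delta> (\<sigma> g t) = \<theta> h (\<Delta> t)"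
    and "g \<in> carrier \<Gamma> \<Longrightarrow> g' \<in> carrier \<Gamma> \<Longrightarrow> \<Delta> (\<sigma> g t) = \<Delta> (\<sigma> g' t) \<Longrightarrow> \<sigma> g t = \<sigma> g' t"
  using Q_QX[OF assms] unfolding QX_def by blast+

definition QN :: "'x \<times> nat \<Rightarrow> bool" where "QN s \<longleftrightarrow> s \<in> Xn \<and> Q (fst s)"

lemma QN_D:
  assumes "QN (x, i)"
  obtains h where "h \<in> carrier \<Lambda>" "D (x, i) = \<theta> h (\<Delta> x)" "\<Delta> x = \<theta> (inv h) (D (x, i))"
proof -
  have s: "(x, i) \<in> Xn" and q: "Q x" using assms by (auto simp: QN_def)
  have "(D (x, i), \<psi> i (D (x, i))) \<in> orbit_rel \<Lambda> \<theta>"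
    using s D_Yp(1)[OF s] by (intro \<psi>_orbit) (auto simp: Xn_iff)
  then obtain k where k: "k \<in> carrier \<Lambda>" "\<Delta> x = \<theta> k (D (x, i))"
    using D_Yp(2)[OF s] by (auto simp: orbit_rel_def orbit_def)
  have "D (x, i) = \<theta> (inv k) (\<Delta> x)" using k by (simp add: \<theta>_mult \<theta>_one)
  then show thesis using that[of "inv k"] k by simp
qed

lemma QN_QY: "QN (x, i) \<Longrightarrow> QY (D (x, i))"
proof -
  assume s: "QN (x, i)"
  obtain h where "h \<in> carrier \<Lambda>" "D (x, i) = \<theta> h (\<Delta> x)" by (rule QN_D[OF s])
  moreover have "QY (\<Delta> x)" using s by (simp add: QN_def Q_facts(2))
  ultimately show "QY (D (x, i))" by (simp add: QY_\<theta>)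
qed

text \<open>The value of \<open>D\<close> determines the index, since the pieces are disjoint. Then
  \<open>\<psi>\<close> recovers \<open>\<Delta>\<close>, which is injective on the
  \<open>\<Gamma>\<close>-orbit.\<close>

lemma QN_unique:
  assumes s: "QN s" and 1: "(s, s1) \<in> Rn" and 2: "(s, s2) \<in> Rn" and D: "D s1 = D s2"
  shows "s1 = s2"
proof -
  obtain x i where x: "s = (x, i)" by (cases s)
  obtain x1 i1 where x1: "s1 = (x1, i1)" by (cases s1)
  obtain x2 i2 where x2: "s2 = (x2, i2)" by (cases s2)
  obtain g1 where g1: "g1 \<in> carrier \<Gamma>" "x1 = \<sigma> g1 x" and m1: "(x1, i1) \<in> Xn" using 1 by (auto simp: x x1 Rn_iff)
  obtain g2 where g2: "g2 \<in> carrier \<Gamma>" "x2 = \<sigma> g2 x" and m2: "(x2, i2) \<in> Xn" using 2 by (auto simp: x x2 Rn_iff)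
  have i: "i1 = i2"
    using Yp_disj[of i1 i2 "D s1"] D_Yp(1)[OF m1] D_Yp(1)[OF m2] m1 m2 D by (simp add: x1 x2 Xn_iff)
  have "\<Delta> x1 = \<Delta> x2" using D_Yp(2)[OF m1] D_Yp(2)[OF m2] D i by (simp add: x1 x2)
  then have "x1 = x2" using Q_facts(6)[of x g1 g2] s g1 g2 by (simp add: QN_def x)
  then show ?thesis using i by (simp add: x1 x2)
qed

text \<open>The wanted image lies in some piece; its partial map \<open>\<psi>\<close> leads along
  the orbit into \<open>Y0\<close>, where \<open>\<Delta>\<close> is onto from the
  \<open>\<Gamma>\<close>-orbit. The index of the piece becomes the second coordinate.\<close>

lemma QN_exists:
  assumes s: "QN s" and h: "h \<in> carrier \<Lambda>"
  shows "\<exists>s'. (s, s') \<in> Rn \<and> D s' = \<theta> h (D s)"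
proof -
  obtain x i where x: "s = (x, i)" by (cases s)
  have q: "Q x" "(x, i) \<in> Xn" using s by (auto simp: QN_def x)
  obtain k where k: "k \<in> carrier \<Lambda>" "D (x, i) = \<theta> k (\<Delta> x)" using QN_D s x by metis
  define y where "y = \<theta> h (D s)"
  obtain j where j: "j \<ge> 1" "y \<in> Yp j" using QN_QY s h unfolding QY_def y_def x by blast
  obtain l where l: "l \<in> carrier \<Lambda>" "\<psi> j y = \<theta> l y"
    using \<psi>_orbit[OF j] by (auto simp: orbit_rel_def orbit_def)
  have e: "\<psi> j y = \<theta> (l \<otimes> (h \<otimes> k)) (\<Delta> x)" using l h k by (simp add: y_def x \<theta>_mult)
  then obtain g where g: "g \<in> carrier \<Gamma>" "\<Delta> (\<sigma> g x) = \<psi> j y"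
    using Q_facts(5)[OF q(1), of "l \<otimes> (h \<otimes> k)"] \<psi>_Y0[OF j] l h k by auto
  have "(\<sigma> g x, j) \<in> Xn \<and> D (\<sigma> g x, j) = y" by (rule D_eq[OF j g(2)])
  then show ?thesis using q g by (intro exI[of _ "(\<sigma> g x, j)"]) (auto simp: x Rn_iff y_def)
qed

section \<open>The pulled back action\<close>

lemma \<theta>'_eq:
  assumes s: "QN s" and "(s, s') \<in> Rn" "D s' = \<theta> h (D s)"
  shows "\<theta>' h s = s'"
  unfolding pull_back_def
  by (rule the_unique_eq) (use assms QN_unique[OF s] in auto)

lemma \<theta>'_facts:
  assumes s: "QN s" and h: "h \<in> carrier \<Lambda>"
  shows "(s, \<theta>' h s) \<in> Rn" "D (\<theta>' h s) = \<theta> h (D s)" "QN (\<theta>' h s)"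
proof -
  obtain s' where s': "(s, s') \<in> Rn" "D s' = \<theta> h (D s)" using QN_exists[OF s h] by blast
  then have e: "\<theta>' h s = s'" by (rule \<theta>'_eq[OF s])
  show "(s, \<theta>' h s) \<in> Rn" "D (\<theta>' h s) = \<theta> h (D s)" using s' e by auto
  obtain x i where x: "s = (x, i)" by (cases s)
  obtain x' i' where x': "s' = (x', i')" by (cases s')
  have "QN s'" using s'(1) s Q_\<sigma> by (auto simp: QN_def x x' Rn_iff)
  then show "QN (\<theta>' h s)" using e by simp
qed

lemma Rn_trans: "(s, s') \<in> Rn \<Longrightarrow> (s', s'') \<in> Rn \<Longrightarrow> (s, s'') \<in> Rn"
  by (cases s; cases s'; cases s'') (auto simp: Rn_iff \<sigma>_mult)

lemma Rn_refl: "s \<in> Xn \<Longrightarrow> (s, s) \<in> Rn"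
  by (cases s) (auto simp: Rn_iff \<sigma>_one intro!: bexI[of _ "\<one>\<^bsub>\<Gamma>\<^esub>"])

text \<open>Both sides lie in the orbit of \<open>s\<close> and have the same image under
  \<open>D\<close>, and such a point is unique.\<close>

lemma \<theta>'_mult:
  assumes s: "QN s" and h: "h \<in> carrier \<Lambda>" and k: "k \<in> carrier \<Lambda>"
  shows "\<theta>' h (\<theta>' k s) = \<theta>' (h \<otimes> k) s"
proof -
  note f = \<theta>'_facts[OF s k]
  note f' = \<theta>'_facts[OF f(3) h]
  show ?thesis
    by (rule \<theta>'_eq[OF s Rn_trans[OF f(1) f'(1)], symmetric]) (simp add: f(2) f'(2) \<theta>_mult h k)
qed

lemma \<theta>'_one: "QN s \<Longrightarrow> \<theta>' \<one> s = s"
  by (rule \<theta>'_eq) (auto simp: \<theta>_one QN_def Rn_refl)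

lemma \<theta>'_free: "QN s \<Longrightarrow> h \<in> carrier \<Lambda> \<Longrightarrow> \<theta>' h s = s \<Longrightarrow> h = \<one>"
  using \<theta>'_facts(2)[of s h] QN_QY[of "fst s" "snd s"] by (auto simp: QY_def LA.good_def)

section \<open>The amplified measure\<close>

lemma level_Xn: "{x. (x, i) \<in> Xn} \<in> sets \<mu>"
proof (cases "i \<ge> 1")
  case True
  have "\<psi> i ` Yp i \<in> sets \<nu>" by (rule \<psi>_image(1)[OF True Yp_sets[OF True]]) simp
  from measurable_sets[OF \<Delta>_meas this] show ?thesis
    using True by (simp add: Xn_iff space_\<mu> vimage_def)
qed (simp add: Xn_iff)

lemma \<kappa>_setsI:
  assumes "\<And>i. {x. (x, i) \<in> A} \<in> sets \<mu>"
  shows "A \<in> sets \<kappa>"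
proof -
  have "(\<lambda>p. p \<in> A) \<in> measurable \<kappa> (count_space UNIV)"
  proof (rule measurable_pair_countable)
    fix i :: nat
    show "(\<lambda>x. (x, i) \<in> A) \<in> measurable \<mu> (count_space UNIV)"
      using assms[of i] by (simp add: pred_def[symmetric] space_\<mu> Measurable.pred_def)
  qed simp
  then show ?thesis by (simp add: pred_def Measurable.pred_def space_pair_measure space_\<mu>)
qed

lemma Xn_sets: "Xn \<in> sets \<kappa>"
  by (rule \<kappa>_setsI) (rule level_Xn)

lemma space_\<kappa>: "space \<kappa> = UNIV"
  by (simp add: space_pair_measure space_\<mu>)

lemma space_\<mu>n: "space \<mu>n = Xn"
  by (simp add: amp_measure_def space_scale_measure space_restrict_space space_\<kappa>)

lemma sets_\<mu>n: "A \<in> sets \<mu>n \<longleftrightarrow> A \<in> sets \<kappa> \<and> A \<subseteq> Xn"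
  using Xn_sets by (simp add: amp_measure_def sets_restrict_space_iff space_\<kappa> conj_commute)

lemma n_inv: "1 / n = measure \<nu> Y0" by (simp add: n)

lemma nn_integral_\<kappa>:
  assumes "f \<in> borel_measurable \<kappa>"
  shows "(\<integral>\<^sup>+s. f s \<partial>\<kappa>) = (\<integral>\<^sup>+x. (\<integral>\<^sup>+i. f (x, i) \<partial>count_space UNIV) \<partial>\<mu>)"
proof -
  interpret C: sigma_finite_measure "count_space (UNIV :: nat set)"
    by (rule sigma_finite_measure_count_space_countable) simp
  show ?thesis using C.nn_integral_fst[OF assms] by simp
qed

lemma \<mu>n_measurable:
  assumes "f \<in> borel_measurable \<mu>n"
  shows "(\<lambda>s. if s \<in> Xn then f s else 0 :: ennreal) \<in> borel_measurable \<kappa>"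
proof -
  have "f \<in> borel_measurable (restrict_space \<kappa> Xn)"
    using assms by (simp add: amp_measure_def cong: measurable_cong_sets)
  then have "(\<lambda>s. f s * indicator Xn s) \<in> borel_measurable \<kappa>"
    using borel_measurable_restrict_space_iff_ennreal[of Xn \<kappa> f] Xn_sets by (simp add: space_\<kappa>)
  also have "(\<lambda>s. f s * indicator Xn s) = (\<lambda>s. if s \<in> Xn then f s else 0)" by (auto simp: indicator_def)
  finally show ?thesis .
qed

lemma nn_integral_\<mu>n:
  assumes f: "f \<in> borel_measurable \<mu>n"
  shows "(\<integral>\<^sup>+s. f s \<partial>\<mu>n) = ennreal (1 / n) * (\<integral>\<^sup>+x. (\<integral>\<^sup>+i. f (x, i) \<partial>count_space {i. (x, i) \<in> Xn}) \<partial>\<mu>)"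
proof -
  have f': "f \<in> borel_measurable (restrict_space \<kappa> Xn)"
    using f by (simp add: amp_measure_def cong: measurable_cong_sets)
  have "(\<integral>\<^sup>+s. f s \<partial>\<mu>n) = ennreal (1 / n) * (\<integral>\<^sup>+s. f s \<partial>restrict_space \<kappa> Xn)"
    unfolding amp_measure_def by (rule nn_integral_scale_measure[OF f'])
  also have "(\<integral>\<^sup>+s. f s \<partial>restrict_space \<kappa> Xn) = (\<integral>\<^sup>+s. f s * indicator Xn s \<partial>\<kappa>)"
    by (rule nn_integral_restrict_space) (use Xn_sets in \<open>simp add: space_\<kappa>\<close>)
  also have "\<dots> = (\<integral>\<^sup>+s. (if s \<in> Xn then f s else 0) \<partial>\<kappa>)"
    by (rule nn_integral_cong) simp
  also have "\<dots> = (\<integral>\<^sup>+x. (\<integral>\<^sup>+i. (if (x, i) \<in> Xn then f (x, i) else 0) \<partial>count_space UNIV) \<partial>\<mu>)"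
    by (rule nn_integral_\<kappa>[OF \<mu>n_measurable[OF f]])
  also have "\<dots> = (\<integral>\<^sup>+x. (\<integral>\<^sup>+i. f (x, i) \<partial>count_space {i. (x, i) \<in> Xn}) \<partial>\<mu>)"
    using nn_integral_count_space_subset_eq[of "{i. (x, i) \<in> Xn}" UNIV "\<lambda>i. f (x, i)" for x] by simp
  finally show ?thesis .
qed

lemma AE_\<mu>n:
  assumes "AE x in \<mu>. \<forall>i. (x, i) \<in> Xn \<longrightarrow> P (x, i)"
  shows "AE s in \<mu>n. P s"
proof -
  obtain N where N: "N \<in> sets \<mu>" "emeasure \<mu> N = 0" "{x \<in> space \<mu>. \<not> (\<forall>i. (x, i) \<in> Xn \<longrightarrow> P (x, i))} \<subseteq> N"
    using assms by (auto elim: AE_E)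
  have NX: "(N \<times> UNIV) \<inter> Xn \<in> sets \<mu>n" using N(1) Xn_sets by (simp add: sets_\<mu>n)
  have "emeasure \<mu>n ((N \<times> UNIV) \<inter> Xn) = (\<integral>\<^sup>+s. indicator ((N \<times> UNIV) \<inter> Xn) s \<partial>\<mu>n)" using NX by simp
  also have "\<dots> = ennreal (1 / n) * (\<integral>\<^sup>+x. (\<integral>\<^sup>+i. indicator ((N \<times> UNIV) \<inter> Xn) (x, i) \<partial>count_space {i. (x, i) \<in> Xn}) \<partial>\<mu>)"
    by (rule nn_integral_\<mu>n) (use NX in simp)
  also have "(\<integral>\<^sup>+x. (\<integral>\<^sup>+i. indicator ((N \<times> UNIV) \<inter> Xn) (x, i) \<partial>count_space {i. (x, i) \<in> Xn}) \<partial>\<mu>) = (\<integral>\<^sup>+x. 0 \<partial>\<mu>)"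
  proof (rule nn_integral_cong_AE)
    have "AE x in \<mu>. x \<notin> N" using N by (intro AE_not_in) auto
    then show "AE x in \<mu>. (\<integral>\<^sup>+i. indicator ((N \<times> UNIV) \<inter> Xn) (x, i) \<partial>count_space {i. (x, i) \<in> Xn}) = 0"
      by eventually_elim simp
  qed
  finally have "emeasure \<mu>n ((N \<times> UNIV) \<inter> Xn) = 0" by simp
  moreover have "{s \<in> space \<mu>n. \<not> P s} \<subseteq> (N \<times> UNIV) \<inter> Xn"
    using N(3) by (auto simp: space_\<mu>n space_\<mu>)
  ultimately show ?thesis by (intro AE_I[OF _ _ NX])
qed

lemma AE_QN: "AE s in \<mu>n. QN s"
  by (rule AE_\<mu>n) (use AE_Q in eventually_elim, simp add: QN_def)

text \<open>The level of index \<open>i\<close> has measure \<open>\<nu> (Yp i) / \<nu> Y0\<close>,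
  because \<open>\<psi> i\<close> preserves measure and \<open>\<Delta>\<close> pushes
  \<open>\<mu>\<close> to the normalised measure on \<open>Y0\<close>. The pieces exhaust
  \<open>Y\<close>, so the levels sum to \<open>n\<close>, and the scaling by \<open>1 / n\<close>
  gives 1.\<close>

lemma \<mu>n_prob: "prob_space \<mu>n"
proof
  have YU: "emeasure \<mu> {x. (x, i) \<in> Xn} = emeasure \<nu> (Yp i) / emeasure \<nu> Y0" if i: "i \<ge> 1" for i
  proof -
    have im: "\<psi> i ` Yp i \<in> sets \<nu>" by (rule \<psi>_image(1)[OF i Yp_sets[OF i]]) simp
    have "emeasure \<mu> {x. (x, i) \<in> Xn} = emeasure \<mu> (\<Delta> -` (\<psi> i ` Yp i) \<inter> space \<mu>)"
      using i by (simp add: Xn_iff space_\<mu> vimage_def)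
    also have "\<dots> = emeasure (distr \<mu> (uniform_measure \<nu> Y0) \<Delta>) (\<psi> i ` Yp i)"
      using \<Delta>_mp im by (subst emeasure_distr) (auto simp: mp_map_def)
    also have "\<dots> = emeasure (uniform_measure \<nu> Y0) (\<psi> i ` Yp i)" using \<Delta>_mp by (simp only: mp_map_def)
    also have "\<dots> = emeasure \<nu> (Y0 \<inter> \<psi> i ` Yp i) / emeasure \<nu> Y0"
      using Y0 im by (rule emeasure_uniform_measure)
    also have "Y0 \<inter> \<psi> i ` Yp i = \<psi> i ` Yp i" using \<psi>_Y0[OF i] by auto
    also have "emeasure \<nu> (\<psi> i ` Yp i) = emeasure \<nu> (Yp i)" by (rule \<psi>_image(2)[OF i Yp_sets[OF i]]) simp
    finally show ?thesis .
  qed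
  have "emeasure \<mu>n (space \<mu>n) = (\<integral>\<^sup>+s. 1 \<partial>\<mu>n)" by simp
  also have "\<dots> = ennreal (1 / n) * (\<integral>\<^sup>+x. (\<integral>\<^sup>+i. 1 \<partial>count_space {i. (x, i) \<in> Xn}) \<partial>\<mu>)"
    by (rule nn_integral_\<mu>n) simp
  also have "(\<integral>\<^sup>+x. (\<integral>\<^sup>+i. 1 \<partial>count_space {i. (x, i) \<in> Xn}) \<partial>\<mu>) =
      (\<integral>\<^sup>+x. (\<integral>\<^sup>+i. (if (x, i) \<in> Xn then 1 else 0) \<partial>count_space UNIV) \<partial>\<mu>)"
    using nn_integral_count_space_subset_eq[of "{i. (x, i) \<in> Xn}" UNIV "\<lambda>i. 1" for x] by simp
  also have "\<dots> = (\<integral>\<^sup>+i. (\<integral>\<^sup>+x. (if (x, i) \<in> Xn then 1 else 0) \<partial>\<mu>) \<partial>count_space UNIV)"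
    by (rule nn_integral_count_swap[OF GA.PZ.sigma_finite_measure_axioms])
       (use level_Xn in \<open>auto intro!: measurable_If simp: space_\<mu>\<close>)
  also have "\<dots> = (\<integral>\<^sup>+i. (\<integral>\<^sup>+y. (if i \<ge> 1 \<and> y \<in> Yp i then 1 else 0) \<partial>\<nu>) / emeasure \<nu> Y0 \<partial>count_space UNIV)"
  proof (rule nn_integral_cong)
    fix i :: nat
    have "(\<integral>\<^sup>+x. (if (x, i) \<in> Xn then 1 else 0) \<partial>\<mu>) = (\<integral>\<^sup>+x. indicator {x. (x, i) \<in> Xn} x \<partial>\<mu>)"
      by (rule nn_integral_cong) (simp add: indicator_def)
    also have "\<dots> = emeasure \<mu> {x. (x, i) \<in> Xn}" using level_Xn by simp
    also have "\<dots> = (\<integral>\<^sup>+y. (if i \<ge> 1 \<and> y \<in> Yp i then 1 else 0) \<partial>\<nu>) / emeasure \<nu> Y0"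
    proof (cases "i \<ge> 1")
      case True
      have "(\<integral>\<^sup>+y. (if i \<ge> 1 \<and> y \<in> Yp i then 1 else 0) \<partial>\<nu>) = (\<integral>\<^sup>+y. indicator (Yp i) y \<partial>\<nu>)"
        using True by (intro nn_integral_cong) (simp add: indicator_def)
      also have "\<dots> = emeasure \<nu> (Yp i)" using Yp_sets[OF True] by simp
      finally show ?thesis using YU[OF True] by simp
    qed (simp add: Xn_iff)
    finally show "(\<integral>\<^sup>+x. (if (x, i) \<in> Xn then 1 else 0) \<partial>\<mu>) =
      (\<integral>\<^sup>+y. (if i \<ge> 1 \<and> y \<in> Yp i then 1 else 0) \<partial>\<nu>) / emeasure \<nu> Y0" .
  qed
  also have "\<dots> = (\<integral>\<^sup>+i. (\<integral>\<^sup>+y. (if i \<ge> 1 \<and> y \<in> Yp i then 1 else 0) \<partial>\<nu>) \<partial>count_space UNIV) / emeasure \<nu> Y0"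
    by (rule nn_integral_divide) simp
  also have "(\<integral>\<^sup>+i. (\<integral>\<^sup>+y. (if i \<ge> 1 \<and> y \<in> Yp i then 1 else 0) \<partial>\<nu>) \<partial>count_space UNIV) =
      (\<integral>\<^sup>+y. (\<integral>\<^sup>+i. (if i \<ge> 1 \<and> y \<in> Yp i then 1 else 0) \<partial>count_space UNIV) \<partial>\<nu>)"
  proof (rule nn_integral_count_swap[OF LA.PZ.sigma_finite_measure_axioms, symmetric])
    fix i :: nat
    have "{y \<in> space \<nu>. i \<ge> 1 \<and> y \<in> Yp i} \<in> sets \<nu>"
      using Yp_sets[of i] by (cases "i \<ge> 1") (auto simp: space_\<nu>)
    then show "(\<lambda>y. if i \<ge> 1 \<and> y \<in> Yp i then 1 else (0 :: ennreal)) \<in> borel_measurable \<nu>"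
      by (rule measurable_If[OF borel_measurable_const borel_measurable_const])
  qed simp
  also have "\<dots> = (\<integral>\<^sup>+y. 1 \<partial>\<nu>)"
  proof (rule nn_integral_cong_AE)
    show "AE y in \<nu>. (\<integral>\<^sup>+i. (if i \<ge> 1 \<and> y \<in> Yp i then 1 else 0) \<partial>count_space UNIV) = 1"
      using Yp_cover
    proof eventually_elim
      fix y assume "\<exists>i\<ge>1. y \<in> Yp i"
      then obtain i where i: "i \<ge> 1" "y \<in> Yp i" by blast
      have "(\<integral>\<^sup>+j. (if j \<ge> 1 \<and> y \<in> Yp j then 1 else 0) \<partial>count_space UNIV) =
          (\<integral>\<^sup>+j. (if j \<in> {i} then 1 else 0) \<partial>count_space UNIV)"
        by (rule nn_integral_cong) (use i Yp_disj in auto)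
      also have "\<dots> = 1" by (subst nn_integral_count_space_subset) auto
      finally show "(\<integral>\<^sup>+i. (if i \<ge> 1 \<and> y \<in> Yp i then 1 else 0) \<partial>count_space UNIV) = 1" .
    qed
  qed
  also have "\<dots> = 1" by (simp add: LA.PZ.emeasure_space_1)
  also have "ennreal (1 / n) * (1 / emeasure \<nu> Y0) = 1"
    unfolding n_inv LA.PZ.emeasure_eq_measure using Y0_pos
    by (simp add: divide_ennreal[of 1, simplified] ennreal_mult[symmetric])
  finally show "emeasure \<mu>n (space \<mu>n) = 1" .
qed

text \<open>Outside \<open>Xn\<close> the value of \<open>inv_into\<close> is unspecified; a
  constant there gives a measurable map on the whole product.\<close>

definition D0 :: "'x \<times> nat \<Rightarrow> 'y" where "D0 s = (if s \<in> Xn then D s else undefined)"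

lemma D0_meas: "D0 \<in> measurable \<kappa> \<nu>"
proof (rule measurable_pair_countable)
  fix i :: nat
  show "(\<lambda>x. D0 (x, i)) \<in> measurable \<mu> \<nu>"
  proof (rule measurableI)
    fix A assume A: "A \<in> sets \<nu>"
    have "(\<lambda>x. D0 (x, i)) -` A \<inter> space \<mu> =
        {x. (x, i) \<in> Xn \<and> D (x, i) \<in> A} \<union> (if undefined \<in> A then - {x. (x, i) \<in> Xn} else {})"
      by (auto simp: D0_def space_\<mu> split: if_splits)
    moreover have "{x. (x, i) \<in> Xn \<and> D (x, i) \<in> A} \<in> sets \<mu>"
    proof (cases "i \<ge> 1")
      case True
      \<comment> \<open>The preimage under the inverse of \<open>\<psi> i\<close> is an image under
        \<open>\<psi> i\<close>, and the amplification data guarantee that such images are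
        measurable.\<close>
      have "{x. (x, i) \<in> Xn \<and> D (x, i) \<in> A} = \<Delta> -` (\<psi> i ` (A \<inter> Yp i)) \<inter> space \<mu>"
      proof (intro equalityI subsetI)
        fix x assume "x \<in> {x. (x, i) \<in> Xn \<and> D (x, i) \<in> A}"
        then have x: "(x, i) \<in> Xn" "D (x, i) \<in> A" by auto
        then have "\<Delta> x = \<psi> i (D (x, i))" "D (x, i) \<in> A \<inter> Yp i" using D_Yp[OF x(1)] by auto
        then show "x \<in> \<Delta> -` (\<psi> i ` (A \<inter> Yp i)) \<inter> space \<mu>" by (auto simp: space_\<mu>)
      next
        fix x assume "x \<in> \<Delta> -` (\<psi> i ` (A \<inter> Yp i)) \<inter> space \<mu>"
        then obtain y where "y \<in> A" "y \<in> Yp i" "\<Delta> x = \<psi> i y" by auto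
        then show "x \<in> {x. (x, i) \<in> Xn \<and> D (x, i) \<in> A}" using D_eq[OF True] by auto
      qed
      moreover have "\<psi> i ` (A \<inter> Yp i) \<in> sets \<nu>"
        using \<psi>_image(1)[OF True, of "A \<inter> Yp i"] A Yp_sets[OF True] by auto
      ultimately show ?thesis using measurable_sets[OF \<Delta>_meas] by simp
    qed (simp add: Xn_iff)
    moreover have "- {x. (x, i) \<in> Xn} \<in> sets \<mu>"
      using sets.compl_sets[OF level_Xn[of i]] by (simp add: space_\<mu> Compl_eq_Diff_UNIV)
    ultimately show "(\<lambda>x. D0 (x, i)) -` A \<inter> space \<mu> \<in> sets \<mu>" by auto
  qed (simp add: space_\<nu>)
qed simp

text \<open>Points in the orbit of \<open>(x, i)\<close> are reached by countably many measurable
  moves, a group element together with a new index. This makes the measurability of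
  \<open>\<theta>'\<close>, which is defined by a unique choice, a countable matter.\<close>

definition move :: "'g \<times> nat \<Rightarrow> 'x \<times> nat \<Rightarrow> 'x \<times> nat" where
  "move = (\<lambda>(g, j) (x, i). (\<sigma> g x, j))"

abbreviation "Ix \<equiv> carrier \<Gamma> \<times> (UNIV :: nat set)"

lemma cnt_Ix: "countable Ix" using GA.cnt by simp

lemma move_meas: "q \<in> Ix \<Longrightarrow> move q \<in> measurable \<kappa> \<kappa>"
proof -
  assume "q \<in> Ix"
  then obtain g j where q: "q = (g, j)" "g \<in> carrier \<Gamma>" by (cases q) auto
  note [measurable] = GA.T_meas[OF q(2)]
  have "(\<lambda>p. (\<sigma> g (fst p), j)) \<in> measurable \<kappa> \<kappa>" by measurable
  then show ?thesis by (simp add: move_def q case_prod_beta')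
qed

definition hits :: "'h \<Rightarrow> 'g \<times> nat \<Rightarrow> 'x \<times> nat \<Rightarrow> bool" where
  "hits h q s \<longleftrightarrow> s \<in> Xn \<and> move q s \<in> Xn \<and> D0 (move q s) = \<theta> h (D0 s)"

lemma sets_borel_\<nu>: "measurable M \<nu> = measurable M borel" for M :: "'c measure"
  using \<nu>_std by (intro measurable_cong_sets) (auto simp: standard_prob_space_def)

lemma sets_borel_\<mu>: "measurable M \<mu> = measurable M borel" for M :: "'c measure"
  using \<mu>_std by (intro measurable_cong_sets) (auto simp: standard_prob_space_def)

text \<open>Equality of two measurable maps is a measurable condition when the target is a Polish
  space with its Borel sets.\<close>

lemma equality_\<nu>: "f \<in> measurable M \<nu> \<Longrightarrow> g \<in> measurable M \<nu> \<Longrightarrow> {x \<in> space M. f x = g x} \<in> sets M"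
  unfolding sets_borel_\<nu> by (rule measurable_equality_set)

lemma equality_\<mu>: "f \<in> measurable M \<mu> \<Longrightarrow> g \<in> measurable M \<mu> \<Longrightarrow> {x \<in> space M. f x = g x} \<in> sets M"
  unfolding sets_borel_\<mu> by (rule measurable_equality_set)

lemma hits_sets:
  assumes h: "h \<in> carrier \<Lambda>" and q: "q \<in> Ix"
  shows "{s \<in> space \<kappa>. hits h q s} \<in> sets \<kappa>"
proof -
  have "{s \<in> space \<kappa>. D0 (move q s) = \<theta> h (D0 s)} \<in> sets \<kappa>"
    by (rule equality_\<nu>[OF measurable_compose[OF move_meas[OF q] D0_meas] measurable_compose[OF D0_meas LA.T_meas[OF h]]])
  moreover have "{s \<in> space \<kappa>. move q s \<in> Xn} \<in> sets \<kappa>"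
    using measurable_sets[OF move_meas[OF q] Xn_sets] by (simp add: vimage_def space_\<kappa>)
  moreover have "{s \<in> space \<kappa>. s \<in> Xn} \<in> sets \<kappa>" using Xn_sets by (simp add: space_\<kappa>)
  ultimately show ?thesis unfolding hits_def by (intro sets.sets_Collect_conj)
qed

lemma hits_iff:
  assumes "s \<in> Xn"
  shows "(s, s') \<in> Rn \<and> D s' = \<theta> h (D s) \<longleftrightarrow> (\<exists>q\<in>Ix. s' = move q s \<and> hits h q s)"
  using assms by (cases s; cases s') (fastforce simp: Rn_iff hits_def move_def D0_def)

text \<open>The condition under which \<open>the_unique\<close> does not return its default.
  Uniqueness is asked of the point reached, as different moves may lead to the same point where
  freeness fails.\<close>

definition wd :: "'h \<Rightarrow> 'x \<times> nat \<Rightarrow> bool" where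
  "wd h s \<longleftrightarrow> (\<exists>q\<in>Ix. hits h q s) \<and> (\<forall>q\<in>Ix. \<forall>q'\<in>Ix. hits h q s \<longrightarrow> hits h q' s \<longrightarrow> move q s = move q' s)"

lemma move_eq_sets:
  assumes "q \<in> Ix" "q' \<in> Ix"
  shows "{s \<in> space \<kappa>. move q s = move q' s} \<in> sets \<kappa>"
proof -
  obtain g j where q: "q = (g, j)" "g \<in> carrier \<Gamma>" using assms by (cases q) auto
  obtain g' j' where q': "q' = (g', j')" "g' \<in> carrier \<Gamma>" using assms by (cases q') auto
  have "{s \<in> space \<kappa>. \<sigma> g (fst s) = \<sigma> g' (fst s)} \<in> sets \<kappa>"
    by (rule equality_\<mu>; rule measurable_compose[OF measurable_fst GA.T_meas]) (use q q' in auto)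
  moreover have "{s \<in> space \<kappa>. move q s = move q' s} = (if j = j' then {s \<in> space \<kappa>. \<sigma> g (fst s) = \<sigma> g' (fst s)} else {})"
    by (auto simp: move_def q q')
  ultimately show ?thesis by simp
qed

lemma wd_sets: "h \<in> carrier \<Lambda> \<Longrightarrow> {s \<in> space \<kappa>. wd h s} \<in> sets \<kappa>"
  unfolding wd_def
  by (intro sets.sets_Collect_conj sets.sets_Collect_countable_Ex' sets.sets_Collect_countable_All'
      sets.sets_Collect_imp hits_sets move_eq_sets cnt_Ix)

lemma \<theta>'_wd:
  assumes "s \<in> Xn"
  shows "wd h s \<Longrightarrow> q \<in> Ix \<Longrightarrow> hits h q s \<Longrightarrow> \<theta>' h s = move q s" "\<not> wd h s \<Longrightarrow> \<theta>' h s = s"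
proof -
  let ?P = "\<lambda>s'. (s, s') \<in> Rn \<and> D s' = \<theta> h (D s)"
  have iff: "?P s' \<longleftrightarrow> (\<exists>q\<in>Ix. s' = move q s \<and> hits h q s)" for s' by (rule hits_iff[OF assms])
  { assume w: "wd h s" and q: "q \<in> Ix" "hits h q s"
    have "\<exists>!s'. ?P s'"
    proof (rule ex1I[of _ "move q s"])
      show "?P (move q s)" unfolding iff using q by blast
      fix s' assume "?P s'"
      then show "s' = move q s" unfolding iff using w q unfolding wd_def by blast
    qed
    then show "\<theta>' h s = move q s"
      unfolding pull_back_def by (rule the_unique_eq) (use iff[of "move q s"] q in blast) }
  { assume w: "\<not> wd h s"
    have "\<not> (\<exists>!s'. ?P s')"
    proof
      assume e: "\<exists>!s'. ?P s'"
      then obtain s' where s': "?P s'" by blast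
      have "wd h s"
        unfolding wd_def
      proof (intro conjI ballI impI)
        show "\<exists>q\<in>Ix. hits h q s" using s' unfolding iff by blast
        fix q q' assume "q \<in> Ix" "q' \<in> Ix" "hits h q s" "hits h q' s"
        then have "?P (move q s)" "?P (move q' s)" unfolding iff by blast+
        then show "move q s = move q' s" using e by blast
      qed
      then show False using w by simp
    qed
    then show "\<theta>' h s = s" unfolding pull_back_def the_unique_def by (simp only: if_False) }
qed

lemma \<theta>'_Xn:
  assumes s: "s \<in> Xn"
  shows "\<theta>' h s \<in> Xn"
proof (cases "wd h s")
  case True
  then obtain q where q: "q \<in> Ix" "hits h q s" by (auto simp: wd_def)
  then show ?thesis using \<theta>'_wd(1)[OF s True q] by (simp add: hits_def)
qed (simp add: \<theta>'_wd(2)[OF s] s)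

text \<open>Where \<open>wd\<close> holds, \<open>\<theta>' h\<close> agrees with any move that
  hits; where it fails, with the identity. Each preimage is therefore built from countably many
  measurable conditions.\<close>

lemma \<theta>'_meas:
  assumes h: "h \<in> carrier \<Lambda>"
  shows "\<theta>' h \<in> measurable \<mu>n \<mu>n"
proof (rule measurableI)
  show "\<theta>' h s \<in> space \<mu>n" if "s \<in> space \<mu>n" for s using that by (simp add: space_\<mu>n \<theta>'_Xn)
  fix A assume "A \<in> sets \<mu>n"
  then have A: "A \<in> sets \<kappa>" "A \<subseteq> Xn" by (auto simp: sets_\<mu>n)
  have "\<theta>' h -` A \<inter> space \<mu>n = {s \<in> space \<kappa>. (wd h s \<and> (\<exists>q\<in>Ix. hits h q s \<and> move q s \<in> A)) \<or> (\<not> wd h s \<and> s \<in> A)}"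
  proof (intro equalityI subsetI)
    fix s assume "s \<in> \<theta>' h -` A \<inter> space \<mu>n"
    then have s: "s \<in> Xn" "\<theta>' h s \<in> A" by (auto simp: space_\<mu>n)
    show "s \<in> {s \<in> space \<kappa>. (wd h s \<and> (\<exists>q\<in>Ix. hits h q s \<and> move q s \<in> A)) \<or> (\<not> wd h s \<and> s \<in> A)}"
    proof (cases "wd h s")
      case True
      then obtain q where q: "q \<in> Ix" "hits h q s" by (auto simp: wd_def)
      then show ?thesis using \<theta>'_wd(1)[OF s(1) True q] True s by (auto simp: space_\<kappa>)
    qed (use \<theta>'_wd(2)[OF s(1)] s in \<open>auto simp: space_\<kappa>\<close>)
  next
    fix s assume s: "s \<in> {s \<in> space \<kappa>. (wd h s \<and> (\<exists>q\<in>Ix. hits h q s \<and> move q s \<in> A)) \<or> (\<not> wd h s \<and> s \<in> A)}"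
    show "s \<in> \<theta>' h -` A \<inter> space \<mu>n"
    proof (cases "wd h s")
      case True
      then obtain q where q: "q \<in> Ix" "hits h q s" "move q s \<in> A" using s by auto
      then have "s \<in> Xn" by (simp add: hits_def)
      then show ?thesis using \<theta>'_wd(1)[OF _ True q(1,2)] q by (simp add: space_\<mu>n)
    next
      case False
      then have "s \<in> A" using s by simp
      then show ?thesis using \<theta>'_wd(2)[OF _ False] A by (auto simp: space_\<mu>n)
    qed
  qed
  also have "\<dots> \<in> sets \<kappa>"
  proof -
    have m: "{s \<in> space \<kappa>. move q s \<in> A} \<in> sets \<kappa>" if "q \<in> Ix" for q
      using measurable_sets[OF move_meas[OF that] A(1)] by (simp add: vimage_def space_\<kappa>)
    have a: "{s \<in> space \<kappa>. s \<in> A} \<in> sets \<kappa>" using A by (simp add: space_\<kappa>)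
    show ?thesis
      by (intro sets.sets_Collect_disj sets.sets_Collect_conj sets.sets_Collect_neg sets.sets_Collect_countable_Ex'
          wd_sets hits_sets m a cnt_Ix h)
  qed
  finally show "\<theta>' h -` A \<inter> space \<mu>n \<in> sets \<mu>n" by (auto simp: sets_\<mu>n space_\<mu>n)
qed

section \<open>Invariance of the amplified measure\<close>

lemma GA_inj: "Q x \<Longrightarrow> g \<in> carrier \<Gamma> \<Longrightarrow> g' \<in> carrier \<Gamma> \<Longrightarrow> \<sigma> g x = \<sigma> g' x \<Longrightarrow> g = g'"
  using GA.good_inj[of x g g'] Q_facts(3) by blast

(* Mass transport: theta' moves (x, i) to (sigma_g x, j), and substituting sigma_g x for x in each
   of the countably many pieces turns the integral over targets into the one over sources. *)
lemma nn_integral_\<theta>':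
  assumes h: "h \<in> carrier \<Lambda>" and f: "f \<in> borel_measurable \<mu>n"
  shows "(\<integral>\<^sup>+s. f (\<theta>' h s) \<partial>\<mu>n) = (\<integral>\<^sup>+s. f s \<partial>\<mu>n)"
proof -
  define f0 where "f0 s = (if s \<in> Xn then f s else 0)" for s
  have f0m: "f0 \<in> borel_measurable \<kappa>" unfolding f0_def[abs_def] by (rule \<mu>n_measurable[OF f])
  \<comment> \<open>Extension by the identity, a measurable map on the full product; it is used to
    show that the pieces below are measurable.\<close>
  define t0 where "t0 s = (if s \<in> Xn then \<theta>' h s else s)" for s
  have t0m: "t0 \<in> measurable \<kappa> \<kappa>"
  proof (rule measurableI)
    fix A assume A: "A \<in> sets \<kappa>"
    have "A \<inter> Xn \<in> sets \<mu>n" using A Xn_sets by (simp add: sets_\<mu>n)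
    from measurable_sets[OF \<theta>'_meas[OF h] this]
    have "\<theta>' h -` (A \<inter> Xn) \<inter> Xn \<in> sets \<kappa>" by (simp add: sets_\<mu>n space_\<mu>n)
    moreover have "t0 -` A \<inter> space \<kappa> = (\<theta>' h -` (A \<inter> Xn) \<inter> Xn) \<union> (A - Xn)"
    proof (rule Set.set_eqI)
      fix s
      show "s \<in> t0 -` A \<inter> space \<kappa> \<longleftrightarrow> s \<in> (\<theta>' h -` (A \<inter> Xn) \<inter> Xn) \<union> (A - Xn)"
        by (cases "s \<in> Xn") (simp_all add: t0_def space_\<kappa> \<theta>'_Xn)
    qed
    ultimately show "t0 -` A \<inter> space \<kappa> \<in> sets \<kappa>" using A Xn_sets by auto
  qed (simp add: space_\<kappa>)
  define C where "C = (UNIV :: nat set) \<times> Ix"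
  have cC: "countable C" unfolding C_def using cnt_Ix by simp
  \<comment> \<open>\<open>V x\<close> lists the pieces leaving \<open>x\<close>, recorded as source
    index, group element and target index; \<open>W x\<close> lists the pieces arriving at
    \<open>x\<close>, and \<open>a\<close> evaluates the integrand at the target.\<close>
  define V where "V x = {(i, g, j). g \<in> carrier \<Gamma> \<and> (x, i) \<in> Xn \<and> \<theta>' h (x, i) = (\<sigma> g x, j)}" for x
  define W where "W x = {(i, g, j). g \<in> carrier \<Gamma> \<and> (\<sigma> (inv\<^bsub>\<Gamma>\<^esub> g) x, i) \<in> Xn \<and> \<theta>' h (\<sigma> (inv\<^bsub>\<Gamma>\<^esub> g) x, i) = (x, j)}" for x
  define a where "a = (\<lambda>(i, g, j) x. if (i, g, j) \<in> V x then f0 (\<sigma> g x, j) else 0)"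
  have am: "a q \<in> borel_measurable \<mu>" if qC: "q \<in> C" for q
  proof -
    obtain i g j where q: "q = (i, g, j)" "g \<in> carrier \<Gamma>" using qC by (cases q) (auto simp: C_def)
    have ti: "(\<lambda>x. t0 (x, i)) \<in> measurable \<mu> \<kappa>" by (rule measurable_compose[OF _ t0m]) simp
    have "{x \<in> space \<mu>. fst (t0 (x, i)) = \<sigma> g x} \<in> sets \<mu>"
      by (rule equality_\<mu>[OF measurable_compose[OF ti measurable_fst] GA.T_meas[OF q(2)]])
    moreover have "{x \<in> space \<mu>. snd (t0 (x, i)) = j} \<in> sets \<mu>"
      using measurable_sets[OF measurable_compose[OF ti measurable_snd], of "{j}"] by (simp add: vimage_def space_\<mu>)
    moreover have "{x \<in> space \<mu>. (x, i) \<in> Xn} \<in> sets \<mu>" using level_Xn by (simp add: space_\<mu>)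
    ultimately have "{x \<in> space \<mu>. (x, i) \<in> Xn \<and> fst (t0 (x, i)) = \<sigma> g x \<and> snd (t0 (x, i)) = j} \<in> sets \<mu>"
      by (intro sets.sets_Collect_conj)
    also have "{x \<in> space \<mu>. (x, i) \<in> Xn \<and> fst (t0 (x, i)) = \<sigma> g x \<and> snd (t0 (x, i)) = j} = {x \<in> space \<mu>. (i, g, j) \<in> V x}"
      using q(2) by (auto simp: V_def t0_def prod_eq_iff)
    finally have m: "{x \<in> space \<mu>. (i, g, j) \<in> V x} \<in> sets \<mu>" .
    have "(\<lambda>x. f0 (\<sigma> g x, j)) \<in> borel_measurable \<mu>"
      by (rule measurable_compose[OF _ f0m]) (use GA.T_meas[OF q(2)] in simp)
    then show ?thesis unfolding a_def q(1) prod.case by (rule measurable_If[OF _ _ m]) simp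
  qed
  have ft: "(\<lambda>s. f (\<theta>' h s)) \<in> borel_measurable \<mu>n" by (rule measurable_compose[OF \<theta>'_meas[OF h] f])
  have "(\<integral>\<^sup>+x. (\<integral>\<^sup>+i. f (\<theta>' h (x, i)) \<partial>count_space {i. (x, i) \<in> Xn}) \<partial>\<mu>) = (\<integral>\<^sup>+x. (\<integral>\<^sup>+q. a q x \<partial>count_space C) \<partial>\<mu>)"
  proof (rule nn_integral_cong_AE)
    show "AE x in \<mu>. (\<integral>\<^sup>+i. f (\<theta>' h (x, i)) \<partial>count_space {i. (x, i) \<in> Xn}) = (\<integral>\<^sup>+q. a q x \<partial>count_space C)"
      using AE_Q
    proof eventually_elim
      fix x assume x: "Q x"
      \<comment> \<open>Every source index occurs once: \<open>\<theta>' h\<close> has one value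
        there, and freeness recovers the group element from it.\<close>
      have b: "bij_betw fst (V x) {i. (x, i) \<in> Xn}"
        unfolding bij_betw_def
      proof
        show "inj_on fst (V x)"
          using GA_inj[OF x] by (auto simp: inj_on_def V_def)
        show "fst ` V x = {i. (x, i) \<in> Xn}"
        proof (intro equalityI subsetI)
          fix i assume "i \<in> {i. (x, i) \<in> Xn}"
          then have i: "QN (x, i)" using x by (simp add: QN_def)
          obtain x' j where e: "\<theta>' h (x, i) = (x', j)" by (cases "\<theta>' h (x, i)")
          have "((x, i), (x', j)) \<in> Rn" using \<theta>'_facts(1)[OF i h] e by simp
          then obtain g where "g \<in> carrier \<Gamma>" "x' = \<sigma> g x" by (auto simp: Rn_iff)
          then have "(i, g, j) \<in> V x" using e i by (simp add: V_def QN_def)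
          then show "i \<in> fst ` V x" by force
        qed (auto simp: V_def)
      qed
      have "(\<integral>\<^sup>+i. f (\<theta>' h (x, i)) \<partial>count_space {i. (x, i) \<in> Xn}) = (\<integral>\<^sup>+q. f (\<theta>' h (x, fst q)) \<partial>count_space (V x))"
        by (rule nn_integral_bij_count_space[OF b, symmetric])
      also have "\<dots> = (\<integral>\<^sup>+q. a q x \<partial>count_space (V x))"
      proof (rule nn_integral_cong)
        fix q assume "q \<in> space (count_space (V x))"
        then have q: "q \<in> V x" by simp
        obtain i g j where e: "q = (i, g, j)" by (cases q)
        have "\<theta>' h (x, i) = (\<sigma> g x, j)" "(\<sigma> g x, j) \<in> Xn" using q \<theta>'_Xn[of "(x, i)" h] by (auto simp: e V_def)
        then show "f (\<theta>' h (x, fst q)) = a q x" using q by (simp add: e a_def f0_def)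
      qed
      also have "\<dots> = (\<integral>\<^sup>+q. (if q \<in> V x then a q x else 0) \<partial>count_space C)"
        by (rule nn_integral_count_space_subset_eq[symmetric]) (auto simp: V_def C_def)
      also have "\<dots> = (\<integral>\<^sup>+q. a q x \<partial>count_space C)"
        by (rule nn_integral_cong) (auto simp: a_def)
      finally show "(\<integral>\<^sup>+i. f (\<theta>' h (x, i)) \<partial>count_space {i. (x, i) \<in> Xn}) = (\<integral>\<^sup>+q. a q x \<partial>count_space C)" .
    qed
  qed
  \<comment> \<open>Replacing \<open>x\<close> by its translate under the inverse of the group
    element of \<open>q\<close> exchanges the roles of source and target, that is, of
    \<open>V\<close> and \<open>W\<close>.\<close>
  also have "\<dots> = (\<integral>\<^sup>+x. (\<integral>\<^sup>+q. a q (\<sigma> (inv\<^bsub>\<Gamma>\<^esub> (fst (snd q))) x) \<partial>count_space C) \<partial>\<mu>)"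
    by (rule nn_integral_count_mp[OF GA.PZ.sigma_finite_measure_axioms cC am])
       (auto simp: C_def GA.T_meas GA.T_distr)
  also have "\<dots> = (\<integral>\<^sup>+x. (\<integral>\<^sup>+j. f (x, j) \<partial>count_space {j. (x, j) \<in> Xn}) \<partial>\<mu>)"
  proof (rule nn_integral_cong_AE)
    show "AE x in \<mu>. (\<integral>\<^sup>+q. a q (\<sigma> (inv\<^bsub>\<Gamma>\<^esub> (fst (snd q))) x) \<partial>count_space C) = (\<integral>\<^sup>+j. f (x, j) \<partial>count_space {j. (x, j) \<in> Xn})"
      using AE_Q
    proof eventually_elim
      fix x assume x: "Q x"
      have inv_cancel: "\<sigma> g (\<sigma> (inv\<^bsub>\<Gamma>\<^esub> g) x) = x" if "g \<in> carrier \<Gamma>" for g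
        using that by (simp add: \<sigma>_mult \<sigma>_one)
      have b: "bij_betw (\<lambda>q. snd (snd q)) (W x) {j. (x, j) \<in> Xn}"
        unfolding bij_betw_def
      proof
        show "inj_on (\<lambda>q. snd (snd q)) (W x)"
        proof (rule inj_onI)
          fix q q' assume q: "q \<in> W x" and q': "q' \<in> W x" and e: "snd (snd q) = snd (snd q')"
          obtain i g j where q1: "q = (i, g, j)" by (cases q)
          obtain i' g' where q2: "q' = (i', g', j)" using e q1 by (cases q') auto
          have g: "g \<in> carrier \<Gamma>" "g' \<in> carrier \<Gamma>" using q q' by (auto simp: q1 q2 W_def)
          have s: "QN (\<sigma> (inv\<^bsub>\<Gamma>\<^esub> g) x, i)" "QN (\<sigma> (inv\<^bsub>\<Gamma>\<^esub> g') x, i')"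
            using q q' Q_\<sigma>[OF x] g by (auto simp: q1 q2 W_def QN_def)
          have "\<theta>' h (\<sigma> (inv\<^bsub>\<Gamma>\<^esub> g) x, i) = \<theta>' h (\<sigma> (inv\<^bsub>\<Gamma>\<^esub> g') x, i')"
            using q q' by (auto simp: q1 q2 W_def)
          \<comment> \<open>Two pieces arriving at the same target have the same source, since
            \<open>\<theta>' (inv h)\<close> undoes \<open>\<theta>' h\<close>; freeness then
            identifies the group elements.\<close>
          then have "\<theta>' (inv h) (\<theta>' h (\<sigma> (inv\<^bsub>\<Gamma>\<^esub> g) x, i)) = \<theta>' (inv h) (\<theta>' h (\<sigma> (inv\<^bsub>\<Gamma>\<^esub> g') x, i'))" by simp
          then have "(\<sigma> (inv\<^bsub>\<Gamma>\<^esub> g) x, i) = (\<sigma> (inv\<^bsub>\<Gamma>\<^esub> g') x, i')"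
            using s h by (simp add: \<theta>'_mult \<theta>'_one)
          then have "i = i'" "inv\<^bsub>\<Gamma>\<^esub> g = inv\<^bsub>\<Gamma>\<^esub> g'" using GA_inj[OF x] g by auto
          then show "q = q'" using g q1 q2 by (metis GA.L.inv_inv)
        qed
        show "(\<lambda>q. snd (snd q)) ` W x = {j. (x, j) \<in> Xn}"
        proof (intro equalityI subsetI)
          fix j assume "j \<in> (\<lambda>q. snd (snd q)) ` W x"
          then obtain i g where "(\<sigma> (inv\<^bsub>\<Gamma>\<^esub> g) x, i) \<in> Xn" "\<theta>' h (\<sigma> (inv\<^bsub>\<Gamma>\<^esub> g) x, i) = (x, j)"
            by (auto simp: W_def)
          then show "j \<in> {j. (x, j) \<in> Xn}" using \<theta>'_Xn[of "(\<sigma> (inv\<^bsub>\<Gamma>\<^esub> g) x, i)" h] by simp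
        next
          fix j assume "j \<in> {j. (x, j) \<in> Xn}"
          then have j: "QN (x, j)" using x by (simp add: QN_def)
          obtain x' i where e: "\<theta>' (inv h) (x, j) = (x', i)" by (cases "\<theta>' (inv h) (x, j)")
          have ih: "inv h \<in> carrier \<Lambda>" using h by simp
          have "((x, j), (x', i)) \<in> Rn" "QN (x', i)" using \<theta>'_facts(1,3)[OF j ih] e by auto
          then obtain g where g: "g \<in> carrier \<Gamma>" "x' = \<sigma> g x" "(x', i) \<in> Xn" by (auto simp: Rn_iff)
          have "\<theta>' h (x', i) = (x, j)" using \<theta>'_mult[OF j h ih] h e \<theta>'_one[OF j] by simp
          then have "(i, inv\<^bsub>\<Gamma>\<^esub> g, j) \<in> W x" using g by (simp add: W_def)
          then show "j \<in> (\<lambda>q. snd (snd q)) ` W x" by force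
        qed
      qed
      have "(\<integral>\<^sup>+q. a q (\<sigma> (inv\<^bsub>\<Gamma>\<^esub> (fst (snd q))) x) \<partial>count_space C) =
          (\<integral>\<^sup>+q. (if q \<in> W x then f (x, snd (snd q)) else 0) \<partial>count_space C)"
      proof (rule nn_integral_cong)
        fix q assume "q \<in> space (count_space C)"
        then obtain i g j where q: "q = (i, g, j)" "g \<in> carrier \<Gamma>" by (cases q) (auto simp: C_def)
        have "(i, g, j) \<in> V (\<sigma> (inv\<^bsub>\<Gamma>\<^esub> g) x) \<longleftrightarrow> (i, g, j) \<in> W x"
          using q inv_cancel by (simp add: V_def W_def)
        moreover have "(x, j) \<in> Xn" if "(i, g, j) \<in> W x"
          using that \<theta>'_Xn[of "(\<sigma> (inv\<^bsub>\<Gamma>\<^esub> g) x, i)" h] by (simp add: W_def)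
        ultimately show "a q (\<sigma> (inv\<^bsub>\<Gamma>\<^esub> (fst (snd q))) x) = (if q \<in> W x then f (x, snd (snd q)) else 0)"
          using q inv_cancel by (auto simp: a_def f0_def)
      qed
      also have "\<dots> = (\<integral>\<^sup>+q. f (x, snd (snd q)) \<partial>count_space (W x))"
        by (rule nn_integral_count_space_subset_eq) (auto simp: W_def C_def)
      also have "\<dots> = (\<integral>\<^sup>+j. f (x, j) \<partial>count_space {j. (x, j) \<in> Xn})"
        by (rule nn_integral_bij_count_space[OF b])
      finally show "(\<integral>\<^sup>+q. a q (\<sigma> (inv\<^bsub>\<Gamma>\<^esub> (fst (snd q))) x) \<partial>count_space C) = (\<integral>\<^sup>+j. f (x, j) \<partial>count_space {j. (x, j) \<in> Xn})" .
    qed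
  qed
  finally show ?thesis unfolding nn_integral_\<mu>n[OF ft] nn_integral_\<mu>n[OF f] by simp
qed

lemma \<theta>'_distr:
  assumes h: "h \<in> carrier \<Lambda>"
  shows "distr \<mu>n \<mu>n (\<theta>' h) = \<mu>n"
proof (rule measure_eqI)
  fix A assume "A \<in> sets (distr \<mu>n \<mu>n (\<theta>' h))"
  then have A: "A \<in> sets \<mu>n" by simp
  have "emeasure (distr \<mu>n \<mu>n (\<theta>' h)) A = (\<integral>\<^sup>+p. indicator A p \<partial>distr \<mu>n \<mu>n (\<theta>' h))"
    using A by simp
  also have "\<dots> = (\<integral>\<^sup>+p. indicator A (\<theta>' h p) \<partial>\<mu>n)"
    by (rule nn_integral_distr[OF \<theta>'_meas[OF h]]) (use A in simp)
  also have "\<dots> = emeasure \<mu>n A" using nn_integral_\<theta>'[OF h, of "indicator A"] A by simp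
  finally show "emeasure (distr \<mu>n \<mu>n (\<theta>' h)) A = emeasure \<mu>n A" .
qed simp

lemma \<theta>'_near_action: "near_action \<Lambda> \<mu>n \<theta>'"
proof (rule near_action.intro)
  show "AE z in \<mu>n. \<forall>h\<in>carrier \<Lambda>. \<forall>k\<in>carrier \<Lambda>. \<theta>' h (\<theta>' k z) = \<theta>' (h \<otimes> k) z"
    using AE_QN by eventually_elim (simp add: \<theta>'_mult)
  show "AE z in \<mu>n. \<theta>' \<one> z = z" using AE_QN by eventually_elim (simp add: \<theta>'_one)
  show "AE z in \<mu>n. \<forall>h\<in>carrier \<Lambda>. \<theta>' h z = z \<longrightarrow> h = \<one>"
    using AE_QN by eventually_elim (use \<theta>'_free in blast)
qed (use LA.grp LA.cnt \<mu>n_prob \<theta>'_meas \<theta>'_distr in auto)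

section \<open>The first copy of the space inside the amplification\<close>

abbreviation X :: "('x \<times> nat) set" where "X \<equiv> Xn \<inter> UNIV \<times> {1}"

definition x0 :: "'x \<times> nat" where "x0 = (SOME s. s \<in> X)"

(* The default value keeps iota inside the space of mu_n; it is attained on a null set only. *)
definition \<iota> :: "'x \<Rightarrow> 'x \<times> nat" where "\<iota> t = (if (t, 1) \<in> Xn then (t, 1) else x0)"

lemma \<iota>_Q: "Q t \<Longrightarrow> \<iota> t = (t, 1)" "Q t \<Longrightarrow> QN (t, 1)" "Q t \<Longrightarrow> D (t, 1) = \<Delta> t"
  using X1[of t] Q_facts(1)[of t] by (auto simp: \<iota>_def QN_def)

lemma X_sets: "X \<in> sets \<mu>n"
proof -
  have "X \<in> sets \<kappa>"
  proof (rule \<kappa>_setsI)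
    fix i
    have e: "{x. (x, i) \<in> X} = (if i = 1 then {x. (x, i) \<in> Xn} else {})" by auto
    show "{x. (x, i) \<in> X} \<in> sets \<mu>" unfolding e using level_Xn[of i] by (cases "i = 1") simp_all
  qed
  then show ?thesis by (simp add: sets_\<mu>n)
qed

lemma emeasure_X:
  assumes A: "A \<in> sets \<mu>n"
  shows "emeasure \<mu>n (X \<inter> A) = ennreal (1 / n) * emeasure \<mu> {t. (t, 1) \<in> A}"
proof -
  have AX: "A \<subseteq> Xn" using A by (simp add: sets_\<mu>n)
  have XA: "X \<inter> A \<in> sets \<mu>n" using X_sets A by simp
  have "{t. (t, 1) \<in> A} = (\<lambda>t. (t, 1)) -` A \<inter> space \<mu>" by (auto simp: space_\<mu>)
  also have "\<dots> \<in> sets \<mu>" by (rule measurable_sets[of _ \<mu> \<kappa>]) (use A in \<open>auto simp: sets_\<mu>n\<close>)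
  finally have As: "{t. (t, 1) \<in> A} \<in> sets \<mu>" .
  have "emeasure \<mu>n (X \<inter> A) = (\<integral>\<^sup>+s. indicator (X \<inter> A) s \<partial>\<mu>n)" using XA by simp
  also have "\<dots> = ennreal (1 / n) * (\<integral>\<^sup>+x. (\<integral>\<^sup>+i. indicator (X \<inter> A) (x, i) \<partial>count_space {i. (x, i) \<in> Xn}) \<partial>\<mu>)"
    by (rule nn_integral_\<mu>n) (use XA in simp)
  also have "(\<integral>\<^sup>+x. (\<integral>\<^sup>+i. indicator (X \<inter> A) (x, i) \<partial>count_space {i. (x, i) \<in> Xn}) \<partial>\<mu>) = (\<integral>\<^sup>+x. indicator {t. (t, 1) \<in> A} x \<partial>\<mu>)"
  proof (rule nn_integral_cong)
    fix x
    have "(\<integral>\<^sup>+i. indicator (X \<inter> A) (x, i) \<partial>count_space {i. (x, i) \<in> Xn}) =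
        (\<integral>\<^sup>+i. (if i \<in> {1} \<inter> {i. (x, i) \<in> A} then 1 else 0) \<partial>count_space {i. (x, i) \<in> Xn})"
      by (rule nn_integral_cong) (auto simp: indicator_def)
    also have "\<dots> = (\<Sum>i\<in>{1} \<inter> {i. (x, i) \<in> A}. 1)"
      by (rule nn_integral_count_space_subset) (use AX in auto)
    also have "\<dots> = indicator {t. (t, 1) \<in> A} x" by (auto simp: indicator_def)
    finally show "(\<integral>\<^sup>+i. indicator (X \<inter> A) (x, i) \<partial>count_space {i. (x, i) \<in> Xn}) = indicator {t. (t, 1) \<in> A} x" .
  qed
  also have "\<dots> = emeasure \<mu> {t. (t, 1) \<in> A}" using As by simp
  finally show ?thesis .
qed

lemma emeasure_X': "emeasure \<mu>n X = ennreal (1 / n)"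
proof -
  have "emeasure \<mu>n (X \<inter> Xn) = ennreal (1 / n) * emeasure \<mu> {t. (t, 1) \<in> Xn}"
    by (rule emeasure_X) (use Xn_sets in \<open>simp add: sets_\<mu>n\<close>)
  moreover have "AE t in \<mu>. t \<in> {t. (t, 1) \<in> Xn}" using AE_Q by eventually_elim (use \<iota>_Q(2) in \<open>auto simp: QN_def\<close>)
  then have "emeasure \<mu> {t. (t, 1) \<in> Xn} = 1"
    using GA.PZ.emeasure_eq_1_AE level_Xn by blast
  ultimately show ?thesis by (simp add: Int_absorb2 Int_commute Int_left_commute)
qed

lemma measure_X: "measure \<mu>n X = 1 / n"
  using emeasure_X' Y0_pos by (simp add: measure_def n)

lemma n_pos: "1 / n > 0" using Y0_pos by (simp add: n)

lemma X_nonempty: "X \<noteq> {}"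
proof
  assume "X = {}"
  then have "emeasure \<mu>n X = 0" by simp
  then show False unfolding emeasure_X' using n_pos by simp
qed

lemma \<iota>_X: "\<iota> t \<in> X"
  using someI_ex[of "\<lambda>s. s \<in> X"] X_nonempty by (auto simp: \<iota>_def x0_def)

lemma \<iota>_meas: "\<iota> \<in> measurable \<mu> \<mu>n"
proof (rule measurableI)
  show "\<iota> t \<in> space \<mu>n" for t using \<iota>_X by (simp add: space_\<mu>n)
  fix A assume A: "A \<in> sets \<mu>n"
  have "{t. (t, 1) \<in> A} = (\<lambda>t. (t, 1)) -` A \<inter> space \<mu>" by (auto simp: space_\<mu>)
  also have "\<dots> \<in> sets \<mu>" by (rule measurable_sets[of _ \<mu> \<kappa>]) (use A in \<open>auto simp: sets_\<mu>n\<close>)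
  finally have As: "{t. (t, 1) \<in> A} \<in> sets \<mu>" .
  have "\<iota> -` A \<inter> space \<mu> = {t. (t, 1) \<in> A} \<union> (if x0 \<in> A then space \<mu> - {t. (t, 1) \<in> Xn} else {})"
    using A by (auto simp: \<iota>_def space_\<mu> sets_\<mu>n split: if_splits)
  then show "\<iota> -` A \<inter> space \<mu> \<in> sets \<mu>" using As level_Xn[of 1] by auto
qed

lemma \<iota>_mp: "mp_map \<mu> (uniform_measure \<mu>n X) \<iota>"
  unfolding mp_map_def
proof
  show m: "\<iota> \<in> measurable \<mu> (uniform_measure \<mu>n X)" using \<iota>_meas by (simp cong: measurable_cong_sets)
  show "distr \<mu> (uniform_measure \<mu>n X) \<iota> = uniform_measure \<mu>n X"
  proof (rule measure_eqI)
    fix A assume "A \<in> sets (distr \<mu> (uniform_measure \<mu>n X) \<iota>)"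
    then have A: "A \<in> sets \<mu>n" by simp
    have As: "{t. (t, 1) \<in> A} \<in> sets \<mu>"
    proof -
      have "{t. (t, 1) \<in> A} = (\<lambda>t. (t, 1)) -` A \<inter> space \<mu>" by (auto simp: space_\<mu>)
      also have "\<dots> \<in> sets \<mu>" by (rule measurable_sets[of _ \<mu> \<kappa>]) (use A in \<open>auto simp: sets_\<mu>n\<close>)
      finally show ?thesis .
    qed
    have "emeasure (distr \<mu> (uniform_measure \<mu>n X) \<iota>) A = emeasure \<mu> (\<iota> -` A \<inter> space \<mu>)"
      by (rule emeasure_distr[OF m]) (use A in simp)
    also have "\<dots> = emeasure \<mu> {t. (t, 1) \<in> A}"
    proof (rule emeasure_eq_AE[OF _ measurable_sets[OF \<iota>_meas A] As])
      show "AE t in \<mu>. t \<in> \<iota> -` A \<inter> space \<mu> \<longleftrightarrow> t \<in> {t. (t, 1) \<in> A}"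
        using AE_Q by eventually_elim (simp add: \<iota>_Q space_\<mu>)
    qed
    also have "\<dots> = (ennreal (1 / n) * emeasure \<mu> {t. (t, 1) \<in> A}) / ennreal (1 / n)"
      using n_pos by (subst ennreal_mult_divide_eq[symmetric]) (auto simp: mult.commute)
    also have "\<dots> = emeasure \<mu>n (X \<inter> A) / emeasure \<mu>n X"
      by (simp only: emeasure_X[OF A] emeasure_X')
    also have "\<dots> = emeasure (uniform_measure \<mu>n X) A"
      using X_sets A by (simp only: emeasure_uniform_measure)
    finally show "emeasure (distr \<mu> (uniform_measure \<mu>n X) \<iota>) A = emeasure (uniform_measure \<mu>n X) A" .
  qed simp
qed

lemma \<iota>_inverse: "mod_null_inverse \<mu> (uniform_measure \<mu>n X) \<iota> fst"
  unfolding mod_null_inverse_def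
proof (intro conjI)
  show "fst \<in> measurable (uniform_measure \<mu>n X) \<mu>"
  proof -
    have "fst \<in> measurable (restrict_space \<kappa> Xn) \<mu>" by (rule measurable_restrict_space1) simp
    then have "fst \<in> measurable \<mu>n \<mu>" by (simp add: amp_measure_def cong: measurable_cong_sets)
    then show ?thesis by (simp cong: measurable_cong_sets)
  qed
  show "AE x in \<mu>. fst (\<iota> x) = x" using AE_Q by eventually_elim (simp add: \<iota>_Q)
  show "AE y in uniform_measure \<mu>n X. \<iota> (fst y) = y"
    by (rule AE_uniform_measureI[OF X_sets]) (auto simp: \<iota>_def)
qed

lemma \<iota>_orbit: "AE t in \<mu>. \<forall>g\<in>carrier \<Gamma>. \<exists>h\<in>carrier \<Lambda>. \<iota> (\<sigma> g t) = \<theta>' h (\<iota> t)"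
  using AE_Q
proof eventually_elim
  fix t assume t: "Q t"
  show "\<forall>g\<in>carrier \<Gamma>. \<exists>h\<in>carrier \<Lambda>. \<iota> (\<sigma> g t) = \<theta>' h (\<iota> t)"
  proof
    fix g assume g: "g \<in> carrier \<Gamma>"
    obtain h where h: "h \<in> carrier \<Lambda>" "\<Delta> (\<sigma> g t) = \<theta> h (\<Delta> t)" using Q_facts(4)[OF t g] by blast
    have "\<theta>' h (t, 1) = (\<sigma> g t, 1)"
      using \<iota>_Q[OF t] \<iota>_Q[OF Q_\<sigma>[OF t g]] g h by (intro \<theta>'_eq) (auto simp: Rn_iff QN_def)
    then show "\<exists>h\<in>carrier \<Lambda>. \<iota> (\<sigma> g t) = \<theta>' h (\<iota> t)"
      using h(1) unfolding \<iota>_Q(1)[OF t] \<iota>_Q(1)[OF Q_\<sigma>[OF t g]] by (intro bexI[of _ h]) simp_all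
  qed
qed

text \<open>\<open>\<theta>'\<close> moves points inside the amplified relation of
  \<open>\<Gamma>\<close>, so a return to index 1 is a \<open>\<Gamma>\<close>-translate.\<close>

lemma \<iota>_same_orbits:
  "AE t in \<mu>. \<forall>h\<in>carrier \<Lambda>. \<theta>' h (\<iota> t) \<in> X \<longrightarrow> (\<exists>g\<in>carrier \<Gamma>. \<theta>' h (\<iota> t) = \<iota> (\<sigma> g t))"
  using AE_Q
proof eventually_elim
  fix t assume t: "Q t"
  show "\<forall>h\<in>carrier \<Lambda>. \<theta>' h (\<iota> t) \<in> X \<longrightarrow> (\<exists>g\<in>carrier \<Gamma>. \<theta>' h (\<iota> t) = \<iota> (\<sigma> g t))"
  proof (intro ballI impI)
    fix h assume h: "h \<in> carrier \<Lambda>" and X: "\<theta>' h (\<iota> t) \<in> X"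
    obtain x where x: "\<theta>' h (t, 1) = (x, 1)" using X \<iota>_Q(1)[OF t] by auto
    have "((t, 1), (x, 1)) \<in> Rn" using \<theta>'_facts(1)[OF \<iota>_Q(2)[OF t] h] x by simp
    then obtain g where g: "g \<in> carrier \<Gamma>" "x = \<sigma> g t" by (auto simp: Rn_iff)
    have "\<theta>' h (\<iota> t) = \<iota> (\<sigma> g t)"
      unfolding \<iota>_Q(1)[OF t] \<iota>_Q(1)[OF Q_\<sigma>[OF t g(1)]] x g(2) ..
    then show "\<exists>g\<in>carrier \<Gamma>. \<theta>' h (\<iota> t) = \<iota> (\<sigma> g t)" using g(1) by blast
  qed
qed

text \<open>Each \<open>(x, i)\<close> is related to \<open>(x, 1)\<close>, and the map
  \<open>\<psi> i\<close> along the orbit supplies the group element.\<close>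

lemma complete_section: "AE s in \<mu>n. \<exists>h\<in>carrier \<Lambda>. \<theta>' h s \<in> X"
  using AE_QN
proof eventually_elim
  fix s assume s: "QN s"
  obtain x i where x: "s = (x, i)" by (cases s)
  have q: "Q x" using s by (simp add: QN_def x)
  obtain h where h: "h \<in> carrier \<Lambda>" "\<Delta> x = \<theta> (inv h) (D (x, i))" using QN_D s x by metis
  have "\<theta>' (inv h) s = (x, 1)"
    using s \<iota>_Q[OF q] h Rn_refl by (intro \<theta>'_eq) (auto simp: Rn_iff QN_def x intro!: bexI[of _ "\<one>\<^bsub>\<Gamma>\<^esub>"] simp: \<sigma>_one)
  then show "\<exists>h\<in>carrier \<Lambda>. \<theta>' h s \<in> X" using h \<iota>_Q(2)[OF q] by (intro bexI[of _ "inv h"]) (auto simp: QN_def)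
qed

text \<open>Three cocycles are matched: that of \<open>\<Delta>\<close>, in which the hypothesis is
  given, that of \<open>\<iota>\<close>, used in the general argument, and that of
  \<open>t \<mapsto> (t, 1)\<close>. Off a null set, \<open>\<theta>' (inv h)\<close> takes
  \<open>(t, 1)\<close> to \<open>(s, 1)\<close>, where \<open>s\<close> is the translate of
  \<open>t\<close> by the inverse of \<open>g\<close>, exactly when \<open>\<theta> (inv h)\<close>
  takes \<open>\<Delta> t\<close> to \<open>\<Delta> s\<close>, so the defining conditions
  coincide.\<close>

lemma zimmer_eq:
  "AE t in \<mu>. \<forall>g\<in>carrier \<Gamma>. zimmer_cocycle \<Gamma> \<Lambda> \<sigma> \<theta>' \<iota> t g = zimmer_cocycle \<Gamma> \<Lambda> \<sigma> \<theta> \<Delta> t g \<and>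
     zimmer_cocycle \<Gamma> \<Lambda> \<sigma> \<theta>' (\<lambda>t. (t, 1)) t g = zimmer_cocycle \<Gamma> \<Lambda> \<sigma> \<theta> \<Delta> t g"
  using AE_Q
proof eventually_elim
  fix t assume t: "Q t"
  show "\<forall>g\<in>carrier \<Gamma>. zimmer_cocycle \<Gamma> \<Lambda> \<sigma> \<theta>' \<iota> t g = zimmer_cocycle \<Gamma> \<Lambda> \<sigma> \<theta> \<Delta> t g \<and>
     zimmer_cocycle \<Gamma> \<Lambda> \<sigma> \<theta>' (\<lambda>t. (t, 1)) t g = zimmer_cocycle \<Gamma> \<Lambda> \<sigma> \<theta> \<Delta> t g"
  proof
    fix g assume g: "g \<in> carrier \<Gamma>"
    define s where "s = \<sigma> (inv\<^bsub>\<Gamma>\<^esub> g) t"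
    have s: "Q s" using Q_\<sigma>[OF t] g by (simp add: s_def)
    have e: "(s, 1) = \<theta>' (inv h) (t, 1) \<longleftrightarrow> \<Delta> s = \<theta> (inv h) (\<Delta> t)" if h: "h \<in> carrier \<Lambda>" for h
    proof
      have ih: "inv h \<in> carrier \<Lambda>" using h by simp
      assume "(s, 1) = \<theta>' (inv h) (t, 1)"
      then show "\<Delta> s = \<theta> (inv h) (\<Delta> t)"
        using \<theta>'_facts(2)[OF \<iota>_Q(2)[OF t] ih] \<iota>_Q(3)[OF t] \<iota>_Q(3)[OF s] by simp
    next
      assume a: "\<Delta> s = \<theta> (inv h) (\<Delta> t)"
      have "\<theta>' (inv h) (t, 1) = (s, 1)"
        using \<iota>_Q[OF t] \<iota>_Q[OF s] a g by (intro \<theta>'_eq) (auto simp: Rn_iff QN_def s_def)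
      then show "(s, 1) = \<theta>' (inv h) (t, 1)" by simp
    qed
    have P: "(\<lambda>h. h \<in> carrier \<Lambda> \<and> (s, 1) = \<theta>' (inv h) (t, 1)) = (\<lambda>h. h \<in> carrier \<Lambda> \<and> \<Delta> s = \<theta> (inv h) (\<Delta> t))"
      using e by blast
    show "zimmer_cocycle \<Gamma> \<Lambda> \<sigma> \<theta>' \<iota> t g = zimmer_cocycle \<Gamma> \<Lambda> \<sigma> \<theta> \<Delta> t g \<and>
     zimmer_cocycle \<Gamma> \<Lambda> \<sigma> \<theta>' (\<lambda>t. (t, 1)) t g = zimmer_cocycle \<Gamma> \<Lambda> \<sigma> \<theta> \<Delta> t g"
      unfolding zimmer_cocycle_def s_def[symmetric] \<iota>_Q(1)[OF t] \<iota>_Q(1)[OF s] P by simp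
  qed
qed

end

subsection \<open>The theorem\<close>

(* A non-trivial invariant set E spans the one-dimensional invariant subspace of 1_E - mu(E). *)
lemma weak_mixing_ergodic:
  assumes std: "standard_prob_space M" and act: "mp_action G M \<sigma>" and wm: "weak_mixing G M \<sigma>"
  shows "ergodic_action G M \<sigma>"
  unfolding ergodic_action_def
proof (intro ballI impI, rule ccontr)
  interpret prob_space M using std by (simp add: standard_prob_space_def)
  have grp: "group G"
    using act unfolding mp_action_def by (meson group_action.group_hom group_hom.axioms(1))
  fix E assume E: "E \<in> sets M" and inv: "\<forall>g\<in>carrier G. AE t in M. \<sigma> g t \<in> E \<longleftrightarrow> t \<in> E"
    and ne: "\<not> ((AE t in M. t \<in> E) \<or> (AE t in M. t \<notin> E))"
  define c where "c = complex_of_real (prob E)"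
  define f where "f t = indicator E t - c" for t
  have fm: "f \<in> borel_measurable M" unfolding f_def using E by measurable
  have fL: "f \<in> L2 M"
  proof (rule L2_bound[OF fm])
    show "integrable M (\<lambda>_. (1 + cmod c)\<^sup>2)" by simp
    show "AE x in M. (cmod (f x))\<^sup>2 \<le> (1 + cmod c)\<^sup>2"
      by (intro AE_I2 power_mono) (auto simp: f_def indicator_def intro: order_trans[OF norm_triangle_ineq4])
  qed
  have f0: "l2_inner M f (\<lambda>_. 1) = 0"
  proof -
    have i: "integrable M (\<lambda>t. complex_of_real (indicator E t))"
      using E by (intro integrable_of_real) (simp add: integrable_indicator_iff less_top[symmetric])
    have f: "f t = complex_of_real (indicator E t) - c" for t by (simp add: f_def indicator_def)
    have "(\<integral>t. f t \<partial>M) = (\<integral>t. complex_of_real (indicator E t) \<partial>M) - (\<integral>t. c \<partial>M)"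
      unfolding f by (rule Bochner_Integration.integral_diff[OF i]) simp
    also have "(\<integral>t. complex_of_real (indicator E t) \<partial>M) = c"
      using E sets.sets_into_space[OF E] by (simp add: integral_complex_of_real c_def Int_absorb2)
    finally show ?thesis by (simp add: l2_inner_def prob_space)
  qed
  \<comment> \<open>The multiples of \<open>f\<close> up to null sets: a subspace in the sense of
    \<open>weak_mixing\<close> must be closed under equality almost everywhere.\<close>
  define V where "V = {f' \<in> L2 M. \<exists>d. ae_eq M f' (\<lambda>t. d * f t)}"
  have V1: "V \<subseteq> {f \<in> L2 M. l2_inner M f (\<lambda>_. 1) = 0}"
  proof
    fix f' assume "f' \<in> V"
    then obtain d where f': "f' \<in> L2 M" "ae_eq M f' (\<lambda>t. d * f t)" by (auto simp: V_def)
    have one: "(\<lambda>_. 1) \<in> L2 M" by (simp add: L2_def)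
    have "l2_inner M f' (\<lambda>_. 1) = l2_inner M (\<lambda>t. d * f t) (\<lambda>_. 1)"
      by (rule l2_inner_cong[OF f'(2) ae_eq_refl f'(1) L2_scale[OF fL] one one])
    then show "f' \<in> {f \<in> L2 M. l2_inner M f (\<lambda>_. 1) = 0}" using f' f0 by (simp add: l2_inner_scale_left)
  qed
  have V2: "\<forall>f\<in>V. \<forall>f'\<in>L2 M. ae_eq M f f' \<longrightarrow> f' \<in> V"
    unfolding V_def using ae_eq_sym ae_eq_trans by blast
  have V3: "\<forall>f\<in>V. \<forall>f'\<in>V. \<forall>c. (\<lambda>t. c * f t + f' t) \<in> V"
  proof (intro ballI allI)
    fix f1 f2 a assume "f1 \<in> V" "f2 \<in> V"
    then obtain d1 d2 where d: "f1 \<in> L2 M" "f2 \<in> L2 M" "ae_eq M f1 (\<lambda>t. d1 * f t)" "ae_eq M f2 (\<lambda>t. d2 * f t)"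
      by (auto simp: V_def)
    have "ae_eq M (\<lambda>t. a * f1 t + f2 t) (\<lambda>t. (a * d1 + d2) * f t)"
      using d(3,4) unfolding ae_eq_def by eventually_elim (simp add: algebra_simps)
    then show "(\<lambda>t. a * f1 t + f2 t) \<in> V" using L2_lin[OF d(1,2)] by (auto simp: V_def)
  qed
  have V4: "\<forall>g\<in>carrier G. \<forall>f\<in>V. koopman G \<sigma> g f \<in> V"
  proof (intro ballI)
    fix g f' assume g: "g \<in> carrier G" and "f' \<in> V"
    then obtain d where d: "f' \<in> L2 M" "ae_eq M f' (\<lambda>t. d * f t)" by (auto simp: V_def)
    have ig: "inv\<^bsub>G\<^esub> g \<in> carrier G" using group.inv_closed[OF grp g] .
    have s: "\<sigma> (inv\<^bsub>G\<^esub> g) \<in> measurable M M" "distr M M (\<sigma> (inv\<^bsub>G\<^esub> g)) = M"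
      using act ig by (auto simp: mp_action_def)
    have "integrable (distr M M (\<sigma> (inv\<^bsub>G\<^esub> g))) (\<lambda>x. (cmod (f' x))\<^sup>2)"
      unfolding s(2) by (rule L2_integrable[OF d(1)])
    then have "integrable M (\<lambda>x. (cmod (f' (\<sigma> (inv\<^bsub>G\<^esub> g) x)))\<^sup>2)"
      by (subst (asm) integrable_distr_eq[OF s(1)]) (use L2_measurable[OF d(1)] in auto)
    then have L: "koopman G \<sigma> g f' \<in> L2 M"
      using measurable_compose[OF s(1) L2_measurable[OF d(1)]] by (simp add: L2_def koopman_def)
    have "AE t in distr M M (\<sigma> (inv\<^bsub>G\<^esub> g)). f' t = d * f t" unfolding s(2) using d(2) by (simp add: ae_eq_def)
    from AE_distrD[OF s(1) this] inv[rule_format, OF ig]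
    have "ae_eq M (koopman G \<sigma> g f') (\<lambda>t. d * f t)"
      unfolding ae_eq_def by eventually_elim (simp add: koopman_def f_def indicator_def)
    then show "koopman G \<sigma> g f' \<in> V" using L by (auto simp: V_def)
  qed
  have fV: "f \<in> V" using fL by (auto simp: V_def ae_eq_def intro!: exI[of _ 1])
  then have V5: "\<exists>B. finite B \<and> B \<subseteq> V \<and> (\<forall>f\<in>V. \<exists>c. ae_eq M f (\<lambda>t. \<Sum>e\<in>B. c e * e t))"
  proof (intro exI[of _ "{f}"] conjI ballI)
    fix f' assume "f' \<in> V"
    then obtain d where "ae_eq M f' (\<lambda>t. d * f t)" by (auto simp: V_def)
    then show "\<exists>c. ae_eq M f' (\<lambda>t. \<Sum>e\<in>{f}. c e * e t)" by (intro exI[of _ "\<lambda>_. d"]) simp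
  qed auto
  have V6: "\<not> ae_eq M f (\<lambda>_. 0)"
  proof
    assume "ae_eq M f (\<lambda>_. 0)"
    \<comment> \<open>If the indicator were a constant \<open>c\<close> almost everywhere,
      \<open>E\<close> would be conull for \<open>c = 1\<close> and null otherwise.\<close>
    then have a: "AE t in M. indicator E t = c" by (simp add: ae_eq_def f_def)
    show False
    proof (cases "c = 1")
      case True
      have "AE t in M. t \<in> E" using a by eventually_elim (use True in \<open>auto simp: indicator_def split: if_splits\<close>)
      then show False using ne by blast
    next
      case False
      have "AE t in M. t \<notin> E" using a by eventually_elim (use False in \<open>auto simp: indicator_def split: if_splits\<close>)
      then show False using ne by blast
    qed
  qed
  show False
    using wm unfolding weak_mixing_def
    by (elim notE) (intro exI[of _ V] conjI V1 V2 V3 V4 V5 bexI[of "\<lambda>f. \<not> ae_eq M f (\<lambda>_. 0)" f V, OF V6 fV])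
qed

section \<open>Finiteness of the kernel\<close>

lemma (in near_action) zimmer_apply:
  assumes "good (\<Delta> t)" "h \<in> carrier \<Lambda>" "\<Delta> (\<sigma> (inv\<^bsub>\<Gamma>\<^esub> g) t) = T h (\<Delta> t)"
  shows "T (inv (zimmer_cocycle \<Gamma> \<Lambda> \<sigma> T \<Delta> t g)) (\<Delta> t) = \<Delta> (\<sigma> (inv\<^bsub>\<Gamma>\<^esub> g) t)"
    "zimmer_cocycle \<Gamma> \<Lambda> \<sigma> T \<Delta> t g \<in> carrier \<Lambda>"
proof -
  let ?P = "\<lambda>h. h \<in> carrier \<Lambda> \<and> \<Delta> (\<sigma> (inv\<^bsub>\<Gamma>\<^esub> g) t) = T (inv h) (\<Delta> t)"
  have ex: "\<exists>!h. ?P h"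
  proof (rule ex1I[of _ "inv h"])
    show "?P (inv h)" using assms by simp
    fix k assume "?P k"
    then have "inv k = h" using assms good_inj[of "\<Delta> t" "inv k" h] by simp
    then show "k = inv h" using \<open>?P k\<close> by auto
  qed
  then have "zimmer_cocycle \<Gamma> \<Lambda> \<sigma> T \<Delta> t g = (THE h. ?P h)" by (simp add: zimmer_cocycle_def the_unique_def)
  with theI'[OF ex] show "T (inv (zimmer_cocycle \<Gamma> \<Lambda> \<sigma> T \<Delta> t g)) (\<Delta> t) = \<Delta> (\<sigma> (inv\<^bsub>\<Gamma>\<^esub> g) t)"
    "zimmer_cocycle \<Gamma> \<Lambda> \<sigma> T \<Delta> t g \<in> carrier \<Lambda>" by simp_all
qed

(* If v = h on a set of positive measure, its translates under the kernel are disjoint mod null sets. *)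
lemma finite_kernel:
  fixes \<Gamma> :: "('g, 'm) monoid_scheme" and \<Lambda> :: "('h, 'n) monoid_scheme"
    and \<mu> :: "'x::polish_space measure" and \<nu> :: "'y::polish_space measure"
    and \<sigma> :: "'g \<Rightarrow> 'x \<Rightarrow> 'x" and \<theta> :: "'h \<Rightarrow> 'y \<Rightarrow> 'y"
    and Y0 :: "'y set" and \<Delta> :: "'x \<Rightarrow> 'y" and \<delta> :: "'g \<Rightarrow> 'h" and v :: "'x \<Rightarrow> 'h"
  assumes \<mu>_std: "standard_prob_space \<mu>" and \<nu>_std: "standard_prob_space \<nu>"
    and \<sigma>_act: "mp_action \<Gamma> \<mu> \<sigma>" and \<sigma>_free: "free_action \<Gamma> \<mu> \<sigma>"
    and \<theta>_act: "mp_action \<Lambda> \<nu> \<theta>" and \<theta>_free: "free_action \<Lambda> \<nu> \<theta>"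
    and erg: "ergodic_action \<Gamma> \<mu> \<sigma>"
    and Y0: "Y0 \<in> sets \<nu>" and Y0_pos: "measure \<nu> Y0 > 0"
    and \<delta>: "\<delta> \<in> hom \<Gamma> \<Lambda>" and v: "v \<in> measurable \<mu> (count_space (carrier \<Lambda>))"
    and cocycle: "\<forall>g\<in>carrier \<Gamma>. AE t in \<mu>.
           inv\<^bsub>\<Lambda>\<^esub> (v t) \<otimes>\<^bsub>\<Lambda>\<^esub> zimmer_cocycle \<Gamma> \<Lambda> \<sigma> \<theta> \<Delta> t g \<otimes>\<^bsub>\<Lambda>\<^esub> v (\<sigma> (inv\<^bsub>\<Gamma>\<^esub> g) t) = \<delta> g"

    and orb: "AE t in \<mu>. \<forall>g\<in>carrier \<Gamma>. \<exists>h\<in>carrier \<Lambda>. \<Delta> (\<sigma> g t) = \<theta> h (\<Delta> t)"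
    and inj: "AE t in \<mu>. \<forall>g\<in>carrier \<Gamma>. \<forall>g'\<in>carrier \<Gamma>. \<Delta> (\<sigma> g t) = \<Delta> (\<sigma> g' t) \<longrightarrow> \<sigma> g t = \<sigma> g' t"
    and \<Delta>: "mp_map \<mu> (uniform_measure \<nu> Y0) \<Delta>"
  shows "finite (kernel \<Gamma> \<Lambda> \<delta>)"
proof -
  interpret GA: near_action \<Gamma> \<mu> \<sigma> by (rule mp_action_near_action[OF \<sigma>_act \<mu>_std \<sigma>_free])
  interpret LA: near_action \<Lambda> \<nu> \<theta> by (rule mp_action_near_action[OF \<theta>_act \<nu>_std \<theta>_free])
  define K where "K = kernel \<Gamma> \<Lambda> \<delta>"
  have K: "k \<in> carrier \<Gamma>" "\<delta> k = \<one>\<^bsub>\<Lambda>\<^esub>" if "k \<in> K" for k using that by (auto simp: K_def kernel_def)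
  have cK: "countable K" using GA.cnt by (rule countable_subset[rotated]) (use K in auto)
  have hom: "group_hom \<Gamma> \<Lambda> \<delta>" by (simp add: group_hom_def group_hom_axioms_def GA.grp LA.grp \<delta>)
  have Kinv: "inv\<^bsub>\<Gamma>\<^esub> k \<in> K" if "k \<in> K" for k
    using that K[OF that] by (simp add: K_def kernel_def group_hom.hom_inv[OF hom])
  have sp: "space \<mu> = UNIV" by (rule standard_space[OF \<mu>_std])
  have vc: "v t \<in> carrier \<Lambda>" for t using measurable_space[OF v] by (simp add: sp)
  note \<theta>m = mp_action_apply(1)[OF \<theta>_act \<nu>_std]
  define \<Phi> where "\<Phi> t = \<theta> (inv\<^bsub>\<Lambda>\<^esub> (v t)) (\<Delta> t)" for t
  have good: "AE t in \<mu>. LA.good (\<Delta> t)" by (rule AE_uniform_measure_trans[OF \<Delta> Y0 LA.AE_good])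
  have co: "AE t in \<mu>. \<forall>g\<in>carrier \<Gamma>.
      inv\<^bsub>\<Lambda>\<^esub> (v t) \<otimes>\<^bsub>\<Lambda>\<^esub> zimmer_cocycle \<Gamma> \<Lambda> \<sigma> \<theta> \<Delta> t g \<otimes>\<^bsub>\<Lambda>\<^esub> v (\<sigma> (inv\<^bsub>\<Gamma>\<^esub> g) t) = \<delta> g"
    using cocycle GA.cnt by (simp add: AE_ball_countable)
  \<comment> \<open>Equivariance restricted to the kernel, where \<open>\<delta>\<close> contributes
    the unit. It is obtained from \<open>\<Delta>\<close> itself, without an amplification.\<close>
  have inv_\<Phi>: "AE t in \<mu>. \<forall>k\<in>K. \<Phi> (\<sigma> k t) = \<Phi> t"
    using good co orb
  proof eventually_elim
    fix t assume g: "LA.good (\<Delta> t)"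
      and c: "\<forall>g\<in>carrier \<Gamma>. inv\<^bsub>\<Lambda>\<^esub> (v t) \<otimes>\<^bsub>\<Lambda>\<^esub> zimmer_cocycle \<Gamma> \<Lambda> \<sigma> \<theta> \<Delta> t g \<otimes>\<^bsub>\<Lambda>\<^esub> v (\<sigma> (inv\<^bsub>\<Gamma>\<^esub> g) t) = \<delta> g"
      and o: "\<forall>g\<in>carrier \<Gamma>. \<exists>h\<in>carrier \<Lambda>. \<Delta> (\<sigma> g t) = \<theta> h (\<Delta> t)"
    show "\<forall>k\<in>K. \<Phi> (\<sigma> k t) = \<Phi> t"
    proof
      fix k assume k: "k \<in> K"
      define l where "l = inv\<^bsub>\<Gamma>\<^esub> k"
      have l: "l \<in> carrier \<Gamma>" "\<delta> l = \<one>\<^bsub>\<Lambda>\<^esub>" "inv\<^bsub>\<Gamma>\<^esub> l = k" using K[OF Kinv[OF k]] K[OF k] by (auto simp: l_def)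
      obtain h where h: "h \<in> carrier \<Lambda>" "\<Delta> (\<sigma> (inv\<^bsub>\<Gamma>\<^esub> l) t) = \<theta> h (\<Delta> t)" using o l K[OF k] by auto
      let ?w = "zimmer_cocycle \<Gamma> \<Lambda> \<sigma> \<theta> \<Delta> t l"
      have w: "\<theta> (inv\<^bsub>\<Lambda>\<^esub> ?w) (\<Delta> t) = \<Delta> (\<sigma> k t)" "?w \<in> carrier \<Lambda>"
        using LA.zimmer_apply[where \<Delta>=\<Delta> and t=t and h=h and \<sigma>=\<sigma> and \<Gamma>=\<Gamma> and g=l, OF g h] l(3) by auto
      have "inv\<^bsub>\<Lambda>\<^esub> (v t) \<otimes>\<^bsub>\<Lambda>\<^esub> (?w \<otimes>\<^bsub>\<Lambda>\<^esub> v (\<sigma> k t)) = \<one>\<^bsub>\<Lambda>\<^esub>"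
        using c[rule_format, OF l(1)] LA.L.m_assoc[OF LA.L.inv_closed[OF vc] w(2) vc] unfolding l(2,3) by simp
      then have "?w \<otimes>\<^bsub>\<Lambda>\<^esub> v (\<sigma> k t) = v t"
        using LA.L.inv_mult_eq_one[of "v t" "?w \<otimes>\<^bsub>\<Lambda>\<^esub> v (\<sigma> k t)"] w(2) vc by simp
      then have "inv\<^bsub>\<Lambda>\<^esub> (v t) = inv\<^bsub>\<Lambda>\<^esub> (v (\<sigma> k t)) \<otimes>\<^bsub>\<Lambda>\<^esub> inv\<^bsub>\<Lambda>\<^esub> ?w"
        using w(2) vc by (metis LA.L.inv_mult_group)
      then show "\<Phi> (\<sigma> k t) = \<Phi> t"
        using w vc by (simp add: \<Phi>_def w(1)[symmetric] \<theta>m)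
    qed
  qed
  \<comment> \<open>\<open>v\<close> takes countably many values, so not all of its level sets are
    null.\<close>
  have "\<exists>h\<in>carrier \<Lambda>. emeasure \<mu> {t. v t = h} \<noteq> 0"
  proof (rule ccontr)
    assume "\<not> (\<exists>h\<in>carrier \<Lambda>. emeasure \<mu> {t. v t = h} \<noteq> 0)"
    then have z: "emeasure \<mu> {t. v t = h} = 0" if "h \<in> carrier \<Lambda>" for h using that by blast
    have "AE t in \<mu>. v t \<noteq> h" if hc: "h \<in> carrier \<Lambda>" for h
      using z[OF hc] measurable_sets[OF v, of "{h}"] hc
      by (intro AE_I[of _ _ "{t. v t = h}"]) (auto simp: sp vimage_def)
    then have "AE t in \<mu>. \<forall>h\<in>carrier \<Lambda>. v t \<noteq> h" using LA.cnt by (simp add: AE_ball_countable)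
    then have "AE t in \<mu>. False" by eventually_elim (use vc in blast)
    then show False using GA.PZ.AE_False by blast
  qed
  then obtain h where h: "h \<in> carrier \<Lambda>" "emeasure \<mu> {t. v t = h} \<noteq> 0" by blast
  define B where "B = {t. v t = h}"
  have B: "B \<in> sets \<mu>" using measurable_sets[OF v, of "{h}"] h(1) by (simp add: B_def sp vimage_def)
  have kB: "{t \<in> space \<mu>. \<sigma> k t \<in> B} \<in> sets \<mu>" if "k \<in> K" for k
    using measurable_sets[OF GA.T_meas[OF K(1)[OF that]] B] by (simp add: vimage_def sp)
  have "emeasure \<mu> B * emeasure (count_space K) K = (\<integral>\<^sup>+k. (\<integral>\<^sup>+t. (if \<sigma> k t \<in> B then 1 else 0) \<partial>\<mu>) \<partial>count_space K)"
  proof -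
    have "(\<integral>\<^sup>+t. (if \<sigma> k t \<in> B then 1 else 0) \<partial>\<mu>) = emeasure \<mu> B" if k: "k \<in> K" for k
    proof -
      have "(\<integral>\<^sup>+t. (if \<sigma> k t \<in> B then 1 else 0) \<partial>\<mu>) = (\<integral>\<^sup>+t. indicator B (\<sigma> k t) \<partial>\<mu>)"
        by (rule nn_integral_cong) (simp add: indicator_def)
      also have "\<dots> = (\<integral>\<^sup>+t. indicator B t \<partial>distr \<mu> \<mu> (\<sigma> k))"
        by (rule nn_integral_distr[symmetric, OF GA.T_meas[OF K(1)[OF k]]]) (use B in simp)
      also have "\<dots> = emeasure \<mu> B" using B by (simp add: GA.T_distr[OF K(1)[OF k]])
      finally show ?thesis .
    qed
    then have "(\<integral>\<^sup>+k. (\<integral>\<^sup>+t. (if \<sigma> k t \<in> B then 1 else 0) \<partial>\<mu>) \<partial>count_space K) = (\<integral>\<^sup>+k. emeasure \<mu> B \<partial>count_space K)"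
      by (rule nn_integral_cong) (simp only: space_count_space)
    then show ?thesis by simp
  qed
  \<comment> \<open>The left side is the size of the kernel times the measure of \<open>B\<close>;
    the exchanged integral counts, for each \<open>t\<close>, the kernel translates falling into
    \<open>B\<close>.\<close>
  also have "\<dots> = (\<integral>\<^sup>+t. (\<integral>\<^sup>+k. (if \<sigma> k t \<in> B then 1 else 0) \<partial>count_space K) \<partial>\<mu>)"
  proof (rule nn_integral_count_swap[OF GA.PZ.sigma_finite_measure_axioms cK, symmetric])
    fix k assume "k \<in> K"
    then show "(\<lambda>t. if \<sigma> k t \<in> B then 1 else (0 :: ennreal)) \<in> borel_measurable \<mu>"
      by (intro measurable_If[OF borel_measurable_const borel_measurable_const] kB)
  qed
  also have "\<dots> \<le> (\<integral>\<^sup>+t. 1 \<partial>\<mu>)"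
  proof (rule nn_integral_mono_AE)
    show "AE t in \<mu>. (\<integral>\<^sup>+k. (if \<sigma> k t \<in> B then 1 else 0) \<partial>count_space K) \<le> 1"
      using inv_\<Phi> inj GA.AE_good
    proof eventually_elim
      fix t assume i: "\<forall>k\<in>K. \<Phi> (\<sigma> k t) = \<Phi> t"
        and j: "\<forall>g\<in>carrier \<Gamma>. \<forall>g'\<in>carrier \<Gamma>. \<Delta> (\<sigma> g t) = \<Delta> (\<sigma> g' t) \<longrightarrow> \<sigma> g t = \<sigma> g' t" and g: "GA.good t"
      \<comment> \<open>All kernel translates of \<open>t\<close> inside \<open>B\<close> have the
        same image under \<open>\<Delta>\<close>, because \<open>\<Phi>\<close> and \<open>v\<close>
        take the same values at them. Injectivity on orbits and freeness leave at most one such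
        translate.\<close>
      have val: "\<Delta> (\<sigma> k t) = \<theta> h (\<Phi> t)" if "k \<in> K" "\<sigma> k t \<in> B" for k
      proof -
        have "\<theta> h (\<Phi> t) = \<theta> h (\<Phi> (\<sigma> k t))" using i that(1) by simp
        also have "\<dots> = \<theta> h (\<theta> (inv\<^bsub>\<Lambda>\<^esub> h) (\<Delta> (\<sigma> k t)))" using that(2) by (simp add: B_def \<Phi>_def)
        also have "\<dots> = \<Delta> (\<sigma> k t)"
          using h(1) mp_action_apply(2)[OF \<theta>_act \<nu>_std h(1) h(1)] by (simp add: \<theta>m)
        finally show ?thesis by simp
      qed
      have u: "k = l" if "k \<in> K" "l \<in> K" "\<sigma> k t \<in> B" "\<sigma> l t \<in> B" for k l
      proof -
        have "\<sigma> k t = \<sigma> l t" using j val[OF that(1,3)] val[OF that(2,4)] K(1) that(1,2) by simp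
        then show ?thesis using GA.good_inj[OF g] K(1) that(1,2) by blast
      qed
      show "(\<integral>\<^sup>+k. (if \<sigma> k t \<in> B then 1 else 0) \<partial>count_space K) \<le> 1"
      proof (cases "\<exists>k\<in>K. \<sigma> k t \<in> B")
        case True
        then obtain k where k: "k \<in> K" "\<sigma> k t \<in> B" by blast
        have "(\<integral>\<^sup>+l. (if \<sigma> l t \<in> B then 1 else 0) \<partial>count_space K) \<le> (\<integral>\<^sup>+l. (if l \<in> {k} then 1 else 0) \<partial>count_space K)"
        proof (rule nn_integral_mono)
          fix l assume "l \<in> space (count_space K)"
          then have l: "l \<in> K" by simp
          show "(if \<sigma> l t \<in> B then 1 else 0) \<le> (if l \<in> {k} then 1 else (0 :: ennreal))"
          proof (cases "\<sigma> l t \<in> B")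
            case True
            then have "l \<in> {k}" using u[OF l k(1) True k(2)] by (simp only: singleton_iff)
            then show ?thesis by (simp only: True if_True order_refl)
          qed simp
        qed
        also have "\<dots> = 1" by (subst nn_integral_count_space_subset) (use k in auto)
        finally show ?thesis .
      next
        case False
        have "(\<integral>\<^sup>+k. (if \<sigma> k t \<in> B then 1 else 0) \<partial>count_space K) = (\<integral>\<^sup>+k. 0 \<partial>count_space K)"
          by (rule nn_integral_cong) (use False in auto)
        then show ?thesis by simp
      qed
    qed
  qed
  also have "\<dots> = 1" by (simp add: GA.PZ.emeasure_space_1)
  finally have le: "emeasure \<mu> B * emeasure (count_space K) K \<le> 1" .
  have "finite K"
  proof (rule ccontr)
    assume "infinite K"
    then have "emeasure \<mu> B * emeasure (count_space K) K = \<infinity>"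
      using h(2) by (simp add: B_def ennreal_mult_top)
    then show False using le by (simp add: top_unique)
  qed
  then show ?thesis by (simp add: K_def)
qed

section \<open>Orbit conditions extracted from the two kinds of maps\<close>

lemma embedding_orbits:
  assumes "OE_embedding \<mu> (orbit_rel \<Gamma> \<sigma>) \<nu> (orbit_rel \<Lambda> \<theta>) Y0 \<Delta>"
  shows "AE t in \<mu>. \<forall>g\<in>carrier \<Gamma>. \<exists>h\<in>carrier \<Lambda>. \<Delta> (\<sigma> g t) = \<theta> h (\<Delta> t)"
proof -
  have "AE t in \<mu>. \<Delta> ` (orbit_rel \<Gamma> \<sigma> `` {t}) \<subseteq> restrict_rel (orbit_rel \<Lambda> \<theta>) Y0 `` {\<Delta> t}"
    using assms by (simp add: OE_embedding_def)
  then show ?thesis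
  proof eventually_elim
    fix t assume a: "\<Delta> ` (orbit_rel \<Gamma> \<sigma> `` {t}) \<subseteq> restrict_rel (orbit_rel \<Lambda> \<theta>) Y0 `` {\<Delta> t}"
    show "\<forall>g\<in>carrier \<Gamma>. \<exists>h\<in>carrier \<Lambda>. \<Delta> (\<sigma> g t) = \<theta> h (\<Delta> t)"
    proof
      fix g assume "g \<in> carrier \<Gamma>"
      then have "\<Delta> (\<sigma> g t) \<in> \<Delta> ` (orbit_rel \<Gamma> \<sigma> `` {t})" by (auto simp: orbit_rel_def orbit_def)
      then have "\<Delta> (\<sigma> g t) \<in> restrict_rel (orbit_rel \<Lambda> \<theta>) Y0 `` {\<Delta> t}" using a by blast
      then show "\<exists>h\<in>carrier \<Lambda>. \<Delta> (\<sigma> g t) = \<theta> h (\<Delta> t)" by (auto simp: restrict_rel_def orbit_rel_def orbit_def)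
    qed
  qed
qed

lemma local_OE_orbits:
  assumes "local_OE \<mu> (orbit_rel \<Gamma> \<sigma>) \<nu> (orbit_rel \<Lambda> \<theta>) Y0 \<Delta>"
  shows "AE t in \<mu>. \<forall>g\<in>carrier \<Gamma>. \<exists>h\<in>carrier \<Lambda>. \<Delta> (\<sigma> g t) = \<theta> h (\<Delta> t)"
    and "AE t in \<mu>. \<forall>g\<in>carrier \<Gamma>. \<forall>g'\<in>carrier \<Gamma>. \<Delta> (\<sigma> g t) = \<Delta> (\<sigma> g' t) \<longrightarrow> \<sigma> g t = \<sigma> g' t"
proof -
  have b: "AE t in \<mu>. bij_betw \<Delta> (orbit_rel \<Gamma> \<sigma> `` {t}) (restrict_rel (orbit_rel \<Lambda> \<theta>) Y0 `` {\<Delta> t})"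
    using assms by (simp add: local_OE_def)
  have o: "\<sigma> g t \<in> orbit_rel \<Gamma> \<sigma> `` {t}" if "g \<in> carrier \<Gamma>" for g t
    using that by (auto simp: orbit_rel_def orbit_def)
  show "AE t in \<mu>. \<forall>g\<in>carrier \<Gamma>. \<exists>h\<in>carrier \<Lambda>. \<Delta> (\<sigma> g t) = \<theta> h (\<Delta> t)"
    using b
  proof eventually_elim
    fix t assume a: "bij_betw \<Delta> (orbit_rel \<Gamma> \<sigma> `` {t}) (restrict_rel (orbit_rel \<Lambda> \<theta>) Y0 `` {\<Delta> t})"
    show "\<forall>g\<in>carrier \<Gamma>. \<exists>h\<in>carrier \<Lambda>. \<Delta> (\<sigma> g t) = \<theta> h (\<Delta> t)"
      using bij_betw_apply[OF a o] by (fastforce simp: restrict_rel_def orbit_rel_def orbit_def)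
  qed
  show "AE t in \<mu>. \<forall>g\<in>carrier \<Gamma>. \<forall>g'\<in>carrier \<Gamma>. \<Delta> (\<sigma> g t) = \<Delta> (\<sigma> g' t) \<longrightarrow> \<sigma> g t = \<sigma> g' t"
    using b
  proof eventually_elim
    fix t assume "bij_betw \<Delta> (orbit_rel \<Gamma> \<sigma> `` {t}) (restrict_rel (orbit_rel \<Lambda> \<theta>) Y0 `` {\<Delta> t})"
    then show "\<forall>g\<in>carrier \<Gamma>. \<forall>g'\<in>carrier \<Gamma>. \<Delta> (\<sigma> g t) = \<Delta> (\<sigma> g' t) \<longrightarrow> \<sigma> g t = \<sigma> g' t"
      using o by (auto dest: bij_betw_imp_inj_on inj_onD)
  qed
qed

lemma coeff_op_outside: "z \<notin> S \<Longrightarrow> coeff_op G T S \<pi> c \<xi> (z, k) = 0"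
  by (simp add: coeff_op_def mult_op_def transport_def)

lemma no_finite_normal_kernel:
  assumes "group_hom G H f" "finite (kernel G H f)" "no_nontrivial_finite_normal G"
  shows "kernel G H f = {\<one>\<^bsub>G\<^esub>}"
  using assms group_hom.normal_kernel[OF assms(1)] by (auto simp: no_nontrivial_finite_normal_def)

section \<open>The embedding case\<close>

lemma embedding_case:
  fixes \<Gamma> :: "('g, 'm) monoid_scheme" and \<Lambda> :: "('h, 'n) monoid_scheme"
    and \<mu> :: "'x::polish_space measure" and \<nu> :: "'y::polish_space measure"
    and \<sigma> :: "'g \<Rightarrow> 'x \<Rightarrow> 'x" and \<theta> :: "'h \<Rightarrow> 'y \<Rightarrow> 'y"
    and Y0 :: "'y set" and \<Delta> :: "'x \<Rightarrow> 'y" and \<delta> :: "'g \<Rightarrow> 'h" and v :: "'x \<Rightarrow> 'h"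
  assumes \<mu>_std: "standard_prob_space \<mu>" and \<nu>_std: "standard_prob_space \<nu>"
    and \<sigma>_act: "mp_action \<Gamma> \<mu> \<sigma>" and \<sigma>_free: "free_action \<Gamma> \<mu> \<sigma>"
    and \<theta>_act: "mp_action \<Lambda> \<nu> \<theta>" and \<theta>_free: "free_action \<Lambda> \<nu> \<theta>"
    and erg: "ergodic_action \<Gamma> \<mu> \<sigma>"
    and Y0: "Y0 \<in> sets \<nu>" and Y0_pos: "measure \<nu> Y0 > 0"
    and \<delta>: "\<delta> \<in> hom \<Gamma> \<Lambda>" and v: "v \<in> measurable \<mu> (count_space (carrier \<Lambda>))"
    and cocycle: "\<forall>g\<in>carrier \<Gamma>. AE t in \<mu>.
           inv\<^bsub>\<Lambda>\<^esub> (v t) \<otimes>\<^bsub>\<Lambda>\<^esub> zimmer_cocycle \<Gamma> \<Lambda> \<sigma> \<theta> \<Delta> t g \<otimes>\<^bsub>\<Lambda>\<^esub> v (\<sigma> (inv\<^bsub>\<Gamma>\<^esub> g) t) = \<delta> g"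

    and emb: "OE_embedding \<mu> (orbit_rel \<Gamma> \<sigma>) \<nu> (orbit_rel \<Lambda> \<theta>) Y0 \<Delta>"
    and \<Psi>: "mod_null_inverse \<mu> (uniform_measure \<nu> Y0) \<Delta> \<Psi>"
  defines "n \<equiv> 1 / measure \<nu> Y0"
    and "K \<equiv> kernel \<Gamma> \<Lambda> \<delta>"
    and "\<Lambda>0 \<equiv> \<delta> ` carrier \<Gamma>"
    and "\<delta>' \<equiv> (\<lambda>C. the_elem (\<delta> ` C))"
    and "A \<equiv> Linf \<mu>"

  shows "(let P = crossed_product \<Lambda> \<nu> \<theta>;
             H = gms_measure \<Lambda> \<nu>;
             RX = {(s, t). (\<Delta> s, \<Delta> t) \<in> restrict_rel (orbit_rel \<Lambda> \<theta>) Y0};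
             RK = orbit_rel (\<Gamma>\<lparr>carrier := K\<rparr>) \<sigma>;
             u = (\<lambda>g. coeff_op \<Lambda> \<theta> Y0 \<Psi> (\<lambda>t. zimmer_cocycle \<Gamma> \<Lambda> \<sigma> \<theta> \<Delta> t g));
             bv = coeff_op \<Lambda> \<theta> Y0 \<Psi> v (one_vec \<Lambda>)
         in bv \<in> L2 H \<and>
            (\<forall>g\<in>carrier \<Gamma>. ae_eq H (u g bv) (right_v \<Lambda> (\<delta> g) bv)) \<and>
            (\<exists>b E. b \<in> P \<and> ae_eq H (b (one_vec \<Lambda>)) bv \<and>
              scalar_multiple_of_partial_isometry H P b \<and>
              E \<in> sets \<nu> \<and> right_support H b (mult_op (indicator E)) \<and>
              (\<forall>h\<in>\<Lambda>0. ae_eq \<nu> (koopman \<Lambda> \<theta> h (indicator E)) (indicator E)) \<and>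
              (\<exists>\<K> m \<alpha>. finite_invariant_subrel \<Gamma> \<mu> \<sigma> RX \<K> \<and>
                 ae_subrel \<mu> RK \<K> \<and>
                 orbits_have_card \<mu> \<K> m \<and>
                 implements H b (1 / of_nat m) Y0 \<Psi> (rel_fixed_alg \<mu> \<K>) \<alpha> \<and>
                 alg_iso \<mu> (rel_fixed_alg \<mu> \<K>) \<nu> (corner \<nu> E) \<alpha> \<and>
                 quotient_conjugates \<Gamma> K \<Lambda> \<delta>' \<sigma> \<theta> \<nu> (rel_fixed_alg \<mu> \<K>) \<alpha> \<and>
                 ((\<forall>\<K>'. finite_invariant_subrel \<Gamma> \<mu> \<sigma> RX \<K>' \<longrightarrow>
                          ae_subrel \<mu> \<K>' (orbit_rel \<Gamma> \<sigma>)) \<longrightarrow>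
                    ae_subrel \<mu> \<K> RK \<and>
                    op_eq H (adjoint_op H b \<circ> b)
                            (scale_op (of_nat (card K)) (mult_op (indicator E))) \<and>
                    op_eq H (b \<circ> adjoint_op H b) (\<lambda>\<xi> x. \<Sum>k\<in>K. u k \<xi> x) \<and>
                    implements H b (1 / of_nat (card K)) Y0 \<Psi> (fixed_alg \<Gamma> \<mu> \<sigma> K) \<alpha> \<and>
                    alg_iso \<mu> (fixed_alg \<Gamma> \<mu> \<sigma> K) \<nu> (corner \<nu> E) \<alpha> \<and>
                    (no_nontrivial_finite_normal \<Gamma> \<longrightarrow>
                       partial_isometry_op H b \<and> normalizes H \<nu> b \<and>
                       left_support H b (mult_op (indicator Y0)) \<and>
                       \<delta> \<in> iso \<Gamma> (\<Lambda>\<lparr>carrier := \<Lambda>0\<rparr>) \<and>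
                       (\<exists>\<beta>. implements H b 1 Y0 \<Psi> A \<beta> \<and>
                          alg_iso \<mu> A \<nu> (corner \<nu> E) \<beta> \<and>
                          conjugates \<Gamma> \<Lambda> \<delta> \<sigma> \<theta> \<nu> A \<beta>))))))"
proof -
  interpret LA: near_action \<Lambda> \<nu> \<theta> by (rule mp_action_near_action[OF \<theta>_act \<nu>_std \<theta>_free])
  interpret O: oe_cocycle \<Lambda> \<nu> \<theta> \<Gamma> \<mu> \<sigma> Y0 \<Delta> \<Psi> \<delta> v
  proof (unfold_locales; (rule \<mu>_std \<sigma>_act \<sigma>_free erg Y0 Y0_pos \<Psi> \<delta> v cocycle embedding_orbits[OF emb])?)
    show "mp_map \<mu> (uniform_measure \<nu> Y0) \<Delta>" using emb by (simp add: OE_embedding_def mp_iso_def)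
  qed
  let ?RX = "{(s, t). (\<Delta> s, \<Delta> t) \<in> restrict_rel (orbit_rel \<Lambda> \<theta>) Y0}"
  let ?H = "gms_measure \<Lambda> \<nu>"
  let ?u = "\<lambda>g. coeff_op \<Lambda> \<theta> Y0 \<Psi> (\<lambda>t. zimmer_cocycle \<Gamma> \<Lambda> \<sigma> \<theta> \<Delta> t g)"
  have u: "?u = O.u" by (simp add: fun_eq_iff O.u_def)
  \<comment> \<open>The relation is the preimage of the diagonal of \<open>Y\<close>, which is
    measurable because \<open>Y\<close> carries the Borel sets of a Polish space.\<close>
  have KKm: "O.KK \<in> sets (\<mu> \<Otimes>\<^sub>M \<mu>)"
  proof -
    have b: "measurable (\<mu> \<Otimes>\<^sub>M \<mu>) \<nu> = measurable (\<mu> \<Otimes>\<^sub>M \<mu>) borel"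
      using \<nu>_std by (intro measurable_cong_sets) (auto simp: standard_prob_space_def)
    have m1: "(\<lambda>p. O.\<Phi> (fst p)) \<in> measurable (\<mu> \<Otimes>\<^sub>M \<mu>) \<nu>"
      by (rule measurable_compose[OF measurable_fst O.\<Phi>_meas])
    have m2: "(\<lambda>p. O.\<Phi> (snd p)) \<in> measurable (\<mu> \<Otimes>\<^sub>M \<mu>) \<nu>"
      by (rule measurable_compose[OF measurable_snd O.\<Phi>_meas])
    have "{p \<in> space (\<mu> \<Otimes>\<^sub>M \<mu>). O.\<Phi> (fst p) = O.\<Phi> (snd p)} \<in> sets (\<mu> \<Otimes>\<^sub>M \<mu>)"
      by (rule measurable_equality_set[OF m1[unfolded b] m2[unfolded b]])
    also have "{p \<in> space (\<mu> \<Otimes>\<^sub>M \<mu>). O.\<Phi> (fst p) = O.\<Phi> (snd p)} = O.KK"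
      by (auto simp: O.KK_def space_pair_measure O.space_\<mu>)
    finally show ?thesis .
  qed
  have fin: "finite_invariant_subrel \<Gamma> \<mu> \<sigma> ?RX O.KK"
    by (rule O.KK_finite_invariant[OF KKm]) (auto simp: restrict_rel_def orbit_rel_def orbit_def)
  have kfin: "finite (kernel \<Gamma> \<Lambda> \<delta>)"
  proof (rule finite_kernel[OF \<mu>_std \<nu>_std \<sigma>_act \<sigma>_free \<theta>_act \<theta>_free erg Y0 Y0_pos \<delta> v cocycle embedding_orbits[OF emb]])
    show "mp_map \<mu> (uniform_measure \<nu> Y0) \<Delta>" by (rule O.\<iota>_mp)
    show "AE t in \<mu>. \<forall>g\<in>carrier \<Gamma>. \<forall>g'\<in>carrier \<Gamma>. \<Delta> (\<sigma> g t) = \<Delta> (\<sigma> g' t) \<longrightarrow> \<sigma> g t = \<sigma> g' t"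
      using O.AE_G
    proof eventually_elim
      fix t assume t: "O.G t"
      show "\<forall>g\<in>carrier \<Gamma>. \<forall>g'\<in>carrier \<Gamma>. \<Delta> (\<sigma> g t) = \<Delta> (\<sigma> g' t) \<longrightarrow> \<sigma> g t = \<sigma> g' t"
        using O.G_facts(2)[OF O.G_\<sigma>[OF t]] by metis
    qed
  qed
  have rigid: "ae_subrel \<mu> O.KK (orbit_rel (\<Gamma>\<lparr>carrier := K\<rparr>) \<sigma>) \<and>
      op_eq ?H (adjoint_op ?H O.bop \<circ> O.bop) (scale_op (of_nat (card K)) (mult_op (indicator O.E))) \<and>
      op_eq ?H (O.bop \<circ> adjoint_op ?H O.bop) (\<lambda>\<xi> x. \<Sum>k\<in>K. ?u k \<xi> x) \<and>
      implements ?H O.bop (1 / of_nat (card K)) Y0 \<Psi> (fixed_alg \<Gamma> \<mu> \<sigma> K) O.\<alpha> \<and>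
      alg_iso \<mu> (fixed_alg \<Gamma> \<mu> \<sigma> K) \<nu> (corner \<nu> O.E) O.\<alpha> \<and>
      (no_nontrivial_finite_normal \<Gamma> \<longrightarrow>
         partial_isometry_op ?H O.bop \<and> normalizes ?H \<nu> O.bop \<and>
         left_support ?H O.bop (mult_op (indicator Y0)) \<and>
         \<delta> \<in> iso \<Gamma> (\<Lambda>\<lparr>carrier := \<Lambda>0\<rparr>) \<and>
         (\<exists>\<beta>. implements ?H O.bop 1 Y0 \<Psi> A \<beta> \<and> alg_iso \<mu> A \<nu> (corner \<nu> O.E) \<beta> \<and>
            conjugates \<Gamma> \<Lambda> \<delta> \<sigma> \<theta> \<nu> A \<beta>))"
    if "\<forall>\<K>'. finite_invariant_subrel \<Gamma> \<mu> \<sigma> ?RX \<K>' \<longrightarrow> ae_subrel \<mu> \<K>' (orbit_rel \<Gamma> \<sigma>)"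
  proof -
    \<comment> \<open>The additional hypothesis is applied to the constructed relation itself, which
      is finite and invariant.\<close>
    interpret R: oe_cocycle_fibred \<Lambda> \<nu> \<theta> \<Gamma> \<mu> \<sigma> Y0 \<Delta> \<Psi> \<delta> v
      by unfold_locales (use that fin in blast)
    have tr: "partial_isometry_op ?H O.bop \<and> normalizes ?H \<nu> O.bop \<and>
         left_support ?H O.bop (mult_op (indicator Y0)) \<and> \<delta> \<in> iso \<Gamma> (\<Lambda>\<lparr>carrier := \<Lambda>0\<rparr>) \<and>
         (\<exists>\<beta>. implements ?H O.bop 1 Y0 \<Psi> A \<beta> \<and> alg_iso \<mu> A \<nu> (corner \<nu> O.E) \<beta> \<and>
            conjugates \<Gamma> \<Lambda> \<delta> \<sigma> \<theta> \<nu> A \<beta>)"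
      if nn: "no_nontrivial_finite_normal \<Gamma>"
    proof -
      have K1: "kernel \<Gamma> \<Lambda> \<delta> = {\<one>\<^bsub>\<Gamma>\<^esub>}" by (rule no_finite_normal_kernel[OF O.\<delta>_group_hom kfin nn])
      have A: "A = O.AK" unfolding A_def by (rule R.fixed_alg_one[OF K1])
      have "implements ?H O.bop (1 / of_nat O.mlt) Y0 \<Psi> A O.\<alpha>"
        by (rule O.implements_\<alpha>) (simp add: A_def)
      then have "implements ?H O.bop 1 Y0 \<Psi> A O.\<alpha>" by (simp add: R.mlt_one[OF K1])
      then show ?thesis
        using R.bop_partial_isometry_one[OF K1] R.bop_normalizes_one[OF K1] R.bop_left_support_one[OF K1]
          R.\<delta>_iso_one[OF K1] O.\<alpha>_alg_iso O.\<alpha>_conjugates unfolding \<Lambda>0_def A by blast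
    qed
    have "implements ?H O.bop (1 / of_nat O.mlt) Y0 \<Psi> (fixed_alg \<Gamma> \<mu> \<sigma> K) O.\<alpha>"
      by (rule O.implements_\<alpha>) (auto simp: fixed_alg_def)
    then have i: "implements ?H O.bop (1 / of_nat (card K)) Y0 \<Psi> (fixed_alg \<Gamma> \<mu> \<sigma> K) O.\<alpha>"
      by (simp add: R.mlt_card K_def)
    show ?thesis
      by (intro conjI impI i tr R.KK_sub_RK[folded K_def] R.adjoint_bop_K[folded K_def]
          R.bop_adjoint[folded K_def, unfolded O.u_def])
        (simp_all add: R.fixed_alg_eq K_def O.\<alpha>_alg_iso tr)
  qed
  show ?thesis
    unfolding Let_def
    apply (intro conjI ballI exI[of _ O.bop] exI[of _ O.E] O.bv_L2 O.bop_in_crossed_product O.bop_scalar_multiple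
        O.E_sets O.bop_right_support exI[of _ O.KK] exI[of _ O.mlt] exI[of _ O.\<alpha>] fin
        O.RK_subrel[folded K_def] O.KK_orbits_have_card O.implements_\<alpha> O.\<alpha>_alg_iso
        O.\<alpha>_quotient_conjugates[folded K_def \<delta>'_def])
    subgoal using O.u_bv by (simp add: O.u_def)
    subgoal by (simp add: O.bop_coeff ae_eq_refl)
    subgoal using O.E_invariant by (simp add: \<Lambda>0_def)
    subgoal using O.AK_Linf by blast
    subgoal using rigid by (intro impI)
    done
qed

section \<open>The case of a local orbit equivalence\<close>

lemma local_case:
  fixes \<Gamma> :: "('g, 'm) monoid_scheme" and \<Lambda> :: "('h, 'n) monoid_scheme"
    and \<mu> :: "'x::polish_space measure" and \<nu> :: "'y::polish_space measure"
    and \<sigma> :: "'g \<Rightarrow> 'x \<Rightarrow> 'x" and \<theta> :: "'h \<Rightarrow> 'y \<Rightarrow> 'y"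
    and Y0 :: "'y set" and \<Delta> :: "'x \<Rightarrow> 'y" and \<delta> :: "'g \<Rightarrow> 'h" and v :: "'x \<Rightarrow> 'h"
  assumes \<mu>_std: "standard_prob_space \<mu>" and \<nu>_std: "standard_prob_space \<nu>"
    and \<sigma>_act: "mp_action \<Gamma> \<mu> \<sigma>" and \<sigma>_free: "free_action \<Gamma> \<mu> \<sigma>"
    and \<theta>_act: "mp_action \<Lambda> \<nu> \<theta>" and \<theta>_free: "free_action \<Lambda> \<nu> \<theta>"
    and erg: "ergodic_action \<Gamma> \<mu> \<sigma>"
    and Y0: "Y0 \<in> sets \<nu>" and Y0_pos: "measure \<nu> Y0 > 0"
    and \<delta>: "\<delta> \<in> hom \<Gamma> \<Lambda>" and v: "v \<in> measurable \<mu> (count_space (carrier \<Lambda>))"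
    and cocycle: "\<forall>g\<in>carrier \<Gamma>. AE t in \<mu>.
           inv\<^bsub>\<Lambda>\<^esub> (v t) \<otimes>\<^bsub>\<Lambda>\<^esub> zimmer_cocycle \<Gamma> \<Lambda> \<sigma> \<theta> \<Delta> t g \<otimes>\<^bsub>\<Lambda>\<^esub> v (\<sigma> (inv\<^bsub>\<Gamma>\<^esub> g) t) = \<delta> g"

    and loc: "local_OE \<mu> (orbit_rel \<Gamma> \<sigma>) \<nu> (orbit_rel \<Lambda> \<theta>) Y0 \<Delta>"
    and amp: "amplification_data \<nu> (orbit_rel \<Lambda> \<theta>) Y0 Yp \<psi>"
  defines "n \<equiv> 1 / measure \<nu> Y0"
    and "K \<equiv> kernel \<Gamma> \<Lambda> \<delta>"
    and "\<Lambda>0 \<equiv> \<delta> ` carrier \<Gamma>"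
    and "\<delta>' \<equiv> (\<lambda>C. the_elem (\<delta> ` C))"
    and "A \<equiv> Linf \<mu>"

  shows "(let Xn = amp_set Yp \<psi> \<Delta>;
             \<mu>n = amp_measure n \<mu> Xn;
             Rn = amp_rel (orbit_rel \<Gamma> \<sigma>) Xn;
             \<theta>' = pull_back Rn (amp_map Yp \<psi> \<Delta>) \<theta>;
             Mn = crossed_product \<Lambda> \<mu>n \<theta>';
             H = gms_measure \<Lambda> \<mu>n;
             X = Xn \<inter> UNIV \<times> {1};
             u = (\<lambda>g. coeff_op \<Lambda> \<theta>' X fst
                        (\<lambda>t. zimmer_cocycle \<Gamma> \<Lambda> \<sigma> \<theta>' (\<lambda>t. (t, 1)) t g));
             bv = coeff_op \<Lambda> \<theta>' X fst v (one_vec \<Lambda>)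
         in bv \<in> L2 H \<and>
            (\<forall>g\<in>carrier \<Gamma>. ae_eq H (u g bv) (right_v \<Lambda> (\<delta> g) bv)) \<and>
            (\<exists>b E. b \<in> Mn \<and> ae_eq H (b (one_vec \<Lambda>)) bv \<and>
              scalar_multiple_of_partial_isometry H Mn b \<and>
              op_eq H (b \<circ> adjoint_op H b) (\<lambda>\<xi> x. \<Sum>k\<in>K. u k \<xi> x) \<and>
              E \<in> sets \<mu>n \<and>
              op_eq H (adjoint_op H b \<circ> b) (scale_op (of_nat (card K)) (mult_op (indicator E))) \<and>
              (\<forall>h\<in>\<Lambda>0. ae_eq \<mu>n (koopman \<Lambda> \<theta>' h (indicator E)) (indicator E)) \<and>
              finite (rcosets\<^bsub>\<Lambda>\<^esub> \<Lambda>0) \<and>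
              real (card (rcosets\<^bsub>\<Lambda>\<^esub> \<Lambda>0)) = n * real (card K) \<and>
              (\<exists>\<alpha>. implements H b (1 / of_nat (card K)) X fst (fixed_alg \<Gamma> \<mu> \<sigma> K) \<alpha> \<and>
                 alg_iso \<mu> (fixed_alg \<Gamma> \<mu> \<sigma> K) \<mu>n (corner \<mu>n E) \<alpha> \<and>
                 quotient_conjugates \<Gamma> K \<Lambda> \<delta>' \<sigma> \<theta>' \<mu>n (fixed_alg \<Gamma> \<mu> \<sigma> K) \<alpha>) \<and>
              (no_nontrivial_finite_normal \<Gamma> \<longrightarrow>
                 n = real (card (rcosets\<^bsub>\<Lambda>\<^esub> \<Lambda>0)) \<and>
                 op_eq H (adjoint_op H b \<circ> b) (mult_op (indicator E)) \<and>
                 op_eq H (b \<circ> adjoint_op H b) (mult_op (indicator X)) \<and>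
                 \<delta> \<in> iso \<Gamma> (\<Lambda>\<lparr>carrier := \<Lambda>0\<rparr>) \<and>
                 (\<exists>\<alpha>. implements H b 1 X fst A \<alpha> \<and>
                    alg_iso \<mu> A \<mu>n (corner \<mu>n E) \<alpha> \<and>
                    conjugates \<Gamma> \<Lambda> \<delta> \<sigma> \<theta>' \<mu>n A \<alpha> \<and>
                    (\<exists>\<phi>. mp_iso \<mu> (uniform_measure \<mu>n E) \<phi> \<and>
                       (\<forall>a\<in>A. AE t in \<mu>. \<alpha> a (\<phi> t) = a t) \<and>
                       (AE t in \<mu>. ((t, 1), \<phi> t) \<in> Rn \<and>
                                    ((t, 1), \<phi> t) \<in> orbit_rel \<Lambda> \<theta>'))))))"
proof -
  interpret A: amplified \<Gamma> \<Lambda> \<mu> \<nu> \<sigma> \<theta> Y0 \<Delta> Yp \<psi> n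
    by (rule amplified.intro[OF \<mu>_std \<nu>_std \<sigma>_act \<sigma>_free \<theta>_act \<theta>_free Y0 Y0_pos loc amp]) (simp add: n_def)
  interpret TA: near_action \<Lambda> A.\<mu>n A.\<theta>' by (rule A.\<theta>'_near_action)
  \<comment> \<open>The hypothesis speaks of the cocycle of \<open>\<Delta>\<close>; the general
    argument wants it for the inclusion into the amplification.\<close>
  have coc: "\<forall>g\<in>carrier \<Gamma>. AE t in \<mu>. inv\<^bsub>\<Lambda>\<^esub> (v t) \<otimes>\<^bsub>\<Lambda>\<^esub>
      zimmer_cocycle \<Gamma> \<Lambda> \<sigma> A.\<theta>' A.\<iota> t g \<otimes>\<^bsub>\<Lambda>\<^esub> v (\<sigma> (inv\<^bsub>\<Gamma>\<^esub> g) t) = \<delta> g"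
  proof
    fix g assume g: "g \<in> carrier \<Gamma>"
    show "AE t in \<mu>. inv\<^bsub>\<Lambda>\<^esub> (v t) \<otimes>\<^bsub>\<Lambda>\<^esub>
      zimmer_cocycle \<Gamma> \<Lambda> \<sigma> A.\<theta>' A.\<iota> t g \<otimes>\<^bsub>\<Lambda>\<^esub> v (\<sigma> (inv\<^bsub>\<Gamma>\<^esub> g) t) = \<delta> g"
      using A.zimmer_eq cocycle[rule_format, OF g] by eventually_elim (simp add: g)
  qed
  interpret O: oe_cocycle \<Lambda> A.\<mu>n A.\<theta>' \<Gamma> \<mu> \<sigma> A.X A.\<iota> fst \<delta> v
    by (unfold_locales; (rule \<mu>_std \<sigma>_act \<sigma>_free erg A.X_sets A.\<iota>_mp A.\<iota>_inverse A.\<iota>_orbit \<delta> v coc)?)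
      (use A.measure_X A.n_pos in simp)
  have so: "O.same_orbits" unfolding O.same_orbits_def by (rule A.\<iota>_same_orbits)
  interpret R: oe_cocycle_fibred \<Lambda> A.\<mu>n A.\<theta>' \<Gamma> \<mu> \<sigma> A.X A.\<iota> fst \<delta> v
    by unfold_locales (rule O.same_orbits_KK[OF so])
  let ?H = "gms_measure \<Lambda> A.\<mu>n"
  let ?u = "\<lambda>g. coeff_op \<Lambda> A.\<theta>' A.X fst (\<lambda>t. zimmer_cocycle \<Gamma> \<Lambda> \<sigma> A.\<theta>' (\<lambda>t. (t, 1)) t g)"
  let ?bv = "coeff_op \<Lambda> A.\<theta>' A.X fst v (one_vec \<Lambda>)"
  \<comment> \<open>The claim uses \<open>t \<mapsto> (t, 1)\<close>, which need not land in the
    amplified space on a null set, while the general argument uses \<open>\<iota>\<close>. The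
    resulting operators agree above almost every point.\<close>
  have u: "AE z in A.\<mu>n. \<forall>g\<in>carrier \<Gamma>. \<forall>\<xi> k. ?u g \<xi> (z, k) = O.u g \<xi> (z, k)"
    using O.AE_\<pi>[OF A.zimmer_eq]
  proof eventually_elim
    fix z assume z: "z \<in> A.X \<longrightarrow> (\<forall>g\<in>carrier \<Gamma>.
      zimmer_cocycle \<Gamma> \<Lambda> \<sigma> A.\<theta>' A.\<iota> (fst z) g = zimmer_cocycle \<Gamma> \<Lambda> \<sigma> \<theta> \<Delta> (fst z) g \<and>
      zimmer_cocycle \<Gamma> \<Lambda> \<sigma> A.\<theta>' (\<lambda>t. (t, 1)) (fst z) g = zimmer_cocycle \<Gamma> \<Lambda> \<sigma> \<theta> \<Delta> (fst z) g)"
    show "\<forall>g\<in>carrier \<Gamma>. \<forall>\<xi> k. ?u g \<xi> (z, k) = O.u g \<xi> (z, k)"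
    proof (intro ballI allI)
      fix g \<xi> k assume g: "g \<in> carrier \<Gamma>"
      show "?u g \<xi> (z, k) = O.u g \<xi> (z, k)"
      proof (cases "z \<in> A.X")
        case True
        then have e: "zimmer_cocycle \<Gamma> \<Lambda> \<sigma> A.\<theta>' (\<lambda>t. (t, 1)) (fst z) g = O.w (fst z) g" using z g by simp
        have c: "zimmer_cocycle \<Gamma> \<Lambda> \<sigma> A.\<theta>' (\<lambda>t. (t, 1)) (fst z) g \<in> carrier \<Lambda>" unfolding e by (rule O.w_closed)
        show ?thesis unfolding O.u_apply e
          coeff_op_apply[where c="\<lambda>t. zimmer_cocycle \<Gamma> \<Lambda> \<sigma> A.\<theta>' (\<lambda>t. (t, 1)) t g" and \<pi>=fst and z=z, OF c] ..
      next
        case False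
        show ?thesis unfolding O.u_def coeff_op_outside[OF False] ..
      qed
    qed
  qed
  have u_eq: "ae_eq ?H (?u g \<xi>) (O.u g \<xi>)" if "g \<in> carrier \<Gamma>" for g \<xi>
    by (rule TA.ae_eq_HI) (use u in eventually_elim, use that in blast)
  have sum_u: "op_eq ?H (\<lambda>\<xi> x. \<Sum>k\<in>K. O.u k \<xi> x) (\<lambda>\<xi> x. \<Sum>k\<in>K. ?u k \<xi> x)"
    unfolding op_eq_def
  proof (intro ballI TA.ae_eq_HI)
    fix \<xi> :: "('x \<times> nat) \<times> 'h \<Rightarrow> complex"
    show "AE z in A.\<mu>n. \<forall>l\<in>carrier \<Lambda>. (\<Sum>k\<in>K. O.u k \<xi> (z, l)) = (\<Sum>k\<in>K. ?u k \<xi> (z, l))"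
      using u
    proof eventually_elim
      fix z assume "\<forall>g\<in>carrier \<Gamma>. \<forall>\<xi> k. ?u g \<xi> (z, k) = O.u g \<xi> (z, k)"
      then show "\<forall>l\<in>carrier \<Lambda>. (\<Sum>k\<in>K. O.u k \<xi> (z, l)) = (\<Sum>k\<in>K. ?u k \<xi> (z, l))"
        using R.K_closed(1) by (intro ballI sum.cong refl) (simp add: K_def)
    qed
  qed
  have mX: "measure A.\<mu>n A.X = 1 / n" by (rule A.measure_X)
  \<comment> \<open>The copy of \<open>X\<close> has measure \<open>1 / n\<close> and covers
    \<open>E\<close> with multiplicity the order of the kernel; combined with the index formula this
    yields the index.\<close>
  have mE: "1 / n = real (card K) * measure A.\<mu>n O.E"
    using O.measure_E unfolding mX R.mlt_card K_def .
  note idx = O.index_formula[OF so A.complete_section]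
  have n0: "n > 0" using A.n_pos by simp
  have index: "real (card (rcosets\<^bsub>\<Lambda>\<^esub> \<Lambda>0)) = n * real (card K)"
  proof -
    have "real (card (rcosets\<^bsub>\<Lambda>\<^esub> \<Lambda>0)) * (1 / n) = real (card K) * (real (card (rcosets\<^bsub>\<Lambda>\<^esub> \<Lambda>0)) * measure A.\<mu>n O.E)"
      unfolding mE by simp
    also have "\<dots> = real (card K)" using idx(2) by (simp add: \<Lambda>0_def)
    finally show ?thesis using n0 by (simp add: field_simps)
  qed
  have impl: "implements ?H O.bop (1 / of_nat (card K)) A.X fst (fixed_alg \<Gamma> \<mu> \<sigma> K) O.\<alpha>"
  proof -
    have "implements ?H O.bop (1 / of_nat O.mlt) A.X fst (fixed_alg \<Gamma> \<mu> \<sigma> K) O.\<alpha>"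
      by (rule O.implements_\<alpha>) (auto simp: fixed_alg_def)
    then show ?thesis unfolding R.mlt_card K_def .
  qed
  have iso: "alg_iso \<mu> (fixed_alg \<Gamma> \<mu> \<sigma> K) A.\<mu>n (corner A.\<mu>n O.E) O.\<alpha>"
    unfolding K_def R.fixed_alg_eq by (rule O.\<alpha>_alg_iso)
  have qc: "quotient_conjugates \<Gamma> K \<Lambda> \<delta>' \<sigma> A.\<theta>' A.\<mu>n (fixed_alg \<Gamma> \<mu> \<sigma> K) O.\<alpha>"
    unfolding K_def R.fixed_alg_eq \<delta>'_def by (rule O.\<alpha>_quotient_conjugates)
  have tr: "n = real (card (rcosets\<^bsub>\<Lambda>\<^esub> \<Lambda>0)) \<and>
      op_eq ?H (adjoint_op ?H O.bop \<circ> O.bop) (mult_op (indicator O.E)) \<and>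
      op_eq ?H (O.bop \<circ> adjoint_op ?H O.bop) (mult_op (indicator A.X)) \<and>
      \<delta> \<in> iso \<Gamma> (\<Lambda>\<lparr>carrier := \<Lambda>0\<rparr>) \<and>
      (\<exists>\<alpha>. implements ?H O.bop 1 A.X fst A \<alpha> \<and> alg_iso \<mu> A A.\<mu>n (corner A.\<mu>n O.E) \<alpha> \<and>
        conjugates \<Gamma> \<Lambda> \<delta> \<sigma> A.\<theta>' A.\<mu>n A \<alpha> \<and>
        (\<exists>\<phi>. mp_iso \<mu> (uniform_measure A.\<mu>n O.E) \<phi> \<and> (\<forall>a\<in>A. AE t in \<mu>. \<alpha> a (\<phi> t) = a t) \<and>
          (AE t in \<mu>. ((t, 1), \<phi> t) \<in> A.Rn \<and> ((t, 1), \<phi> t) \<in> orbit_rel \<Lambda> A.\<theta>')))"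
    if nn: "no_nontrivial_finite_normal \<Gamma>"
  proof -
    have K1: "kernel \<Gamma> \<Lambda> \<delta> = {\<one>\<^bsub>\<Gamma>\<^esub>}" by (rule no_finite_normal_kernel[OF O.\<delta>_group_hom R.K_finite nn])
    have A: "A = O.AK" unfolding A_def by (rule R.fixed_alg_one[OF K1])
    have "implements ?H O.bop (1 / of_nat O.mlt) A.X fst A O.\<alpha>"
      by (rule O.implements_\<alpha>) (simp add: A_def)
    then have i: "implements ?H O.bop 1 A.X fst A O.\<alpha>" unfolding R.mlt_one[OF K1] of_nat_1 div_by_1 .
    \<comment> \<open>The graph of \<open>\<alpha>\<close> is realised by \<open>\<Phi>\<close>,
      which is translation of \<open>(t, 1)\<close> by the inverse of \<open>v t\<close> and so
      stays in the orbit.\<close>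
    have o: "AE t in \<mu>. ((t, 1), O.\<Phi> t) \<in> A.Rn \<and> ((t, 1), O.\<Phi> t) \<in> orbit_rel \<Lambda> A.\<theta>'"
      using A.AE_Q
    proof eventually_elim
      fix t assume t: "A.Q t"
      have iv: "inv\<^bsub>\<Lambda>\<^esub> (v t) \<in> carrier \<Lambda>" using O.v_closed by simp
      have e: "O.\<Phi> t = A.\<theta>' (inv\<^bsub>\<Lambda>\<^esub> (v t)) (t, 1)" unfolding O.\<Phi>_def A.\<iota>_Q(1)[OF t] ..
      show "((t, 1), O.\<Phi> t) \<in> A.Rn \<and> ((t, 1), O.\<Phi> t) \<in> orbit_rel \<Lambda> A.\<theta>'"
        using A.\<theta>'_facts(1)[OF A.\<iota>_Q(2)[OF t] iv] iv unfolding e by (auto simp: orbit_rel_def orbit_def)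
    qed
    have "\<exists>\<phi>. mp_iso \<mu> (uniform_measure A.\<mu>n O.E) \<phi> \<and> (\<forall>a\<in>A. AE t in \<mu>. O.\<alpha> a (\<phi> t) = a t) \<and>
          (AE t in \<mu>. ((t, 1), \<phi> t) \<in> A.Rn \<and> ((t, 1), \<phi> t) \<in> orbit_rel \<Lambda> A.\<theta>')"
      by (rule exI[of _ O.\<Phi>], intro conjI ballI o O.\<Phi>_mp_iso[OF R.mlt_one[OF K1]])
        (rule O.AK_\<alpha>_\<Phi>, simp only: A)
    moreover have "n = real (card (rcosets\<^bsub>\<Lambda>\<^esub> \<Lambda>0))" using index by (simp add: K_def K1)
    moreover have "conjugates \<Gamma> \<Lambda> \<delta> \<sigma> A.\<theta>' A.\<mu>n A O.\<alpha>" unfolding A by (rule O.\<alpha>_conjugates)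
    moreover have "alg_iso \<mu> A A.\<mu>n (corner A.\<mu>n O.E) O.\<alpha>" unfolding A by (rule O.\<alpha>_alg_iso)
    ultimately show ?thesis
      using i R.bop_adjoint_one[OF K1] R.adjoint_bop_one[OF K1] R.\<delta>_iso_one[OF K1] unfolding \<Lambda>0_def
      by (intro conjI exI[of _ O.\<alpha>])
  qed
  note tr' = impI[OF tr]
  have fin: "finite (rcosets\<^bsub>\<Lambda>\<^esub> \<Lambda>0)" using idx(1) by (simp add: \<Lambda>0_def)
  show ?thesis
    unfolding Let_def
    apply (intro conjI ballI exI[of _ O.bop] exI[of _ O.E] exI[of _ O.\<alpha>] O.bv_L2 O.bop_in_crossed_product
      O.bop_scalar_multiple op_eq_trans[OF R.bop_adjoint[folded K_def] sum_u] O.E_sets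
      R.adjoint_bop_K[folded K_def] index fin impl iso qc tr')
    subgoal using ae_eq_trans[OF u_eq O.u_bv] by blast
    subgoal unfolding O.bop_coeff by (rule ae_eq_refl)
    subgoal using O.E_invariant by (simp add: \<Lambda>0_def)
    subgoal by assumption
    done
qed

theorem proposition5p11:
  fixes \<Gamma> :: "('g, 'm) monoid_scheme" and \<Lambda> :: "('h, 'n) monoid_scheme"
    and \<mu> :: "'x::polish_space measure" and \<nu> :: "'y::polish_space measure"
    and \<sigma> :: "'g \<Rightarrow> 'x \<Rightarrow> 'x" and \<theta> :: "'h \<Rightarrow> 'y \<Rightarrow> 'y"
    and Y0 :: "'y set" and \<Delta> :: "'x \<Rightarrow> 'y" and \<delta> :: "'g \<Rightarrow> 'h" and v :: "'x \<Rightarrow> 'h"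
  assumes "standard_prob_space \<mu>" and "standard_prob_space \<nu>"
    and "mp_action \<Gamma> \<mu> \<sigma>" and "free_action \<Gamma> \<mu> \<sigma>"
    and "mp_action \<Lambda> \<nu> \<theta>" and "free_action \<Lambda> \<nu> \<theta>"
    and "weak_mixing \<Gamma> \<mu> \<sigma>"
    and "Y0 \<in> sets \<nu>" and "measure \<nu> Y0 > 0"
    and "OE_embedding \<mu> (orbit_rel \<Gamma> \<sigma>) \<nu> (orbit_rel \<Lambda> \<theta>) Y0 \<Delta> \<or>
         local_OE \<mu> (orbit_rel \<Gamma> \<sigma>) \<nu> (orbit_rel \<Lambda> \<theta>) Y0 \<Delta>"
    and "\<delta> \<in> hom \<Gamma> \<Lambda>" and "v \<in> measurable \<mu> (count_space (carrier \<Lambda>))"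
    and "\<forall>g\<in>carrier \<Gamma>. AE t in \<mu>.
           inv\<^bsub>\<Lambda>\<^esub> (v t) \<otimes>\<^bsub>\<Lambda>\<^esub> zimmer_cocycle \<Gamma> \<Lambda> \<sigma> \<theta> \<Delta> t g \<otimes>\<^bsub>\<Lambda>\<^esub> v (\<sigma> (inv\<^bsub>\<Gamma>\<^esub> g) t) = \<delta> g"
  defines "n \<equiv> 1 / measure \<nu> Y0"
    and "K \<equiv> kernel \<Gamma> \<Lambda> \<delta>"
    and "\<Lambda>0 \<equiv> \<delta> ` carrier \<Gamma>"
    and "\<delta>' \<equiv> (\<lambda>C. the_elem (\<delta> ` C))"
    and "A \<equiv> Linf \<mu>"
  shows "K \<lhd> \<Gamma> \<and> finite K \<and> \<delta>' \<in> iso (\<Gamma> Mod K) (\<Lambda>\<lparr>carrier := \<Lambda>0\<rparr>) \<and>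

    \<comment> \<open>local orbit equivalences\<close>
    (local_OE \<mu> (orbit_rel \<Gamma> \<sigma>) \<nu> (orbit_rel \<Lambda> \<theta>) Y0 \<Delta> \<and> ergodic_action \<Lambda> \<nu> \<theta> \<longrightarrow>
      (\<forall>Yp \<psi>. amplification_data \<nu> (orbit_rel \<Lambda> \<theta>) Y0 Yp \<psi> \<longrightarrow>
        (let Xn = amp_set Yp \<psi> \<Delta>;
             \<mu>n = amp_measure n \<mu> Xn;
             Rn = amp_rel (orbit_rel \<Gamma> \<sigma>) Xn;
             \<theta>' = pull_back Rn (amp_map Yp \<psi> \<Delta>) \<theta>;
             Mn = crossed_product \<Lambda> \<mu>n \<theta>';
             H = gms_measure \<Lambda> \<mu>n;
             X = Xn \<inter> UNIV \<times> {1};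
             u = (\<lambda>g. coeff_op \<Lambda> \<theta>' X fst
                        (\<lambda>t. zimmer_cocycle \<Gamma> \<Lambda> \<sigma> \<theta>' (\<lambda>t. (t, 1)) t g));
             bv = coeff_op \<Lambda> \<theta>' X fst v (one_vec \<Lambda>)
         in bv \<in> L2 H \<and>
            (\<forall>g\<in>carrier \<Gamma>. ae_eq H (u g bv) (right_v \<Lambda> (\<delta> g) bv)) \<and>
            (\<exists>b E. b \<in> Mn \<and> ae_eq H (b (one_vec \<Lambda>)) bv \<and>
              scalar_multiple_of_partial_isometry H Mn b \<and>
              op_eq H (b \<circ> adjoint_op H b) (\<lambda>\<xi> x. \<Sum>k\<in>K. u k \<xi> x) \<and>
              E \<in> sets \<mu>n \<and>
              op_eq H (adjoint_op H b \<circ> b) (scale_op (of_nat (card K)) (mult_op (indicator E))) \<and>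
              (\<forall>h\<in>\<Lambda>0. ae_eq \<mu>n (koopman \<Lambda> \<theta>' h (indicator E)) (indicator E)) \<and>
              finite (rcosets\<^bsub>\<Lambda>\<^esub> \<Lambda>0) \<and>
              real (card (rcosets\<^bsub>\<Lambda>\<^esub> \<Lambda>0)) = n * real (card K) \<and>
              (\<exists>\<alpha>. implements H b (1 / of_nat (card K)) X fst (fixed_alg \<Gamma> \<mu> \<sigma> K) \<alpha> \<and>
                 alg_iso \<mu> (fixed_alg \<Gamma> \<mu> \<sigma> K) \<mu>n (corner \<mu>n E) \<alpha> \<and>
                 quotient_conjugates \<Gamma> K \<Lambda> \<delta>' \<sigma> \<theta>' \<mu>n (fixed_alg \<Gamma> \<mu> \<sigma> K) \<alpha>) \<and>
              (no_nontrivial_finite_normal \<Gamma> \<longrightarrow>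
                 n = real (card (rcosets\<^bsub>\<Lambda>\<^esub> \<Lambda>0)) \<and>
                 op_eq H (adjoint_op H b \<circ> b) (mult_op (indicator E)) \<and>
                 op_eq H (b \<circ> adjoint_op H b) (mult_op (indicator X)) \<and>
                 \<delta> \<in> iso \<Gamma> (\<Lambda>\<lparr>carrier := \<Lambda>0\<rparr>) \<and>
                 (\<exists>\<alpha>. implements H b 1 X fst A \<alpha> \<and>
                    alg_iso \<mu> A \<mu>n (corner \<mu>n E) \<alpha> \<and>
                    conjugates \<Gamma> \<Lambda> \<delta> \<sigma> \<theta>' \<mu>n A \<alpha> \<and>
                    (\<exists>\<phi>. mp_iso \<mu> (uniform_measure \<mu>n E) \<phi> \<and>
                       (\<forall>a\<in>A. AE t in \<mu>. \<alpha> a (\<phi> t) = a t) \<and>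
                       (AE t in \<mu>. ((t, 1), \<phi> t) \<in> Rn \<and>
                                    ((t, 1), \<phi> t) \<in> orbit_rel \<Lambda> \<theta>')))))))) \<and>

    \<comment> \<open>embeddings; \<open>\<Psi>\<close> is the inverse of the identification \<open>\<Delta>\<close> of \<open>X\<close> with \<open>Y0\<close>\<close>
    (OE_embedding \<mu> (orbit_rel \<Gamma> \<sigma>) \<nu> (orbit_rel \<Lambda> \<theta>) Y0 \<Delta> \<longrightarrow>
      (\<forall>\<Psi>. mod_null_inverse \<mu> (uniform_measure \<nu> Y0) \<Delta> \<Psi> \<longrightarrow>
        (let P = crossed_product \<Lambda> \<nu> \<theta>;
             H = gms_measure \<Lambda> \<nu>;
             RX = {(s, t). (\<Delta> s, \<Delta> t) \<in> restrict_rel (orbit_rel \<Lambda> \<theta>) Y0};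
             RK = orbit_rel (\<Gamma>\<lparr>carrier := K\<rparr>) \<sigma>;
             u = (\<lambda>g. coeff_op \<Lambda> \<theta> Y0 \<Psi> (\<lambda>t. zimmer_cocycle \<Gamma> \<Lambda> \<sigma> \<theta> \<Delta> t g));
             bv = coeff_op \<Lambda> \<theta> Y0 \<Psi> v (one_vec \<Lambda>)
         in bv \<in> L2 H \<and>
            (\<forall>g\<in>carrier \<Gamma>. ae_eq H (u g bv) (right_v \<Lambda> (\<delta> g) bv)) \<and>
            (\<exists>b E. b \<in> P \<and> ae_eq H (b (one_vec \<Lambda>)) bv \<and>
              scalar_multiple_of_partial_isometry H P b \<and>
              E \<in> sets \<nu> \<and> right_support H b (mult_op (indicator E)) \<and>
              (\<forall>h\<in>\<Lambda>0. ae_eq \<nu> (koopman \<Lambda> \<theta> h (indicator E)) (indicator E)) \<and>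
              (\<exists>\<K> m \<alpha>. finite_invariant_subrel \<Gamma> \<mu> \<sigma> RX \<K> \<and>
                 ae_subrel \<mu> RK \<K> \<and>
                 orbits_have_card \<mu> \<K> m \<and>
                 implements H b (1 / of_nat m) Y0 \<Psi> (rel_fixed_alg \<mu> \<K>) \<alpha> \<and>
                 alg_iso \<mu> (rel_fixed_alg \<mu> \<K>) \<nu> (corner \<nu> E) \<alpha> \<and>
                 quotient_conjugates \<Gamma> K \<Lambda> \<delta>' \<sigma> \<theta> \<nu> (rel_fixed_alg \<mu> \<K>) \<alpha> \<and>
                 ((\<forall>\<K>'. finite_invariant_subrel \<Gamma> \<mu> \<sigma> RX \<K>' \<longrightarrow>
                          ae_subrel \<mu> \<K>' (orbit_rel \<Gamma> \<sigma>)) \<longrightarrow>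
                    ae_subrel \<mu> \<K> RK \<and>
                    op_eq H (adjoint_op H b \<circ> b)
                            (scale_op (of_nat (card K)) (mult_op (indicator E))) \<and>
                    op_eq H (b \<circ> adjoint_op H b) (\<lambda>\<xi> x. \<Sum>k\<in>K. u k \<xi> x) \<and>
                    implements H b (1 / of_nat (card K)) Y0 \<Psi> (fixed_alg \<Gamma> \<mu> \<sigma> K) \<alpha> \<and>
                    alg_iso \<mu> (fixed_alg \<Gamma> \<mu> \<sigma> K) \<nu> (corner \<nu> E) \<alpha> \<and>
                    (no_nontrivial_finite_normal \<Gamma> \<longrightarrow>
                       partial_isometry_op H b \<and> normalizes H \<nu> b \<and>
                       left_support H b (mult_op (indicator Y0)) \<and>
                       \<delta> \<in> iso \<Gamma> (\<Lambda>\<lparr>carrier := \<Lambda>0\<rparr>) \<and>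
                       (\<exists>\<beta>. implements H b 1 Y0 \<Psi> A \<beta> \<and>
                          alg_iso \<mu> A \<nu> (corner \<nu> E) \<beta> \<and>
                          conjugates \<Gamma> \<Lambda> \<delta> \<sigma> \<theta> \<nu> A \<beta>))))))))"

proof -
  have erg: "ergodic_action \<Gamma> \<mu> \<sigma>" by (rule weak_mixing_ergodic[OF assms(1,3,7)])
  have grp: "group \<Gamma>" "group \<Lambda>"
    using near_action.grp mp_action_near_action[OF assms(3,1,4)] mp_action_near_action[OF assms(5,2,6)] by blast+
  have hom: "group_hom \<Gamma> \<Lambda> \<delta>" using grp assms(11) by (simp add: group_hom_def group_hom_axioms_def)
  have normal: "K \<lhd> \<Gamma>" unfolding K_def by (rule group_hom.normal_kernel[OF hom])
  have fin: "finite K"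
    using assms(10) unfolding K_def
  proof
    assume emb: "OE_embedding \<mu> (orbit_rel \<Gamma> \<sigma>) \<nu> (orbit_rel \<Lambda> \<theta>) Y0 \<Delta>"
    then obtain \<Psi> where \<Psi>: "mod_null_inverse \<mu> (uniform_measure \<nu> Y0) \<Delta> \<Psi>"
      and mp: "mp_map \<mu> (uniform_measure \<nu> Y0) \<Delta>" by (auto simp: OE_embedding_def mp_iso_def)
    have "AE t in \<mu>. \<Psi> (\<Delta> t) = t" using \<Psi> by (simp add: mod_null_inverse_def)
    \<comment> \<open>The left inverse of \<open>\<Delta>\<close> must be valid at all points of the
      orbit of \<open>t\<close> at the same time; then \<open>\<Delta>\<close> is injective on that
      orbit.\<close>
    from near_action.AE_T[OF mp_action_near_action[OF assms(3,1,4)] this]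
    have inj: "AE t in \<mu>. \<forall>g\<in>carrier \<Gamma>. \<forall>g'\<in>carrier \<Gamma>. \<Delta> (\<sigma> g t) = \<Delta> (\<sigma> g' t) \<longrightarrow> \<sigma> g t = \<sigma> g' t"
      by eventually_elim metis
    show "finite (kernel \<Gamma> \<Lambda> \<delta>)"
      by (rule finite_kernel[OF assms(1-6) erg assms(8,9,11-13) embedding_orbits[OF emb] inj mp])
  next
    assume loc: "local_OE \<mu> (orbit_rel \<Gamma> \<sigma>) \<nu> (orbit_rel \<Lambda> \<theta>) Y0 \<Delta>"
    then have mp: "mp_map \<mu> (uniform_measure \<nu> Y0) \<Delta>" by (simp add: local_OE_def)
    show "finite (kernel \<Gamma> \<Lambda> \<delta>)"
      by (rule finite_kernel[OF assms(1-6) erg assms(8,9,11-13) local_OE_orbits[OF loc] mp])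
  qed
  have iso: "\<delta>' \<in> iso (\<Gamma> Mod K) (\<Lambda>\<lparr>carrier := \<Lambda>0\<rparr>)"
  proof -
    \<comment> \<open>The target is cut down to the image of \<open>\<delta>\<close> to make the
      homomorphism onto, as the first isomorphism theorem requires; the kernel does not
      change.\<close>
    have "group (\<Lambda>\<lparr>carrier := \<Lambda>0\<rparr>)"
      unfolding \<Lambda>0_def using group.subgroup_imp_group[OF grp(2) group_hom.img_is_subgroup[OF hom]] .
    then have h: "group_hom \<Gamma> (\<Lambda>\<lparr>carrier := \<Lambda>0\<rparr>) \<delta>"
      using grp(1) assms(11) by (auto simp: group_hom_def group_hom_axioms_def hom_def \<Lambda>0_def)
    have "kernel \<Gamma> (\<Lambda>\<lparr>carrier := \<Lambda>0\<rparr>) \<delta> = K" by (simp add: kernel_def K_def)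
    then show ?thesis using group_hom.FactGroup_iso_set[OF h] by (simp add: \<delta>'_def \<Lambda>0_def)
  qed
  note loc = local_case[OF assms(1-6) erg assms(8,9,11-13), folded n_def K_def \<Lambda>0_def \<delta>'_def A_def]
  note emb = embedding_case[OF assms(1-6) erg assms(8,9,11-13), folded n_def K_def \<Lambda>0_def \<delta>'_def A_def]
  show ?thesis
    by (intro conjI impI allI normal fin iso loc emb; (elim conjE)?; assumption)
qed

end
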